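(* Let $\mathbf k$ be a field of characteristic $p>0$, let $H_1,H_2$ be Hopf algebras in $\mathcal H_\nu$, and assume that $H_2$ is finite dimensional. Then $$\underline{\mathrm{Hom}}(H_1,H_2)\cong(H_1\boxtimes H_2^* )^0$$ as Hopf algebras.
   Context: All Hopf algebras over $\mathbf k$ are commutative and cocommutative. Hopf algebra maps $A\to B$ form an abelian group under convolution ($f+g=m_B(f\otimes g)\Delta_A$), and $[m]$ denotes $m$ times the identity endomorphism. $\mathcal H$ is the category of Hopf algebras; $\mathcal H_\nu$ is the full subcategory of those $H$ with $[p^\nu](a)=\epsilon(a)1$ for all $a\in H$. A bilinear map $A\otimes B\to K$, $x\otimes y\mapsto x\circ y$, is a coalgebra map with $xy\circ z=\sum(x\circ z^{(1)})(y\circ z^{(2)})$, $x\circ wz=\sum(x^{(1)}\circ w)(x^{(2)}\circ z)$, $x\circ1=\epsilon(x)1$, $1\circ z=\epsilon(z)1$; $A\boxtimes B$ is the Hopf algebra with a universal bilinear map from $A\otimes B$. The internal Hom $\underline{\mathrm{Hom}}$ is characterized by natural isomorphisms $\mathrm{Hom}(A\boxtimes B,C)\cong\mathrm{Hom}(A,\underline{\mathrm{Hom}}(B,C))$. $H^*$ is the linear dual, in general only a topological Hopf algebra with comultiplication $H^*\to(H\otimes H)^*$; a Hopf subalgebra of $H^*$ is a subalgebra $A$, closed under the antipode, with $\Delta(A)\subset A\otimes A\subset(H\otimes H)^*$. $H^0$ (the Cartier dual) is the union of all Hopf subalgebras of $H^*$; it is a Hopf algebra. *)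

theory Defs
  imports
    "HOL-Algebra.Multiplicative_Group"
    "HOL-Algebra.Subrings"
    "Jordan_Normal_Form.Missing_VectorSpace"
begin

section \<open>Tensor products over a field\<close>

definition characteristic :: "('k, 'm) ring_scheme \<Rightarrow> nat" where
  "characteristic k = group.ord (add_monoid k) \<one>\<^bsub>k\<^esub>"

text \<open>\<open>A \<otimes> B\<close> is the set of formal finite sums of pairs modulo the congruence
  generated by commutativity of the sum and the bilinearity relations; a formal sum is a list.\<close>

inductive tensor_rel ::
  "('k, 'm) ring_scheme \<Rightarrow> ('k, 'a, 'x) module_scheme \<Rightarrow> ('k, 'b, 'y) module_scheme
    \<Rightarrow> ('a \<times> 'b) list \<Rightarrow> ('a \<times> 'b) list \<Rightarrow> bool"
  for k A B where
  refl: "xs \<in> lists (carrier A \<times> carrier B) \<Longrightarrow> tensor_rel k A B xs xs"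
| sym: "tensor_rel k A B xs ys \<Longrightarrow> tensor_rel k A B ys xs"
| trans: "tensor_rel k A B xs ys \<Longrightarrow> tensor_rel k A B ys zs \<Longrightarrow> tensor_rel k A B xs zs"
| append: "tensor_rel k A B xs xs' \<Longrightarrow> tensor_rel k A B ys ys'
    \<Longrightarrow> tensor_rel k A B (xs @ ys) (xs' @ ys')"
| comm: "xs \<in> lists (carrier A \<times> carrier B) \<Longrightarrow> ys \<in> lists (carrier A \<times> carrier B)
    \<Longrightarrow> tensor_rel k A B (xs @ ys) (ys @ xs)"
| add_left: "a \<in> carrier A \<Longrightarrow> a' \<in> carrier A \<Longrightarrow> b \<in> carrier B
    \<Longrightarrow> tensor_rel k A B [(a \<oplus>\<^bsub>A\<^esub> a', b)] [(a, b), (a', b)]"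
| add_right: "a \<in> carrier A \<Longrightarrow> b \<in> carrier B \<Longrightarrow> b' \<in> carrier B
    \<Longrightarrow> tensor_rel k A B [(a, b \<oplus>\<^bsub>B\<^esub> b')] [(a, b), (a, b')]"
| smult: "c \<in> carrier k \<Longrightarrow> a \<in> carrier A \<Longrightarrow> b \<in> carrier B
    \<Longrightarrow> tensor_rel k A B [(c \<odot>\<^bsub>A\<^esub> a, b)] [(a, c \<odot>\<^bsub>B\<^esub> b)]"
| zero: "b \<in> carrier B \<Longrightarrow> tensor_rel k A B [(\<zero>\<^bsub>A\<^esub>, b)] []"

definition tensor_class where
  "tensor_class k A B xs = {ys. tensor_rel k A B xs ys}"

definition pure_tensor where
  "pure_tensor k A B a b = tensor_class k A B [(a, b)]"

text \<open>The multiplication and unit below are those of the tensor product of two algebras.\<close>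

definition tensor ::
  "('k, 'm) ring_scheme \<Rightarrow> ('k, 'a, 'x) module_scheme \<Rightarrow> ('k, 'b, 'y) module_scheme
    \<Rightarrow> ('k, ('a \<times> 'b) list set) module" where
  "tensor k A B =
    \<lparr> carrier = tensor_class k A B ` lists (carrier A \<times> carrier B),
      mult = (\<lambda>X Y. \<Union>xs\<in>X. \<Union>ys\<in>Y. tensor_class k A B
        [(a \<otimes>\<^bsub>A\<^esub> a', b \<otimes>\<^bsub>B\<^esub> b'). (a, b) \<leftarrow> xs, (a', b') \<leftarrow> ys]),
      one = pure_tensor k A B \<one>\<^bsub>A\<^esub> \<one>\<^bsub>B\<^esub>,
      zero = tensor_class k A B [],
      add = (\<lambda>X Y. \<Union>xs\<in>X. \<Union>ys\<in>Y. tensor_class k A B (xs @ ys)),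
      smult = (\<lambda>c X. \<Union>xs\<in>X. tensor_class k A B (map (\<lambda>(a, b). (c \<odot>\<^bsub>A\<^esub> a, b)) xs)) \<rparr>"

text \<open>For a bilinear \<open>F\<close> with values in \<open>M\<close>, \<open>tensor_lift M F\<close> is the induced linear map
  \<open>a \<otimes> b \<mapsto> F a b\<close>: the value \<open>\<Sum>i. F a\<^sub>i b\<^sub>i\<close> is the same for all representatives
  \<open>[(a\<^sub>1, b\<^sub>1), \<dots>]\<close> of the class \<open>X\<close>.\<close>

definition tensor_sum :: "('c, 'm) ring_scheme \<Rightarrow> ('a \<Rightarrow> 'b \<Rightarrow> 'c) \<Rightarrow> ('a \<times> 'b) list \<Rightarrow> 'c" where
  "tensor_sum M F xs = foldr (\<lambda>(a, b) s. F a b \<oplus>\<^bsub>M\<^esub> s) xs \<zero>\<^bsub>M\<^esub>"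

definition tensor_lift ::
  "('c, 'm) ring_scheme \<Rightarrow> ('a \<Rightarrow> 'b \<Rightarrow> 'c) \<Rightarrow> ('a \<times> 'b) list set \<Rightarrow> 'c" where
  "tensor_lift M F X = the_elem (tensor_sum M F ` X)"

definition tensor_map where
  "tensor_map k A B f g = tensor_lift (tensor k A B) (\<lambda>a b. pure_tensor k A B (f a) (g b))"

definition tensor_swap where
  "tensor_swap k A B = tensor_lift (tensor k B A) (\<lambda>a b. pure_tensor k B A b a)"

definition tensor_assoc where
  "tensor_assoc k A B C =
    tensor_lift (tensor k A (tensor k B C))
      (\<lambda>t c. tensor_lift (tensor k A (tensor k B C))
        (\<lambda>a b. pure_tensor k A (tensor k B C) a (pure_tensor k B C b c)) t)"

definition base_algebra :: "('k, 'm) ring_scheme \<Rightarrow> ('k, 'k) module" where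
  "base_algebra k =
    \<lparr> carrier = carrier k, mult = mult k, one = one k, zero = zero k, add = add k,
      smult = mult k \<rparr>"

definition alg_hom where
  "alg_hom k A B = ring_hom A B \<inter> module_hom k A B"


section \<open>Commutative and cocommutative Hopf algebras\<close>

record ('k, 'a) hopf = "('k, 'a) module" +
  comult :: "'a \<Rightarrow> ('a \<times> 'a) list set"
  counit :: "'a \<Rightarrow> 'k"
  antipode :: "'a \<Rightarrow> 'a"

text \<open>Commutativity is part of the library locale \<open>algebra\<close>.\<close>

locale hopf_algebra = algebra k H + field k
  for k :: "('k, 'm) ring_scheme" and H :: "('k, 'a, 'x) hopf_scheme" +
  assumes comult_hom: "comult H \<in> alg_hom k H (tensor k H H)"
    and counit_hom: "counit H \<in> alg_hom k H (base_algebra k)"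
    and antipode_linear: "antipode H \<in> module_hom k H H"
    and coassoc: "x \<in> carrier H \<Longrightarrow>
      tensor_assoc k H H H (tensor_map k (tensor k H H) H (comult H) id (comult H x))
        = tensor_map k H (tensor k H H) id (comult H) (comult H x)"
    and counit_left: "x \<in> carrier H \<Longrightarrow>
      tensor_lift H (\<lambda>a b. counit H a \<odot>\<^bsub>H\<^esub> b) (comult H x) = x"
    and counit_right: "x \<in> carrier H \<Longrightarrow>
      tensor_lift H (\<lambda>a b. counit H b \<odot>\<^bsub>H\<^esub> a) (comult H x) = x"
    and antipode_left: "x \<in> carrier H \<Longrightarrow>
      tensor_lift H (\<lambda>a b. antipode H a \<otimes>\<^bsub>H\<^esub> b) (comult H x) = counit H x \<odot>\<^bsub>H\<^esub> \<one>\<^bsub>H\<^esub>"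
    and antipode_right: "x \<in> carrier H \<Longrightarrow>
      tensor_lift H (\<lambda>a b. a \<otimes>\<^bsub>H\<^esub> antipode H b) (comult H x) = counit H x \<odot>\<^bsub>H\<^esub> \<one>\<^bsub>H\<^esub>"
    and cocomm: "x \<in> carrier H \<Longrightarrow> tensor_swap k H H (comult H x) = comult H x"

definition coalg_hom where
  "coalg_hom k C D = {f \<in> module_hom k C D. \<forall>x\<in>carrier C.
     tensor_map k D D f f (comult C x) = comult D (f x) \<and> counit D (f x) = counit C x}"

text \<open>Homomorphisms are extensional, so that they are determined by their values on the carrier.\<close>

definition hopf_hom where
  "hopf_hom k A B = alg_hom k A B \<inter> coalg_hom k A B \<inter> extensional (carrier A)"

definition hopf_isomorphic where
  "hopf_isomorphic k A B \<longleftrightarrow> hopf_algebra k A \<and> hopf_algebra k B \<and>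
     (\<exists>f \<in> hopf_hom k A B. bij_betw f (carrier A) (carrier B))"

definition convolution where
  "convolution A B f g = (\<lambda>x\<in>carrier A. tensor_lift B (\<lambda>a b. f a \<otimes>\<^bsub>B\<^esub> g b) (comult A x))"

text \<open>\<open>hopf_mult H m\<close> is \<open>[m]\<close>; the neutral element for convolution is \<open>x \<mapsto> \<epsilon>(x) 1\<close>.\<close>

primrec hopf_mult :: "('k, 'a, 'x) hopf_scheme \<Rightarrow> nat \<Rightarrow> 'a \<Rightarrow> 'a" where
  "hopf_mult H 0 = (\<lambda>x\<in>carrier H. counit H x \<odot>\<^bsub>H\<^esub> \<one>\<^bsub>H\<^esub>)"
| "hopf_mult H (Suc m) = convolution H H id (hopf_mult H m)"

definition hopf_algebra_killed_by where
  "hopf_algebra_killed_by k m H \<longleftrightarrow> hopf_algebra k H \<and>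
     (\<forall>a\<in>carrier H. hopf_mult H m a = counit H a \<odot>\<^bsub>H\<^esub> \<one>\<^bsub>H\<^esub>)"


section \<open>Bilinear maps and the tensor product of Hopf algebras\<close>

definition tensor_hopf ::
  "('k, 'm) ring_scheme \<Rightarrow> ('k, 'a, 'x) hopf_scheme \<Rightarrow> ('k, 'b, 'y) hopf_scheme
    \<Rightarrow> ('k, ('a \<times> 'b) list set) hopf" where
  "tensor_hopf k A B =
    (let AB = tensor k A B; AB2 = tensor k AB AB in
      module.extend AB (hopf.fields
        (tensor_lift AB2 (\<lambda>a b.
          tensor_lift AB2 (\<lambda>a1 a2.
            tensor_lift AB2 (\<lambda>b1 b2.
              pure_tensor k AB AB (pure_tensor k A B a1 b1) (pure_tensor k A B a2 b2))
            (comult B b))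
          (comult A a)))
        (tensor_lift k (\<lambda>a b. counit A a \<otimes>\<^bsub>k\<^esub> counit B b))
        (tensor_map k A B (antipode A) (antipode B))))"

text \<open>\<open>x \<circ> y\<close> is \<open>\<beta> (x \<otimes> y)\<close>.\<close>

definition bilinear_map where
  "bilinear_map k A B K =
    {\<beta> \<in> coalg_hom k (tensor_hopf k A B) K.
      let circ = (\<lambda>x y. \<beta> (pure_tensor k A B x y)) in
        (\<forall>x\<in>carrier A. \<forall>y\<in>carrier A. \<forall>z\<in>carrier B.
          circ (x \<otimes>\<^bsub>A\<^esub> y) z
            = tensor_lift K (\<lambda>z1 z2. circ x z1 \<otimes>\<^bsub>K\<^esub> circ y z2) (comult B z)) \<and>
        (\<forall>x\<in>carrier A. \<forall>w\<in>carrier B. \<forall>z\<in>carrier B.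
          circ x (w \<otimes>\<^bsub>B\<^esub> z)
            = tensor_lift K (\<lambda>x1 x2. circ x1 w \<otimes>\<^bsub>K\<^esub> circ x2 z) (comult A x)) \<and>
        (\<forall>x\<in>carrier A. circ x \<one>\<^bsub>B\<^esub> = counit A x \<odot>\<^bsub>K\<^esub> \<one>\<^bsub>K\<^esub>) \<and>
        (\<forall>z\<in>carrier B. circ \<one>\<^bsub>A\<^esub> z = counit B z \<odot>\<^bsub>K\<^esub> \<one>\<^bsub>K\<^esub>)}"

text \<open>HOL cannot quantify over the Hopf algebras on all types, so the category of Hopf algebras
  is that of the Hopf algebras whose carrier is a set of elements of a type \<open>'u\<close>.
  No largeness of \<open>'u\<close> is needed beyond being infinite: the base field embeds into the carrier of
  every Hopf algebra, and \<open>A \<boxtimes> B\<close> is generated as an algebra by the elements \<open>a \<circ> b\<close>.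
  \<open>is_box k A B T \<beta>\<close> says that \<open>T\<close>, together with the bilinear map \<open>\<beta>\<close>, is \<open>A \<boxtimes> B\<close>, where
  \<open>A\<close> and \<open>B\<close> may live on other types.\<close>

definition is_box ::
  "('k, 'm) ring_scheme \<Rightarrow> ('k, 'a) hopf \<Rightarrow> ('k, 'b) hopf \<Rightarrow> ('k, 'u) hopf
    \<Rightarrow> (('a \<times> 'b) list set \<Rightarrow> 'u) \<Rightarrow> bool" where
  "is_box k A B T \<beta> \<longleftrightarrow>
    hopf_algebra k T \<and> \<beta> \<in> bilinear_map k A B T \<and>
    (\<forall>(K :: ('k, 'u) hopf) \<gamma>. hopf_algebra k K \<longrightarrow> \<gamma> \<in> bilinear_map k A B K \<longrightarrow>
      (\<exists>!f. f \<in> hopf_hom k T K \<and> (\<forall>t\<in>carrier (tensor k A B). f (\<beta> t) = \<gamma> t)))"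

text \<open>\<open>box_map \<dots> f\<close> is \<open>f \<boxtimes> B : A' \<boxtimes> B \<rightarrow> A \<boxtimes> B\<close> for \<open>f : A' \<rightarrow> A\<close>, where \<open>(T', \<beta>')\<close> is
  \<open>A' \<boxtimes> B\<close> and \<open>(T, \<beta>)\<close> is \<open>A \<boxtimes> B\<close>.\<close>

definition box_map where
  "box_map k A' A B T' \<beta>' T \<beta> f =
    (THE h. h \<in> hopf_hom k T' T \<and>
      (\<forall>t\<in>carrier (tensor k A' B). h (\<beta>' t) = \<beta> (tensor_map k A B f id t)))"

text \<open>\<open>E\<close> is the internal Hom from \<open>B\<close> to \<open>C\<close>: for a choice \<open>A \<mapsto> (box A, \<beta> A)\<close> of the
  products \<open>A \<boxtimes> B\<close>, which have to exist, there are bijections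
  \<open>Hom(A \<boxtimes> B, C) \<rightarrow> Hom(A, E)\<close> natural in \<open>A\<close>.\<close>

definition is_internal_hom ::
  "('k, 'm) ring_scheme \<Rightarrow> ('k, 'u) hopf \<Rightarrow> ('k, 'u) hopf \<Rightarrow> ('k, 'u) hopf \<Rightarrow> bool" where
  "is_internal_hom k B C E \<longleftrightarrow> hopf_algebra k E \<and>
    (\<exists>(box :: ('k, 'u) hopf \<Rightarrow> ('k, 'u) hopf) \<beta> \<phi>.
      (\<forall>A. hopf_algebra k A \<longrightarrow> is_box k A B (box A) (\<beta> A)) \<and>
      (\<forall>A. hopf_algebra k A \<longrightarrow> bij_betw (\<phi> A) (hopf_hom k (box A) C) (hopf_hom k A E)) \<and>
      (\<forall>A A' f g. hopf_algebra k A \<longrightarrow> hopf_algebra k A' \<longrightarrow>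
        f \<in> hopf_hom k A' A \<longrightarrow> g \<in> hopf_hom k (box A) C \<longrightarrow>
        \<phi> A' (compose (carrier (box A')) g (box_map k A' A B (box A') (\<beta> A') (box A) (\<beta> A) f))
          = compose (carrier A') (\<phi> A g) f))"


section \<open>The linear dual and the Cartier dual\<close>

text \<open>The algebra \<open>H\<^sup>*\<close>, with the multiplication dual to the comultiplication of \<open>H\<close>.\<close>

definition dual_algebra ::
  "('k, 'm) ring_scheme \<Rightarrow> ('k, 'a, 'x) hopf_scheme \<Rightarrow> ('k, 'a \<Rightarrow> 'k) module" where
  "dual_algebra k H =
    \<lparr> carrier = module_hom k H (base_algebra k) \<inter> extensional (carrier H),
      mult = (\<lambda>f g. \<lambda>x\<in>carrier H. tensor_lift k (\<lambda>a b. f a \<otimes>\<^bsub>k\<^esub> g b) (comult H x)),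
      one = restrict (counit H) (carrier H),
      zero = (\<lambda>x\<in>carrier H. \<zero>\<^bsub>k\<^esub>),
      add = (\<lambda>f g. \<lambda>x\<in>carrier H. f x \<oplus>\<^bsub>k\<^esub> g x),
      smult = (\<lambda>c f. \<lambda>x\<in>carrier H. c \<otimes>\<^bsub>k\<^esub> f x) \<rparr>"

definition dual_antipode where
  "dual_antipode H f = (\<lambda>x\<in>carrier H. f (antipode H x))"

text \<open>The comultiplication \<open>H\<^sup>* \<rightarrow> (H \<otimes> H)\<^sup>*\<close>, dual to the multiplication of \<open>H\<close>.\<close>

definition dual_comult where
  "dual_comult k H f = (\<lambda>u\<in>carrier (tensor k H H). f (tensor_lift H (mult H) u))"

text \<open>The embedding \<open>H\<^sup>* \<otimes> H\<^sup>* \<rightarrow> (H \<otimes> H)\<^sup>*\<close>, \<open>(f \<otimes> g)(x \<otimes> y) = f(x) g(y)\<close>.\<close>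

definition dual_tensor_embed where
  "dual_tensor_embed k H t = (\<lambda>u\<in>carrier (tensor k H H).
     tensor_lift k (\<lambda>f g. tensor_lift k (\<lambda>x y. f x \<otimes>\<^bsub>k\<^esub> g y) u) t)"

abbreviation dual_tensor_square where
  "dual_tensor_square k H S \<equiv>
    tensor k (dual_algebra k H\<lparr>carrier := S\<rparr>) (dual_algebra k H\<lparr>carrier := S\<rparr>)"

definition hopf_subalgebra_of_dual where
  "hopf_subalgebra_of_dual k H S \<longleftrightarrow>
    subring S (dual_algebra k H) \<and>
    (\<forall>c\<in>carrier k. \<forall>f\<in>S. c \<odot>\<^bsub>dual_algebra k H\<^esub> f \<in> S) \<and>
    (\<forall>f\<in>S. dual_antipode H f \<in> S) \<and>
    (\<forall>f\<in>S. \<exists>t\<in>carrier (dual_tensor_square k H S). dual_comult k H f = dual_tensor_embed k H t)"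

text \<open>The Hopf algebra on a set \<open>S\<close> of functionals with \<open>\<Delta>(S) \<subseteq> S \<otimes> S \<subseteq> (H \<otimes> H)\<^sup>*\<close>.\<close>

definition dual_hopf ::
  "('k, 'm) ring_scheme \<Rightarrow> ('k, 'a, 'x) hopf_scheme \<Rightarrow> ('a \<Rightarrow> 'k) set \<Rightarrow> ('k, 'a \<Rightarrow> 'k) hopf" where
  "dual_hopf k H S =
    module.extend (dual_algebra k H\<lparr>carrier := S\<rparr>) (hopf.fields
      (\<lambda>f. THE t. t \<in> carrier (dual_tensor_square k H S) \<and>
        dual_comult k H f = dual_tensor_embed k H t)
      (\<lambda>f. f \<one>\<^bsub>H\<^esub>)
      (dual_antipode H))"

text \<open>\<open>H\<^sup>*\<close> as a Hopf algebra; this is only meaningful for finite dimensional \<open>H\<close>.\<close>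

definition linear_dual where
  "linear_dual k H = dual_hopf k H (carrier (dual_algebra k H))"

definition cartier_dual where
  "cartier_dual k H = dual_hopf k H (\<Union>{S. hopf_subalgebra_of_dual k H S})"

end

theory Submission
  imports Defs
begin

text \<open>Let \<open>T = B \<boxtimes> C\<^sup>*\<close> with \<open>C\<close> finite dimensional. A Hopf algebra map \<open>A \<rightarrow> T\<^sup>0\<close> is the
  same as a Hopf pairing of \<open>A\<close> and \<open>T\<close>, hence, by the symmetry of this notion, as a map
  \<open>T \<rightarrow> A\<^sup>0\<close>, that is, as a bilinear map from \<open>B\<close> and \<open>C\<^sup>*\<close> to \<open>A\<^sup>0\<close>. This is a trilinear
  form on \<open>A\<close>, \<open>B\<close> and \<open>C\<^sup>*\<close> with conditions that are symmetric in the three arguments, and since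
  \<open>C = C\<^sup>*\<^sup>*\<close> it is also the same as a bilinear map from \<open>A\<close> and \<open>B\<close> to \<open>C\<close>. So \<open>T\<^sup>0\<close> represents the
  functor that defines the internal Hom \<open>E\<close>. All identities between elements of duals and of tensor
  products of duals are verified by evaluation, since over a field the functionals separate points.

  The functors are only compared on Hopf algebras living on the type \<open>'u\<close>. Every element of \<open>T\<^sup>0\<close>
  lies in a Hopf subalgebra that is no larger than \<open>'u\<close>, obtained by closing up under the operations
  and under the components of a choice of coproducts. Hence the universal map \<open>E \<rightarrow> T\<^sup>0\<close> is
  surjective, so that \<open>T\<^sup>0\<close> itself embeds into \<open>'u\<close> and the Yoneda argument applies.\<close>

section \<open>Sums over lists and tensor products\<close>

text \<open>The obstacle is size. If \<open>T\<close> is infinite dimensional, its full dual can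
  have more elements than \<open>'u\<close>, and nothing says beforehand that
  \<open>T\<^sup>0\<close> is among the Hopf algebras on which \<open>is_internal_hom\<close> is
  tested. The same holds for \<open>A\<^sup>0\<close>, the natural target of maps out of
  \<open>T\<close>, so the universal property of the box cannot be applied to it directly either.

  The symmetry of the trilinear form rests on one observation: when a bilinear map into
  \<open>K\<close> is paired with a further Hopf algebra, compatibility with the coproduct of
  \<open>K\<close> turns into multiplicativity in the new variable. Multiplicativity in any one
  variable is then a double sum over the coproducts of the other two.

  Finite dimension of \<open>C\<close> gives two things: all functionals on \<open>C\<close>
  together form a Hopf algebra, and every functional on that dual is evaluation at a point of
  \<open>C\<close>, so that a form can be turned back into a map to \<open>C\<close>.

  Since elements of tensor products are classes of lists, a coproduct has a list of components. All
  laws become identities between iterated finite sums, and no basis of an infinite dimensional space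
  is chosen.\<close>

lemma tensor_sum_Nil [simp]: "tensor_sum M F [] = \<zero>\<^bsub>M\<^esub>"
  by (simp add: tensor_sum_def)

lemma tensor_sum_Cons [simp]:
  "tensor_sum M F (x # xs) = F (fst x) (snd x) \<oplus>\<^bsub>M\<^esub> tensor_sum M F xs"
  by (cases x) (simp add: tensor_sum_def)

lemma tensor_sum_cong:
  "(\<And>a b. (a, b) \<in> set xs \<Longrightarrow> F a b = G a b) \<Longrightarrow> tensor_sum M F xs = tensor_sum M G xs"
  by (induction xs) auto

lemma tensor_sum_map:
  "tensor_sum M F (map (\<lambda>(a, b). (f a b, g a b)) xs)
    = tensor_sum M (\<lambda>a b. F (f a b) (g a b)) xs"
  by (induction xs) (auto simp: case_prod_beta)

context abelian_monoid
begin

lemma add_add_exchange: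
  assumes "w \<in> carrier G" "x \<in> carrier G" "y \<in> carrier G" "z \<in> carrier G"
  shows "(w \<oplus> x) \<oplus> (y \<oplus> z) = (w \<oplus> y) \<oplus> (x \<oplus> z)"
  using assms by (simp add: a_ac)

lemma tensor_sum_closed [simp]:
  "(\<And>a b. (a, b) \<in> set xs \<Longrightarrow> F a b \<in> carrier G) \<Longrightarrow> tensor_sum G F xs \<in> carrier G"
  by (induction xs) auto

lemma tensor_sum_append:
  assumes "\<And>a b. (a, b) \<in> set xs \<union> set ys \<Longrightarrow> F a b \<in> carrier G"
  shows "tensor_sum G F (xs @ ys) = tensor_sum G F xs \<oplus> tensor_sum G F ys"
  using assms by (induction xs) (auto simp: a_assoc)

lemma tensor_sum_zero: "tensor_sum G (\<lambda>a b. \<zero>) xs = \<zero>"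
  by (induction xs) auto

lemma tensor_sum_add:
  assumes "\<And>a b. (a, b) \<in> set xs \<Longrightarrow> F a b \<in> carrier G"
    and "\<And>a b. (a, b) \<in> set xs \<Longrightarrow> F' a b \<in> carrier G"
  shows "tensor_sum G (\<lambda>a b. F a b \<oplus> F' a b) xs = tensor_sum G F xs \<oplus> tensor_sum G F' xs"
  using assms
proof (induction xs)
  case (Cons x xs)
  have [simp]: "F (fst x) (snd x) \<in> carrier G" "F' (fst x) (snd x) \<in> carrier G"
    "tensor_sum G F xs \<in> carrier G" "tensor_sum G F' xs \<in> carrier G"
    using Cons.prems by auto
  show ?case using Cons by (simp add: a_ac)
qed auto

lemma tensor_sum_swap:
  assumes "\<And>a b c d. (a, b) \<in> set xs \<Longrightarrow> (c, d) \<in> set ys \<Longrightarrow> F a b c d \<in> carrier G"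
  shows "tensor_sum G (\<lambda>a b. tensor_sum G (\<lambda>c d. F a b c d) ys) xs
    = tensor_sum G (\<lambda>c d. tensor_sum G (\<lambda>a b. F a b c d) xs) ys"
  using assms
proof (induction xs)
  case (Cons x xs)
  have "tensor_sum G (\<lambda>c d. F (fst x) (snd x) c d \<oplus> tensor_sum G (\<lambda>a b. F a b c d) xs) ys
     = tensor_sum G (\<lambda>c d. F (fst x) (snd x) c d) ys
       \<oplus> tensor_sum G (\<lambda>c d. tensor_sum G (\<lambda>a b. F a b c d) xs) ys"
    by (rule tensor_sum_add) (use Cons.prems in auto)
  then show ?case using Cons by simp
qed (simp add: tensor_sum_zero)

text \<open>Lists of this shape define the product in \<open>tensor\<close>; the same shape recurs
  whenever the components of two coproducts are combined.\<close>

lemma tensor_sum_prod: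
  assumes "\<And>a b c d. (a, b) \<in> set xs \<Longrightarrow> (c, d) \<in> set ys \<Longrightarrow> F (f a c) (g b d) \<in> carrier G"
  shows "tensor_sum G F [(f a c, g b d). (a, b) \<leftarrow> xs, (c, d) \<leftarrow> ys]
    = tensor_sum G (\<lambda>a b. tensor_sum G (\<lambda>c d. F (f a c) (g b d)) ys) xs"
  using assms
proof (induction xs)
  case (Cons x xs)
  obtain a b where x: "x = (a, b)" by force
  have "tensor_sum G F (map (\<lambda>(c, d). (f a c, g b d)) ys) = tensor_sum G (\<lambda>c d. F (f a c) (g b d)) ys"
    by (rule tensor_sum_map)
  moreover have "tensor_sum G F (map (\<lambda>(c, d). (f a c, g b d)) ys @ [(f a c, g b d). (a, b) \<leftarrow> xs, (c, d) \<leftarrow> ys])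
    = tensor_sum G F (map (\<lambda>(c, d). (f a c, g b d)) ys) \<oplus> tensor_sum G F [(f a c, g b d). (a, b) \<leftarrow> xs, (c, d) \<leftarrow> ys]"
  proof (rule tensor_sum_append)
    fix u v assume "(u, v) \<in> set (map (\<lambda>(c, d). (f a c, g b d)) ys) \<union> set [(f a c, g b d). (a, b) \<leftarrow> xs, (c, d) \<leftarrow> ys]"
    then obtain a' b' c d where "(a', b') \<in> set (x # xs)" "(c, d) \<in> set ys" "u = f a' c" "v = g b' d"
      using x by auto
    then show "F u v \<in> carrier G" using Cons.prems by simp
  qed
  ultimately show ?case using Cons x by simp
qed auto

end

lemma tensor_sum_hom:
  assumes "\<And>a b. (a, b) \<in> set xs \<Longrightarrow> F a b \<in> carrier M" "abelian_monoid M"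
    and "h \<zero>\<^bsub>M\<^esub> = \<zero>\<^bsub>N\<^esub>"
    and "\<And>x y. x \<in> carrier M \<Longrightarrow> y \<in> carrier M \<Longrightarrow> h (x \<oplus>\<^bsub>M\<^esub> y) = h x \<oplus>\<^bsub>N\<^esub> h y"
  shows "h (tensor_sum M F xs) = tensor_sum N (\<lambda>a b. h (F a b)) xs"
  using assms(1)
proof (induction xs)
  case (Cons x xs)
  have "tensor_sum M F xs \<in> carrier M"
    by (rule abelian_monoid.tensor_sum_closed[OF assms(2)]) (use Cons.prems in auto)
  then show ?case using Cons assms(4) by simp
qed (use assms in auto)

lemma base_algebra_simps [simp]:
  "carrier (base_algebra k) = carrier k" "mult (base_algebra k) = mult k"
  "one (base_algebra k) = one k" "zero (base_algebra k) = zero k"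
  "add (base_algebra k) = add k" "smult (base_algebra k) = mult k"
  by (simp_all add: base_algebra_def)

lemma tensor_sum_base_algebra [simp]: "tensor_sum (base_algebra k) = tensor_sum k"
  by (intro ext) (simp add: tensor_sum_def)

lemma tensor_lift_base_algebra [simp]: "tensor_lift (base_algebra k) = tensor_lift k"
  by (intro ext) (simp add: tensor_lift_def)

lemma base_algebra_module:
  assumes "cring k" shows "module k (base_algebra k)"
proof -
  interpret cring k by fact
  show ?thesis
    by (rule moduleI[OF assms])
      (auto intro!: abelian_groupI simp: a_assoc l_distr r_distr m_assoc intro: a_comm l_neg a_inv_closed)
qed

lemma module_hom_iff:
  "f \<in> module_hom k M N \<longleftrightarrow> (\<forall>x\<in>carrier M. f x \<in> carrier N) \<and>
    (\<forall>x\<in>carrier M. \<forall>y\<in>carrier M. f (x \<oplus>\<^bsub>M\<^esub> y) = f x \<oplus>\<^bsub>N\<^esub> f y) \<and>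
    (\<forall>c\<in>carrier k. \<forall>x\<in>carrier M. f (c \<odot>\<^bsub>M\<^esub> x) = c \<odot>\<^bsub>N\<^esub> f x)"
  by (auto simp: module_hom_def Pi_def)

lemma module_homI:
  assumes "\<And>x. x \<in> carrier M \<Longrightarrow> f x \<in> carrier N"
    "\<And>x y. x \<in> carrier M \<Longrightarrow> y \<in> carrier M \<Longrightarrow> f (x \<oplus>\<^bsub>M\<^esub> y) = f x \<oplus>\<^bsub>N\<^esub> f y"
    "\<And>c x. c \<in> carrier k \<Longrightarrow> x \<in> carrier M \<Longrightarrow> f (c \<odot>\<^bsub>M\<^esub> x) = c \<odot>\<^bsub>N\<^esub> f x"
  shows "f \<in> module_hom k M N"
  using assms by (simp add: module_hom_iff)

lemma module_homD:
  assumes "f \<in> module_hom k M N"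
  shows "x \<in> carrier M \<Longrightarrow> f x \<in> carrier N"
    "x \<in> carrier M \<Longrightarrow> y \<in> carrier M \<Longrightarrow> f (x \<oplus>\<^bsub>M\<^esub> y) = f x \<oplus>\<^bsub>N\<^esub> f y"
    "c \<in> carrier k \<Longrightarrow> x \<in> carrier M \<Longrightarrow> f (c \<odot>\<^bsub>M\<^esub> x) = c \<odot>\<^bsub>N\<^esub> f x"
  using assms by (simp_all add: module_hom_iff)

lemma module_hom_cong:
  assumes "module k M" "\<And>x. x \<in> carrier M \<Longrightarrow> f x = g x"
  shows "f \<in> module_hom k M N \<longleftrightarrow> g \<in> module_hom k M N"
proof -
  interpret module k M by fact
  show ?thesis using assms(2) by (simp add: module_hom_iff)
qed

lemma module_hom_congI:
  assumes "f \<in> module_hom k M N" "module k M" "\<And>x. x \<in> carrier M \<Longrightarrow> f x = g x"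
  shows "g \<in> module_hom k M N"
  using assms(1) module_hom_cong[OF assms(2,3), where N = N] by simp

lemma module_hom_zero:
  assumes "f \<in> module_hom k M N" "module k M" "module k N"
  shows "f \<zero>\<^bsub>M\<^esub> = \<zero>\<^bsub>N\<^esub>"
proof -
  interpret M: module k M by fact
  interpret N: module k N by fact
  have "f (\<zero>\<^bsub>k\<^esub> \<odot>\<^bsub>M\<^esub> \<zero>\<^bsub>M\<^esub>) = \<zero>\<^bsub>k\<^esub> \<odot>\<^bsub>N\<^esub> f \<zero>\<^bsub>M\<^esub>"
    by (rule module_homD(3)[OF assms(1)]) auto
  then show ?thesis using module_homD(1)[OF assms(1)] by simp
qed

lemma module_hom_tensor_sum:
  assumes "f \<in> module_hom k M N" "module k M" "module k N"
    "\<And>a b. (a, b) \<in> set xs \<Longrightarrow> F a b \<in> carrier M"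
  shows "f (tensor_sum M F xs) = tensor_sum N (\<lambda>a b. f (F a b)) xs"
proof -
  interpret M: module k M by fact
  show ?thesis
    by (rule tensor_sum_hom) (use assms module_hom_zero module_homD[OF assms(1)] in \<open>auto intro: M.abelian_monoid_axioms\<close>)
qed

lemma module_hom_id: "(\<lambda>x. x) \<in> module_hom k M M"
  by (simp add: module_hom_iff)

lemma module_hom_comp:
  "f \<in> module_hom k A B \<Longrightarrow> g \<in> module_hom k B C \<Longrightarrow> (\<lambda>x. g (f x)) \<in> module_hom k A C"
  by (simp add: module_hom_iff)

text \<open>The list stays fixed while the summands depend linearly on a parameter. In this way
  linearity in one variable is obtained for expressions that already contain a sum over the
  components of another.\<close>

lemma module_hom_sum:
  assumes "module k M" "module k N" "\<And>a b. (a, b) \<in> set xs \<Longrightarrow> (\<lambda>x. F x a b) \<in> module_hom k M N"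
  shows "(\<lambda>x. tensor_sum N (F x) xs) \<in> module_hom k M N"
proof -
  interpret M: module k M by fact
  interpret N: module k N by fact
  have *: "(\<lambda>y. c \<odot>\<^bsub>N\<^esub> y) \<in> module_hom k N N" if "c \<in> carrier k" for c
    using that by (auto simp: module_hom_iff N.smult_r_distr N.smult_assoc1[symmetric] M.R.m_comm)
  show ?thesis
  proof (rule module_homI)
    fix x y assume xy: "x \<in> carrier M" "y \<in> carrier M"
    have "tensor_sum N (F (x \<oplus>\<^bsub>M\<^esub> y)) xs = tensor_sum N (\<lambda>a b. F x a b \<oplus>\<^bsub>N\<^esub> F y a b) xs"
      by (rule tensor_sum_cong) (use module_homD(2)[OF assms(3)] xy in auto)
    also have "\<dots> = tensor_sum N (F x) xs \<oplus>\<^bsub>N\<^esub> tensor_sum N (F y) xs"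
      by (rule N.tensor_sum_add) (use assms(3) xy in \<open>auto dest: module_homD(1)\<close>)
    finally show "tensor_sum N (F (x \<oplus>\<^bsub>M\<^esub> y)) xs = tensor_sum N (F x) xs \<oplus>\<^bsub>N\<^esub> tensor_sum N (F y) xs" .
  next
    fix c x assume cx: "c \<in> carrier k" "x \<in> carrier M"
    have "tensor_sum N (F (c \<odot>\<^bsub>M\<^esub> x)) xs = tensor_sum N (\<lambda>a b. c \<odot>\<^bsub>N\<^esub> F x a b) xs"
      by (rule tensor_sum_cong) (use module_homD(3)[OF assms(3)] cx in auto)
    also have "\<dots> = c \<odot>\<^bsub>N\<^esub> tensor_sum N (F x) xs"
      by (rule module_hom_tensor_sum[OF *, symmetric])
        (use assms cx in \<open>auto dest: module_homD(1)\<close>)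
    finally show "tensor_sum N (F (c \<odot>\<^bsub>M\<^esub> x)) xs = c \<odot>\<^bsub>N\<^esub> tensor_sum N (F x) xs" .
  qed (auto intro: N.tensor_sum_closed module_homD(1)[OF assms(3)])
qed

lemma module_hom_smult:
  assumes "module k N" "f \<in> module_hom k M N" "c \<in> carrier k"
  shows "(\<lambda>x. c \<odot>\<^bsub>N\<^esub> f x) \<in> module_hom k M N"
proof -
  interpret N: module k N by fact
  show ?thesis
    using assms by (simp add: module_hom_iff N.smult_r_distr N.smult_assoc1[symmetric] N.R.m_comm)
qed

lemma module_hom_smult_left:
  assumes "module k N" "f \<in> module_hom k M (base_algebra k)" "y \<in> carrier N"
  shows "(\<lambda>x. f x \<odot>\<^bsub>N\<^esub> y) \<in> module_hom k M N"
proof -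
  interpret N: module k N by fact
  show ?thesis
    using assms by (simp add: module_hom_iff N.smult_l_distr N.smult_assoc1[symmetric])
qed

lemma module_hom_mult_left:
  assumes "algebra k N" "f \<in> module_hom k M N" "y \<in> carrier N"
  shows "(\<lambda>x. f x \<otimes>\<^bsub>N\<^esub> y) \<in> module_hom k M N"
proof -
  interpret N: algebra k N by fact
  show ?thesis
    using assms by (simp add: module_hom_iff N.l_distr N.smult_assoc2)
qed

lemma module_hom_mult_right:
  assumes "algebra k N" "f \<in> module_hom k M N" "y \<in> carrier N"
  shows "(\<lambda>x. y \<otimes>\<^bsub>N\<^esub> f x) \<in> module_hom k M N"
proof -
  interpret N: algebra k N by fact
  have "(\<lambda>x. f x \<otimes>\<^bsub>N\<^esub> y) \<in> module_hom k M N" by (rule module_hom_mult_left) fact+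
  then show ?thesis
    using assms by (simp add: module_hom_iff N.m_comm)
qed

lemma module_hom_scalar_left:
  assumes "cring k" "f \<in> module_hom k M (base_algebra k)" "c \<in> carrier k"
  shows "(\<lambda>x. f x \<otimes>\<^bsub>k\<^esub> c) \<in> module_hom k M (base_algebra k)"
proof -
  interpret cring k by fact
  show ?thesis using assms by (simp add: module_hom_iff l_distr m_assoc)
qed

lemma module_hom_scalar_right:
  assumes "cring k" "f \<in> module_hom k M (base_algebra k)" "c \<in> carrier k"
  shows "(\<lambda>x. c \<otimes>\<^bsub>k\<^esub> f x) \<in> module_hom k M (base_algebra k)"
proof -
  interpret cring k by fact
  show ?thesis using assms by (simp add: module_hom_iff r_distr m_lcomm)
qed

section \<open>The tensor product of modules and its universal property\<close>

definition bilinear where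
  "bilinear k A B M F \<longleftrightarrow> (\<forall>b\<in>carrier B. (\<lambda>a. F a b) \<in> module_hom k A M) \<and>
     (\<forall>a\<in>carrier A. (\<lambda>b. F a b) \<in> module_hom k B M)"

lemma bilinearI:
  assumes "\<And>b. b \<in> carrier B \<Longrightarrow> (\<lambda>a. F a b) \<in> module_hom k A M"
    "\<And>a. a \<in> carrier A \<Longrightarrow> (\<lambda>b. F a b) \<in> module_hom k B M"
  shows "bilinear k A B M F"
  using assms by (simp add: bilinear_def)

lemma bilinearD:
  assumes "bilinear k A B M F"
  shows "b \<in> carrier B \<Longrightarrow> (\<lambda>a. F a b) \<in> module_hom k A M"
    "a \<in> carrier A \<Longrightarrow> (\<lambda>b. F a b) \<in> module_hom k B M"
    "a \<in> carrier A \<Longrightarrow> b \<in> carrier B \<Longrightarrow> F a b \<in> carrier M"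
  using assms by (simp_all add: bilinear_def module_hom_iff)

lemma bilinear_comp:
  "bilinear k A B M F \<Longrightarrow> g \<in> module_hom k M N \<Longrightarrow> bilinear k A B N (\<lambda>a b. g (F a b))"
  by (auto simp: bilinear_def intro: module_hom_comp[where g = g])

lemma bilinear_comp2:
  assumes "bilinear k A B M F" "f \<in> module_hom k A' A" "g \<in> module_hom k B' B"
  shows "bilinear k A' B' M (\<lambda>a b. F (f a) (g b))"
  using assms unfolding bilinear_def module_hom_iff by simp

lemma bilinear_swap: "bilinear k A B M F \<Longrightarrow> bilinear k B A M (\<lambda>b a. F a b)"
  by (simp add: bilinear_def)

locale two_modules = A?: module k A + B?: module k B
  for k :: "('k, 'm) ring_scheme" and A :: "('k, 'a, 'x) module_scheme"
    and B :: "('k, 'b, 'y) module_scheme"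
begin

abbreviation cls where "cls \<equiv> tensor_class k A B"
abbreviation rel where "rel \<equiv> tensor_rel k A B"
abbreviation L where "L \<equiv> lists (carrier A \<times> carrier B)"

lemma listsD: "xs \<in> L \<Longrightarrow> (a, b) \<in> set xs \<Longrightarrow> a \<in> carrier A \<and> b \<in> carrier B"
  by (auto simp: lists_eq_set)

lemma map_lists:
  "xs \<in> L \<Longrightarrow> (\<And>a. a \<in> carrier A \<Longrightarrow> f a \<in> carrier A) \<Longrightarrow> map (\<lambda>(a, b). (f a, b)) xs \<in> L"
  by (induction xs) auto

lemma rel_lists: "rel xs ys \<Longrightarrow> xs \<in> L \<and> ys \<in> L"
  by (induction rule: tensor_rel.induct) auto

lemma cls_eq_iff: "xs \<in> L \<Longrightarrow> cls xs = cls ys \<longleftrightarrow> rel xs ys"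
  unfolding tensor_class_def by (auto intro: tensor_rel.intros dest: tensor_rel.refl)

lemma cls_eq: "rel xs ys \<Longrightarrow> cls xs = cls ys"
  using rel_lists cls_eq_iff by blast

lemma mem_cls: "xs \<in> L \<Longrightarrow> xs \<in> cls xs"
  unfolding tensor_class_def by (auto intro: tensor_rel.refl)

lemma carrier_tensor: "carrier (tensor k A B) = cls ` L"
  by (simp add: tensor_def)

lemma tensor_cases:
  assumes "t \<in> carrier (tensor k A B)"
  obtains xs where "xs \<in> L" "t = cls xs"
  using assms by (auto simp: carrier_tensor)

lemma tensor_zero: "\<zero>\<^bsub>tensor k A B\<^esub> = cls []"
  by (simp add: tensor_def)

lemma cls_closed: "xs \<in> L \<Longrightarrow> cls xs \<in> carrier (tensor k A B)"
  by (simp add: carrier_tensor)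

text \<open>The definition of \<open>add\<close> joins the classes obtained from all pairs of
  representatives. They coincide by congruence and there is at least one, so the union is a single
  class; \<open>cls_smult\<close> follows the same pattern.\<close>

lemma cls_add:
  assumes "xs \<in> L" "ys \<in> L"
  shows "cls xs \<oplus>\<^bsub>tensor k A B\<^esub> cls ys = cls (xs @ ys)"
proof -
  have "cls (xs' @ ys') = cls (xs @ ys)" if "xs' \<in> cls xs" "ys' \<in> cls ys" for xs' ys'
    using that by (intro cls_eq tensor_rel.append) (auto simp: tensor_class_def intro: tensor_rel.sym)
  then have "(\<Union>xs'\<in>cls xs. \<Union>ys'\<in>cls ys. cls (xs' @ ys'))
      = (\<Union>xs'\<in>cls xs. \<Union>ys'\<in>cls ys. cls (xs @ ys))"
    by (intro SUP_cong HOL.refl)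
  also have "\<dots> = cls (xs @ ys)" using mem_cls[OF assms(1)] mem_cls[OF assms(2)] by blast
  finally show ?thesis by (simp add: tensor_def)
qed

lemma rel_smult:
  assumes "rel xs ys" "c \<in> carrier k"
  shows "rel (map (\<lambda>(a, b). (c \<odot>\<^bsub>A\<^esub> a, b)) xs) (map (\<lambda>(a, b). (c \<odot>\<^bsub>A\<^esub> a, b)) ys)"
  using assms(1)
proof (induction rule: tensor_rel.induct)
  case (refl xs)
  then show ?case using assms(2) by (intro tensor_rel.refl map_lists) auto
next
  case (comm xs ys)
  then show ?case using assms(2) by (simp only: map_append) (intro tensor_rel.comm map_lists; simp)
next
  case (add_left a a' b)
  then show ?case using assms(2) by (auto simp: A.smult_r_distr intro!: tensor_rel.add_left)
next
  case (smult d a b)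
  have "c \<odot>\<^bsub>A\<^esub> (d \<odot>\<^bsub>A\<^esub> a) = d \<odot>\<^bsub>A\<^esub> (c \<odot>\<^bsub>A\<^esub> a)"
    using smult assms(2) by (simp add: A.smult_assoc1[symmetric] A.R.m_comm)
  then show ?case using smult assms(2) by (auto intro!: tensor_rel.smult)
qed (use assms in \<open>auto intro: tensor_rel.intros\<close>)

lemma cls_smult:
  assumes "xs \<in> L" "c \<in> carrier k"
  shows "c \<odot>\<^bsub>tensor k A B\<^esub> cls xs = cls (map (\<lambda>(a, b). (c \<odot>\<^bsub>A\<^esub> a, b)) xs)"
proof -
  have "cls (map (\<lambda>(a, b). (c \<odot>\<^bsub>A\<^esub> a, b)) xs') = cls (map (\<lambda>(a, b). (c \<odot>\<^bsub>A\<^esub> a, b)) xs)" if "xs' \<in> cls xs" for xs'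
    using that assms by (intro cls_eq rel_smult) (auto simp: tensor_class_def intro: tensor_rel.sym)
  then have "(\<Union>xs'\<in>cls xs. cls (map (\<lambda>(a, b). (c \<odot>\<^bsub>A\<^esub> a, b)) xs'))
      = (\<Union>xs'\<in>cls xs. cls (map (\<lambda>(a, b). (c \<odot>\<^bsub>A\<^esub> a, b)) xs))"
    by (intro SUP_cong HOL.refl)
  also have "\<dots> = cls (map (\<lambda>(a, b). (c \<odot>\<^bsub>A\<^esub> a, b)) xs)" using mem_cls[OF assms(1)] by blast
  finally show ?thesis by (simp add: tensor_def)
qed

lemma pure_closed [simp]:
  "a \<in> carrier A \<Longrightarrow> b \<in> carrier B \<Longrightarrow> pure_tensor k A B a b \<in> carrier (tensor k A B)"
  by (simp add: pure_tensor_def cls_closed)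

lemma cls_Cons:
  assumes "a \<in> carrier A" "b \<in> carrier B" "xs \<in> L"
  shows "cls ((a, b) # xs) = pure_tensor k A B a b \<oplus>\<^bsub>tensor k A B\<^esub> cls xs"
  using assms by (simp add: pure_tensor_def cls_add)

text \<open>Formal sums form only a monoid, so additive inverses have to come from the relations:
  negate the left factors and cancel one pair at a time by additivity on the left and the rule for
  zero.\<close>

lemma neg_rel:
  assumes "xs \<in> L"
  shows "rel (map (\<lambda>(a, b). (\<ominus>\<^bsub>A\<^esub> a, b)) xs @ xs) []"
  using assms
proof (induction xs rule: list.induct)
  case (Cons x xs)
  obtain a b where x: "x = (a, b)" by force
  let ?n = "map (\<lambda>(a, b). (\<ominus>\<^bsub>A\<^esub> a, b)) xs"
  have ab: "a \<in> carrier A" "b \<in> carrier B" "xs \<in> L"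
    using Cons.prems x by auto
  have n: "?n \<in> L" by (intro map_lists ab) auto
  have "rel [(\<ominus>\<^bsub>A\<^esub> a \<oplus>\<^bsub>A\<^esub> a, b)] [(\<ominus>\<^bsub>A\<^esub> a, b), (a, b)]"
    by (rule tensor_rel.add_left) (use ab in auto)
  then have 1: "rel [(\<ominus>\<^bsub>A\<^esub> a, b), (a, b)] []"
    using ab A.M.l_neg[of a] tensor_rel.zero[of b B k A] by (metis tensor_rel.sym tensor_rel.trans)
  have "rel (?n @ [(a, b)]) ([(a, b)] @ ?n)"
    by (rule tensor_rel.comm) (use ab n in auto)
  then have "rel ([(\<ominus>\<^bsub>A\<^esub> a, b)] @ (?n @ [(a, b)]) @ xs) ([(\<ominus>\<^bsub>A\<^esub> a, b)] @ ([(a, b)] @ ?n) @ xs)"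
    by (intro tensor_rel.append[OF tensor_rel.refl tensor_rel.append[OF _ tensor_rel.refl]]) (use ab in auto)
  moreover have "rel ([(\<ominus>\<^bsub>A\<^esub> a, b)] @ ([(a, b)] @ ?n) @ xs) ([] @ [])"
    using tensor_rel.append[OF 1 Cons.IH[OF ab(3)]] by simp
  ultimately have "rel ([(\<ominus>\<^bsub>A\<^esub> a, b)] @ (?n @ [(a, b)]) @ xs) ([] @ [])"
    by (rule tensor_rel.trans)
  then show ?case by (simp add: x)
qed (simp add: tensor_rel.refl)

sublocale tensor: abelian_group "tensor k A B"
proof (rule abelian_groupI)
  show "x \<oplus>\<^bsub>tensor k A B\<^esub> y \<in> carrier (tensor k A B)"
    if "x \<in> carrier (tensor k A B)" "y \<in> carrier (tensor k A B)" for x y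
    using that by (elim tensor_cases) (simp add: cls_add cls_closed)
  show "\<zero>\<^bsub>tensor k A B\<^esub> \<in> carrier (tensor k A B)"
    by (simp add: tensor_zero cls_closed)
  show "x \<oplus>\<^bsub>tensor k A B\<^esub> y \<oplus>\<^bsub>tensor k A B\<^esub> z = x \<oplus>\<^bsub>tensor k A B\<^esub> (y \<oplus>\<^bsub>tensor k A B\<^esub> z)"
    if "x \<in> carrier (tensor k A B)" "y \<in> carrier (tensor k A B)" "z \<in> carrier (tensor k A B)" for x y z
    using that by (elim tensor_cases) (simp add: cls_add)
  show "x \<oplus>\<^bsub>tensor k A B\<^esub> y = y \<oplus>\<^bsub>tensor k A B\<^esub> x"
    if "x \<in> carrier (tensor k A B)" "y \<in> carrier (tensor k A B)" for x y
    using that by (elim tensor_cases) (simp add: cls_add cls_eq tensor_rel.comm)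
  show "\<zero>\<^bsub>tensor k A B\<^esub> \<oplus>\<^bsub>tensor k A B\<^esub> x = x" if "x \<in> carrier (tensor k A B)" for x
    using that by (elim tensor_cases) (simp add: cls_add tensor_zero)
  show "\<exists>y\<in>carrier (tensor k A B). y \<oplus>\<^bsub>tensor k A B\<^esub> x = \<zero>\<^bsub>tensor k A B\<^esub>"
    if "x \<in> carrier (tensor k A B)" for x
  proof -
    obtain xs where xs: "xs \<in> L" "x = cls xs" using \<open>x \<in> _\<close> by (rule tensor_cases)
    have n: "map (\<lambda>(a, b). (\<ominus>\<^bsub>A\<^esub> a, b)) xs \<in> L" using xs by (intro map_lists) auto
    show ?thesis
      by (rule bexI[of _ "cls (map (\<lambda>(a, b). (\<ominus>\<^bsub>A\<^esub> a, b)) xs)"])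
        (use xs n in \<open>simp_all add: cls_add cls_closed tensor_zero cls_eq neg_rel\<close>)
  qed
qed

lemma smult_pure:
  assumes "c \<in> carrier k" "a \<in> carrier A" "b \<in> carrier B"
  shows "c \<odot>\<^bsub>tensor k A B\<^esub> pure_tensor k A B a b = pure_tensor k A B (c \<odot>\<^bsub>A\<^esub> a) b"
  using assms by (simp add: pure_tensor_def cls_smult)

lemma pure_add_left:
  assumes "a \<in> carrier A" "a' \<in> carrier A" "b \<in> carrier B"
  shows "pure_tensor k A B (a \<oplus>\<^bsub>A\<^esub> a') b
    = pure_tensor k A B a b \<oplus>\<^bsub>tensor k A B\<^esub> pure_tensor k A B a' b"
  using assms cls_eq[OF tensor_rel.add_left] by (simp add: pure_tensor_def cls_add)

lemma pure_add_right:
  assumes "a \<in> carrier A" "b \<in> carrier B" "b' \<in> carrier B"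
  shows "pure_tensor k A B a (b \<oplus>\<^bsub>B\<^esub> b')
    = pure_tensor k A B a b \<oplus>\<^bsub>tensor k A B\<^esub> pure_tensor k A B a b'"
  using assms cls_eq[OF tensor_rel.add_right] by (simp add: pure_tensor_def cls_add)

lemma pure_zero_left:
  "b \<in> carrier B \<Longrightarrow> pure_tensor k A B \<zero>\<^bsub>A\<^esub> b = \<zero>\<^bsub>tensor k A B\<^esub>"
  using cls_eq[OF tensor_rel.zero] by (simp add: pure_tensor_def tensor_zero)

lemma tensor_module: "module k (tensor k A B)"
proof (rule moduleI)
  show "cring k" ..
  show "abelian_group (tensor k A B)" ..
  have closed: "map (\<lambda>(a, b). (c \<odot>\<^bsub>A\<^esub> a, b)) xs \<in> L" if "c \<in> carrier k" "xs \<in> L" for c xs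
    using that by (intro map_lists) auto
  show "c \<odot>\<^bsub>tensor k A B\<^esub> x \<in> carrier (tensor k A B)"
    if "c \<in> carrier k" "x \<in> carrier (tensor k A B)" for c x
    using that by (elim tensor_cases) (simp add: cls_smult cls_closed closed)
  show "c \<odot>\<^bsub>tensor k A B\<^esub> (x \<oplus>\<^bsub>tensor k A B\<^esub> y)
      = c \<odot>\<^bsub>tensor k A B\<^esub> x \<oplus>\<^bsub>tensor k A B\<^esub> c \<odot>\<^bsub>tensor k A B\<^esub> y"
    if "c \<in> carrier k" "x \<in> carrier (tensor k A B)" "y \<in> carrier (tensor k A B)" for c x y
    using that by (elim tensor_cases) (simp add: cls_smult cls_add closed)
  show "(c \<otimes>\<^bsub>k\<^esub> d) \<odot>\<^bsub>tensor k A B\<^esub> x = c \<odot>\<^bsub>tensor k A B\<^esub> (d \<odot>\<^bsub>tensor k A B\<^esub> x)"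
    if "c \<in> carrier k" "d \<in> carrier k" "x \<in> carrier (tensor k A B)" for c d x
  proof -
    obtain xs where xs: "xs \<in> L" "x = cls xs" using \<open>x \<in> _\<close> by (rule tensor_cases)
    have "map (\<lambda>(a, b). ((c \<otimes>\<^bsub>k\<^esub> d) \<odot>\<^bsub>A\<^esub> a, b)) xs
      = map (\<lambda>(a, b). (c \<odot>\<^bsub>A\<^esub> a, b)) (map (\<lambda>(a, b). (d \<odot>\<^bsub>A\<^esub> a, b)) xs)"
      using xs that by (auto simp: A.smult_assoc1 dest: listsD)
    then show ?thesis using xs that by (simp only: cls_smult closed A.R.m_closed)
  qed
  show "\<one>\<^bsub>k\<^esub> \<odot>\<^bsub>tensor k A B\<^esub> x = x" if "x \<in> carrier (tensor k A B)" for x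
  proof -
    obtain xs where xs: "xs \<in> L" "x = cls xs" using \<open>x \<in> _\<close> by (rule tensor_cases)
    have "map (\<lambda>(a, b). (\<one>\<^bsub>k\<^esub> \<odot>\<^bsub>A\<^esub> a, b)) xs = xs"
      using xs by (intro map_idI) (auto dest: listsD)
    then show ?thesis using xs by (simp add: cls_smult)
  qed
  show "(c \<oplus>\<^bsub>k\<^esub> d) \<odot>\<^bsub>tensor k A B\<^esub> x
      = c \<odot>\<^bsub>tensor k A B\<^esub> x \<oplus>\<^bsub>tensor k A B\<^esub> d \<odot>\<^bsub>tensor k A B\<^esub> x"
    if cd: "c \<in> carrier k" "d \<in> carrier k" and x: "x \<in> carrier (tensor k A B)" for c d x
  proof -
    obtain xs where xs: "xs \<in> L" "x = cls xs" using x by (rule tensor_cases)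
    \<comment> \<open>The two lists on the right have to be interleaved, so unlike the other laws of
      scalar multiplication this one needs an induction over the representative.\<close>
    have *: "cls (map (\<lambda>(a, b). ((c \<oplus>\<^bsub>k\<^esub> d) \<odot>\<^bsub>A\<^esub> a, b)) xs)
      = cls (map (\<lambda>(a, b). (c \<odot>\<^bsub>A\<^esub> a, b)) xs) \<oplus>\<^bsub>tensor k A B\<^esub> cls (map (\<lambda>(a, b). (d \<odot>\<^bsub>A\<^esub> a, b)) xs)"
      using xs(1)
    proof (induction xs rule: list.induct)
      case Nil then show ?case by (simp add: cls_add)
    next
      case (Cons x xs)
      obtain a b where x: "x = (a, b)" by force
      have ab: "a \<in> carrier A" "b \<in> carrier B" "xs \<in> L" using Cons x by auto
      let ?c = "map (\<lambda>(a, b). (c \<odot>\<^bsub>A\<^esub> a, b)) xs" and ?d = "map (\<lambda>(a, b). (d \<odot>\<^bsub>A\<^esub> a, b)) xs"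
      have cl: "?c \<in> L" "?d \<in> L" "map (\<lambda>(a, b). ((c \<oplus>\<^bsub>k\<^esub> d) \<odot>\<^bsub>A\<^esub> a, b)) xs \<in> L"
        using closed ab cd by auto
      have "cls (map (\<lambda>(a, b). ((c \<oplus>\<^bsub>k\<^esub> d) \<odot>\<^bsub>A\<^esub> a, b)) ((a, b) # xs))
        = pure_tensor k A B ((c \<oplus>\<^bsub>k\<^esub> d) \<odot>\<^bsub>A\<^esub> a) b \<oplus>\<^bsub>tensor k A B\<^esub> (cls ?c \<oplus>\<^bsub>tensor k A B\<^esub> cls ?d)"
        using ab cd cl by (simp add: cls_Cons Cons.IH[OF ab(3)])
      also have "\<dots> = (pure_tensor k A B (c \<odot>\<^bsub>A\<^esub> a) b \<oplus>\<^bsub>tensor k A B\<^esub> pure_tensor k A B (d \<odot>\<^bsub>A\<^esub> a) b)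
          \<oplus>\<^bsub>tensor k A B\<^esub> (cls ?c \<oplus>\<^bsub>tensor k A B\<^esub> cls ?d)"
        using ab cd by (simp add: A.smult_l_distr pure_add_left)
      also have "\<dots> = (pure_tensor k A B (c \<odot>\<^bsub>A\<^esub> a) b \<oplus>\<^bsub>tensor k A B\<^esub> cls ?c)
          \<oplus>\<^bsub>tensor k A B\<^esub> (pure_tensor k A B (d \<odot>\<^bsub>A\<^esub> a) b \<oplus>\<^bsub>tensor k A B\<^esub> cls ?d)"
        by (rule tensor.add_add_exchange) (use ab cd cl in \<open>auto intro: cls_closed\<close>)
      also have "\<dots> = cls (map (\<lambda>(a, b). (c \<odot>\<^bsub>A\<^esub> a, b)) ((a, b) # xs))
          \<oplus>\<^bsub>tensor k A B\<^esub> cls (map (\<lambda>(a, b). (d \<odot>\<^bsub>A\<^esub> a, b)) ((a, b) # xs))"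
        using ab cd cl by (simp add: cls_Cons)
      finally show ?case unfolding x .
    qed
    show ?thesis using xs cd * by (simp add: cls_smult)
  qed
qed


lemma cls_sum:
  "xs \<in> L \<Longrightarrow> cls xs = tensor_sum (tensor k A B) (pure_tensor k A B) xs"
proof (induction xs rule: list.induct)
  case (Cons x xs)
  obtain a b where x: "x = (a, b)" by force
  show ?case using Cons.prems by (simp add: x cls_Cons Cons.IH)
qed (simp add: tensor_zero)

lemma pure_bilinear: "bilinear k A B (tensor k A B) (pure_tensor k A B)"
proof (rule bilinearI)
  fix b assume b: "b \<in> carrier B"
  show "(\<lambda>a. pure_tensor k A B a b) \<in> module_hom k A (tensor k A B)"
    by (rule module_homI) (simp_all add: b pure_add_left smult_pure)
next
  fix a assume a: "a \<in> carrier A"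
  show "pure_tensor k A B a \<in> module_hom k B (tensor k A B)"
  proof (rule module_homI)
    fix c b assume cb: "c \<in> carrier k" "b \<in> carrier B"
    have "pure_tensor k A B (c \<odot>\<^bsub>A\<^esub> a) b = pure_tensor k A B a (c \<odot>\<^bsub>B\<^esub> b)"
      unfolding pure_tensor_def by (rule cls_eq[OF tensor_rel.smult]) (use a cb in auto)
    then show "pure_tensor k A B a (c \<odot>\<^bsub>B\<^esub> b) = c \<odot>\<^bsub>tensor k A B\<^esub> pure_tensor k A B a b"
      using a cb by (simp add: smult_pure)
  qed (simp_all add: a pure_add_right)
qed

text \<open>Each generating relation is an identity that a bilinear \<open>F\<close> respects. This
  makes the value in \<open>tensor_lift\<close> independent of the representative.\<close>

lemma tensor_sum_rel:
  assumes F: "bilinear k A B M F" and M: "module k M" and "rel xs ys"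
  shows "tensor_sum M F xs = tensor_sum M F ys"
proof -
  interpret M: module k M by fact
  note D = bilinearD[OF F]
  have cl: "F a b \<in> carrier M" if "xs \<in> L" "(a, b) \<in> set xs" for a b xs
    using that D(3) by (auto dest: listsD)
  show ?thesis using assms(3)
  proof (induction rule: tensor_rel.induct)
    case (append xs xs' ys ys')
    then show ?case using rel_lists[OF append(1)] rel_lists[OF append(2)]
      by (subst (1 2) M.tensor_sum_append) (auto intro: cl)
  next
    case (comm xs ys)
    then show ?case
      by (subst (1 2) M.tensor_sum_append) (auto intro: cl M.tensor_sum_closed M.a_comm)
  next
    case (add_left a a' b)
    then show ?case using module_homD(2)[OF D(1)[of b], of a a'] D(3) by (simp add: M.a_assoc)
  next
    case (add_right a b b')
    then show ?case using module_homD(2)[OF D(2)[of a], of b b'] D(3) by (simp add: M.a_assoc)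
  next
    case (smult c a b)
    then show ?case using module_homD(3)[OF D(1)[of b], of c a] module_homD(3)[OF D(2)[of a], of c b] by simp
  next
    case (zero b)
    then show ?case using module_hom_zero[OF D(1)[of b] A.module_axioms M] by simp
  qed auto
qed

lemma tensor_lift_cls:
  assumes F: "bilinear k A B M F" and M: "module k M" and xs: "xs \<in> L"
  shows "tensor_lift M F (cls xs) = tensor_sum M F xs"
proof -
  have "tensor_sum M F ys = tensor_sum M F xs" if "ys \<in> cls xs" for ys
    by (rule tensor_sum_rel[OF F M, symmetric]) (use that in \<open>simp add: tensor_class_def\<close>)
  then have "tensor_sum M F ` cls xs = {tensor_sum M F xs}"
    using mem_cls[OF xs] by blast
  then show ?thesis by (simp add: tensor_lift_def)
qed

lemma tensor_lift_pure:
  assumes F: "bilinear k A B M F" and M: "module k M" and ab: "a \<in> carrier A" "b \<in> carrier B"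
  shows "tensor_lift M F (pure_tensor k A B a b) = F a b"
proof -
  interpret M: module k M by fact
  show ?thesis
    using tensor_lift_cls[OF F M, of "[(a, b)]"] ab bilinearD(3)[OF F ab] by (simp add: pure_tensor_def)
qed

lemma tensor_lift_linear:
  assumes F: "bilinear k A B M F" and M: "module k M"
  shows "tensor_lift M F \<in> module_hom k (tensor k A B) M"
proof -
  interpret M: module k M by fact
  have cl: "F a b \<in> carrier M" if "xs \<in> L" "(a, b) \<in> set xs" for a b xs
    using that bilinearD(3)[OF F] by (auto dest: listsD)
  show ?thesis
  proof (rule module_homI)
    fix x assume "x \<in> carrier (tensor k A B)"
    then show "tensor_lift M F x \<in> carrier M"
      by (elim tensor_cases) (simp add: tensor_lift_cls[OF F M] cl)
  next
    fix x y assume "x \<in> carrier (tensor k A B)" "y \<in> carrier (tensor k A B)"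
    then obtain xs ys where xs: "xs \<in> L" "x = cls xs" and ys: "ys \<in> L" "y = cls ys"
      by (elim tensor_cases)
    have "tensor_sum M F (xs @ ys) = tensor_sum M F xs \<oplus>\<^bsub>M\<^esub> tensor_sum M F ys"
      by (rule M.tensor_sum_append) (use cl[OF xs(1)] cl[OF ys(1)] in auto)
    then show "tensor_lift M F (x \<oplus>\<^bsub>tensor k A B\<^esub> y) = tensor_lift M F x \<oplus>\<^bsub>M\<^esub> tensor_lift M F y"
      using xs ys by (simp add: tensor_lift_cls[OF F M] cls_add)
  next
    fix c x assume c: "c \<in> carrier k" and "x \<in> carrier (tensor k A B)"
    then obtain xs where xs: "xs \<in> L" "x = cls xs" by (elim tensor_cases)
    have L: "map (\<lambda>(a, b). (c \<odot>\<^bsub>A\<^esub> a, b)) xs \<in> L" using c xs by (intro map_lists) auto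
    have "tensor_sum M F (map (\<lambda>(a, b). (c \<odot>\<^bsub>A\<^esub> a, b)) xs) = tensor_sum M (\<lambda>a b. F (c \<odot>\<^bsub>A\<^esub> a) b) xs"
      by (rule tensor_sum_map)
    also have "\<dots> = tensor_sum M (\<lambda>a b. c \<odot>\<^bsub>M\<^esub> F a b) xs"
      by (rule tensor_sum_cong) (use xs c module_homD(3)[OF bilinearD(1)[OF F]] in \<open>auto dest: listsD\<close>)
    also have "\<dots> = c \<odot>\<^bsub>M\<^esub> tensor_sum M F xs"
      by (rule module_hom_tensor_sum[OF module_hom_smult[OF M module_hom_id c] M M, symmetric]) (rule cl[OF xs(1)])
    finally show "tensor_lift M F (c \<odot>\<^bsub>tensor k A B\<^esub> x) = c \<odot>\<^bsub>M\<^esub> tensor_lift M F x"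
      using c L xs by (simp add: cls_smult tensor_lift_cls[OF F M])
  qed
qed

lemma module_hom_eqI:
  assumes f: "f \<in> module_hom k (tensor k A B) M" and g: "g \<in> module_hom k (tensor k A B) M"
    and M: "module k M" and t: "t \<in> carrier (tensor k A B)"
    and eq: "\<And>a b. a \<in> carrier A \<Longrightarrow> b \<in> carrier B \<Longrightarrow> f (pure_tensor k A B a b) = g (pure_tensor k A B a b)"
  shows "f t = g t"
proof -
  obtain xs where xs: "xs \<in> L" "t = cls xs" using t by (rule tensor_cases)
  have m: "a \<in> carrier A \<and> b \<in> carrier B" if "(a, b) \<in> set xs" for a b
    using that xs(1) by (auto dest: listsD)
  have "f (cls xs) = tensor_sum M (\<lambda>a b. f (pure_tensor k A B a b)) xs"
    unfolding cls_sum[OF xs(1)]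
    by (rule module_hom_tensor_sum[OF f tensor_module M]) (use m in auto)
  also have "\<dots> = tensor_sum M (\<lambda>a b. g (pure_tensor k A B a b)) xs"
    by (rule tensor_sum_cong) (use m eq in auto)
  also have "\<dots> = g (cls xs)"
    unfolding cls_sum[OF xs(1)]
    by (rule module_hom_tensor_sum[OF g tensor_module M, symmetric]) (use m in auto)
  finally show ?thesis using xs by simp
qed

end

lemma module_tensor_sum_closed:
  assumes "module k M" "\<And>a b. (a, b) \<in> set xs \<Longrightarrow> F a b \<in> carrier M"
  shows "tensor_sum M F xs \<in> carrier M"
proof -
  interpret module k M by fact
  show ?thesis by (rule M.tensor_sum_closed) (use assms in auto)
qed

lemma module_tensor_sum_add:
  assumes "module k M"
    "\<And>a b. (a, b) \<in> set xs \<Longrightarrow> F a b \<in> carrier M"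
    "\<And>a b. (a, b) \<in> set xs \<Longrightarrow> F' a b \<in> carrier M"
  shows "tensor_sum M (\<lambda>a b. F a b \<oplus>\<^bsub>M\<^esub> F' a b) xs = tensor_sum M F xs \<oplus>\<^bsub>M\<^esub> tensor_sum M F' xs"
proof -
  interpret module k M by fact
  show ?thesis by (rule M.tensor_sum_add) (use assms in auto)
qed

lemma module_tensor_sum_swap:
  assumes "module k M"
    "\<And>a b c d. (a, b) \<in> set xs \<Longrightarrow> (c, d) \<in> set ys \<Longrightarrow> F a b c d \<in> carrier M"
  shows "tensor_sum M (\<lambda>a b. tensor_sum M (\<lambda>c d. F a b c d) ys) xs
    = tensor_sum M (\<lambda>c d. tensor_sum M (\<lambda>a b. F a b c d) xs) ys"
proof -
  interpret module k M by fact
  show ?thesis by (rule M.tensor_sum_swap) (use assms in auto)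
qed

context two_modules
begin

text \<open>One representative of \<open>t\<close> serves for all values of the parameter, so the
  claim reduces to finite sums. Nested lifts, as in the coproduct of a tensor product, depend on
  this.\<close>

lemma tensor_lift_linear_param:
  assumes M: "module k M" and C: "module k C" and t: "t \<in> carrier (tensor k A B)"
    and F: "\<And>c. c \<in> carrier C \<Longrightarrow> bilinear k A B M (F c)"
    and lin: "\<And>a b. a \<in> carrier A \<Longrightarrow> b \<in> carrier B \<Longrightarrow> (\<lambda>c. F c a b) \<in> module_hom k C M"
  shows "(\<lambda>c. tensor_lift M (F c) t) \<in> module_hom k C M"
proof -
  obtain xs where xs: "xs \<in> L" "t = cls xs" using t by (rule tensor_cases)
  have "(\<lambda>c. tensor_sum M (F c) xs) \<in> module_hom k C M"
    by (rule module_hom_sum[OF C M]) (use lin listsD[OF xs(1)] in auto)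
  then show ?thesis
    using module_hom_cong[OF C, of "\<lambda>c. tensor_lift M (F c) t" "\<lambda>c. tensor_sum M (F c) xs" M]
      tensor_lift_cls[OF F M xs(1)] xs(2) by simp
qed

text \<open>Independence of the representatives is shown one factor at a time: with the second list
  fixed the product is a bilinear expression in the entries of the first, and after exchanging the
  two sums the roles are reversed.\<close>

lemma tensor_mult_cls:
  assumes A: "algebra k A" and B: "algebra k B" and xy: "xs \<in> L" "ys \<in> L"
  defines "p \<equiv> \<lambda>xs ys. [(a \<otimes>\<^bsub>A\<^esub> c, b \<otimes>\<^bsub>B\<^esub> d). (a, b) \<leftarrow> xs, (c, d) \<leftarrow> ys]"
  shows "cls xs \<otimes>\<^bsub>tensor k A B\<^esub> cls ys = cls (p xs ys)"
    and "p xs ys \<in> L"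
    and "bilinear k A B N G \<Longrightarrow> module k N \<Longrightarrow> tensor_sum N G (p xs ys)
      = tensor_sum N (\<lambda>a b. tensor_sum N (\<lambda>c d. G (a \<otimes>\<^bsub>A\<^esub> c) (b \<otimes>\<^bsub>B\<^esub> d)) ys) xs"
proof -
  interpret AA: algebra k A by fact
  interpret BB: algebra k B by fact
  have pL: "p xs ys \<in> L" if xs: "xs \<in> L" and ys: "ys \<in> L" for xs ys
  proof -
    have "u \<in> carrier A \<and> v \<in> carrier B" if uv: "(u, v) \<in> set (p xs ys)" for u v
    proof -
      obtain a b c d where "(a, b) \<in> set xs" "(c, d) \<in> set ys" "u = a \<otimes>\<^bsub>A\<^esub> c" "v = b \<otimes>\<^bsub>B\<^esub> d"
        using uv by (auto simp: p_def)
      then show ?thesis using listsD[OF xs] listsD[OF ys] by simp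
    qed
    then show ?thesis by (simp add: lists_eq_set subset_iff)
  qed
  then show "p xs ys \<in> L" using xy by simp
  have sum: "tensor_sum N G (p xs ys) = tensor_sum N (\<lambda>a b. tensor_sum N (\<lambda>c d. G (a \<otimes>\<^bsub>A\<^esub> c) (b \<otimes>\<^bsub>B\<^esub> d)) ys) xs"
    if G: "bilinear k A B N G" and N: "module k N" and xs: "xs \<in> L" and ys: "ys \<in> L"
    for N :: "('k, 'n, 'o) module_scheme" and G xs ys
  proof -
    interpret N: module k N by fact
    show ?thesis unfolding p_def
      by (rule N.tensor_sum_prod) (use listsD[OF xs] listsD[OF ys] bilinearD(3)[OF G] in auto)
  qed
  then show "bilinear k A B N G \<Longrightarrow> module k N \<Longrightarrow> tensor_sum N G (p xs ys)
      = tensor_sum N (\<lambda>a b. tensor_sum N (\<lambda>c d. G (a \<otimes>\<^bsub>A\<^esub> c) (b \<otimes>\<^bsub>B\<^esub> d)) ys) xs"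
    using xy by blast
  let ?t = "tensor k A B" and ?q = "pure_tensor k A B"
  note tm = tensor_module
  have bil1: "bilinear k A B ?t (\<lambda>a b. tensor_sum ?t (\<lambda>c d. ?q (a \<otimes>\<^bsub>A\<^esub> c) (b \<otimes>\<^bsub>B\<^esub> d)) ys)"
    if ys: "ys \<in> L" for ys
    using listsD[OF ys]
    by (intro bilinearI module_hom_sum A.module_axioms B.module_axioms tm module_hom_comp[OF _ bilinearD(1)[OF pure_bilinear]]
        module_hom_comp[OF _ bilinearD(2)[OF pure_bilinear]] module_hom_mult_left[OF A module_hom_id] module_hom_mult_left[OF B module_hom_id]) auto
  have bil2: "bilinear k A B ?t (\<lambda>c d. tensor_sum ?t (\<lambda>a b. ?q (a \<otimes>\<^bsub>A\<^esub> c) (b \<otimes>\<^bsub>B\<^esub> d)) xs)"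
    if xs: "xs \<in> L" for xs
    using listsD[OF xs]
    by (intro bilinearI module_hom_sum A.module_axioms B.module_axioms tm module_hom_comp[OF _ bilinearD(1)[OF pure_bilinear]]
        module_hom_comp[OF _ bilinearD(2)[OF pure_bilinear]] module_hom_mult_right[OF A module_hom_id] module_hom_mult_right[OF B module_hom_id]) auto
  have cong: "cls (p xs' ys') = cls (p xs ys)" if r: "xs' \<in> cls xs" "ys' \<in> cls ys" for xs' ys'
  proof -
    have r': "rel xs xs'" "rel ys ys'" using r by (auto simp: tensor_class_def)
    have xy': "xs' \<in> L" "ys' \<in> L" using r' rel_lists by auto
    have "cls (p xs ys) = tensor_sum ?t (\<lambda>a b. tensor_sum ?t (\<lambda>c d. ?q (a \<otimes>\<^bsub>A\<^esub> c) (b \<otimes>\<^bsub>B\<^esub> d)) ys) xs"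
      using cls_sum[OF pL[OF xy]] sum[OF pure_bilinear tm xy] by simp
    also have "\<dots> = tensor_sum ?t (\<lambda>a b. tensor_sum ?t (\<lambda>c d. ?q (a \<otimes>\<^bsub>A\<^esub> c) (b \<otimes>\<^bsub>B\<^esub> d)) ys) xs'"
      by (rule tensor_sum_rel[OF bil1[OF xy(2)] tm r'(1)])
    also have "\<dots> = tensor_sum ?t (\<lambda>c d. tensor_sum ?t (\<lambda>a b. ?q (a \<otimes>\<^bsub>A\<^esub> c) (b \<otimes>\<^bsub>B\<^esub> d)) xs') ys"
      by (rule module_tensor_sum_swap[OF tm]) (use listsD[OF xy(2)] listsD[OF xy'(1)] in auto)
    also have "\<dots> = tensor_sum ?t (\<lambda>c d. tensor_sum ?t (\<lambda>a b. ?q (a \<otimes>\<^bsub>A\<^esub> c) (b \<otimes>\<^bsub>B\<^esub> d)) xs') ys'"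
      by (rule tensor_sum_rel[OF bil2[OF xy'(1)] tm r'(2)])
    also have "\<dots> = tensor_sum ?t (\<lambda>a b. tensor_sum ?t (\<lambda>c d. ?q (a \<otimes>\<^bsub>A\<^esub> c) (b \<otimes>\<^bsub>B\<^esub> d)) ys') xs'"
      by (rule module_tensor_sum_swap[OF tm]) (use listsD[OF xy'(2)] listsD[OF xy'(1)] in auto)
    also have "\<dots> = cls (p xs' ys')"
      using cls_sum[OF pL[OF xy']] sum[OF pure_bilinear tm xy'] by simp
    finally show ?thesis by simp
  qed
  have "(\<Union>xs'\<in>cls xs. \<Union>ys'\<in>cls ys. cls (p xs' ys')) = (\<Union>xs'\<in>cls xs. \<Union>ys'\<in>cls ys. cls (p xs ys))"
    by (intro SUP_cong HOL.refl cong)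
  also have "\<dots> = cls (p xs ys)" using mem_cls[OF xy(1)] mem_cls[OF xy(2)] by blast
  finally show "cls xs \<otimes>\<^bsub>?t\<^esub> cls ys = cls (p xs ys)" by (simp add: tensor_def p_def)
qed

end

subsection \<open>Separating families of functionals\<close>

text \<open>The functionals are indexed by a set \<open>X\<close> instead of being collected in a
  subset of the dual. For a tensor product the index set is then just \<open>X \<times> Y\<close>,
  and the construction can be iterated.\<close>

definition separating where
  "separating k A X \<omega> \<longleftrightarrow> (\<forall>x\<in>X. (\<lambda>a. \<omega> a x) \<in> module_hom k A (base_algebra k)) \<and>
     (\<forall>a\<in>carrier A. (\<forall>x\<in>X. \<omega> a x = \<zero>\<^bsub>k\<^esub>) \<longrightarrow> a = \<zero>\<^bsub>A\<^esub>)"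

lemma separatingD:
  assumes "separating k A X \<omega>"
  shows "x \<in> X \<Longrightarrow> (\<lambda>a. \<omega> a x) \<in> module_hom k A (base_algebra k)"
    "a \<in> carrier A \<Longrightarrow> (\<And>x. x \<in> X \<Longrightarrow> \<omega> a x = \<zero>\<^bsub>k\<^esub>) \<Longrightarrow> a = \<zero>\<^bsub>A\<^esub>"
  using assms unfolding separating_def by blast+

lemma separating_eqI:
  assumes sep: "separating k A X \<omega>" and A: "module k A" and ab: "a \<in> carrier A" "b \<in> carrier A"
    and eq: "\<And>x. x \<in> X \<Longrightarrow> \<omega> a x = \<omega> b x"
  shows "a = b"
proof -
  interpret module k A by fact
  let ?m = "\<ominus>\<^bsub>k\<^esub> \<one>\<^bsub>k\<^esub> \<odot>\<^bsub>A\<^esub> b"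
  have m: "?m \<in> carrier A" using ab by simp
  have "a \<oplus>\<^bsub>A\<^esub> ?m = \<zero>\<^bsub>A\<^esub>"
  proof (rule separatingD(2)[OF sep])
    fix x assume x: "x \<in> X"
    note h = module_homD[OF separatingD(1)[OF sep x]]
    have c: "\<omega> b x \<in> carrier k" using h(1)[OF ab(2)] by simp
    have "\<omega> (a \<oplus>\<^bsub>A\<^esub> ?m) x = \<omega> b x \<oplus>\<^bsub>k\<^esub> \<ominus>\<^bsub>k\<^esub> \<one>\<^bsub>k\<^esub> \<otimes>\<^bsub>k\<^esub> \<omega> b x"
      using h(2)[OF ab(1) m] h(3)[of "\<ominus>\<^bsub>k\<^esub> \<one>\<^bsub>k\<^esub>", OF _ ab(2)] eq[OF x] by simp
    also have "\<dots> = \<zero>\<^bsub>k\<^esub>" using c by (simp add: R.l_minus R.r_neg)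
    finally show "\<omega> (a \<oplus>\<^bsub>A\<^esub> ?m) x = \<zero>\<^bsub>k\<^esub>" .
  qed (use ab m in auto)
  moreover have "?m = \<ominus>\<^bsub>A\<^esub> b" using ab by (simp add: smult_l_minus)
  ultimately show ?thesis using ab by (metis M.minus_equality M.minus_minus m)
qed

locale two_vector_spaces = two_modules + k?: field k
begin

lemma k_cring: "cring k" ..

lemma bilinear_pairing:
  assumes "(\<lambda>a. \<omega> a x) \<in> module_hom k A (base_algebra k)"
    "(\<lambda>b. \<omega>' b y) \<in> module_hom k B (base_algebra k)"
  shows "bilinear k A B (base_algebra k) (\<lambda>a b. \<omega> a x \<otimes>\<^bsub>k\<^esub> \<omega>' b y)"
  by (intro bilinearI module_hom_scalar_left module_hom_scalar_right k_cring)
    (use assms module_homD(1)[OF assms(1)] module_homD(1)[OF assms(2)] in simp_all)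

text \<open>If \<open>\<omega> a\<^sub>1 x \<noteq> 0\<close>, then the relation \<open>\<Sum>i. \<omega> a\<^sub>i x b\<^sub>i = 0\<close> allows to eliminate \<open>b\<^sub>1\<close>,
  so that the length of a vanishing sum decreases.\<close>

lemma tensor_eq_zero:
  assumes sepA: "separating k A X \<omega>" and sepB: "separating k B Y \<omega>'" and xs: "xs \<in> L"
    and zero: "\<And>x y. x \<in> X \<Longrightarrow> y \<in> Y \<Longrightarrow>
      tensor_sum k (\<lambda>a b. \<omega> a x \<otimes>\<^bsub>k\<^esub> \<omega>' b y) xs = \<zero>\<^bsub>k\<^esub>"
  shows "cls xs = \<zero>\<^bsub>tensor k A B\<^esub>"
  using xs zero
proof (induction "length xs" arbitrary: xs rule: less_induct)
  case less
  interpret tensor: module k "tensor k A B" by (rule tensor_module)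
  note k1 = base_algebra_module[OF k_cring]
  show ?case
  proof (cases xs)
    case Nil
    then show ?thesis by (simp add: tensor_zero)
  next
    case (Cons z zs)
    obtain a b where z: "z = (a, b)" by force
    have ab: "a \<in> carrier A" "b \<in> carrier B" and zs: "zs \<in> L" using less.prems(1) Cons z by auto
    note cA = module_homD(1)[OF separatingD(1)[OF sepA], simplified]
    note cB = module_homD(1)[OF separatingD(1)[OF sepB], simplified]
    have prem: "\<omega> a x \<otimes>\<^bsub>k\<^esub> \<omega>' b y \<oplus>\<^bsub>k\<^esub> tensor_sum k (\<lambda>a b. \<omega> a x \<otimes>\<^bsub>k\<^esub> \<omega>' b y) zs = \<zero>\<^bsub>k\<^esub>"
      if "x \<in> X" "y \<in> Y" for x y
      using less.prems(2)[OF that] Cons z by simp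
    have sc: "tensor_sum k (\<lambda>a b. \<omega> a x \<otimes>\<^bsub>k\<^esub> \<omega>' b y) zs \<in> carrier k" if "x \<in> X" "y \<in> Y" for x y
      by (rule module_tensor_sum_closed[OF k1, simplified]) (use cA cB that listsD[OF zs] in auto)
    show ?thesis
    proof (cases "\<forall>x\<in>X. \<omega> a x = \<zero>\<^bsub>k\<^esub>")
      case True
      then have "a = \<zero>\<^bsub>A\<^esub>" using separatingD(2)[OF sepA] ab by blast
      moreover have "cls zs = \<zero>\<^bsub>tensor k A B\<^esub>"
        by (rule less.hyps) (use Cons zs prem True sc cB ab in \<open>simp_all\<close>)
      ultimately show ?thesis
        using ab zs unfolding Cons z by (simp add: cls_Cons pure_zero_left)
    next
      case False
      then obtain x0 where x0: "x0 \<in> X" "\<omega> a x0 \<noteq> \<zero>\<^bsub>k\<^esub>" by blast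
      \<comment> \<open>Multiplying the relation at \<open>x0\<close> by \<open>u\<close> solves it
        for \<open>b\<close>; the coefficients of the remaining entries become the
        \<open>c a'\<close>.\<close>
      define u where "u = \<ominus>\<^bsub>k\<^esub> (inv\<^bsub>k\<^esub> (\<omega> a x0))"
      have un: "\<omega> a x0 \<in> Units k" using x0 cA ab by (simp add: k.field_Units)
      have u: "u \<in> carrier k" "u \<otimes>\<^bsub>k\<^esub> \<omega> a x0 = \<ominus>\<^bsub>k\<^esub> \<one>\<^bsub>k\<^esub>"
        using un cA[OF x0(1) ab(1)] by (simp_all add: u_def A.R.l_minus)
      define c where "c a' = u \<otimes>\<^bsub>k\<^esub> \<omega> a' x0" for a'
      have c: "c a' \<in> carrier k" if "a' \<in> carrier A" for a' using that u x0 cA by (simp add: c_def)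
      define s where "s = tensor_sum B (\<lambda>a' b'. c a' \<odot>\<^bsub>B\<^esub> b') zs"
      have s: "s \<in> carrier B" unfolding s_def
        by (rule module_tensor_sum_closed[OF B.module_axioms]) (use listsD[OF zs] c in auto)
      \<comment> \<open>The relation is only known after evaluation. As \<open>Y\<close> separates
        \<open>B\<close>, it holds in \<open>B\<close> itself.\<close>
      have b: "b = s"
      proof (rule separating_eqI[OF sepB B.module_axioms ab(2) s])
        fix y assume y: "y \<in> Y"
        note hy = separatingD(1)[OF sepB y]
        let ?S = "tensor_sum k (\<lambda>a b. \<omega> a x0 \<otimes>\<^bsub>k\<^esub> \<omega>' b y) zs"
        have "\<omega>' s y = tensor_sum k (\<lambda>a' b'. \<omega>' (c a' \<odot>\<^bsub>B\<^esub> b') y) zs"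
          unfolding s_def using module_hom_tensor_sum[OF hy B.module_axioms k1, of zs "\<lambda>a' b'. c a' \<odot>\<^bsub>B\<^esub> b'"]
            c listsD[OF zs] by simp
        also have "\<dots> = tensor_sum k (\<lambda>a' b'. u \<otimes>\<^bsub>k\<^esub> (\<omega> a' x0 \<otimes>\<^bsub>k\<^esub> \<omega>' b' y)) zs"
          by (rule tensor_sum_cong)
            (use module_homD(3)[OF hy] c u cA[OF x0(1)] cB[OF y] listsD[OF zs] in \<open>auto simp: c_def A.R.m_assoc\<close>)
        also have "\<dots> = u \<otimes>\<^bsub>k\<^esub> ?S"
          using module_hom_tensor_sum[OF module_hom_smult[OF k1 module_hom_id u(1)] k1 k1, of zs "\<lambda>a b. \<omega> a x0 \<otimes>\<^bsub>k\<^esub> \<omega>' b y"]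
            cA[OF x0(1)] cB[OF y] listsD[OF zs] by simp
        also have "?S = \<ominus>\<^bsub>k\<^esub> (\<omega> a x0 \<otimes>\<^bsub>k\<^esub> \<omega>' b y)"
          using prem[OF x0(1) y] sc[OF x0(1) y] cA[OF x0(1) ab(1)] cB[OF y ab(2)]
          by (metis A.R.add.inv_comm A.R.m_closed A.R.minus_equality)
        also have "u \<otimes>\<^bsub>k\<^esub> \<dots> = \<ominus>\<^bsub>k\<^esub> ((u \<otimes>\<^bsub>k\<^esub> \<omega> a x0) \<otimes>\<^bsub>k\<^esub> \<omega>' b y)"
          using u(1) cA[OF x0(1) ab(1)] cB[OF y ab(2)] by (simp add: A.R.r_minus A.R.m_assoc)
        also have "\<dots> = \<omega>' b y"
          unfolding u(2) using cB[OF y ab(2)] by (simp add: A.R.l_minus)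
        finally show "\<omega>' b y = \<omega>' s y" by simp
      qed
      \<comment> \<open>With \<open>b\<close> replaced by \<open>s\<close>, the first term is
        distributed over the other entries, whose left factors absorb multiples of \<open>a\<close>.
        The new list is one entry shorter and has the same class.\<close>
      define ws where "ws = map (\<lambda>(a', b'). (a' \<oplus>\<^bsub>A\<^esub> c a' \<odot>\<^bsub>A\<^esub> a, b')) zs"
      have ws: "ws \<in> L" unfolding ws_def by (rule map_lists[OF zs]) (use ab c in auto)
      have "cls ws = tensor_sum (tensor k A B) (\<lambda>a' b'. pure_tensor k A B (a' \<oplus>\<^bsub>A\<^esub> c a' \<odot>\<^bsub>A\<^esub> a) b') zs"
        unfolding cls_sum[OF ws] unfolding ws_def by (rule tensor_sum_map)
      also have "\<dots> = tensor_sum (tensor k A B) (\<lambda>a' b'. pure_tensor k A B a (c a' \<odot>\<^bsub>B\<^esub> b')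
          \<oplus>\<^bsub>tensor k A B\<^esub> pure_tensor k A B a' b') zs"
      proof (rule tensor_sum_cong)
        fix a' b' assume "(a', b') \<in> set zs"
        then have m: "a' \<in> carrier A" "b' \<in> carrier B" using listsD[OF zs] by auto
        have "pure_tensor k A B a (c a' \<odot>\<^bsub>B\<^esub> b') = pure_tensor k A B (c a' \<odot>\<^bsub>A\<^esub> a) b'"
          using module_homD(3)[OF bilinearD(2)[OF pure_bilinear ab(1)] c[OF m(1)] m(2)]
            smult_pure[OF c[OF m(1)] ab(1) m(2)] by simp
        then show "pure_tensor k A B (a' \<oplus>\<^bsub>A\<^esub> c a' \<odot>\<^bsub>A\<^esub> a) b'
          = pure_tensor k A B a (c a' \<odot>\<^bsub>B\<^esub> b') \<oplus>\<^bsub>tensor k A B\<^esub> pure_tensor k A B a' b'"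
          using m ab c by (simp add: pure_add_left tensor.a_comm)
      qed
      also have "\<dots> = tensor_sum (tensor k A B) (\<lambda>a' b'. pure_tensor k A B a (c a' \<odot>\<^bsub>B\<^esub> b')) zs
          \<oplus>\<^bsub>tensor k A B\<^esub> tensor_sum (tensor k A B) (pure_tensor k A B) zs"
        by (rule module_tensor_sum_add[OF tensor_module]) (use listsD[OF zs] ab c in auto)
      also have "tensor_sum (tensor k A B) (\<lambda>a' b'. pure_tensor k A B a (c a' \<odot>\<^bsub>B\<^esub> b')) zs
          = pure_tensor k A B a s"
        unfolding s_def
        by (rule module_hom_tensor_sum[OF bilinearD(2)[OF pure_bilinear ab(1)] B.module_axioms tensor_module, symmetric])
          (use listsD[OF zs] c in auto)
      also have "tensor_sum (tensor k A B) (pure_tensor k A B) zs = cls zs"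
        by (rule cls_sum[OF zs, symmetric])
      also have "pure_tensor k A B a s \<oplus>\<^bsub>tensor k A B\<^esub> cls zs = cls xs"
        unfolding Cons z b[symmetric] by (rule cls_Cons[OF ab zs, symmetric])
      finally have cls: "cls ws = cls xs" .
      have "cls ws = \<zero>\<^bsub>tensor k A B\<^esub>"
      proof (rule less.hyps)
        show "length ws < length xs" by (simp add: ws_def Cons)
        show "ws \<in> L" by (rule ws)
        fix x y assume xy: "x \<in> X" "y \<in> Y"
        have "tensor_sum (base_algebra k) (\<lambda>a b. \<omega> a x \<otimes>\<^bsub>k\<^esub> \<omega>' b y) ws
          = tensor_sum (base_algebra k) (\<lambda>a b. \<omega> a x \<otimes>\<^bsub>k\<^esub> \<omega>' b y) xs"
          by (rule tensor_sum_rel[OF bilinear_pairing k1])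
            (use xy sepA sepB separatingD(1) cls cls_eq_iff[OF ws] in auto)
        then show "tensor_sum k (\<lambda>a b. \<omega> a x \<otimes>\<^bsub>k\<^esub> \<omega>' b y) ws = \<zero>\<^bsub>k\<^esub>"
          using less.prems(2)[OF xy] by simp
      qed
      then show ?thesis using cls by simp
    qed
  qed
qed

text \<open>Over a field the tensor product of two injective maps is injective; here
  \<open>A\<close> and \<open>B\<close> are embedded into functions on \<open>X\<close> and on
  \<open>Y\<close>. All later comparisons of coproducts by evaluation rest on this.\<close>

lemma tensor_separating:
  assumes sepA: "separating k A X \<omega>" and sepB: "separating k B Y \<omega>'"
  shows "separating k (tensor k A B) (X \<times> Y)
    (\<lambda>t (x, y). tensor_lift k (\<lambda>a b. \<omega> a x \<otimes>\<^bsub>k\<^esub> \<omega>' b y) t)"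
  unfolding separating_def
proof (intro conjI ballI impI)
  note k1 = base_algebra_module[OF k_cring]
  have bil: "bilinear k A B (base_algebra k) (\<lambda>a b. \<omega> a x \<otimes>\<^bsub>k\<^esub> \<omega>' b y)" if "x \<in> X" "y \<in> Y" for x y
    using that by (intro bilinear_pairing separatingD(1)[OF sepA] separatingD(1)[OF sepB])
  show "(\<lambda>t. case z of (x, y) \<Rightarrow> tensor_lift k (\<lambda>a b. \<omega> a x \<otimes>\<^bsub>k\<^esub> \<omega>' b y) t)
      \<in> module_hom k (tensor k A B) (base_algebra k)" if "z \<in> X \<times> Y" for z
    using that tensor_lift_linear[OF bil k1] by (auto simp: eta_contract_eq)
  show "t = \<zero>\<^bsub>tensor k A B\<^esub>" if t: "t \<in> carrier (tensor k A B)"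
    and z: "\<forall>z\<in>X \<times> Y. (case z of (x, y) \<Rightarrow> tensor_lift k (\<lambda>a b. \<omega> a x \<otimes>\<^bsub>k\<^esub> \<omega>' b y) t) = \<zero>\<^bsub>k\<^esub>" for t
  proof -
    obtain xs where xs: "xs \<in> L" "t = cls xs" using t by (rule tensor_cases)
    have "tensor_sum k (\<lambda>a b. \<omega> a x \<otimes>\<^bsub>k\<^esub> \<omega>' b y) xs = \<zero>\<^bsub>k\<^esub>" if "x \<in> X" "y \<in> Y" for x y
      using z that tensor_lift_cls[OF bil[OF that] k1 xs(1)] by (auto simp: xs(2))
    then show ?thesis unfolding xs(2) by (rule tensor_eq_zero[OF sepA sepB xs(1)])
  qed
qed

end

definition trilinear where
  "trilinear k A B C M F \<longleftrightarrow> (\<forall>c\<in>carrier C. bilinear k A B M (\<lambda>a b. F a b c)) \<and>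
     (\<forall>a\<in>carrier A. \<forall>b\<in>carrier B. (\<lambda>c. F a b c) \<in> module_hom k C M)"

lemma trilinearI:
  assumes "\<And>b c. b \<in> carrier B \<Longrightarrow> c \<in> carrier C \<Longrightarrow> (\<lambda>a. F a b c) \<in> module_hom k A M"
    "\<And>a c. a \<in> carrier A \<Longrightarrow> c \<in> carrier C \<Longrightarrow> (\<lambda>b. F a b c) \<in> module_hom k B M"
    "\<And>a b. a \<in> carrier A \<Longrightarrow> b \<in> carrier B \<Longrightarrow> (\<lambda>c. F a b c) \<in> module_hom k C M"
  shows "trilinear k A B C M F"
  using assms by (simp add: trilinear_def bilinear_def)

lemma trilinearD:
  assumes "trilinear k A B C M F"
  shows "b \<in> carrier B \<Longrightarrow> c \<in> carrier C \<Longrightarrow> (\<lambda>a. F a b c) \<in> module_hom k A M"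
    "a \<in> carrier A \<Longrightarrow> c \<in> carrier C \<Longrightarrow> (\<lambda>b. F a b c) \<in> module_hom k B M"
    "a \<in> carrier A \<Longrightarrow> b \<in> carrier B \<Longrightarrow> (\<lambda>c. F a b c) \<in> module_hom k C M"
    "a \<in> carrier A \<Longrightarrow> b \<in> carrier B \<Longrightarrow> c \<in> carrier C \<Longrightarrow> F a b c \<in> carrier M"
  using assms by (simp_all add: trilinear_def bilinear_def module_hom_iff)

section \<open>Sweedler sums\<close>

text \<open>The list behind Sweedler notation. Sums of bilinear terms over it do not depend on the
  choice, by \<open>lift_comult\<close>.\<close>

definition sweedler where
  "sweedler k H x = (SOME xs. xs \<in> lists (carrier H \<times> carrier H) \<and> tensor_class k H H xs = comult H x)"

text \<open>Only linearity of the coproduct is assumed, so that Sweedler sums and the expanded sides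
  of coassociativity are also available for a structure whose Hopf laws are still to be
  proved.\<close>

locale comult_space = module k H + field k
  for k :: "('k, 'm) ring_scheme" and H :: "('k, 'a, 'x) hopf_scheme" +
  assumes comult_linear: "comult H \<in> module_hom k H (tensor k H H)"
begin

sublocale HH: two_vector_spaces k H H
  by unfold_locales

abbreviation \<Delta> where "\<Delta> \<equiv> sweedler k H"

lemma k1: "module k (base_algebra k)"
  by (rule base_algebra_module) unfold_locales

lemma H_module: "module k H" ..

lemma sweedler:
  assumes "x \<in> carrier H"
  shows "\<Delta> x \<in> lists (carrier H \<times> carrier H)" "tensor_class k H H (\<Delta> x) = comult H x"
proof -
  have "\<exists>xs. xs \<in> lists (carrier H \<times> carrier H) \<and> tensor_class k H H xs = comult H x"
    using module_homD(1)[OF comult_linear assms] by (auto elim!: HH.tensor_cases)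
  from someI_ex[OF this] show "\<Delta> x \<in> lists (carrier H \<times> carrier H)" "tensor_class k H H (\<Delta> x) = comult H x"
    unfolding sweedler_def by auto
qed

lemma sweedlerD:
  assumes "x \<in> carrier H" "(a, b) \<in> set (\<Delta> x)"
  shows "a \<in> carrier H" "b \<in> carrier H"
  using HH.listsD[OF sweedler(1)[OF assms(1)] assms(2)] by auto

lemma lift_comult:
  assumes "bilinear k H H M F" "module k M" "x \<in> carrier H"
  shows "tensor_lift M F (comult H x) = tensor_sum M F (\<Delta> x)"
  using HH.tensor_lift_cls[OF assms(1,2) sweedler(1)[OF assms(3)]] sweedler(2)[OF assms(3)] by simp

lemma swap_comult:
  assumes x: "x \<in> carrier H"
  shows "tensor_swap k H H (comult H x) = tensor_sum (tensor k H H) (\<lambda>a b. pure_tensor k H H b a) (\<Delta> x)"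
  unfolding tensor_swap_def
  by (rule lift_comult[OF bilinear_swap[OF HH.pure_bilinear] HH.tensor_module x])

sublocale H1: two_vector_spaces k H "tensor k H H"
  by (intro two_vector_spaces.intro two_modules.intro H_module HH.tensor_module) unfold_locales

sublocale H2: two_vector_spaces k "tensor k H H" H
  by (intro two_vector_spaces.intro two_modules.intro H_module HH.tensor_module) unfold_locales

abbreviation H3 where "H3 \<equiv> tensor k H (tensor k H H)"

lemma comult_closed: "a \<in> carrier H \<Longrightarrow> comult H a \<in> carrier (tensor k H H)"
  by (rule module_homD(1)[OF comult_linear])

lemma pure3_bilinear:
  "c \<in> carrier H \<Longrightarrow> bilinear k H H H3 (\<lambda>a b. pure_tensor k H (tensor k H H) a (pure_tensor k H H b c))"
  by (intro bilinear_comp2[OF H1.pure_bilinear module_hom_id] bilinearD(1)[OF HH.pure_bilinear])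

text \<open>Together with \<open>assoc_comult_right\<close> this writes both sides of
  coassociativity as sums in the right-nested cube, to which either a trilinear map or a triple of
  functionals can be applied.\<close>

lemma assoc_comult_left:
  assumes x: "x \<in> carrier H"
  shows "tensor_assoc k H H H (tensor_map k (tensor k H H) H (comult H) id (comult H x))
    = tensor_sum H3 (\<lambda>a c. tensor_sum H3 (\<lambda>a b. pure_tensor k H (tensor k H H) a (pure_tensor k H H b c)) (\<Delta> a)) (\<Delta> x)"
proof -
  note T1 = H1.tensor_module and T2 = H2.tensor_module
  let ?P = "\<lambda>t c. tensor_lift H3 (\<lambda>a b. pure_tensor k H (tensor k H H) a (pure_tensor k H H b c)) t"
  have P: "bilinear k (tensor k H H) H H3 ?P"
  proof (rule bilinearI)
    fix c assume "c \<in> carrier H"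
    then show "(\<lambda>t. ?P t c) \<in> module_hom k (tensor k H H) H3"
      by (rule HH.tensor_lift_linear[OF pure3_bilinear T1])
  next
    fix t assume "t \<in> carrier (tensor k H H)"
    then show "?P t \<in> module_hom k H H3"
      by (rule HH.tensor_lift_linear_param[OF T1 H_module _ pure3_bilinear])
        (auto intro: module_hom_comp[OF bilinearD(2)[OF HH.pure_bilinear] bilinearD(2)[OF H1.pure_bilinear]] 
           module_hom_comp[OF bilinearD(2)[OF HH.pure_bilinear] bilinearD(2)[OF H1.pure_bilinear]])
  qed
  have "tensor_map k (tensor k H H) H (comult H) id (comult H x)
    = tensor_sum (tensor k (tensor k H H) H) (\<lambda>a b. pure_tensor k (tensor k H H) H (comult H a) b) (\<Delta> x)"
    unfolding tensor_map_def id_apply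
    by (rule lift_comult[OF bilinear_comp2[OF H2.pure_bilinear comult_linear module_hom_id] T2 x])
  then have "tensor_assoc k H H H (tensor_map k (tensor k H H) H (comult H) id (comult H x))
    = tensor_sum H3 (\<lambda>a c. tensor_lift H3 ?P (pure_tensor k (tensor k H H) H (comult H a) c)) (\<Delta> x)"
    unfolding tensor_assoc_def
    using module_hom_tensor_sum[OF H2.tensor_lift_linear[OF P T1] T2 T1, of "\<Delta> x" "\<lambda>a b. pure_tensor k (tensor k H H) H (comult H a) b"]
      sweedlerD[OF x] comult_closed by simp
  also have "\<dots> = tensor_sum H3 (\<lambda>a c. ?P (comult H a) c) (\<Delta> x)"
    by (rule tensor_sum_cong) (use H2.tensor_lift_pure[OF P T1] sweedlerD[OF x] comult_closed in auto)
  also have "\<dots> = tensor_sum H3 (\<lambda>a c. tensor_sum H3 (\<lambda>a b. pure_tensor k H (tensor k H H) a (pure_tensor k H H b c)) (\<Delta> a)) (\<Delta> x)"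
    by (rule tensor_sum_cong) (use lift_comult[OF pure3_bilinear T1] sweedlerD[OF x] in auto)
  finally show ?thesis .
qed

lemma assoc_comult_right:
  assumes x: "x \<in> carrier H"
  shows "tensor_map k H (tensor k H H) id (comult H) (comult H x)
    = tensor_sum H3 (\<lambda>a b. pure_tensor k H (tensor k H H) a (comult H b)) (\<Delta> x)"
  unfolding tensor_map_def id_apply
  by (rule lift_comult[OF bilinear_comp2[OF H1.pure_bilinear module_hom_id comult_linear] H1.tensor_module x])

end

sublocale hopf_algebra \<subseteq> comult_space k H
  by unfold_locales (use comult_hom in \<open>simp add: alg_hom_def\<close>)

context hopf_algebra
begin

lemma H_algebra: "algebra k H" ..

lemma counit_linear: "counit H \<in> module_hom k H (base_algebra k)"
  using counit_hom by (auto simp: alg_hom_def)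

lemma counit_closed [simp]: "x \<in> carrier H \<Longrightarrow> counit H x \<in> carrier k"
  using module_homD(1)[OF counit_linear] by simp

lemma antipode_closed [simp]: "x \<in> carrier H \<Longrightarrow> antipode H x \<in> carrier H"
  using module_homD(1)[OF antipode_linear] by simp

lemma counit_mult: "x \<in> carrier H \<Longrightarrow> y \<in> carrier H \<Longrightarrow> counit H (x \<otimes>\<^bsub>H\<^esub> y) = counit H x \<otimes>\<^bsub>k\<^esub> counit H y"
  and counit_one: "counit H \<one>\<^bsub>H\<^esub> = \<one>\<^bsub>k\<^esub>"
  using counit_hom by (auto simp: alg_hom_def ring_hom_def)

lemma sweedler_one:
  assumes F: "bilinear k H H M F" and M: "module k M"
  shows "tensor_sum M F (\<Delta> \<one>\<^bsub>H\<^esub>) = F \<one>\<^bsub>H\<^esub> \<one>\<^bsub>H\<^esub>"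
proof -
  have "comult H \<one>\<^bsub>H\<^esub> = pure_tensor k H H \<one>\<^bsub>H\<^esub> \<one>\<^bsub>H\<^esub>"
    using comult_hom by (auto simp: alg_hom_def ring_hom_def tensor_def)
  then show ?thesis using lift_comult[OF F M, of "\<one>\<^bsub>H\<^esub>"] HH.tensor_lift_pure[OF F M, of "\<one>\<^bsub>H\<^esub>" "\<one>\<^bsub>H\<^esub>"] by simp
qed

lemma sweedler_cocomm:
  assumes F: "bilinear k H H M F" and M: "module k M" and x: "x \<in> carrier H"
  shows "tensor_sum M F (\<Delta> x) = tensor_sum M (\<lambda>a b. F b a) (\<Delta> x)"
proof -
  have "comult H x = tensor_sum (tensor k H H) (\<lambda>a b. pure_tensor k H H b a) (\<Delta> x)"
    using cocomm[OF x] swap_comult[OF x] by simp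
  then have "tensor_lift M F (comult H x)
    = tensor_sum M (\<lambda>a b. tensor_lift M F (pure_tensor k H H b a)) (\<Delta> x)"
    using module_hom_tensor_sum[OF HH.tensor_lift_linear[OF F M] HH.tensor_module M, of "\<Delta> x" "\<lambda>a b. pure_tensor k H H b a"]
      sweedlerD[OF x] by simp
  also have "\<dots> = tensor_sum M (\<lambda>a b. F b a) (\<Delta> x)"
    by (rule tensor_sum_cong) (use sweedlerD[OF x] HH.tensor_lift_pure[OF F M] in auto)
  finally show ?thesis using lift_comult[OF F M x] by simp
qed

text \<open>The counit law is stated after an arbitrary linear \<open>g\<close>, because in this
  form it rewrites one variable inside a larger expression. The antipode laws below have the same
  form for the same reason.\<close>

lemma sweedler_counit_left:
  assumes g: "g \<in> module_hom k H M" and M: "module k M" and x: "x \<in> carrier H"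
  shows "tensor_sum M (\<lambda>a b. counit H a \<odot>\<^bsub>M\<^esub> g b) (\<Delta> x) = g x"
proof -
  have bil: "bilinear k H H H (\<lambda>a b. counit H a \<odot>\<^bsub>H\<^esub> b)"
    by (intro bilinearI module_hom_smult_left module_hom_smult H_module counit_linear module_hom_id) auto
  have "x = tensor_sum H (\<lambda>a b. counit H a \<odot>\<^bsub>H\<^esub> b) (\<Delta> x)"
    using counit_left[OF x] lift_comult[OF bil H_module x] by simp
  then have "g x = g (tensor_sum H (\<lambda>a b. counit H a \<odot>\<^bsub>H\<^esub> b) (\<Delta> x))" by simp
  also have "\<dots> = tensor_sum M (\<lambda>a b. g (counit H a \<odot>\<^bsub>H\<^esub> b)) (\<Delta> x)"
    by (rule module_hom_tensor_sum[OF g H_module M]) (use sweedlerD[OF x] in auto)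
  also have "\<dots> = tensor_sum M (\<lambda>a b. counit H a \<odot>\<^bsub>M\<^esub> g b) (\<Delta> x)"
    by (rule tensor_sum_cong) (use sweedlerD[OF x] module_homD(3)[OF g] in auto)
  finally show ?thesis by simp
qed

lemma sweedler_counit_right:
  assumes g: "g \<in> module_hom k H M" and M: "module k M" and x: "x \<in> carrier H"
  shows "tensor_sum M (\<lambda>a b. counit H b \<odot>\<^bsub>M\<^esub> g a) (\<Delta> x) = g x"
proof -
  interpret M: module k M by fact
  have bil: "bilinear k H H M (\<lambda>a b. counit H b \<odot>\<^bsub>M\<^esub> g a)"
    by (intro bilinearI module_hom_smult_left module_hom_smult M counit_linear g) (use module_homD(1)[OF g] in auto)
  show ?thesis using sweedler_cocomm[OF bil M x] sweedler_counit_left[OF g M x] by simp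
qed

lemma sweedler_antipode_left:
  assumes g: "g \<in> module_hom k H M" and M: "module k M" and x: "x \<in> carrier H"
  shows "tensor_sum M (\<lambda>a b. g (antipode H a \<otimes>\<^bsub>H\<^esub> b)) (\<Delta> x) = counit H x \<odot>\<^bsub>M\<^esub> g \<one>\<^bsub>H\<^esub>"
proof -
  have bil: "bilinear k H H H (\<lambda>a b. antipode H a \<otimes>\<^bsub>H\<^esub> b)"
    by (intro bilinearI module_hom_mult_left module_hom_mult_right H_algebra antipode_linear module_hom_id) auto
  have "counit H x \<odot>\<^bsub>H\<^esub> \<one>\<^bsub>H\<^esub> = tensor_sum H (\<lambda>a b. antipode H a \<otimes>\<^bsub>H\<^esub> b) (\<Delta> x)"
    using antipode_left[OF x] lift_comult[OF bil H_module x] by simp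
  then have "g (counit H x \<odot>\<^bsub>H\<^esub> \<one>\<^bsub>H\<^esub>) = g (tensor_sum H (\<lambda>a b. antipode H a \<otimes>\<^bsub>H\<^esub> b) (\<Delta> x))" by simp
  also have "\<dots> = tensor_sum M (\<lambda>a b. g (antipode H a \<otimes>\<^bsub>H\<^esub> b)) (\<Delta> x)"
    by (rule module_hom_tensor_sum[OF g H_module M]) (use sweedlerD[OF x] in auto)
  finally show ?thesis using x module_homD(3)[OF g] by simp
qed

lemma sweedler_mult:
  assumes F: "bilinear k H H M F" and M: "module k M" and x: "x \<in> carrier H" and y: "y \<in> carrier H"
  shows "tensor_sum M F (\<Delta> (x \<otimes>\<^bsub>H\<^esub> y))
    = tensor_sum M (\<lambda>a b. tensor_sum M (\<lambda>c d. F (a \<otimes>\<^bsub>H\<^esub> c) (b \<otimes>\<^bsub>H\<^esub> d)) (\<Delta> y)) (\<Delta> x)"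
proof -
  note mult = HH.tensor_mult_cls[OF H_algebra H_algebra sweedler(1)[OF x] sweedler(1)[OF y]]
  have "tensor_lift M F (comult H (x \<otimes>\<^bsub>H\<^esub> y)) = tensor_lift M F (comult H x \<otimes>\<^bsub>tensor k H H\<^esub> comult H y)"
    using comult_hom x y by (simp add: alg_hom_def ring_hom_def)
  also have "\<dots> = tensor_sum M F [(a \<otimes>\<^bsub>H\<^esub> c, b \<otimes>\<^bsub>H\<^esub> d). (a, b) \<leftarrow> \<Delta> x, (c, d) \<leftarrow> \<Delta> y]"
    using mult(1) HH.tensor_lift_cls[OF F M mult(2)] x y by (simp add: sweedler(2))
  finally show ?thesis using mult(3)[OF F M] lift_comult[OF F M, of "x \<otimes>\<^bsub>H\<^esub> y"] x y by simp
qed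

text \<open>Lift \<open>F\<close> to a linear map on the right-nested cube and apply it to both
  sides of the coassociativity axiom.\<close>

lemma sweedler_coassoc:
  assumes F: "trilinear k H H H M F" and M: "module k M" and x: "x \<in> carrier H"
  shows "tensor_sum M (\<lambda>a c. tensor_sum M (\<lambda>a b. F a b c) (\<Delta> a)) (\<Delta> x)
    = tensor_sum M (\<lambda>a b. tensor_sum M (\<lambda>b c. F a b c) (\<Delta> b)) (\<Delta> x)"
proof -
  note T1 = H1.tensor_module
  let ?G = "\<lambda>a t. tensor_lift M (\<lambda>b c. F a b c) t"
  have Fb: "bilinear k H H M (\<lambda>b c. F a b c)" if "a \<in> carrier H" for a
    using trilinearD[OF F] that by (intro bilinearI) auto
  have G: "bilinear k H (tensor k H H) M ?G"
    by (intro bilinearI HH.tensor_lift_linear_param M H_module Fb HH.tensor_lift_linear)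
      (use trilinearD(1)[OF F] in auto)
  note lin = H1.tensor_lift_linear[OF G M]
  have inner: "tensor_sum H3 (\<lambda>a b. pure_tensor k H (tensor k H H) a (pure_tensor k H H b c)) (\<Delta> a) \<in> carrier H3"
    if "a \<in> carrier H" "c \<in> carrier H" for a c
    by (rule module_tensor_sum_closed[OF T1]) (use sweedlerD[OF that(1)] that in auto)
  have "tensor_lift M ?G (tensor_sum H3 (\<lambda>a c. tensor_sum H3 (\<lambda>a b. pure_tensor k H (tensor k H H) a (pure_tensor k H H b c)) (\<Delta> a)) (\<Delta> x))
    = tensor_sum M (\<lambda>a c. tensor_lift M ?G (tensor_sum H3 (\<lambda>a b. pure_tensor k H (tensor k H H) a (pure_tensor k H H b c)) (\<Delta> a))) (\<Delta> x)"
    by (rule module_hom_tensor_sum[OF lin T1 M]) (use sweedlerD[OF x] inner in auto)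
  also have "\<dots> = tensor_sum M (\<lambda>a c. tensor_sum M (\<lambda>a b. F a b c) (\<Delta> a)) (\<Delta> x)"
  proof (rule tensor_sum_cong)
    fix a c assume "(a, c) \<in> set (\<Delta> x)"
    then have ac: "a \<in> carrier H" "c \<in> carrier H" using sweedlerD[OF x] by auto
    have "tensor_lift M ?G (tensor_sum H3 (\<lambda>a b. pure_tensor k H (tensor k H H) a (pure_tensor k H H b c)) (\<Delta> a))
      = tensor_sum M (\<lambda>a b. tensor_lift M ?G (pure_tensor k H (tensor k H H) a (pure_tensor k H H b c))) (\<Delta> a)"
      by (rule module_hom_tensor_sum[OF lin T1 M]) (use sweedlerD[OF ac(1)] ac in auto)
    also have "\<dots> = tensor_sum M (\<lambda>a b. F a b c) (\<Delta> a)"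
      by (rule tensor_sum_cong)
        (use sweedlerD[OF ac(1)] ac H1.tensor_lift_pure[OF G M] HH.tensor_lift_pure[OF Fb M] in auto)
    finally show "tensor_lift M ?G (tensor_sum H3 (\<lambda>a b. pure_tensor k H (tensor k H H) a (pure_tensor k H H b c)) (\<Delta> a))
      = tensor_sum M (\<lambda>a b. F a b c) (\<Delta> a)" .
  qed
  finally have 3: "tensor_lift M ?G (tensor_sum H3 (\<lambda>a c. tensor_sum H3 (\<lambda>a b. pure_tensor k H (tensor k H H) a (pure_tensor k H H b c)) (\<Delta> a)) (\<Delta> x)) = \<dots>" .
  have "tensor_lift M ?G (tensor_sum H3 (\<lambda>a b. pure_tensor k H (tensor k H H) a (comult H b)) (\<Delta> x))
    = tensor_sum M (\<lambda>a b. tensor_lift M ?G (pure_tensor k H (tensor k H H) a (comult H b))) (\<Delta> x)"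
    by (rule module_hom_tensor_sum[OF lin T1 M]) (use sweedlerD[OF x] comult_closed in auto)
  also have "\<dots> = tensor_sum M (\<lambda>a b. tensor_sum M (\<lambda>b c. F a b c) (\<Delta> b)) (\<Delta> x)"
    by (rule tensor_sum_cong)
      (use sweedlerD[OF x] comult_closed H1.tensor_lift_pure[OF G M] lift_comult[OF Fb M] in auto)
  finally show ?thesis using 3 coassoc[OF x] assoc_comult_left[OF x] assoc_comult_right[OF x] by simp
qed

end

lemma tensor_sum_mult_left:
  assumes "cring k" "c \<in> carrier k" "\<And>a b. (a, b) \<in> set xs \<Longrightarrow> F a b \<in> carrier k"
  shows "c \<otimes>\<^bsub>k\<^esub> tensor_sum k F xs = tensor_sum k (\<lambda>a b. c \<otimes>\<^bsub>k\<^esub> F a b) xs"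
  using module_hom_tensor_sum[OF module_hom_scalar_right[OF assms(1) module_hom_id assms(2)]
      base_algebra_module[OF assms(1)] base_algebra_module[OF assms(1)], of xs F] assms(3) by simp

lemma tensor_sum_mult_right:
  assumes "cring k" "c \<in> carrier k" "\<And>a b. (a, b) \<in> set xs \<Longrightarrow> F a b \<in> carrier k"
  shows "tensor_sum k F xs \<otimes>\<^bsub>k\<^esub> c = tensor_sum k (\<lambda>a b. F a b \<otimes>\<^bsub>k\<^esub> c) xs"
  using module_hom_tensor_sum[OF module_hom_scalar_left[OF assms(1) module_hom_id assms(2)]
      base_algebra_module[OF assms(1)] base_algebra_module[OF assms(1)], of xs F] assms(3) by simp

context hopf_algebra
begin

lemma k_cring: "cring k" ..

lemma sweedler_antipode_right:
  assumes g: "g \<in> module_hom k H M" and M: "module k M" and x: "x \<in> carrier H"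
  shows "tensor_sum M (\<lambda>a b. g (a \<otimes>\<^bsub>H\<^esub> antipode H b)) (\<Delta> x) = counit H x \<odot>\<^bsub>M\<^esub> g \<one>\<^bsub>H\<^esub>"
proof -
  have bil: "bilinear k H H H (\<lambda>a b. a \<otimes>\<^bsub>H\<^esub> antipode H b)"
    by (intro bilinearI module_hom_mult_left module_hom_mult_right H_algebra antipode_linear module_hom_id) auto
  have "counit H x \<odot>\<^bsub>H\<^esub> \<one>\<^bsub>H\<^esub> = tensor_sum H (\<lambda>a b. a \<otimes>\<^bsub>H\<^esub> antipode H b) (\<Delta> x)"
    using antipode_right[OF x] lift_comult[OF bil H_module x] by simp
  then have "g (counit H x \<odot>\<^bsub>H\<^esub> \<one>\<^bsub>H\<^esub>) = g (tensor_sum H (\<lambda>a b. a \<otimes>\<^bsub>H\<^esub> antipode H b) (\<Delta> x))" by simp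
  also have "\<dots> = tensor_sum M (\<lambda>a b. g (a \<otimes>\<^bsub>H\<^esub> antipode H b)) (\<Delta> x)"
    by (rule module_hom_tensor_sum[OF g H_module M]) (use sweedlerD[OF x] in auto)
  finally show ?thesis using x module_homD(3)[OF g] by simp
qed

lemmas sum_mult_left = tensor_sum_mult_left[OF k_cring]
lemmas sum_mult_right = tensor_sum_mult_right[OF k_cring]
lemmas sum_add = module_tensor_sum_add[OF k1, simplified]
lemmas sum_swap = module_tensor_sum_swap[OF k1, simplified]
lemmas sum_closed = module_tensor_sum_closed[OF k1, simplified]

text \<open>The self-duality of the bialgebra axiom as an identity of fourfold sums: on the left
  functionals are first multiplied out along their coproducts, on the right along the coproducts of
  their arguments. It is used for the coproduct of a product of functionals.\<close>

lemma sum_interchange: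
  assumes p: "\<And>g h x1 x2. (g, h) \<in> set ts \<Longrightarrow> (x1, x2) \<in> set xs \<Longrightarrow> p g x1 \<in> carrier k"
    and q: "\<And>g h y1 y2. (g, h) \<in> set ts \<Longrightarrow> (y1, y2) \<in> set ys \<Longrightarrow> q h y1 \<in> carrier k"
    and r: "\<And>g h x1 x2. (g, h) \<in> set us \<Longrightarrow> (x1, x2) \<in> set xs \<Longrightarrow> r g x2 \<in> carrier k"
    and s: "\<And>g h y1 y2. (g, h) \<in> set us \<Longrightarrow> (y1, y2) \<in> set ys \<Longrightarrow> s h y2 \<in> carrier k"
  shows "tensor_sum k (\<lambda>x1 x2. tensor_sum k (\<lambda>y1 y2.
      tensor_sum k (\<lambda>a b. p a x1 \<otimes>\<^bsub>k\<^esub> q b y1) ts \<otimes>\<^bsub>k\<^esub> tensor_sum k (\<lambda>c d. r c x2 \<otimes>\<^bsub>k\<^esub> s d y2) us) ys) xs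
    = tensor_sum k (\<lambda>a b. tensor_sum k (\<lambda>c d.
      tensor_sum k (\<lambda>x1 x2. p a x1 \<otimes>\<^bsub>k\<^esub> r c x2) xs \<otimes>\<^bsub>k\<^esub> tensor_sum k (\<lambda>y1 y2. q b y1 \<otimes>\<^bsub>k\<^esub> s d y2) ys) us) ts"
    (is "?l = ?r")
proof -
  let ?e = "\<lambda>a b c d x1 x2 y1 y2. (p a x1 \<otimes>\<^bsub>k\<^esub> r c x2) \<otimes>\<^bsub>k\<^esub> (q b y1 \<otimes>\<^bsub>k\<^esub> s d y2)"
  have "?l = tensor_sum k (\<lambda>x1 x2. tensor_sum k (\<lambda>y1 y2. tensor_sum k (\<lambda>a b. tensor_sum k (\<lambda>c d.
      ?e a b c d x1 x2 y1 y2) us) ts) ys) xs"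
  proof (intro tensor_sum_cong)
    fix x1 x2 y1 y2 assume x: "(x1, x2) \<in> set xs" and y: "(y1, y2) \<in> set ys"
    note [simp] = p[OF _ x] q[OF _ y] r[OF _ x] s[OF _ y]
    have "tensor_sum k (\<lambda>a b. p a x1 \<otimes>\<^bsub>k\<^esub> q b y1) ts \<otimes>\<^bsub>k\<^esub> tensor_sum k (\<lambda>c d. r c x2 \<otimes>\<^bsub>k\<^esub> s d y2) us
      = tensor_sum k (\<lambda>a b. (p a x1 \<otimes>\<^bsub>k\<^esub> q b y1) \<otimes>\<^bsub>k\<^esub> tensor_sum k (\<lambda>c d. r c x2 \<otimes>\<^bsub>k\<^esub> s d y2) us) ts"
      by (rule sum_mult_right) (auto intro!: sum_closed)
    also have "\<dots> = tensor_sum k (\<lambda>a b. tensor_sum k (\<lambda>c d. (p a x1 \<otimes>\<^bsub>k\<^esub> q b y1) \<otimes>\<^bsub>k\<^esub> (r c x2 \<otimes>\<^bsub>k\<^esub> s d y2)) us) ts"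
      by (intro tensor_sum_cong sum_mult_left) auto
    also have "\<dots> = tensor_sum k (\<lambda>a b. tensor_sum k (\<lambda>c d. ?e a b c d x1 x2 y1 y2) us) ts"
      by (intro tensor_sum_cong) (simp add: R.m_ac)
    finally show "tensor_sum k (\<lambda>a b. p a x1 \<otimes>\<^bsub>k\<^esub> q b y1) ts \<otimes>\<^bsub>k\<^esub> tensor_sum k (\<lambda>c d. r c x2 \<otimes>\<^bsub>k\<^esub> s d y2) us = \<dots>" .
  qed
  also have "\<dots> = tensor_sum k (\<lambda>x1 x2. tensor_sum k (\<lambda>a b. tensor_sum k (\<lambda>y1 y2. tensor_sum k (\<lambda>c d.
      ?e a b c d x1 x2 y1 y2) us) ys) ts) xs"
    by (intro tensor_sum_cong sum_swap sum_closed) (use p q r s in auto)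
  also have "\<dots> = tensor_sum k (\<lambda>a b. tensor_sum k (\<lambda>x1 x2. tensor_sum k (\<lambda>y1 y2. tensor_sum k (\<lambda>c d.
      ?e a b c d x1 x2 y1 y2) us) ys) xs) ts"
    by (intro sum_swap sum_closed) (use p q r s in auto)
  also have "\<dots> = tensor_sum k (\<lambda>a b. tensor_sum k (\<lambda>x1 x2. tensor_sum k (\<lambda>c d. tensor_sum k (\<lambda>y1 y2.
      ?e a b c d x1 x2 y1 y2) ys) us) xs) ts"
    by (intro tensor_sum_cong sum_swap sum_closed) (use p q r s in auto)
  also have "\<dots> = tensor_sum k (\<lambda>a b. tensor_sum k (\<lambda>c d. tensor_sum k (\<lambda>x1 x2. tensor_sum k (\<lambda>y1 y2.
      ?e a b c d x1 x2 y1 y2) ys) xs) us) ts"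
    by (intro tensor_sum_cong sum_swap sum_closed) (use p q r s in auto)
  also have "\<dots> = ?r"
  proof (intro tensor_sum_cong)
    fix a b c d assume a: "(a, b) \<in> set ts" and c: "(c, d) \<in> set us"
    note [simp] = p[OF a] q[OF a] r[OF c] s[OF c]
    have "tensor_sum k (\<lambda>x1 x2. tensor_sum k (\<lambda>y1 y2. ?e a b c d x1 x2 y1 y2) ys) xs
      = tensor_sum k (\<lambda>x1 x2. (p a x1 \<otimes>\<^bsub>k\<^esub> r c x2) \<otimes>\<^bsub>k\<^esub> tensor_sum k (\<lambda>y1 y2. q b y1 \<otimes>\<^bsub>k\<^esub> s d y2) ys) xs"
      by (intro tensor_sum_cong sum_mult_left[symmetric]) auto
    also have "\<dots> = tensor_sum k (\<lambda>x1 x2. p a x1 \<otimes>\<^bsub>k\<^esub> r c x2) xs \<otimes>\<^bsub>k\<^esub> tensor_sum k (\<lambda>y1 y2. q b y1 \<otimes>\<^bsub>k\<^esub> s d y2) ys"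
      by (rule sum_mult_right[symmetric]) (auto intro!: sum_closed)
    finally show "tensor_sum k (\<lambda>x1 x2. tensor_sum k (\<lambda>y1 y2. ?e a b c d x1 x2 y1 y2) ys) xs = \<dots>" .
  qed
  finally show ?thesis .
qed

end

section \<open>Hopf algebras of functionals\<close>

text \<open>An algebraic structure whose elements are determined by the functionals \<open>\<omega> x\<close> on a Hopf
  algebra inherits all laws from it.\<close>

locale separated_algebra = T: hopf_algebra k T
  for k :: "('k, 'm) ring_scheme" and T :: "('k, 't, 'x) hopf_scheme" +
  fixes K :: "('k, 'b, 'z) module_scheme" and \<omega> :: "'b \<Rightarrow> 't \<Rightarrow> 'k"
  assumes add_closed [simp]: "x \<in> carrier K \<Longrightarrow> y \<in> carrier K \<Longrightarrow> x \<oplus>\<^bsub>K\<^esub> y \<in> carrier K"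
    and zero_closed [simp]: "\<zero>\<^bsub>K\<^esub> \<in> carrier K"
    and mult_closed [simp]: "x \<in> carrier K \<Longrightarrow> y \<in> carrier K \<Longrightarrow> x \<otimes>\<^bsub>K\<^esub> y \<in> carrier K"
    and one_closed [simp]: "\<one>\<^bsub>K\<^esub> \<in> carrier K"
    and smult_closed [simp]: "c \<in> carrier k \<Longrightarrow> x \<in> carrier K \<Longrightarrow> c \<odot>\<^bsub>K\<^esub> x \<in> carrier K"
    and linear: "x \<in> carrier K \<Longrightarrow> \<omega> x \<in> module_hom k T (base_algebra k)"
    and add: "x \<in> carrier K \<Longrightarrow> y \<in> carrier K \<Longrightarrow> t \<in> carrier T \<Longrightarrow> \<omega> (x \<oplus>\<^bsub>K\<^esub> y) t = \<omega> x t \<oplus>\<^bsub>k\<^esub> \<omega> y t"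
    and zero: "t \<in> carrier T \<Longrightarrow> \<omega> \<zero>\<^bsub>K\<^esub> t = \<zero>\<^bsub>k\<^esub>"
    and mult: "x \<in> carrier K \<Longrightarrow> y \<in> carrier K \<Longrightarrow> t \<in> carrier T \<Longrightarrow>
      \<omega> (x \<otimes>\<^bsub>K\<^esub> y) t = tensor_sum k (\<lambda>a b. \<omega> x a \<otimes>\<^bsub>k\<^esub> \<omega> y b) (sweedler k T t)"
    and one: "t \<in> carrier T \<Longrightarrow> \<omega> \<one>\<^bsub>K\<^esub> t = counit T t"
    and smult: "c \<in> carrier k \<Longrightarrow> x \<in> carrier K \<Longrightarrow> t \<in> carrier T \<Longrightarrow> \<omega> (c \<odot>\<^bsub>K\<^esub> x) t = c \<otimes>\<^bsub>k\<^esub> \<omega> x t"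
    and eqI: "x \<in> carrier K \<Longrightarrow> y \<in> carrier K \<Longrightarrow> (\<And>t. t \<in> carrier T \<Longrightarrow> \<omega> x t = \<omega> y t) \<Longrightarrow> x = y"
begin

lemma closed [simp]: "x \<in> carrier K \<Longrightarrow> t \<in> carrier T \<Longrightarrow> \<omega> x t \<in> carrier k"
  using module_homD(1)[OF linear] by simp

lemma prod_bilinear:
  "x \<in> carrier K \<Longrightarrow> y \<in> carrier K \<Longrightarrow> bilinear k T T (base_algebra k) (\<lambda>a b. \<omega> x a \<otimes>\<^bsub>k\<^esub> \<omega> y b)"
  by (intro bilinearI module_hom_scalar_left module_hom_scalar_right T.k_cring linear) auto

text \<open>Dual to cocommutativity of \<open>T\<close>, just as \<open>m_assoc\<close> is dual to
  its coassociativity.\<close>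

lemma m_comm: "x \<in> carrier K \<Longrightarrow> y \<in> carrier K \<Longrightarrow> x \<otimes>\<^bsub>K\<^esub> y = y \<otimes>\<^bsub>K\<^esub> x"
proof (rule eqI)
  fix t assume xyt: "x \<in> carrier K" "y \<in> carrier K" "t \<in> carrier T"
  have "tensor_sum k (\<lambda>a b. \<omega> x b \<otimes>\<^bsub>k\<^esub> \<omega> y a) (sweedler k T t)
    = tensor_sum k (\<lambda>a b. \<omega> y a \<otimes>\<^bsub>k\<^esub> \<omega> x b) (sweedler k T t)"
    by (rule tensor_sum_cong) (use T.sweedlerD[OF xyt(3)] xyt in \<open>simp add: T.R.m_comm\<close>)
  then show "\<omega> (x \<otimes>\<^bsub>K\<^esub> y) t = \<omega> (y \<otimes>\<^bsub>K\<^esub> x) t"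
    using T.sweedler_cocomm[OF prod_bilinear[OF xyt(1,2)] T.k1 xyt(3)] xyt by (simp add: mult)
qed auto

lemma m_assoc:
  assumes xyz: "x \<in> carrier K" "y \<in> carrier K" "z \<in> carrier K"
  shows "(x \<otimes>\<^bsub>K\<^esub> y) \<otimes>\<^bsub>K\<^esub> z = x \<otimes>\<^bsub>K\<^esub> (y \<otimes>\<^bsub>K\<^esub> z)"
proof (rule eqI)
  fix t assume t: "t \<in> carrier T"
  have tri: "trilinear k T T T (base_algebra k) (\<lambda>a b c. \<omega> x a \<otimes>\<^bsub>k\<^esub> (\<omega> y b \<otimes>\<^bsub>k\<^esub> \<omega> z c))"
    by (intro trilinearI module_hom_scalar_left module_hom_scalar_right T.k_cring linear) (use xyz in auto)
  have "\<omega> ((x \<otimes>\<^bsub>K\<^esub> y) \<otimes>\<^bsub>K\<^esub> z) t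
    = tensor_sum k (\<lambda>a c. tensor_sum k (\<lambda>a b. \<omega> x a \<otimes>\<^bsub>k\<^esub> (\<omega> y b \<otimes>\<^bsub>k\<^esub> \<omega> z c)) (sweedler k T a)) (sweedler k T t)"
    unfolding mult[OF mult_closed[OF xyz(1,2)] xyz(3) t]
  proof (rule tensor_sum_cong)
    fix a c assume "(a, c) \<in> set (sweedler k T t)"
    then have ac: "a \<in> carrier T" "c \<in> carrier T" using T.sweedlerD[OF t] by auto
    show "\<omega> (x \<otimes>\<^bsub>K\<^esub> y) a \<otimes>\<^bsub>k\<^esub> \<omega> z c
      = tensor_sum k (\<lambda>a b. \<omega> x a \<otimes>\<^bsub>k\<^esub> (\<omega> y b \<otimes>\<^bsub>k\<^esub> \<omega> z c)) (sweedler k T a)"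
      unfolding mult[OF xyz(1,2) ac(1)]
      by (subst T.sum_mult_right) (use T.sweedlerD[OF ac(1)] ac xyz in \<open>auto simp: T.R.m_assoc intro!: tensor_sum_cong\<close>)
  qed
  also have "\<dots> = tensor_sum k (\<lambda>a b. tensor_sum k (\<lambda>b c. \<omega> x a \<otimes>\<^bsub>k\<^esub> (\<omega> y b \<otimes>\<^bsub>k\<^esub> \<omega> z c)) (sweedler k T b)) (sweedler k T t)"
    using T.sweedler_coassoc[OF tri T.k1 t] by simp
  also have "\<dots> = \<omega> (x \<otimes>\<^bsub>K\<^esub> (y \<otimes>\<^bsub>K\<^esub> z)) t"
    unfolding mult[OF xyz(1) mult_closed[OF xyz(2,3)] t]
  proof (rule tensor_sum_cong)
    fix a b assume "(a, b) \<in> set (sweedler k T t)"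
    then have ab: "a \<in> carrier T" "b \<in> carrier T" using T.sweedlerD[OF t] by auto
    show "tensor_sum k (\<lambda>b c. \<omega> x a \<otimes>\<^bsub>k\<^esub> (\<omega> y b \<otimes>\<^bsub>k\<^esub> \<omega> z c)) (sweedler k T b)
      = \<omega> x a \<otimes>\<^bsub>k\<^esub> \<omega> (y \<otimes>\<^bsub>K\<^esub> z) b"
      unfolding mult[OF xyz(2,3) ab(2)]
      by (rule T.sum_mult_left[symmetric]) (use T.sweedlerD[OF ab(2)] ab xyz in auto)
  qed
  finally show "\<omega> ((x \<otimes>\<^bsub>K\<^esub> y) \<otimes>\<^bsub>K\<^esub> z) t = \<omega> (x \<otimes>\<^bsub>K\<^esub> (y \<otimes>\<^bsub>K\<^esub> z)) t" .
qed (use xyz in auto)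

lemma is_algebra: "algebra k K"
proof (rule algebraI)
  show "cring k" by (rule T.k_cring)
  show "cring K"
  proof (rule cringI)
    show "abelian_group K"
    proof (rule abelian_groupI)
      fix x assume x: "x \<in> carrier K"
      show "\<exists>y\<in>carrier K. y \<oplus>\<^bsub>K\<^esub> x = \<zero>\<^bsub>K\<^esub>"
      proof (rule bexI)
        show "(\<ominus>\<^bsub>k\<^esub> \<one>\<^bsub>k\<^esub>) \<odot>\<^bsub>K\<^esub> x \<oplus>\<^bsub>K\<^esub> x = \<zero>\<^bsub>K\<^esub>"
          by (rule eqI) (use x in \<open>auto simp: add smult zero T.R.l_minus T.R.l_neg\<close>)
      qed (use x in auto)
    qed (auto intro!: eqI simp: add zero T.R.a_ac)
    show "comm_monoid K"
    proof (rule comm_monoidI)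
      fix x assume x: "x \<in> carrier K"
      show "\<one>\<^bsub>K\<^esub> \<otimes>\<^bsub>K\<^esub> x = x"
      proof (rule eqI)
        fix t assume t: "t \<in> carrier T"
        have "tensor_sum k (\<lambda>a b. \<omega> \<one>\<^bsub>K\<^esub> a \<otimes>\<^bsub>k\<^esub> \<omega> x b) (sweedler k T t)
          = tensor_sum k (\<lambda>a b. counit T a \<otimes>\<^bsub>k\<^esub> \<omega> x b) (sweedler k T t)"
          by (rule tensor_sum_cong) (use T.sweedlerD[OF t] in \<open>simp add: one\<close>)
        then show "\<omega> (\<one>\<^bsub>K\<^esub> \<otimes>\<^bsub>K\<^esub> x) t = \<omega> x t"
          using T.sweedler_counit_left[OF linear[OF x] T.k1 t] x t by (simp add: mult)
      qed (use x in auto)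
    qed (auto intro: m_comm m_assoc)
    fix x y z assume xyz: "x \<in> carrier K" "y \<in> carrier K" "z \<in> carrier K"
    show "(x \<oplus>\<^bsub>K\<^esub> y) \<otimes>\<^bsub>K\<^esub> z = x \<otimes>\<^bsub>K\<^esub> z \<oplus>\<^bsub>K\<^esub> y \<otimes>\<^bsub>K\<^esub> z"
    proof (rule eqI)
      fix t assume t: "t \<in> carrier T"
      have "tensor_sum k (\<lambda>a b. \<omega> (x \<oplus>\<^bsub>K\<^esub> y) a \<otimes>\<^bsub>k\<^esub> \<omega> z b) (sweedler k T t)
        = tensor_sum k (\<lambda>a b. \<omega> x a \<otimes>\<^bsub>k\<^esub> \<omega> z b \<oplus>\<^bsub>k\<^esub> \<omega> y a \<otimes>\<^bsub>k\<^esub> \<omega> z b) (sweedler k T t)"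
        by (rule tensor_sum_cong) (use T.sweedlerD[OF t] xyz in \<open>simp add: add T.R.l_distr\<close>)
      also have "\<dots> = tensor_sum k (\<lambda>a b. \<omega> x a \<otimes>\<^bsub>k\<^esub> \<omega> z b) (sweedler k T t)
        \<oplus>\<^bsub>k\<^esub> tensor_sum k (\<lambda>a b. \<omega> y a \<otimes>\<^bsub>k\<^esub> \<omega> z b) (sweedler k T t)"
        by (rule T.sum_add) (use T.sweedlerD[OF t] xyz in auto)
      finally show "\<omega> ((x \<oplus>\<^bsub>K\<^esub> y) \<otimes>\<^bsub>K\<^esub> z) t = \<omega> (x \<otimes>\<^bsub>K\<^esub> z \<oplus>\<^bsub>K\<^esub> y \<otimes>\<^bsub>K\<^esub> z) t"
        using xyz t by (simp add: add mult)
    qed (use xyz in auto)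
  qed
  fix c x y assume c: "c \<in> carrier k" and xy: "x \<in> carrier K" "y \<in> carrier K"
  show "(c \<odot>\<^bsub>K\<^esub> x) \<otimes>\<^bsub>K\<^esub> y = c \<odot>\<^bsub>K\<^esub> (x \<otimes>\<^bsub>K\<^esub> y)"
  proof (rule eqI)
    fix t assume t: "t \<in> carrier T"
    have "tensor_sum k (\<lambda>a b. \<omega> (c \<odot>\<^bsub>K\<^esub> x) a \<otimes>\<^bsub>k\<^esub> \<omega> y b) (sweedler k T t)
      = tensor_sum k (\<lambda>a b. c \<otimes>\<^bsub>k\<^esub> (\<omega> x a \<otimes>\<^bsub>k\<^esub> \<omega> y b)) (sweedler k T t)"
      by (rule tensor_sum_cong) (use T.sweedlerD[OF t] c xy in \<open>simp add: smult T.R.m_assoc\<close>)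
    also have "\<dots> = c \<otimes>\<^bsub>k\<^esub> tensor_sum k (\<lambda>a b. \<omega> x a \<otimes>\<^bsub>k\<^esub> \<omega> y b) (sweedler k T t)"
      by (rule T.sum_mult_left[symmetric]) (use T.sweedlerD[OF t] c xy in auto)
    finally show "\<omega> ((c \<odot>\<^bsub>K\<^esub> x) \<otimes>\<^bsub>K\<^esub> y) t = \<omega> (c \<odot>\<^bsub>K\<^esub> (x \<otimes>\<^bsub>K\<^esub> y)) t"
      using c xy t by (simp add: smult mult)
  qed (use c xy in auto)
qed (auto intro!: eqI simp: add smult T.R.l_distr T.R.r_distr T.R.m_assoc)

lemma K_module: "module k K"
  by (rule algebra.module[OF is_algebra])

lemma separating: "separating k K (carrier T) \<omega>"
  unfolding separating_def by (auto intro!: module_homI eqI simp: add smult zero)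

end

text \<open>The last clause makes the coproduct of \<open>K\<close> dual to the product of
  \<open>T\<close>. Elements of \<open>K\<close> act through \<open>\<omega>\<close> instead of
  being functions themselves, so that a copy of a Hopf algebra of functionals on another type is
  covered as well.\<close>

locale separated_hopf = separated_algebra k T K \<omega>
  for k :: "('k, 'm) ring_scheme" and T :: "('k, 't, 'x) hopf_scheme"
    and K :: "('k, 'b, 'z) hopf_scheme" and \<omega> :: "'b \<Rightarrow> 't \<Rightarrow> 'k" +
  assumes comult_carrier: "x \<in> carrier K \<Longrightarrow> comult K x \<in> carrier (tensor k K K)"
    and antipode_carrier [simp]: "x \<in> carrier K \<Longrightarrow> antipode K x \<in> carrier K"
    and counit: "x \<in> carrier K \<Longrightarrow> counit K x = \<omega> x \<one>\<^bsub>T\<^esub>"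
    and antipode: "x \<in> carrier K \<Longrightarrow> t \<in> carrier T \<Longrightarrow> \<omega> (antipode K x) t = \<omega> x (antipode T t)"
    and comult: "x \<in> carrier K \<Longrightarrow> s \<in> carrier T \<Longrightarrow> t \<in> carrier T \<Longrightarrow>
      tensor_lift k (\<lambda>a b. \<omega> a s \<otimes>\<^bsub>k\<^esub> \<omega> b t) (comult K x) = \<omega> x (s \<otimes>\<^bsub>T\<^esub> t)"
begin

sublocale KK: two_vector_spaces k K K
  by (intro two_vector_spaces.intro two_modules.intro K_module) unfold_locales

definition ev where "ev u = (\<lambda>(s, t). tensor_lift k (\<lambda>a b. \<omega> a s \<otimes>\<^bsub>k\<^esub> \<omega> b t) u)"

lemma ev_separating: "separating k (tensor k K K) (carrier T \<times> carrier T) ev"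
  unfolding ev_def by (rule KK.tensor_separating[OF separating separating])

lemma ev_eqI:
  assumes "u \<in> carrier (tensor k K K)" "v \<in> carrier (tensor k K K)"
    and "\<And>s t. s \<in> carrier T \<Longrightarrow> t \<in> carrier T \<Longrightarrow> ev u (s, t) = ev v (s, t)"
  shows "u = v"
  by (rule separating_eqI[OF ev_separating KK.tensor_module assms(1,2)]) (use assms(3) in auto)

lemma ev_linear: "s \<in> carrier T \<Longrightarrow> t \<in> carrier T \<Longrightarrow> (\<lambda>u. ev u (s, t)) \<in> module_hom k (tensor k K K) (base_algebra k)"
  by (rule separatingD(1)[OF ev_separating]) simp

lemma linear_left: "t \<in> carrier T \<Longrightarrow> (\<lambda>x. \<omega> x t) \<in> module_hom k K (base_algebra k)"
  by (rule separatingD(1)[OF separating])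

lemma ev_bilinear: "s \<in> carrier T \<Longrightarrow> t \<in> carrier T \<Longrightarrow> bilinear k K K (base_algebra k) (\<lambda>a b. \<omega> a s \<otimes>\<^bsub>k\<^esub> \<omega> b t)"
  by (rule KK.bilinear_pairing[OF linear_left linear_left])

lemma ev_pure: "s \<in> carrier T \<Longrightarrow> t \<in> carrier T \<Longrightarrow> a \<in> carrier K \<Longrightarrow> b \<in> carrier K \<Longrightarrow>
    ev (pure_tensor k K K a b) (s, t) = \<omega> a s \<otimes>\<^bsub>k\<^esub> \<omega> b t"
  using KK.tensor_lift_pure[OF ev_bilinear T.k1] by (simp add: ev_def)

lemma ev_comult: "x \<in> carrier K \<Longrightarrow> s \<in> carrier T \<Longrightarrow> t \<in> carrier T \<Longrightarrow> ev (comult K x) (s, t) = \<omega> x (s \<otimes>\<^bsub>T\<^esub> t)"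
  by (simp add: ev_def comult)

lemma comult_linear: "comult K \<in> module_hom k K (tensor k K K)"
proof -
  interpret t: module k "tensor k K K" by (rule KK.tensor_module)
  show ?thesis
    by (intro module_homI comult_carrier ev_eqI)
      (auto simp: comult_carrier module_homD(2,3)[OF ev_linear] ev_comult add smult)
qed

sublocale comult_space k K
  by (intro comult_space.intro K_module comult_space_axioms.intro comult_linear) unfold_locales

lemma ev_sweedler:
  assumes x: "x \<in> carrier K" and st: "s \<in> carrier T" "t \<in> carrier T"
  shows "tensor_sum k (\<lambda>a b. \<omega> a s \<otimes>\<^bsub>k\<^esub> \<omega> b t) (sweedler k K x) = \<omega> x (s \<otimes>\<^bsub>T\<^esub> t)"
  using lift_comult[OF ev_bilinear[OF st] T.k1 x] comult[OF x st] by simp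

lemma counit_alg_hom: "counit K \<in> alg_hom k K (base_algebra k)"
proof -
  interpret K: algebra k K by (rule is_algebra)
  have "counit K (x \<otimes>\<^bsub>K\<^esub> y) = counit K x \<otimes>\<^bsub>k\<^esub> counit K y" if "x \<in> carrier K" "y \<in> carrier K" for x y
    using that T.sweedler_one[OF prod_bilinear T.k1] by (simp add: counit mult)
  then show ?thesis
    by (auto simp: alg_hom_def ring_hom_def module_hom_iff counit add smult one T.counit_one)
qed

lemma antipode_linear: "antipode K \<in> module_hom k K K"
  by (rule module_homI) (auto intro!: eqI simp: add smult antipode)

lemma ev_swap_comult:
  assumes x: "x \<in> carrier K" and st: "s \<in> carrier T" "t \<in> carrier T"
  shows "ev (tensor_swap k K K (comult K x)) (s, t) = \<omega> x (t \<otimes>\<^bsub>T\<^esub> s)"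
proof -
  have "ev (tensor_swap k K K (comult K x)) (s, t)
    = tensor_sum k (\<lambda>a b. ev (pure_tensor k K K b a) (s, t)) (sweedler k K x)"
    unfolding swap_comult[OF x]
    using module_hom_tensor_sum[OF ev_linear[OF st] KK.tensor_module T.k1, of "sweedler k K x" "\<lambda>a b. pure_tensor k K K b a"]
      sweedlerD[OF x] by simp
  also have "\<dots> = tensor_sum k (\<lambda>a b. \<omega> a t \<otimes>\<^bsub>k\<^esub> \<omega> b s) (sweedler k K x)"
    by (rule tensor_sum_cong) (use sweedlerD[OF x] st in \<open>simp add: ev_pure T.R.m_comm\<close>)
  finally show ?thesis using ev_sweedler[OF x st(2,1)] by simp
qed

text \<open>The axiom is its own dual: evaluated at \<open>s\<close> and \<open>t\<close>,
  multiplicativity of the coproduct of \<open>K\<close> becomes that of the coproduct of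
  \<open>T\<close>, and preservation of the unit becomes multiplicativity of the counit of
  \<open>T\<close>.\<close>

lemma comult_alg_hom: "comult K \<in> alg_hom k K (tensor k K K)"
proof -
  interpret K: algebra k K by (rule is_algebra)
  have one: "comult K \<one>\<^bsub>K\<^esub> = \<one>\<^bsub>tensor k K K\<^esub>"
  proof (rule ev_eqI)
    show "\<one>\<^bsub>tensor k K K\<^esub> \<in> carrier (tensor k K K)" by (simp add: tensor_def KK.cls_closed pure_tensor_def)
    fix s t assume st: "s \<in> carrier T" "t \<in> carrier T"
    then have "ev (pure_tensor k K K \<one>\<^bsub>K\<^esub> \<one>\<^bsub>K\<^esub>) (s, t) = counit T s \<otimes>\<^bsub>k\<^esub> counit T t"
      by (simp add: ev_pure one)
    then show "ev (comult K \<one>\<^bsub>K\<^esub>) (s, t) = ev \<one>\<^bsub>tensor k K K\<^esub> (s, t)"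
      using st by (simp add: ev_comult one T.counit_mult tensor_def)
  qed (simp add: comult_carrier)
  have mult: "comult K (x \<otimes>\<^bsub>K\<^esub> y) = comult K x \<otimes>\<^bsub>tensor k K K\<^esub> comult K y"
    if xy: "x \<in> carrier K" "y \<in> carrier K" for x y
  proof (rule ev_eqI)
    note m = KK.tensor_mult_cls[OF is_algebra is_algebra sweedler(1)[OF xy(1)] sweedler(1)[OF xy(2)]]
    let ?p = "[(a \<otimes>\<^bsub>K\<^esub> c, b \<otimes>\<^bsub>K\<^esub> d). (a, b) \<leftarrow> sweedler k K x, (c, d) \<leftarrow> sweedler k K y]"
    have prod: "comult K x \<otimes>\<^bsub>tensor k K K\<^esub> comult K y = tensor_class k K K ?p"
      using m(1) xy by (simp add: sweedler(2))
    then show "comult K x \<otimes>\<^bsub>tensor k K K\<^esub> comult K y \<in> carrier (tensor k K K)"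
      using KK.cls_closed[OF m(2)] by simp
    show "comult K (x \<otimes>\<^bsub>K\<^esub> y) \<in> carrier (tensor k K K)" using xy by (simp add: comult_carrier)
    fix s t assume st: "s \<in> carrier T" "t \<in> carrier T"
    let ?X = "sweedler k K x" and ?Y = "sweedler k K y" and ?S = "sweedler k T s" and ?U = "sweedler k T t"
    note X = sweedlerD[OF xy(1)] and Y = sweedlerD[OF xy(2)] and S = T.sweedlerD[OF st(1)] and U = T.sweedlerD[OF st(2)]
    have "ev (comult K (x \<otimes>\<^bsub>K\<^esub> y)) (s, t)
      = tensor_sum k (\<lambda>s1 s2. tensor_sum k (\<lambda>t1 t2. \<omega> x (s1 \<otimes>\<^bsub>T\<^esub> t1) \<otimes>\<^bsub>k\<^esub> \<omega> y (s2 \<otimes>\<^bsub>T\<^esub> t2)) ?U) ?S"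
      using xy st T.sweedler_mult[OF prod_bilinear[OF xy] T.k1 st] by (simp add: ev_comult mult)
    also have "\<dots> = tensor_sum k (\<lambda>s1 s2. tensor_sum k (\<lambda>t1 t2.
        tensor_sum k (\<lambda>a b. \<omega> a s1 \<otimes>\<^bsub>k\<^esub> \<omega> b t1) ?X \<otimes>\<^bsub>k\<^esub> tensor_sum k (\<lambda>c d. \<omega> c s2 \<otimes>\<^bsub>k\<^esub> \<omega> d t2) ?Y) ?U) ?S"
      by (intro tensor_sum_cong) (use xy S U in \<open>simp add: ev_sweedler\<close>)
    also have "\<dots> = tensor_sum k (\<lambda>a b. tensor_sum k (\<lambda>c d.
        tensor_sum k (\<lambda>s1 s2. \<omega> a s1 \<otimes>\<^bsub>k\<^esub> \<omega> c s2) ?S \<otimes>\<^bsub>k\<^esub> tensor_sum k (\<lambda>t1 t2. \<omega> b t1 \<otimes>\<^bsub>k\<^esub> \<omega> d t2) ?U) ?Y) ?X"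
      by (rule T.sum_interchange) (use X Y S U in auto)
    also have "\<dots> = tensor_sum k (\<lambda>a b. tensor_sum k (\<lambda>c d. \<omega> (a \<otimes>\<^bsub>K\<^esub> c) s \<otimes>\<^bsub>k\<^esub> \<omega> (b \<otimes>\<^bsub>K\<^esub> d) t) ?Y) ?X"
      by (intro tensor_sum_cong) (use X Y st in \<open>simp add: mult\<close>)
    also have "\<dots> = ev (tensor_class k K K ?p) (s, t)"
      using KK.tensor_lift_cls[OF ev_bilinear[OF st] T.k1 m(2)] m(3)[OF ev_bilinear[OF st] T.k1] by (simp add: ev_def)
    finally show "ev (comult K (x \<otimes>\<^bsub>K\<^esub> y)) (s, t) = ev (comult K x \<otimes>\<^bsub>tensor k K K\<^esub> comult K y) (s, t)"
      using prod by simp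
  qed
  show ?thesis
    using module_homD(2)[OF comult_linear]
    by (simp add: alg_hom_def ring_hom_def one mult comult_linear comult_carrier)
qed

text \<open>The index is nested as \<open>(r, (s, t))\<close> to match the nesting of the cube, so
  that separation follows by applying \<open>tensor_separating\<close> once more.\<close>

definition ev3 where "ev3 u = (\<lambda>(r, z). tensor_lift k (\<lambda>a v. \<omega> a r \<otimes>\<^bsub>k\<^esub> ev v z) u)"

lemma ev3_separating: "separating k H3 (carrier T \<times> (carrier T \<times> carrier T)) ev3"
  unfolding ev3_def by (rule H1.tensor_separating[OF separating ev_separating])

lemma ev3_linear: "r \<in> carrier T \<Longrightarrow> s \<in> carrier T \<Longrightarrow> t \<in> carrier T \<Longrightarrow>
    (\<lambda>u. ev3 u (r, (s, t))) \<in> module_hom k H3 (base_algebra k)"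
  by (rule separatingD(1)[OF ev3_separating]) simp

lemma ev3_pure: "r \<in> carrier T \<Longrightarrow> s \<in> carrier T \<Longrightarrow> t \<in> carrier T \<Longrightarrow> a \<in> carrier K \<Longrightarrow> v \<in> carrier (tensor k K K) \<Longrightarrow>
    ev3 (pure_tensor k K (tensor k K K) a v) (r, (s, t)) = \<omega> a r \<otimes>\<^bsub>k\<^esub> ev v (s, t)"
  using H1.tensor_lift_pure[OF H1.bilinear_pairing[where \<omega> = \<omega> and x = r and \<omega>' = ev and y = "(s, t)",
        OF linear_left ev_linear] T.k1] by (simp add: ev3_def)

text \<open>Evaluated at \<open>r\<close>, \<open>s\<close>, \<open>t\<close>, the two sides are the
  values of \<open>x\<close> at the two bracketings of the product of \<open>r\<close>,
  \<open>s\<close> and \<open>t\<close> in \<open>T\<close>.\<close>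

lemma coassociative:
  assumes x: "x \<in> carrier K"
  shows "tensor_assoc k K K K (tensor_map k (tensor k K K) K (comult K) id (comult K x))
    = tensor_map k K (tensor k K K) id (comult K) (comult K x)"
  unfolding assoc_comult_left[OF x] assoc_comult_right[OF x]
proof (rule separating_eqI[OF ev3_separating H1.tensor_module])
  let ?q = "\<lambda>a b c. pure_tensor k K (tensor k K K) a (pure_tensor k K K b c)"
  let ?s = "\<lambda>a c. tensor_sum H3 (\<lambda>a b. ?q a b c) (sweedler k K a)"
  let ?p = "\<lambda>a b. pure_tensor k K (tensor k K K) a (comult K b)"
  let ?l = "tensor_sum H3 ?s (sweedler k K x)" and ?r = "tensor_sum H3 ?p (sweedler k K x)"
  note X = sweedlerD[OF x]
  have inner: "?s a c \<in> carrier H3"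
    if "a \<in> carrier K" "c \<in> carrier K" for a c
    by (rule module_tensor_sum_closed[OF H1.tensor_module]) (use sweedlerD[OF that(1)] that in auto)
  show "?l \<in> carrier H3"
    by (rule module_tensor_sum_closed[OF H1.tensor_module]) (use X inner in auto)
  show "?r \<in> carrier H3"
    by (rule module_tensor_sum_closed[OF H1.tensor_module]) (use X comult_carrier in auto)
  fix z assume "z \<in> carrier T \<times> (carrier T \<times> carrier T)"
  then obtain r s t where z: "z = (r, (s, t))" and r: "r \<in> carrier T" and s: "s \<in> carrier T" and t: "t \<in> carrier T" by auto
  note lin = ev3_linear[OF r s t]
  have "ev3 (?l) (r, (s, t))
    = tensor_sum k (\<lambda>a c. ev3 (?s a c) (r, (s, t))) (sweedler k K x)"
    using module_hom_tensor_sum[OF lin H1.tensor_module T.k1, of "sweedler k K x" ?s]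
      X inner by simp
  also have "\<dots> = tensor_sum k (\<lambda>a c. \<omega> a (r \<otimes>\<^bsub>T\<^esub> s) \<otimes>\<^bsub>k\<^esub> \<omega> c t) (sweedler k K x)"
  proof (rule tensor_sum_cong)
    fix a c assume "(a, c) \<in> set (sweedler k K x)"
    then have ac: "a \<in> carrier K" "c \<in> carrier K" using X by auto
    note A = sweedlerD[OF ac(1)]
    have "ev3 (?s a c) (r, (s, t))
      = tensor_sum k (\<lambda>a b. ev3 (?q a b c) (r, (s, t))) (sweedler k K a)"
      using module_hom_tensor_sum[OF lin H1.tensor_module T.k1, of "sweedler k K a" "\<lambda>a b. ?q a b c"]
        A ac by simp
    also have "\<dots> = tensor_sum k (\<lambda>a b. \<omega> a r \<otimes>\<^bsub>k\<^esub> \<omega> b s \<otimes>\<^bsub>k\<^esub> \<omega> c t) (sweedler k K a)"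
      by (rule tensor_sum_cong) (use A ac r s t in \<open>simp add: ev3_pure ev_pure T.R.m_assoc\<close>)
    also have "\<dots> = tensor_sum k (\<lambda>a b. \<omega> a r \<otimes>\<^bsub>k\<^esub> \<omega> b s) (sweedler k K a) \<otimes>\<^bsub>k\<^esub> \<omega> c t"
      by (rule T.sum_mult_right[symmetric]) (use A ac r s t in auto)
    finally show "ev3 (?s a c) (r, (s, t))
      = \<omega> a (r \<otimes>\<^bsub>T\<^esub> s) \<otimes>\<^bsub>k\<^esub> \<omega> c t"
      using ev_sweedler[OF ac(1) r s] by simp
  qed
  also have "\<dots> = \<omega> x (r \<otimes>\<^bsub>T\<^esub> (s \<otimes>\<^bsub>T\<^esub> t))"
    using ev_sweedler[OF x _ t, of "r \<otimes>\<^bsub>T\<^esub> s"] r s t by (simp add: T.m_assoc)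
  also have "\<dots> = tensor_sum k (\<lambda>a b. \<omega> a r \<otimes>\<^bsub>k\<^esub> \<omega> b (s \<otimes>\<^bsub>T\<^esub> t)) (sweedler k K x)"
    using ev_sweedler[OF x r, of "s \<otimes>\<^bsub>T\<^esub> t"] s t by simp
  also have "\<dots> = tensor_sum k (\<lambda>a b. ev3 (pure_tensor k K (tensor k K K) a (comult K b)) (r, (s, t))) (sweedler k K x)"
    by (rule tensor_sum_cong) (use X r s t in \<open>simp add: ev3_pure ev_comult comult_carrier\<close>)
  also have "\<dots> = ev3 (?r) (r, (s, t))"
    using module_hom_tensor_sum[OF lin H1.tensor_module T.k1, of "sweedler k K x" "?p"]
      X comult_carrier by simp
  finally show "ev3 (?l) z
    = ev3 (?r) z"
    unfolding z .
qed

text \<open>Both antipode laws in one: \<open>F\<close> is the product with the antipode applied to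
  one factor, and \<open>f\<close>, \<open>g\<close> are the corresponding maps on \<open>T\<close>.
  Exchanging the sums over the components of \<open>x\<close> and of \<open>t\<close> reduces the
  law for \<open>K\<close> to the one for \<open>T\<close>.\<close>

lemma antipode_law:
  assumes x: "x \<in> carrier K" and F: "\<And>a b. a \<in> carrier K \<Longrightarrow> b \<in> carrier K \<Longrightarrow> F a b \<in> carrier K"
    and bil: "bilinear k K K K F"
    and f: "\<And>t. t \<in> carrier T \<Longrightarrow> f t \<in> carrier T" and g: "\<And>t. t \<in> carrier T \<Longrightarrow> g t \<in> carrier T"
    and \<omega>F: "\<And>a b t. a \<in> carrier K \<Longrightarrow> b \<in> carrier K \<Longrightarrow> t \<in> carrier T \<Longrightarrow>
      \<omega> (F a b) t = tensor_sum k (\<lambda>s t. \<omega> a (f s) \<otimes>\<^bsub>k\<^esub> \<omega> b (g t)) (sweedler k T t)"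
    and law: "\<And>t. t \<in> carrier T \<Longrightarrow>
      tensor_sum k (\<lambda>s t. \<omega> x (f s \<otimes>\<^bsub>T\<^esub> g t)) (sweedler k T t) = counit T t \<otimes>\<^bsub>k\<^esub> \<omega> x \<one>\<^bsub>T\<^esub>"
  shows "tensor_lift K F (comult K x) = counit K x \<odot>\<^bsub>K\<^esub> \<one>\<^bsub>K\<^esub>"
proof (rule eqI)
  note X = sweedlerD[OF x]
  have eq: "tensor_lift K F (comult K x) = tensor_sum K F (sweedler k K x)"
    by (rule lift_comult[OF bil K_module x])
  show "tensor_lift K F (comult K x) \<in> carrier K"
    unfolding eq by (rule module_tensor_sum_closed[OF K_module]) (use F X in auto)
  show "counit K x \<odot>\<^bsub>K\<^esub> \<one>\<^bsub>K\<^esub> \<in> carrier K" using x by (simp add: counit)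
  fix t assume t: "t \<in> carrier T"
  note U = T.sweedlerD[OF t]
  have "\<omega> (tensor_sum K F (sweedler k K x)) t = tensor_sum k (\<lambda>a b. \<omega> (F a b) t) (sweedler k K x)"
    using module_hom_tensor_sum[OF linear_left[OF t] K_module T.k1, of "sweedler k K x" F] F X by simp
  also have "\<dots> = tensor_sum k (\<lambda>a b. tensor_sum k (\<lambda>s t. \<omega> a (f s) \<otimes>\<^bsub>k\<^esub> \<omega> b (g t)) (sweedler k T t)) (sweedler k K x)"
    by (rule tensor_sum_cong) (use X t in \<open>simp add: \<omega>F\<close>)
  also have "\<dots> = tensor_sum k (\<lambda>s t. tensor_sum k (\<lambda>a b. \<omega> a (f s) \<otimes>\<^bsub>k\<^esub> \<omega> b (g t)) (sweedler k K x)) (sweedler k T t)"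
    by (rule T.sum_swap) (use X U f g in auto)
  also have "\<dots> = tensor_sum k (\<lambda>s t. \<omega> x (f s \<otimes>\<^bsub>T\<^esub> g t)) (sweedler k T t)"
    by (rule tensor_sum_cong) (use U f g x in \<open>simp add: ev_sweedler\<close>)
  finally show "\<omega> (tensor_lift K F (comult K x)) t = \<omega> (counit K x \<odot>\<^bsub>K\<^esub> \<one>\<^bsub>K\<^esub>) t"
    using x t law[OF t] by (simp add: eq counit smult one T.R.m_comm)
qed

theorem is_hopf_algebra: "hopf_algebra k K"
proof (intro hopf_algebra.intro hopf_algebra_axioms.intro is_algebra comult_alg_hom counit_alg_hom
    antipode_linear coassociative)
  show "field k" ..
  fix x assume x: "x \<in> carrier K"
  note X = sweedlerD[OF x]
  have cl: "counit K \<in> module_hom k K (base_algebra k)"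
    using counit_alg_hom by (simp add: alg_hom_def)
  have cc: "counit K a \<in> carrier k" if "a \<in> carrier K" for a using that by (simp add: counit)
  have bil: "bilinear k K K K (\<lambda>a b. counit K a \<odot>\<^bsub>K\<^esub> b)"
    by (intro bilinearI module_hom_smult_left module_hom_smult K_module cl module_hom_id) (auto simp: cc)
  show left: "tensor_lift K (\<lambda>a b. counit K a \<odot>\<^bsub>K\<^esub> b) (comult K x) = x"
    unfolding lift_comult[OF bil K_module x]
  proof (rule eqI)
    show "tensor_sum K (\<lambda>a b. counit K a \<odot>\<^bsub>K\<^esub> b) (sweedler k K x) \<in> carrier K"
      by (rule module_tensor_sum_closed[OF K_module]) (use X cc in auto)
    fix t assume t: "t \<in> carrier T"
    have "\<omega> (tensor_sum K (\<lambda>a b. counit K a \<odot>\<^bsub>K\<^esub> b) (sweedler k K x)) t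
      = tensor_sum k (\<lambda>a b. \<omega> (counit K a \<odot>\<^bsub>K\<^esub> b) t) (sweedler k K x)"
      using module_hom_tensor_sum[OF linear_left[OF t] K_module T.k1, of "sweedler k K x" "\<lambda>a b. counit K a \<odot>\<^bsub>K\<^esub> b"] cc X by simp
    also have "\<dots> = tensor_sum k (\<lambda>a b. \<omega> a \<one>\<^bsub>T\<^esub> \<otimes>\<^bsub>k\<^esub> \<omega> b t) (sweedler k K x)"
      by (rule tensor_sum_cong) (use X t cc in \<open>simp add: smult counit\<close>)
    finally show "\<omega> (tensor_sum K (\<lambda>a b. counit K a \<odot>\<^bsub>K\<^esub> b) (sweedler k K x)) t = \<omega> x t"
      using ev_sweedler[OF x _ t] t by simp
  qed (rule x)
  show swap: "tensor_swap k K K (comult K x) = comult K x"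
  proof (rule ev_eqI)
    show "tensor_swap k K K (comult K x) \<in> carrier (tensor k K K)"
      unfolding swap_comult[OF x] by (rule module_tensor_sum_closed[OF KK.tensor_module]) (use X in auto)
  qed (use x in \<open>simp_all add: comult_carrier ev_swap_comult ev_comult T.m_comm\<close>)
  have bil': "bilinear k K K K (\<lambda>a b. counit K b \<odot>\<^bsub>K\<^esub> a)"
    by (rule bilinear_swap[OF bil])
  \<comment> \<open>The right counit law is the left one read through the flip, which fixes the
    coproduct by cocommutativity.\<close>
  have "tensor_lift K (\<lambda>a b. counit K a \<odot>\<^bsub>K\<^esub> b) (tensor_swap k K K (comult K x))
    = tensor_sum K (\<lambda>a b. tensor_lift K (\<lambda>a b. counit K a \<odot>\<^bsub>K\<^esub> b) (pure_tensor k K K b a)) (sweedler k K x)"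
    unfolding swap_comult[OF x]
    by (rule module_hom_tensor_sum[OF KK.tensor_lift_linear[OF bil K_module] KK.tensor_module K_module]) (use X in auto)
  also have "\<dots> = tensor_sum K (\<lambda>a b. counit K b \<odot>\<^bsub>K\<^esub> a) (sweedler k K x)"
    by (rule tensor_sum_cong) (use X KK.tensor_lift_pure[OF bil K_module] in auto)
  finally show "tensor_lift K (\<lambda>a b. counit K b \<odot>\<^bsub>K\<^esub> a) (comult K x) = x"
    using left swap lift_comult[OF bil' K_module x] by simp
  show "tensor_lift K (\<lambda>a b. antipode K a \<otimes>\<^bsub>K\<^esub> b) (comult K x) = counit K x \<odot>\<^bsub>K\<^esub> \<one>\<^bsub>K\<^esub>"
  proof (rule antipode_law[OF x, where f = "antipode T" and g = id])
    show "bilinear k K K K (\<lambda>a b. antipode K a \<otimes>\<^bsub>K\<^esub> b)"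
      by (intro bilinearI module_hom_mult_left module_hom_mult_right is_algebra antipode_linear module_hom_id) auto
    fix t assume t: "t \<in> carrier T"
    show "tensor_sum k (\<lambda>s t. \<omega> x (antipode T s \<otimes>\<^bsub>T\<^esub> id t)) (sweedler k T t) = counit T t \<otimes>\<^bsub>k\<^esub> \<omega> x \<one>\<^bsub>T\<^esub>"
      using T.sweedler_antipode_left[OF linear[OF x] T.k1 t] by simp
    show "\<omega> (antipode K a \<otimes>\<^bsub>K\<^esub> b) t = tensor_sum k (\<lambda>s t. \<omega> a (antipode T s) \<otimes>\<^bsub>k\<^esub> \<omega> b (id t)) (sweedler k T t)"
      if "a \<in> carrier K" "b \<in> carrier K" for a b
      using that t T.sweedlerD[OF t] by (auto simp: mult antipode intro!: tensor_sum_cong)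
  qed auto
  show "tensor_lift K (\<lambda>a b. a \<otimes>\<^bsub>K\<^esub> antipode K b) (comult K x) = counit K x \<odot>\<^bsub>K\<^esub> \<one>\<^bsub>K\<^esub>"
  proof (rule antipode_law[OF x, where f = id and g = "antipode T"])
    show "bilinear k K K K (\<lambda>a b. a \<otimes>\<^bsub>K\<^esub> antipode K b)"
      by (intro bilinearI module_hom_mult_left module_hom_mult_right is_algebra antipode_linear module_hom_id) auto
    fix t assume t: "t \<in> carrier T"
    show "tensor_sum k (\<lambda>s t. \<omega> x (id s \<otimes>\<^bsub>T\<^esub> antipode T t)) (sweedler k T t) = counit T t \<otimes>\<^bsub>k\<^esub> \<omega> x \<one>\<^bsub>T\<^esub>"
      using T.sweedler_antipode_right[OF linear[OF x] T.k1 t] by simp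
    show "\<omega> (a \<otimes>\<^bsub>K\<^esub> antipode K b) t = tensor_sum k (\<lambda>s t. \<omega> a (id s) \<otimes>\<^bsub>k\<^esub> \<omega> b (antipode T t)) (sweedler k T t)"
      if "a \<in> carrier K" "b \<in> carrier K" for a b
      using that t T.sweedlerD[OF t] by (auto simp: mult antipode intro!: tensor_sum_cong)
  qed auto
qed

end

section \<open>Pairings\<close>

text \<open>Products on either side are dual to coproducts on the other, so the notion is symmetric.
  Antipodes do not occur, in accordance with \<open>hopf_hom\<close>, which asks for algebra and
  coalgebra maps.\<close>

definition hopf_pairing where
  "hopf_pairing k A T \<pi> \<longleftrightarrow> bilinear k A T (base_algebra k) \<pi> \<and>
    (\<forall>a\<in>carrier A. \<forall>a'\<in>carrier A. \<forall>t\<in>carrier T. \<pi> (a \<otimes>\<^bsub>A\<^esub> a') t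
      = tensor_sum k (\<lambda>t1 t2. \<pi> a t1 \<otimes>\<^bsub>k\<^esub> \<pi> a' t2) (sweedler k T t)) \<and>
    (\<forall>a\<in>carrier A. \<forall>t\<in>carrier T. \<forall>t'\<in>carrier T. \<pi> a (t \<otimes>\<^bsub>T\<^esub> t')
      = tensor_sum k (\<lambda>a1 a2. \<pi> a1 t \<otimes>\<^bsub>k\<^esub> \<pi> a2 t') (sweedler k A a)) \<and>
    (\<forall>t\<in>carrier T. \<pi> \<one>\<^bsub>A\<^esub> t = counit T t) \<and> (\<forall>a\<in>carrier A. \<pi> a \<one>\<^bsub>T\<^esub> = counit A a)"

lemma hopf_pairingD:
  assumes "hopf_pairing k A T \<pi>"
  shows "bilinear k A T (base_algebra k) \<pi>"
    "a \<in> carrier A \<Longrightarrow> a' \<in> carrier A \<Longrightarrow> t \<in> carrier T \<Longrightarrow> \<pi> (a \<otimes>\<^bsub>A\<^esub> a') t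
      = tensor_sum k (\<lambda>t1 t2. \<pi> a t1 \<otimes>\<^bsub>k\<^esub> \<pi> a' t2) (sweedler k T t)"
    "a \<in> carrier A \<Longrightarrow> t \<in> carrier T \<Longrightarrow> t' \<in> carrier T \<Longrightarrow> \<pi> a (t \<otimes>\<^bsub>T\<^esub> t')
      = tensor_sum k (\<lambda>a1 a2. \<pi> a1 t \<otimes>\<^bsub>k\<^esub> \<pi> a2 t') (sweedler k A a)"
    "t \<in> carrier T \<Longrightarrow> \<pi> \<one>\<^bsub>A\<^esub> t = counit T t" "a \<in> carrier A \<Longrightarrow> \<pi> a \<one>\<^bsub>T\<^esub> = counit A a"
    "a \<in> carrier A \<Longrightarrow> t \<in> carrier T \<Longrightarrow> \<pi> a t \<in> carrier k"
  using assms bilinearD(3)[of k A T "base_algebra k" \<pi> a t] by (simp_all add: hopf_pairing_def)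

lemma hopf_pairing_swap: "hopf_pairing k A T \<pi> \<Longrightarrow> hopf_pairing k T A (\<lambda>t a. \<pi> a t)"
  using bilinear_swap[of k A T "base_algebra k" \<pi>] by (simp add: hopf_pairing_def)

lemma hopf_pairing_cong:
  assumes A: "hopf_algebra k A" and T: "hopf_algebra k T"
    and eq: "\<And>a t. a \<in> carrier A \<Longrightarrow> t \<in> carrier T \<Longrightarrow> \<pi> a t = \<pi>' a t"
    and \<pi>: "hopf_pairing k A T \<pi>"
  shows "hopf_pairing k A T \<pi>'"
proof -
  interpret A: hopf_algebra k A by fact
  interpret T: hopf_algebra k T by fact
  have bil: "bilinear k A T (base_algebra k) \<pi>'"
  proof (rule bilinearI)
    show "(\<lambda>a. \<pi>' a t) \<in> module_hom k A (base_algebra k)" if "t \<in> carrier T" for t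
      by (rule module_hom_congI[OF bilinearD(1)[OF hopf_pairingD(1)[OF \<pi>] that] A.H_module eq]) (use that in auto)
    show "\<pi>' a \<in> module_hom k T (base_algebra k)" if "a \<in> carrier A" for a
      by (rule module_hom_congI[OF bilinearD(2)[OF hopf_pairingD(1)[OF \<pi>] that] T.H_module eq]) (use that in auto)
  qed
  have sT: "tensor_sum k (\<lambda>t1 t2. \<pi>' a t1 \<otimes>\<^bsub>k\<^esub> \<pi>' a' t2) (sweedler k T t)
    = tensor_sum k (\<lambda>t1 t2. \<pi> a t1 \<otimes>\<^bsub>k\<^esub> \<pi> a' t2) (sweedler k T t)"
    if "a \<in> carrier A" "a' \<in> carrier A" "t \<in> carrier T" for a a' t
    by (rule tensor_sum_cong) (use T.sweedlerD[OF that(3)] that eq in auto)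
  have sA: "tensor_sum k (\<lambda>a1 a2. \<pi>' a1 t \<otimes>\<^bsub>k\<^esub> \<pi>' a2 t') (sweedler k A a)
    = tensor_sum k (\<lambda>a1 a2. \<pi> a1 t \<otimes>\<^bsub>k\<^esub> \<pi> a2 t') (sweedler k A a)"
    if "a \<in> carrier A" "t \<in> carrier T" "t' \<in> carrier T" for a t t'
    by (rule tensor_sum_cong) (use A.sweedlerD[OF that(1)] that eq in auto)
  show ?thesis
    unfolding hopf_pairing_def using bil hopf_pairingD(2-5)[OF \<pi>]
    by (simp add: sT sA eq[symmetric])
qed

lemma (in separated_hopf) hopf_pairing: "hopf_pairing k K T \<omega>"
  unfolding hopf_pairing_def
  by (auto intro!: bilinearI linear linear_left simp: mult ev_sweedler one counit)

text \<open>What remains of a bilinear map from \<open>A\<close> and \<open>B\<close> to a Hopf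
  algebra after pairing the target with \<open>D\<close>. The condition of being a coalgebra map has
  become multiplicativity in \<open>d\<close> together with the value at the unit of
  \<open>D\<close>, which puts the three variables on the same footing.\<close>

definition trilinear_pairing where
  "trilinear_pairing k A B D \<tau> \<longleftrightarrow> trilinear k A B D (base_algebra k) \<tau> \<and>
    (\<forall>a\<in>carrier A. \<forall>a'\<in>carrier A. \<forall>b\<in>carrier B. \<forall>d\<in>carrier D. \<tau> (a \<otimes>\<^bsub>A\<^esub> a') b d
      = tensor_sum k (\<lambda>b1 b2. tensor_sum k (\<lambda>d1 d2. \<tau> a b1 d1 \<otimes>\<^bsub>k\<^esub> \<tau> a' b2 d2) (sweedler k D d)) (sweedler k B b)) \<and>
    (\<forall>a\<in>carrier A. \<forall>b\<in>carrier B. \<forall>b'\<in>carrier B. \<forall>d\<in>carrier D. \<tau> a (b \<otimes>\<^bsub>B\<^esub> b') d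
      = tensor_sum k (\<lambda>a1 a2. tensor_sum k (\<lambda>d1 d2. \<tau> a1 b d1 \<otimes>\<^bsub>k\<^esub> \<tau> a2 b' d2) (sweedler k D d)) (sweedler k A a)) \<and>
    (\<forall>a\<in>carrier A. \<forall>b\<in>carrier B. \<forall>d\<in>carrier D. \<forall>d'\<in>carrier D. \<tau> a b (d \<otimes>\<^bsub>D\<^esub> d')
      = tensor_sum k (\<lambda>a1 a2. tensor_sum k (\<lambda>b1 b2. \<tau> a1 b1 d \<otimes>\<^bsub>k\<^esub> \<tau> a2 b2 d') (sweedler k B b)) (sweedler k A a)) \<and>
    (\<forall>b\<in>carrier B. \<forall>d\<in>carrier D. \<tau> \<one>\<^bsub>A\<^esub> b d = counit B b \<otimes>\<^bsub>k\<^esub> counit D d) \<and>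
    (\<forall>a\<in>carrier A. \<forall>d\<in>carrier D. \<tau> a \<one>\<^bsub>B\<^esub> d = counit A a \<otimes>\<^bsub>k\<^esub> counit D d) \<and>
    (\<forall>a\<in>carrier A. \<forall>b\<in>carrier B. \<tau> a b \<one>\<^bsub>D\<^esub> = counit A a \<otimes>\<^bsub>k\<^esub> counit B b)"

lemma trilinear_pairingD:
  assumes "trilinear_pairing k A B D \<tau>"
  shows "trilinear k A B D (base_algebra k) \<tau>"
    "a \<in> carrier A \<Longrightarrow> a' \<in> carrier A \<Longrightarrow> b \<in> carrier B \<Longrightarrow> d \<in> carrier D \<Longrightarrow> \<tau> (a \<otimes>\<^bsub>A\<^esub> a') b d
      = tensor_sum k (\<lambda>b1 b2. tensor_sum k (\<lambda>d1 d2. \<tau> a b1 d1 \<otimes>\<^bsub>k\<^esub> \<tau> a' b2 d2) (sweedler k D d)) (sweedler k B b)"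
    "a \<in> carrier A \<Longrightarrow> b \<in> carrier B \<Longrightarrow> b' \<in> carrier B \<Longrightarrow> d \<in> carrier D \<Longrightarrow> \<tau> a (b \<otimes>\<^bsub>B\<^esub> b') d
      = tensor_sum k (\<lambda>a1 a2. tensor_sum k (\<lambda>d1 d2. \<tau> a1 b d1 \<otimes>\<^bsub>k\<^esub> \<tau> a2 b' d2) (sweedler k D d)) (sweedler k A a)"
    "a \<in> carrier A \<Longrightarrow> b \<in> carrier B \<Longrightarrow> d \<in> carrier D \<Longrightarrow> d' \<in> carrier D \<Longrightarrow> \<tau> a b (d \<otimes>\<^bsub>D\<^esub> d')
      = tensor_sum k (\<lambda>a1 a2. tensor_sum k (\<lambda>b1 b2. \<tau> a1 b1 d \<otimes>\<^bsub>k\<^esub> \<tau> a2 b2 d') (sweedler k B b)) (sweedler k A a)"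
    "b \<in> carrier B \<Longrightarrow> d \<in> carrier D \<Longrightarrow> \<tau> \<one>\<^bsub>A\<^esub> b d = counit B b \<otimes>\<^bsub>k\<^esub> counit D d"
    "a \<in> carrier A \<Longrightarrow> d \<in> carrier D \<Longrightarrow> \<tau> a \<one>\<^bsub>B\<^esub> d = counit A a \<otimes>\<^bsub>k\<^esub> counit D d"
    "a \<in> carrier A \<Longrightarrow> b \<in> carrier B \<Longrightarrow> \<tau> a b \<one>\<^bsub>D\<^esub> = counit A a \<otimes>\<^bsub>k\<^esub> counit B b"
    "a \<in> carrier A \<Longrightarrow> b \<in> carrier B \<Longrightarrow> d \<in> carrier D \<Longrightarrow> \<tau> a b d \<in> carrier k"
  using assms trilinearD(4)[of k A B D "base_algebra k" \<tau> a b d] by (simp_all add: trilinear_pairing_def)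

text \<open>Apart from the order of summation and the order of factors in \<open>k\<close>, the six
  laws are permuted cyclically. Rotations suffice to bring any variable into the last place, where
  it is the partner of the target.\<close>

lemma trilinear_pairing_rotate:
  assumes A: "hopf_algebra k A" and B: "hopf_algebra k B" and D: "hopf_algebra k D"
    and \<tau>: "trilinear_pairing k A B D \<tau>"
  shows "trilinear_pairing k B D A (\<lambda>b d a. \<tau> a b d)"
proof -
  interpret A: hopf_algebra k A by fact
  interpret B: hopf_algebra k B by fact
  interpret D: hopf_algebra k D by fact
  note t = trilinear_pairingD[OF \<tau>]
  have tri: "trilinear k B D A (base_algebra k) (\<lambda>b d a. \<tau> a b d)"
    by (intro trilinearI trilinearD[OF t(1)])
  have 1: "tensor_sum k (\<lambda>d1 d2. tensor_sum k (\<lambda>a1 a2. \<tau> a1 b d1 \<otimes>\<^bsub>k\<^esub> \<tau> a2 b' d2) (sweedler k A a)) (sweedler k D d)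
     = tensor_sum k (\<lambda>a1 a2. tensor_sum k (\<lambda>d1 d2. \<tau> a1 b d1 \<otimes>\<^bsub>k\<^esub> \<tau> a2 b' d2) (sweedler k D d)) (sweedler k A a)"
    if "a \<in> carrier A" "b \<in> carrier B" "b' \<in> carrier B" "d \<in> carrier D" for a b b' d
    by (rule A.sum_swap) (use that A.sweedlerD[OF that(1)] D.sweedlerD[OF that(4)] t(8) in auto)
  have 2: "tensor_sum k (\<lambda>b1 b2. tensor_sum k (\<lambda>a1 a2. \<tau> a1 b1 d \<otimes>\<^bsub>k\<^esub> \<tau> a2 b2 d') (sweedler k A a)) (sweedler k B b)
     = tensor_sum k (\<lambda>a1 a2. tensor_sum k (\<lambda>b1 b2. \<tau> a1 b1 d \<otimes>\<^bsub>k\<^esub> \<tau> a2 b2 d') (sweedler k B b)) (sweedler k A a)"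
    if "a \<in> carrier A" "b \<in> carrier B" "d \<in> carrier D" "d' \<in> carrier D" for a b d d'
    by (rule A.sum_swap) (use that A.sweedlerD[OF that(1)] B.sweedlerD[OF that(2)] t(8) in auto)
  show ?thesis
    unfolding trilinear_pairing_def using tri
    by (simp add: t(2-7) 1 2 A.R.m_comm)
qed

section \<open>Homomorphisms and bilinear maps\<close>

lemma coalg_hom_iff:
  assumes C: "hopf_algebra k C" and D: "hopf_algebra k D"
  shows "f \<in> coalg_hom k C D \<longleftrightarrow> f \<in> module_hom k C D \<and> (\<forall>x\<in>carrier C. counit D (f x) = counit C x \<and>
    comult D (f x) = tensor_sum (tensor k D D) (\<lambda>a b. pure_tensor k D D (f a) (f b)) (sweedler k C x))"
proof -
  interpret C: hopf_algebra k C by fact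
  interpret D: hopf_algebra k D by fact
  have "tensor_map k D D f f (comult C x)
    = tensor_sum (tensor k D D) (\<lambda>a b. pure_tensor k D D (f a) (f b)) (sweedler k C x)"
    if "f \<in> module_hom k C D" "x \<in> carrier C" for x
    unfolding tensor_map_def
    by (rule C.lift_comult[OF bilinear_comp2[OF D.HH.pure_bilinear that(1) that(1)] D.HH.tensor_module that(2)])
  then show ?thesis by (auto simp: coalg_hom_def)
qed

lemma coalg_hom_sweedler:
  assumes C: "hopf_algebra k C" and D: "hopf_algebra k D" and f: "f \<in> coalg_hom k C D"
    and F: "bilinear k D D M F" and M: "module k M" and x: "x \<in> carrier C"
  shows "tensor_sum M F (sweedler k D (f x)) = tensor_sum M (\<lambda>a b. F (f a) (f b)) (sweedler k C x)"
proof -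
  interpret C: hopf_algebra k C by fact
  interpret D: hopf_algebra k D by fact
  have fl: "f \<in> module_hom k C D"
    and fc: "comult D (f x) = tensor_sum (tensor k D D) (\<lambda>a b. pure_tensor k D D (f a) (f b)) (sweedler k C x)"
    using f x by (auto simp: coalg_hom_iff[OF C D])
  note fD = module_homD(1)[OF fl]
  have "tensor_sum M F (sweedler k D (f x)) = tensor_lift M F (comult D (f x))"
    by (rule D.lift_comult[OF F M fD[OF x], symmetric])
  also have "\<dots> = tensor_sum M (\<lambda>a b. tensor_lift M F (pure_tensor k D D (f a) (f b))) (sweedler k C x)"
    unfolding fc by (rule module_hom_tensor_sum[OF D.HH.tensor_lift_linear[OF F M] D.HH.tensor_module M])
      (use C.sweedlerD[OF x] fD in auto)
  also have "\<dots> = tensor_sum M (\<lambda>a b. F (f a) (f b)) (sweedler k C x)"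
    by (rule tensor_sum_cong) (use C.sweedlerD[OF x] fD D.HH.tensor_lift_pure[OF F M] in auto)
  finally show ?thesis .
qed

lemma hopf_homD:
  assumes "f \<in> hopf_hom k A B"
  shows "f \<in> module_hom k A B" "f \<in> coalg_hom k A B" "f \<in> extensional (carrier A)"
    "x \<in> carrier A \<Longrightarrow> f x \<in> carrier B"
    "x \<in> carrier A \<Longrightarrow> y \<in> carrier A \<Longrightarrow> f (x \<otimes>\<^bsub>A\<^esub> y) = f x \<otimes>\<^bsub>B\<^esub> f y"
    "f \<one>\<^bsub>A\<^esub> = \<one>\<^bsub>B\<^esub>" "x \<in> carrier A \<Longrightarrow> counit B (f x) = counit A x"
  using assms by (auto simp: hopf_hom_def alg_hom_def coalg_hom_def ring_hom_def)

lemma hopf_homI: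
  assumes "f \<in> module_hom k A B" "f \<in> coalg_hom k A B" "f \<in> extensional (carrier A)"
    "\<And>x y. x \<in> carrier A \<Longrightarrow> y \<in> carrier A \<Longrightarrow> f (x \<otimes>\<^bsub>A\<^esub> y) = f x \<otimes>\<^bsub>B\<^esub> f y" "f \<one>\<^bsub>A\<^esub> = \<one>\<^bsub>B\<^esub>"
  shows "f \<in> hopf_hom k A B"
  using assms by (auto simp: hopf_hom_def alg_hom_def ring_hom_def module_hom_iff)

lemma hopf_hom_id:
  assumes A: "hopf_algebra k A"
  shows "(\<lambda>x\<in>carrier A. x) \<in> hopf_hom k A A"
proof -
  interpret A: hopf_algebra k A by fact
  have l: "(\<lambda>x\<in>carrier A. x) \<in> module_hom k A A" by (simp add: module_hom_iff)
  have "tensor_sum (tensor k A A) (\<lambda>a b. pure_tensor k A A ((\<lambda>x\<in>carrier A. x) a) ((\<lambda>x\<in>carrier A. x) b)) (sweedler k A x) = comult A x"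
    if x: "x \<in> carrier A" for x
  proof -
    have "tensor_sum (tensor k A A) (\<lambda>a b. pure_tensor k A A ((\<lambda>x\<in>carrier A. x) a) ((\<lambda>x\<in>carrier A. x) b)) (sweedler k A x)
      = tensor_sum (tensor k A A) (pure_tensor k A A) (sweedler k A x)"
      by (rule tensor_sum_cong) (use A.sweedlerD[OF x] in simp)
    then show ?thesis using A.HH.cls_sum[OF A.sweedler(1)[OF x]] A.sweedler(2)[OF x] by simp
  qed
  then show ?thesis by (intro hopf_homI l) (auto simp: coalg_hom_iff[OF A A] l)
qed

lemma hopf_hom_compose:
  assumes A: "hopf_algebra k A" and B: "hopf_algebra k B" and C: "hopf_algebra k C"
    and f: "f \<in> hopf_hom k A B" and g: "g \<in> hopf_hom k B C"
  shows "compose (carrier A) g f \<in> hopf_hom k A C"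
proof -
  interpret A: hopf_algebra k A by fact
  interpret B: hopf_algebra k B by fact
  interpret C: hopf_algebra k C by fact
  note f' = hopf_homD[OF f] and g' = hopf_homD[OF g]
  have l: "compose (carrier A) g f \<in> module_hom k A C"
    using f' g' by (simp add: module_hom_iff compose_def)
  have co: "comult C (g (f x)) = tensor_sum (tensor k C C) (\<lambda>a b. pure_tensor k C C (compose (carrier A) g f a) (compose (carrier A) g f b)) (sweedler k A x)"
    if x: "x \<in> carrier A" for x
  proof -
    have "comult C (g (f x)) = tensor_sum (tensor k C C) (\<lambda>a b. pure_tensor k C C (g a) (g b)) (sweedler k B (f x))"
      using g'(2) f'(4)[OF x] by (simp add: coalg_hom_iff[OF B C])
    also have "\<dots> = tensor_sum (tensor k C C) (\<lambda>a b. pure_tensor k C C (g (f a)) (g (f b))) (sweedler k A x)"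
      by (rule coalg_hom_sweedler[OF A B f'(2) _ C.HH.tensor_module x])
        (rule bilinear_comp2[OF C.HH.pure_bilinear g'(1) g'(1)])
    also have "\<dots> = tensor_sum (tensor k C C) (\<lambda>a b. pure_tensor k C C (compose (carrier A) g f a) (compose (carrier A) g f b)) (sweedler k A x)"
      by (rule tensor_sum_cong) (use A.sweedlerD[OF x] in \<open>simp add: compose_def\<close>)
    finally show ?thesis .
  qed
  show ?thesis
    by (intro hopf_homI l)
      (use f' g' in \<open>auto simp: coalg_hom_iff[OF A C] l[unfolded compose_def] co[unfolded compose_def] compose_def\<close>)
qed

lemma hopf_pairing_comp:
  assumes A: "hopf_algebra k A" and K: "hopf_algebra k K" and f: "f \<in> hopf_hom k A K"
    and T: "hopf_algebra k T" and \<omega>: "hopf_pairing k K T \<omega>"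
  shows "hopf_pairing k A T (\<lambda>a t. \<omega> (f a) t)"
proof -
  interpret A: hopf_algebra k A by fact
  interpret K: hopf_algebra k K by fact
  interpret T: hopf_algebra k T by fact
  note f' = hopf_homD[OF f] and w = hopf_pairingD[OF \<omega>]
  have bil: "bilinear k K K (base_algebra k) (\<lambda>a b. \<omega> a t \<otimes>\<^bsub>k\<^esub> \<omega> b t')" if "t \<in> carrier T" "t' \<in> carrier T" for t t'
    by (rule K.HH.bilinear_pairing[OF bilinearD(1)[OF w(1)] bilinearD(1)[OF w(1)]]) fact+
  have "tensor_sum k (\<lambda>a b. \<omega> a t \<otimes>\<^bsub>k\<^esub> \<omega> b t') (sweedler k K (f a))
    = tensor_sum k (\<lambda>a b. \<omega> (f a) t \<otimes>\<^bsub>k\<^esub> \<omega> (f b) t') (sweedler k A a)"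
    if "a \<in> carrier A" "t \<in> carrier T" "t' \<in> carrier T" for a t t'
    using coalg_hom_sweedler[OF A K f'(2) bil K.k1 that(1)] that by simp
  then show ?thesis
    unfolding hopf_pairing_def
    using bilinear_comp2[OF w(1) f'(1) module_hom_id] by (simp add: f' w)
qed

text \<open>Nondegeneracy is required on the side of \<open>K\<close> only: \<open>K\<close> embeds
  into the functionals on \<open>T\<close>. In contrast to \<open>separated_hopf\<close> the Hopf
  structure of \<open>K\<close> is given, so that a finite dimensional Hopf algebra paired with its
  dual is an instance.\<close>

locale separating_pairing = K: hopf_algebra k K + T: hopf_algebra k T
  for k :: "('k, 'm) ring_scheme" and K :: "('k, 'b, 'z) hopf_scheme" and T :: "('k, 't, 'x) hopf_scheme" +
  fixes \<omega> :: "'b \<Rightarrow> 't \<Rightarrow> 'k"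
  assumes pairing: "hopf_pairing k K T \<omega>"
    and eqI: "x \<in> carrier K \<Longrightarrow> y \<in> carrier K \<Longrightarrow> (\<And>t. t \<in> carrier T \<Longrightarrow> \<omega> x t = \<omega> y t) \<Longrightarrow> x = y"
begin

lemmas pairing_simps = hopf_pairingD(2-5)[OF pairing]
lemmas \<omega>_closed [simp] = hopf_pairingD(6)[OF pairing]

lemma linear_left: "t \<in> carrier T \<Longrightarrow> (\<lambda>x. \<omega> x t) \<in> module_hom k K (base_algebra k)"
  by (rule bilinearD(1)[OF hopf_pairingD(1)[OF pairing]])

lemma \<omega>_zero: "t \<in> carrier T \<Longrightarrow> \<omega> \<zero>\<^bsub>K\<^esub> t = \<zero>\<^bsub>k\<^esub>"
  using module_hom_zero[OF linear_left K.H_module K.k1] by simp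

lemma separating: "separating k K (carrier T) \<omega>"
  unfolding separating_def by (auto intro!: linear_left eqI simp: \<omega>_zero)

lemma ev_bilinear: "s \<in> carrier T \<Longrightarrow> t \<in> carrier T \<Longrightarrow> bilinear k K K (base_algebra k) (\<lambda>a b. \<omega> a s \<otimes>\<^bsub>k\<^esub> \<omega> b t)"
  by (rule K.HH.bilinear_pairing[OF linear_left linear_left])

text \<open>Pairs from \<open>T\<close> separate the tensor square of \<open>K\<close> by
  \<open>tensor_separating\<close>, and at such a pair the coproduct of \<open>x\<close> takes the
  value of \<open>x\<close> at the product.\<close>

lemma comult_eqI:
  assumes x: "x \<in> carrier K" and u: "u \<in> carrier (tensor k K K)"
    and eq: "\<And>s t. s \<in> carrier T \<Longrightarrow> t \<in> carrier T \<Longrightarrow>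
      tensor_lift k (\<lambda>a b. \<omega> a s \<otimes>\<^bsub>k\<^esub> \<omega> b t) u = \<omega> x (s \<otimes>\<^bsub>T\<^esub> t)"
  shows "comult K x = u"
proof (rule separating_eqI[OF K.HH.tensor_separating[OF separating separating] K.HH.tensor_module K.comult_closed[OF x] u])
  fix z assume "z \<in> carrier T \<times> carrier T"
  then obtain s t where z: "z = (s, t)" and st: "s \<in> carrier T" "t \<in> carrier T" by auto
  show "(case z of (s, t) \<Rightarrow> tensor_lift k (\<lambda>a b. \<omega> a s \<otimes>\<^bsub>k\<^esub> \<omega> b t) (comult K x))
    = (case z of (s, t) \<Rightarrow> tensor_lift k (\<lambda>a b. \<omega> a s \<otimes>\<^bsub>k\<^esub> \<omega> b t) u)"
    using K.lift_comult[OF ev_bilinear[OF st] K.k1 x] eq[OF st] st x by (simp add: z pairing_simps)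
qed

lemma lift_sum:
  assumes "s \<in> carrier T" "t \<in> carrier T"
    and "\<And>a b. (a, b) \<in> set xs \<Longrightarrow> F a b \<in> carrier (tensor k K K)"
  shows "tensor_lift k (\<lambda>a b. \<omega> a s \<otimes>\<^bsub>k\<^esub> \<omega> b t) (tensor_sum (tensor k K K) F xs)
    = tensor_sum k (\<lambda>a b. tensor_lift k (\<lambda>a b. \<omega> a s \<otimes>\<^bsub>k\<^esub> \<omega> b t) (F a b)) xs"
  using module_hom_tensor_sum[OF K.HH.tensor_lift_linear[OF ev_bilinear[OF assms(1,2)] K.k1] K.HH.tensor_module K.k1, of xs F]
    assms(3) by simp

lemma lift_pure: "s \<in> carrier T \<Longrightarrow> t \<in> carrier T \<Longrightarrow> a \<in> carrier K \<Longrightarrow> b \<in> carrier K \<Longrightarrow>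
    tensor_lift k (\<lambda>a b. \<omega> a s \<otimes>\<^bsub>k\<^esub> \<omega> b t) (pure_tensor k K K a b) = \<omega> a s \<otimes>\<^bsub>k\<^esub> \<omega> b t"
  using K.HH.tensor_lift_pure[OF ev_bilinear K.k1] by simp

lemma linearI:
  assumes "\<And>x. x \<in> carrier M \<Longrightarrow> f x \<in> carrier K"
    and "\<And>t. t \<in> carrier T \<Longrightarrow> (\<lambda>x. \<omega> (f x) t) \<in> module_hom k M (base_algebra k)" "module k M"
  shows "f \<in> module_hom k M K"
proof -
  interpret M: module k M by fact
  show ?thesis
    by (rule module_homI; (rule eqI)?)
      (auto simp: assms(1) module_homD(2,3)[OF assms(2)] module_homD(2,3)[OF linear_left])
qed

text \<open>Every law required of \<open>f\<close> is an equation in \<open>K\<close> or in its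
  tensor square, hence can be tested against \<open>T\<close>, where it becomes a law of the pairing
  pulled back along \<open>f\<close>.\<close>

lemma hopf_homI_pairing:
  assumes A: "hopf_algebra k A" and f: "f \<in> carrier A \<rightarrow> carrier K" "f \<in> extensional (carrier A)"
    and \<pi>: "hopf_pairing k A T (\<lambda>a t. \<omega> (f a) t)"
  shows "f \<in> hopf_hom k A K"
proof -
  interpret A: hopf_algebra k A by fact
  note p = hopf_pairingD[OF \<pi>]
  have fc: "\<And>a. a \<in> carrier A \<Longrightarrow> f a \<in> carrier K" using f by auto
  have lin: "f \<in> module_hom k A K"
    by (rule linearI[OF fc bilinearD(1)[OF p(1)] A.H_module])
  have counit: "counit K (f x) = counit A x" if "x \<in> carrier A" for x
    using p(5)[OF that] pairing_simps(4)[OF fc[OF that]] by simp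
  have comult: "comult K (f x) = tensor_sum (tensor k K K) (\<lambda>a b. pure_tensor k K K (f a) (f b)) (sweedler k A x)"
    if x: "x \<in> carrier A" for x
  proof (rule comult_eqI[OF fc[OF x]])
    note X = A.sweedlerD[OF x]
    show "tensor_sum (tensor k K K) (\<lambda>a b. pure_tensor k K K (f a) (f b)) (sweedler k A x) \<in> carrier (tensor k K K)"
      by (rule module_tensor_sum_closed[OF K.HH.tensor_module]) (use X fc in auto)
    fix s t assume st: "s \<in> carrier T" "t \<in> carrier T"
    have "tensor_lift k (\<lambda>a b. \<omega> a s \<otimes>\<^bsub>k\<^esub> \<omega> b t) (tensor_sum (tensor k K K) (\<lambda>a b. pure_tensor k K K (f a) (f b)) (sweedler k A x))
      = tensor_sum k (\<lambda>a b. tensor_lift k (\<lambda>a b. \<omega> a s \<otimes>\<^bsub>k\<^esub> \<omega> b t) (pure_tensor k K K (f a) (f b))) (sweedler k A x)"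
      by (rule lift_sum[OF st]) (use X fc in auto)
    also have "\<dots> = tensor_sum k (\<lambda>a b. \<omega> (f a) s \<otimes>\<^bsub>k\<^esub> \<omega> (f b) t) (sweedler k A x)"
      by (rule tensor_sum_cong) (use X fc st in \<open>simp add: lift_pure\<close>)
    also have "\<dots> = \<omega> (f x) (s \<otimes>\<^bsub>T\<^esub> t)" using p(3)[OF x st] by simp
    finally show "tensor_lift k (\<lambda>a b. \<omega> a s \<otimes>\<^bsub>k\<^esub> \<omega> b t) (tensor_sum (tensor k K K) (\<lambda>a b. pure_tensor k K K (f a) (f b)) (sweedler k A x))
      = \<omega> (f x) (s \<otimes>\<^bsub>T\<^esub> t)" .
  qed
  show ?thesis
  proof (intro hopf_homI lin f(2))
    show "f \<in> coalg_hom k A K" by (simp add: coalg_hom_iff[OF A K.hopf_algebra_axioms] lin counit comult)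
    show "f (x \<otimes>\<^bsub>A\<^esub> y) = f x \<otimes>\<^bsub>K\<^esub> f y" if "x \<in> carrier A" "y \<in> carrier A" for x y
      by (rule eqI) (use that fc p(2) in \<open>auto simp: pairing_simps\<close>)
    show "f \<one>\<^bsub>A\<^esub> = \<one>\<^bsub>K\<^esub>"
      by (rule eqI) (use fc p(4) in \<open>auto simp: pairing_simps\<close>)
  qed
qed

end

section \<open>Bilinear maps of Hopf algebras on pure tensors\<close>

lemma tensor_hopf_simps:
  "carrier (tensor_hopf k A B) = carrier (tensor k A B)"
  "add (tensor_hopf k A B) = add (tensor k A B)"
  "smult (tensor_hopf k A B) = smult (tensor k A B)"
  "counit (tensor_hopf k A B) = tensor_lift k (\<lambda>a b. counit A a \<otimes>\<^bsub>k\<^esub> counit B b)"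
  "comult (tensor_hopf k A B) = tensor_lift (tensor k (tensor k A B) (tensor k A B)) (\<lambda>a b.
      tensor_lift (tensor k (tensor k A B) (tensor k A B)) (\<lambda>a1 a2.
        tensor_lift (tensor k (tensor k A B) (tensor k A B)) (\<lambda>b1 b2.
          pure_tensor k (tensor k A B) (tensor k A B) (pure_tensor k A B a1 b1) (pure_tensor k A B a2 b2))
        (comult B b))
      (comult A a))"
  by (simp_all add: tensor_hopf_def Let_def module.extend_def hopf.fields_def)

lemma module_hom_tensor_hopf: "module_hom k (tensor_hopf k A B) M = module_hom k (tensor k A B) M"
  by (simp add: module_hom_def tensor_hopf_simps)

locale two_hopf_algebras = A: hopf_algebra k A + B: hopf_algebra k B
  for k :: "('k, 'm) ring_scheme" and A :: "('k, 'a, 'x) hopf_scheme" and B :: "('k, 'b, 'y) hopf_scheme"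
begin

sublocale AB: two_vector_spaces k A B
  by unfold_locales

sublocale ABAB: two_vector_spaces k "tensor k A B" "tensor k A B"
  by (intro two_vector_spaces.intro two_modules.intro AB.tensor_module) unfold_locales

abbreviation AB2 where "AB2 \<equiv> tensor k (tensor k A B) (tensor k A B)"
abbreviation p2 where "p2 a1 a2 b1 b2 \<equiv>
  pure_tensor k (tensor k A B) (tensor k A B) (pure_tensor k A B a1 b1) (pure_tensor k A B a2 b2)"

lemma p2_linear:
  "a2 \<in> carrier A \<Longrightarrow> b1 \<in> carrier B \<Longrightarrow> b2 \<in> carrier B \<Longrightarrow> (\<lambda>a1. p2 a1 a2 b1 b2) \<in> module_hom k A AB2"
  "a1 \<in> carrier A \<Longrightarrow> b1 \<in> carrier B \<Longrightarrow> b2 \<in> carrier B \<Longrightarrow> (\<lambda>a2. p2 a1 a2 b1 b2) \<in> module_hom k A AB2"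
  "a1 \<in> carrier A \<Longrightarrow> a2 \<in> carrier A \<Longrightarrow> b2 \<in> carrier B \<Longrightarrow> (\<lambda>b1. p2 a1 a2 b1 b2) \<in> module_hom k B AB2"
  "a1 \<in> carrier A \<Longrightarrow> a2 \<in> carrier A \<Longrightarrow> b1 \<in> carrier B \<Longrightarrow> (\<lambda>b2. p2 a1 a2 b1 b2) \<in> module_hom k B AB2"
  by (rule module_hom_comp[OF bilinearD(1)[OF AB.pure_bilinear] bilinearD(1)[OF ABAB.pure_bilinear]]; simp)
    (rule module_hom_comp[OF bilinearD(1)[OF AB.pure_bilinear] bilinearD(2)[OF ABAB.pure_bilinear]]
      module_hom_comp[OF bilinearD(2)[OF AB.pure_bilinear] bilinearD(1)[OF ABAB.pure_bilinear]]
      module_hom_comp[OF bilinearD(2)[OF AB.pure_bilinear] bilinearD(2)[OF ABAB.pure_bilinear]]; simp)+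

text \<open>The coproduct of \<open>tensor_hopf\<close> is a nest of lifts; an outer lift can only
  be computed once the inner one is known to be bilinear in the outer variables.\<close>

lemma lift_B:
  assumes M: "module k M" and b: "b \<in> carrier B"
    and F1: "\<And>a1 a2 b1 b2. a2 \<in> carrier A \<Longrightarrow> b1 \<in> carrier B \<Longrightarrow> b2 \<in> carrier B \<Longrightarrow> (\<lambda>a1. F a1 a2 b1 b2) \<in> module_hom k A M"
    and F2: "\<And>a1 a2 b1 b2. a1 \<in> carrier A \<Longrightarrow> b1 \<in> carrier B \<Longrightarrow> b2 \<in> carrier B \<Longrightarrow> (\<lambda>a2. F a1 a2 b1 b2) \<in> module_hom k A M"
    and F3: "\<And>a1 a2. a1 \<in> carrier A \<Longrightarrow> a2 \<in> carrier A \<Longrightarrow> bilinear k B B M (F a1 a2)"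
  shows "bilinear k A A M (\<lambda>a1 a2. tensor_lift M (F a1 a2) (comult B b))"
  by (intro bilinearI B.HH.tensor_lift_linear_param M A.H_module B.comult_closed b F1 F2 F3)

lemma comult_tensor_hopf_bilinear:
  "bilinear k A B AB2 (\<lambda>a b. tensor_lift AB2 (\<lambda>a1 a2. tensor_lift AB2 (p2 a1 a2) (comult B b)) (comult A a))"
proof -
  note M = ABAB.tensor_module
  have pb: "bilinear k B B AB2 (p2 a1 a2)" if "a1 \<in> carrier A" "a2 \<in> carrier A" for a1 a2
    by (intro bilinearI p2_linear that)
  have in': "bilinear k A A AB2 (\<lambda>a1 a2. tensor_lift AB2 (p2 a1 a2) (comult B b))" if "b \<in> carrier B" for b
    by (rule lift_B[OF M that p2_linear(1,2) pb])
  show ?thesis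
  proof (rule bilinearI)
    fix b assume b: "b \<in> carrier B"
    show "(\<lambda>a. tensor_lift AB2 (\<lambda>a1 a2. tensor_lift AB2 (p2 a1 a2) (comult B b)) (comult A a)) \<in> module_hom k A AB2"
      by (rule module_hom_comp[OF A.comult_linear A.HH.tensor_lift_linear[OF in'[OF b] M]])
  next
    fix a assume a: "a \<in> carrier A"
    show "(\<lambda>b. tensor_lift AB2 (\<lambda>a1 a2. tensor_lift AB2 (p2 a1 a2) (comult B b)) (comult A a)) \<in> module_hom k B AB2"
      by (rule A.HH.tensor_lift_linear_param[OF M B.H_module A.comult_closed[OF a] in'])
        (auto intro: module_hom_comp[OF B.comult_linear B.HH.tensor_lift_linear[OF pb M]])
  qed
qed

lemma comult_tensor_hopf_pure:
  assumes a: "a \<in> carrier A" and b: "b \<in> carrier B"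
  shows "comult (tensor_hopf k A B) (pure_tensor k A B a b)
    = tensor_sum AB2 (\<lambda>a1 a2. tensor_sum AB2 (\<lambda>b1 b2. p2 a1 a2 b1 b2) (sweedler k B b)) (sweedler k A a)"
proof -
  note M = ABAB.tensor_module
  have pb: "bilinear k B B AB2 (p2 a1 a2)" if "a1 \<in> carrier A" "a2 \<in> carrier A" for a1 a2
    by (intro bilinearI p2_linear that)
  have "comult (tensor_hopf k A B) (pure_tensor k A B a b)
    = tensor_lift AB2 (\<lambda>a1 a2. tensor_lift AB2 (p2 a1 a2) (comult B b)) (comult A a)"
    unfolding tensor_hopf_simps by (rule AB.tensor_lift_pure[OF comult_tensor_hopf_bilinear M a b])
  also have "\<dots> = tensor_sum AB2 (\<lambda>a1 a2. tensor_lift AB2 (p2 a1 a2) (comult B b)) (sweedler k A a)"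
    by (rule A.lift_comult[OF lift_B[OF M b p2_linear(1,2) pb] M a])
  also have "\<dots> = tensor_sum AB2 (\<lambda>a1 a2. tensor_sum AB2 (\<lambda>b1 b2. p2 a1 a2 b1 b2) (sweedler k B b)) (sweedler k A a)"
    by (rule tensor_sum_cong) (use A.sweedlerD[OF a] B.lift_comult[OF pb M b] in auto)
  finally show ?thesis .
qed

text \<open>All conditions are spelled out on pure tensors, which is enough for the coalgebra part
  since both sides are linear there. With Sweedler sums in place of lifts they can be matched with
  \<open>trilinear_pairing\<close>.\<close>

lemma bilinear_map_iff:
  assumes K: "hopf_algebra k K"
  defines "c f \<equiv> \<lambda>a b. f (pure_tensor k A B a b)"
  shows "f \<in> bilinear_map k A B K \<longleftrightarrow> f \<in> module_hom k (tensor k A B) K \<and>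
    (\<forall>a\<in>carrier A. \<forall>b\<in>carrier B. comult K (c f a b) = tensor_sum (tensor k K K) (\<lambda>a1 a2.
      tensor_sum (tensor k K K) (\<lambda>b1 b2. pure_tensor k K K (c f a1 b1) (c f a2 b2)) (sweedler k B b)) (sweedler k A a)) \<and>
    (\<forall>a\<in>carrier A. \<forall>b\<in>carrier B. counit K (c f a b) = counit A a \<otimes>\<^bsub>k\<^esub> counit B b) \<and>
    (\<forall>x\<in>carrier A. \<forall>y\<in>carrier A. \<forall>z\<in>carrier B. c f (x \<otimes>\<^bsub>A\<^esub> y) z
      = tensor_sum K (\<lambda>z1 z2. c f x z1 \<otimes>\<^bsub>K\<^esub> c f y z2) (sweedler k B z)) \<and>
    (\<forall>x\<in>carrier A. \<forall>w\<in>carrier B. \<forall>z\<in>carrier B. c f x (w \<otimes>\<^bsub>B\<^esub> z)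
      = tensor_sum K (\<lambda>x1 x2. c f x1 w \<otimes>\<^bsub>K\<^esub> c f x2 z) (sweedler k A x)) \<and>
    (\<forall>x\<in>carrier A. c f x \<one>\<^bsub>B\<^esub> = counit A x \<odot>\<^bsub>K\<^esub> \<one>\<^bsub>K\<^esub>) \<and>
    (\<forall>z\<in>carrier B. c f \<one>\<^bsub>A\<^esub> z = counit B z \<odot>\<^bsub>K\<^esub> \<one>\<^bsub>K\<^esub>)"
proof (cases "f \<in> module_hom k (tensor k A B) K")
  case f: True
  let ?R = "\<lambda>a b. tensor_sum (tensor k K K) (\<lambda>a1 a2.
      tensor_sum (tensor k K K) (\<lambda>b1 b2. pure_tensor k K K (c f a1 b1) (c f a2 b2)) (sweedler k B b)) (sweedler k A a)"
  interpret K: hopf_algebra k K by fact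
  note fD = module_homD[OF f]
  have cl: "bilinear k A B K (c f)"
    unfolding c_def by (rule bilinear_comp[OF AB.pure_bilinear f])
  have cB: "bilinear k B B K (\<lambda>z1 z2. c f x z1 \<otimes>\<^bsub>K\<^esub> c f y z2)" if "x \<in> carrier A" "y \<in> carrier A" for x y
    by (intro bilinearI module_hom_mult_left module_hom_mult_right K.H_algebra bilinearD[OF cl] that)
  have cA: "bilinear k A A K (\<lambda>x1 x2. c f x1 w \<otimes>\<^bsub>K\<^esub> c f x2 z)" if "w \<in> carrier B" "z \<in> carrier B" for w z
    by (intro bilinearI module_hom_mult_left module_hom_mult_right K.H_algebra bilinearD[OF cl] that)
  have mult: "tensor_lift K (\<lambda>z1 z2. c f x z1 \<otimes>\<^bsub>K\<^esub> c f y z2) (comult B z)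
    = tensor_sum K (\<lambda>z1 z2. c f x z1 \<otimes>\<^bsub>K\<^esub> c f y z2) (sweedler k B z)"
    if "x \<in> carrier A" "y \<in> carrier A" "z \<in> carrier B" for x y z
    by (rule B.lift_comult[OF cB K.H_module]) fact+
  have mult': "tensor_lift K (\<lambda>x1 x2. c f x1 w \<otimes>\<^bsub>K\<^esub> c f x2 z) (comult A x)
    = tensor_sum K (\<lambda>x1 x2. c f x1 w \<otimes>\<^bsub>K\<^esub> c f x2 z) (sweedler k A x)"
    if "x \<in> carrier A" "w \<in> carrier B" "z \<in> carrier B" for x w z
    by (rule A.lift_comult[OF cA K.H_module]) fact+
  have eps: "bilinear k A B (base_algebra k) (\<lambda>a b. counit A a \<otimes>\<^bsub>k\<^esub> counit B b)"
    by (intro bilinearI module_hom_scalar_left module_hom_scalar_right A.k_cring A.counit_linear B.counit_linear) auto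
  have counit: "(\<forall>x\<in>carrier (tensor k A B). counit K (f x) = tensor_lift k (\<lambda>a b. counit A a \<otimes>\<^bsub>k\<^esub> counit B b) x)
    \<longleftrightarrow> (\<forall>a\<in>carrier A. \<forall>b\<in>carrier B. counit K (c f a b) = counit A a \<otimes>\<^bsub>k\<^esub> counit B b)"
  proof (intro iffI ballI)
    fix a b assume "\<forall>x\<in>carrier (tensor k A B). counit K (f x) = tensor_lift k (\<lambda>a b. counit A a \<otimes>\<^bsub>k\<^esub> counit B b) x"
      "a \<in> carrier A" "b \<in> carrier B"
    then show "counit K (c f a b) = counit A a \<otimes>\<^bsub>k\<^esub> counit B b"
      using AB.tensor_lift_pure[OF eps A.k1] by (simp add: c_def)
  next
    fix x assume *: "\<forall>a\<in>carrier A. \<forall>b\<in>carrier B. counit K (c f a b) = counit A a \<otimes>\<^bsub>k\<^esub> counit B b"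
      and x: "x \<in> carrier (tensor k A B)"
    show "counit K (f x) = tensor_lift k (\<lambda>a b. counit A a \<otimes>\<^bsub>k\<^esub> counit B b) x"
      using AB.module_hom_eqI[OF module_hom_comp[OF f K.counit_linear] AB.tensor_lift_linear[OF eps A.k1] A.k1 x]
        * AB.tensor_lift_pure[OF eps A.k1] by (simp add: c_def)
  qed
  have map_bil: "bilinear k (tensor k A B) (tensor k A B) (tensor k K K) (\<lambda>a b. pure_tensor k K K (f a) (f b))"
    by (rule bilinear_comp2[OF K.HH.pure_bilinear f f])
  note tm = K.HH.tensor_module and tm2 = ABAB.tensor_module
  note map_lin = ABAB.tensor_lift_linear[OF map_bil tm, folded tensor_map_def]
  have map_pure: "tensor_map k K K f f (comult (tensor_hopf k A B) (pure_tensor k A B a b))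
    = ?R a b"
    if ab: "a \<in> carrier A" "b \<in> carrier B" for a b
  proof -
    note X = A.sweedlerD[OF ab(1)] and Y = B.sweedlerD[OF ab(2)]
    have inn: "tensor_sum AB2 (\<lambda>b1 b2. p2 a1 a2 b1 b2) (sweedler k B b) \<in> carrier AB2"
      if "a1 \<in> carrier A" "a2 \<in> carrier A" for a1 a2
      by (rule module_tensor_sum_closed[OF tm2]) (use that Y in auto)
    have "tensor_map k K K f f (comult (tensor_hopf k A B) (pure_tensor k A B a b))
      = tensor_sum (tensor k K K) (\<lambda>a1 a2. tensor_map k K K f f (tensor_sum AB2 (\<lambda>b1 b2. p2 a1 a2 b1 b2) (sweedler k B b))) (sweedler k A a)"
      unfolding comult_tensor_hopf_pure[OF ab]
      by (rule module_hom_tensor_sum[OF map_lin tm2 tm]) (use X inn in auto)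
    also have "\<dots> = tensor_sum (tensor k K K) (\<lambda>a1 a2.
      tensor_sum (tensor k K K) (\<lambda>b1 b2. tensor_map k K K f f (p2 a1 a2 b1 b2)) (sweedler k B b)) (sweedler k A a)"
    proof (rule tensor_sum_cong)
      fix a1 a2 assume "(a1, a2) \<in> set (sweedler k A a)"
      then have a12: "a1 \<in> carrier A" "a2 \<in> carrier A" using X by auto
      show "tensor_map k K K f f (tensor_sum AB2 (\<lambda>b1 b2. p2 a1 a2 b1 b2) (sweedler k B b))
        = tensor_sum (tensor k K K) (\<lambda>b1 b2. tensor_map k K K f f (p2 a1 a2 b1 b2)) (sweedler k B b)"
        by (rule module_hom_tensor_sum[OF map_lin tm2 tm]) (use a12 Y in auto)
    qed
    also have "\<dots> = ?R a b"
      by (intro tensor_sum_cong) (use X Y ABAB.tensor_lift_pure[OF map_bil tm] in \<open>auto simp: tensor_map_def c_def\<close>)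
    finally show ?thesis .
  qed
  have comult_lin: "comult (tensor_hopf k A B) \<in> module_hom k (tensor k A B) AB2"
    unfolding tensor_hopf_simps by (rule AB.tensor_lift_linear[OF comult_tensor_hopf_bilinear tm2])
  have comult: "(\<forall>x\<in>carrier (tensor k A B). tensor_map k K K f f (comult (tensor_hopf k A B) x) = comult K (f x))
    \<longleftrightarrow> (\<forall>a\<in>carrier A. \<forall>b\<in>carrier B. comult K (c f a b) = ?R a b)"
    (is "?l \<longleftrightarrow> ?r")
  proof
    assume l: ?l
    show ?r
    proof (intro ballI)
      fix a b assume ab: "a \<in> carrier A" "b \<in> carrier B"
      have "comult K (f (pure_tensor k A B a b)) = tensor_map k K K f f (comult (tensor_hopf k A B) (pure_tensor k A B a b))"
        using l ab by simp
      then show "comult K (c f a b) = ?R a b"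
        unfolding map_pure[OF ab] by (simp add: c_def)
    qed
  next
    assume r: ?r
    show ?l
    proof
      fix x assume x: "x \<in> carrier (tensor k A B)"
      show "tensor_map k K K f f (comult (tensor_hopf k A B) x) = comult K (f x)"
      proof (rule AB.module_hom_eqI[OF module_hom_comp[OF comult_lin map_lin] module_hom_comp[OF f K.comult_linear] tm x])
        fix a b assume ab: "a \<in> carrier A" "b \<in> carrier B"
        show "tensor_map k K K f f (comult (tensor_hopf k A B) (pure_tensor k A B a b)) = comult K (f (pure_tensor k A B a b))"
          unfolding map_pure[OF ab] using r ab by (simp add: c_def)
      qed
    qed
  qed
  have "f \<in> coalg_hom k (tensor_hopf k A B) K \<longleftrightarrow>
    (\<forall>x\<in>carrier (tensor k A B). tensor_map k K K f f (comult (tensor_hopf k A B) x) = comult K (f x)) \<and>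
    (\<forall>x\<in>carrier (tensor k A B). counit K (f x) = tensor_lift k (\<lambda>a b. counit A a \<otimes>\<^bsub>k\<^esub> counit B b) x)"
    using f by (auto simp: coalg_hom_def module_hom_tensor_hopf tensor_hopf_simps(1,4))
  then show ?thesis
    using f unfolding comult counit bilinear_map_def Let_def c_def[symmetric]
    by (simp add: mult mult')
next
  case False
  then show ?thesis by (simp add: bilinear_map_def coalg_hom_def module_hom_tensor_hopf)
qed

end

lemma trilinear_pairing_cong:
  assumes A: "hopf_algebra k A" and B: "hopf_algebra k B" and D: "hopf_algebra k D"
    and eq: "\<And>a b d. a \<in> carrier A \<Longrightarrow> b \<in> carrier B \<Longrightarrow> d \<in> carrier D \<Longrightarrow> \<tau> a b d = \<tau>' a b d"
    and \<tau>: "trilinear_pairing k A B D \<tau>"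
  shows "trilinear_pairing k A B D \<tau>'"
proof -
  interpret A: hopf_algebra k A by fact
  interpret B: hopf_algebra k B by fact
  interpret D: hopf_algebra k D by fact
  note t = trilinear_pairingD[OF \<tau>]
  note tri = trilinearD[OF t(1)]
  have tri': "trilinear k A B D (base_algebra k) \<tau>'"
  proof (rule trilinearI)
    show "(\<lambda>a. \<tau>' a b d) \<in> module_hom k A (base_algebra k)" if "b \<in> carrier B" "d \<in> carrier D" for b d
      by (rule module_hom_congI[OF tri(1)[OF that] A.H_module]) (use that eq in simp)
    show "(\<lambda>b. \<tau>' a b d) \<in> module_hom k B (base_algebra k)" if "a \<in> carrier A" "d \<in> carrier D" for a d
      by (rule module_hom_congI[OF tri(2)[OF that] B.H_module]) (use that eq in simp)
    show "(\<lambda>d. \<tau>' a b d) \<in> module_hom k D (base_algebra k)" if "a \<in> carrier A" "b \<in> carrier B" for a b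
      by (rule module_hom_congI[OF tri(3)[OF that] D.H_module]) (use that eq in simp)
  qed
  have 1: "tensor_sum k (\<lambda>b1 b2. tensor_sum k (\<lambda>d1 d2. \<tau>' a b1 d1 \<otimes>\<^bsub>k\<^esub> \<tau>' a' b2 d2) (sweedler k D d)) (sweedler k B b)
    = tensor_sum k (\<lambda>b1 b2. tensor_sum k (\<lambda>d1 d2. \<tau> a b1 d1 \<otimes>\<^bsub>k\<^esub> \<tau> a' b2 d2) (sweedler k D d)) (sweedler k B b)"
    if "a \<in> carrier A" "a' \<in> carrier A" "b \<in> carrier B" "d \<in> carrier D" for a a' b d
    by (intro tensor_sum_cong) (simp add: eq that D.sweedlerD[OF that(4)] B.sweedlerD[OF that(3)])
  have 2: "tensor_sum k (\<lambda>a1 a2. tensor_sum k (\<lambda>d1 d2. \<tau>' a1 b d1 \<otimes>\<^bsub>k\<^esub> \<tau>' a2 b' d2) (sweedler k D d)) (sweedler k A a)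
    = tensor_sum k (\<lambda>a1 a2. tensor_sum k (\<lambda>d1 d2. \<tau> a1 b d1 \<otimes>\<^bsub>k\<^esub> \<tau> a2 b' d2) (sweedler k D d)) (sweedler k A a)"
    if "a \<in> carrier A" "b \<in> carrier B" "b' \<in> carrier B" "d \<in> carrier D" for a b b' d
    by (intro tensor_sum_cong) (simp add: eq that D.sweedlerD[OF that(4)] A.sweedlerD[OF that(1)])
  have 3: "tensor_sum k (\<lambda>a1 a2. tensor_sum k (\<lambda>b1 b2. \<tau>' a1 b1 d \<otimes>\<^bsub>k\<^esub> \<tau>' a2 b2 d') (sweedler k B b)) (sweedler k A a)
    = tensor_sum k (\<lambda>a1 a2. tensor_sum k (\<lambda>b1 b2. \<tau> a1 b1 d \<otimes>\<^bsub>k\<^esub> \<tau> a2 b2 d') (sweedler k B b)) (sweedler k A a)"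
    if "a \<in> carrier A" "b \<in> carrier B" "d \<in> carrier D" "d' \<in> carrier D" for a b d d'
    by (intro tensor_sum_cong) (simp add: eq that B.sweedlerD[OF that(2)] A.sweedlerD[OF that(1)])
  show ?thesis
    unfolding trilinear_pairing_def using tri' t(2-7) by (simp add: 1 2 3 eq[symmetric])
qed

context two_hopf_algebras
begin

text \<open>Pairing with \<open>t\<close> translates each clause of \<open>bilinear_map_iff\<close>:
  a product in \<open>K\<close> becomes a sum over the components of \<open>t\<close>, and the
  coproduct in \<open>K\<close> becomes a product in \<open>T\<close>.\<close>

lemma bilinear_map_trilinear_pairing:
  assumes K: "hopf_algebra k K" and T: "hopf_algebra k T" and \<omega>: "hopf_pairing k K T \<omega>"
    and f: "f \<in> bilinear_map k A B K"
  shows "trilinear_pairing k A B T (\<lambda>a b t. \<omega> (f (pure_tensor k A B a b)) t)"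
proof -
  interpret K: hopf_algebra k K by fact
  interpret T: hopf_algebra k T by fact
  note w = hopf_pairingD[OF \<omega>]
  define c where "c = (\<lambda>a b. f (pure_tensor k A B a b))"
  note F = f[unfolded bilinear_map_iff[OF K] c_def[symmetric, THEN fun_cong, THEN fun_cong]]
  have fl: "f \<in> module_hom k (tensor k A B) K" using F by blast
  have cl: "bilinear k A B K c"
    unfolding c_def by (rule bilinear_comp[OF AB.pure_bilinear fl])
  note cc = bilinearD(3)[OF cl]
  note wl = bilinearD(1)[OF w(1)]
  have tri: "trilinear k A B T (base_algebra k) (\<lambda>a b t. \<omega> (c a b) t)"
    by (intro trilinearI module_hom_comp[OF bilinearD(1)[OF cl] wl] module_hom_comp[OF bilinearD(2)[OF cl] wl]
        bilinearD(2)[OF w(1)] cc)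
  have ev: "bilinear k K K (base_algebra k) (\<lambda>a b. \<omega> a t \<otimes>\<^bsub>k\<^esub> \<omega> b t')" if "t \<in> carrier T" "t' \<in> carrier T" for t t'
    by (rule K.HH.bilinear_pairing[OF wl wl]) fact+
  have 1: "\<omega> (c (a \<otimes>\<^bsub>A\<^esub> a') b) t
    = tensor_sum k (\<lambda>b1 b2. tensor_sum k (\<lambda>t1 t2. \<omega> (c a b1) t1 \<otimes>\<^bsub>k\<^esub> \<omega> (c a' b2) t2) (sweedler k T t)) (sweedler k B b)"
    if "a \<in> carrier A" "a' \<in> carrier A" "b \<in> carrier B" "t \<in> carrier T" for a a' b t
  proof -
    have "\<omega> (c (a \<otimes>\<^bsub>A\<^esub> a') b) t = \<omega> (tensor_sum K (\<lambda>b1 b2. c a b1 \<otimes>\<^bsub>K\<^esub> c a' b2) (sweedler k B b)) t"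
      using F that by simp
    also have "\<dots> = tensor_sum k (\<lambda>b1 b2. \<omega> (c a b1 \<otimes>\<^bsub>K\<^esub> c a' b2) t) (sweedler k B b)"
      using module_hom_tensor_sum[OF wl[OF that(4)] K.H_module K.k1, of "sweedler k B b" "\<lambda>b1 b2. c a b1 \<otimes>\<^bsub>K\<^esub> c a' b2"]
        B.sweedlerD[OF that(3)] cc that by simp
    also have "\<dots> = tensor_sum k (\<lambda>b1 b2. tensor_sum k (\<lambda>t1 t2. \<omega> (c a b1) t1 \<otimes>\<^bsub>k\<^esub> \<omega> (c a' b2) t2) (sweedler k T t)) (sweedler k B b)"
      by (rule tensor_sum_cong) (use B.sweedlerD[OF that(3)] cc that w(2) in simp)
    finally show ?thesis .
  qed
  have 2: "\<omega> (c a (b \<otimes>\<^bsub>B\<^esub> b')) t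
    = tensor_sum k (\<lambda>a1 a2. tensor_sum k (\<lambda>t1 t2. \<omega> (c a1 b) t1 \<otimes>\<^bsub>k\<^esub> \<omega> (c a2 b') t2) (sweedler k T t)) (sweedler k A a)"
    if "a \<in> carrier A" "b \<in> carrier B" "b' \<in> carrier B" "t \<in> carrier T" for a b b' t
  proof -
    have "\<omega> (c a (b \<otimes>\<^bsub>B\<^esub> b')) t = \<omega> (tensor_sum K (\<lambda>a1 a2. c a1 b \<otimes>\<^bsub>K\<^esub> c a2 b') (sweedler k A a)) t"
      using F that by simp
    also have "\<dots> = tensor_sum k (\<lambda>a1 a2. \<omega> (c a1 b \<otimes>\<^bsub>K\<^esub> c a2 b') t) (sweedler k A a)"
      using module_hom_tensor_sum[OF wl[OF that(4)] K.H_module K.k1, of "sweedler k A a" "\<lambda>a1 a2. c a1 b \<otimes>\<^bsub>K\<^esub> c a2 b'"]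
        A.sweedlerD[OF that(1)] cc that by simp
    also have "\<dots> = tensor_sum k (\<lambda>a1 a2. tensor_sum k (\<lambda>t1 t2. \<omega> (c a1 b) t1 \<otimes>\<^bsub>k\<^esub> \<omega> (c a2 b') t2) (sweedler k T t)) (sweedler k A a)"
      by (rule tensor_sum_cong) (use A.sweedlerD[OF that(1)] cc that w(2) in simp)
    finally show ?thesis .
  qed
  have 3: "\<omega> (c a b) (t \<otimes>\<^bsub>T\<^esub> t')
    = tensor_sum k (\<lambda>a1 a2. tensor_sum k (\<lambda>b1 b2. \<omega> (c a1 b1) t \<otimes>\<^bsub>k\<^esub> \<omega> (c a2 b2) t') (sweedler k B b)) (sweedler k A a)"
    if "a \<in> carrier A" "b \<in> carrier B" "t \<in> carrier T" "t' \<in> carrier T" for a b t t'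
  proof -
    let ?in = "\<lambda>a1 a2. tensor_sum (tensor k K K) (\<lambda>b1 b2. pure_tensor k K K (c a1 b1) (c a2 b2)) (sweedler k B b)"
    let ?out = "tensor_sum (tensor k K K) ?in (sweedler k A a)"
    note E = ev[OF that(3,4)]
    let ?E = "tensor_lift k (\<lambda>a b. \<omega> a t \<otimes>\<^bsub>k\<^esub> \<omega> b t')"
    note lin = K.HH.tensor_lift_linear[OF E K.k1, simplified]
    note X = A.sweedlerD[OF that(1)] and Y = B.sweedlerD[OF that(2)]
    have inn: "?in a1 a2 \<in> carrier (tensor k K K)"
      if "a1 \<in> carrier A" "a2 \<in> carrier A" for a1 a2
      by (rule module_tensor_sum_closed[OF K.HH.tensor_module]) (use that Y cc in auto)
    have "\<omega> (c a b) (t \<otimes>\<^bsub>T\<^esub> t') = ?E (comult K (c a b))"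
      using K.lift_comult[OF E K.k1 cc[OF that(1,2)]] w(3) cc that by simp
    also have "\<dots> = ?E (?out)"
      using F that by simp
    also have "\<dots> = tensor_sum k (\<lambda>a1 a2. ?E (?in a1 a2)) (sweedler k A a)"
      using module_hom_tensor_sum[OF lin K.HH.tensor_module K.k1, of "sweedler k A a"
          ?in] X inn by simp
    also have "\<dots> = tensor_sum k (\<lambda>a1 a2. tensor_sum k (\<lambda>b1 b2. \<omega> (c a1 b1) t \<otimes>\<^bsub>k\<^esub> \<omega> (c a2 b2) t') (sweedler k B b)) (sweedler k A a)"
    proof (rule tensor_sum_cong)
      fix a1 a2 assume "(a1, a2) \<in> set (sweedler k A a)"
      then have a12: "a1 \<in> carrier A" "a2 \<in> carrier A" using X by auto
      have "?E (?in a1 a2)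
        = tensor_sum k (\<lambda>b1 b2. ?E (pure_tensor k K K (c a1 b1) (c a2 b2))) (sweedler k B b)"
        using module_hom_tensor_sum[OF lin K.HH.tensor_module K.k1, of "sweedler k B b" "\<lambda>b1 b2. pure_tensor k K K (c a1 b1) (c a2 b2)"]
          Y cc a12 by simp
      also have "\<dots> = tensor_sum k (\<lambda>b1 b2. \<omega> (c a1 b1) t \<otimes>\<^bsub>k\<^esub> \<omega> (c a2 b2) t') (sweedler k B b)"
        by (rule tensor_sum_cong) (use Y cc a12 K.HH.tensor_lift_pure[OF E K.k1, simplified] in auto)
      finally show "?E (?in a1 a2) = \<dots>" .
    qed
    finally show ?thesis .
  qed
  have 4: "\<omega> (c \<one>\<^bsub>A\<^esub> b) t = counit B b \<otimes>\<^bsub>k\<^esub> counit T t" if "b \<in> carrier B" "t \<in> carrier T" for b t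
    using F that w(4) module_homD(3)[OF wl[OF that(2)], of "counit B b" "\<one>\<^bsub>K\<^esub>"] by simp
  have 5: "\<omega> (c a \<one>\<^bsub>B\<^esub>) t = counit A a \<otimes>\<^bsub>k\<^esub> counit T t" if "a \<in> carrier A" "t \<in> carrier T" for a t
    using F that w(4) module_homD(3)[OF wl[OF that(2)], of "counit A a" "\<one>\<^bsub>K\<^esub>"] by simp
  have 6: "\<omega> (c a b) \<one>\<^bsub>T\<^esub> = counit A a \<otimes>\<^bsub>k\<^esub> counit B b" if "a \<in> carrier A" "b \<in> carrier B" for a b
    using F that w(5) cc by simp
  show ?thesis
    unfolding trilinear_pairing_def c_def[symmetric, THEN fun_cong, THEN fun_cong] using tri by (simp add: 1 2 3 4 5 6)
qed

text \<open>The translation of \<open>bilinear_map_trilinear_pairing\<close> can be reversed when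
  the pairing separates \<open>K\<close>, since then equations in \<open>K\<close> and in its tensor
  square may be checked by evaluation.\<close>

lemma bilinear_mapI_pairing:
  assumes S: "separating_pairing k K T \<omega>" and f: "f \<in> module_hom k (tensor k A B) K"
    and \<tau>: "trilinear_pairing k A B T (\<lambda>a b t. \<omega> (f (pure_tensor k A B a b)) t)"
  shows "f \<in> bilinear_map k A B K"
proof -
  interpret S: separating_pairing k K T \<omega> by fact
  define c where "c = (\<lambda>a b. f (pure_tensor k A B a b))"
  note t = trilinear_pairingD[OF \<tau>, folded c_def[THEN fun_cong, THEN fun_cong]]
  have c_eq: "f (pure_tensor k A B a b) = c a b" for a b by (simp add: c_def)
  note t = trilinear_pairingD[OF \<tau>[unfolded c_eq]]
  have cl: "bilinear k A B K c"
    unfolding c_def by (rule bilinear_comp[OF AB.pure_bilinear f])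
  note cc = bilinearD(3)[OF cl]
  have 1: "comult K (c a b) = tensor_sum (tensor k K K) (\<lambda>a1 a2.
      tensor_sum (tensor k K K) (\<lambda>b1 b2. pure_tensor k K K (c a1 b1) (c a2 b2)) (sweedler k B b)) (sweedler k A a)"
    if ab: "a \<in> carrier A" "b \<in> carrier B" for a b
  proof (rule S.comult_eqI[OF cc[OF ab]])
    let ?in = "\<lambda>a1 a2. tensor_sum (tensor k K K) (\<lambda>b1 b2. pure_tensor k K K (c a1 b1) (c a2 b2)) (sweedler k B b)"
    let ?out = "tensor_sum (tensor k K K) ?in (sweedler k A a)"
    note X = A.sweedlerD[OF ab(1)] and Y = B.sweedlerD[OF ab(2)]
    have inn: "?in a1 a2 \<in> carrier (tensor k K K)"
      if "a1 \<in> carrier A" "a2 \<in> carrier A" for a1 a2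
      by (rule module_tensor_sum_closed[OF S.K.HH.tensor_module]) (use that Y cc in auto)
    show "?out \<in> carrier (tensor k K K)"
      by (rule module_tensor_sum_closed[OF S.K.HH.tensor_module]) (use X inn in auto)
    fix s t assume st: "s \<in> carrier T" "t \<in> carrier T"
    let ?E = "tensor_lift k (\<lambda>a b. \<omega> a s \<otimes>\<^bsub>k\<^esub> \<omega> b t)"
    have "?E (?out)
      = tensor_sum k (\<lambda>a1 a2. ?E (?in a1 a2)) (sweedler k A a)"
      by (rule S.lift_sum[OF st]) (use X inn in auto)
    also have "\<dots> = tensor_sum k (\<lambda>a1 a2. tensor_sum k (\<lambda>b1 b2. \<omega> (c a1 b1) s \<otimes>\<^bsub>k\<^esub> \<omega> (c a2 b2) t) (sweedler k B b)) (sweedler k A a)"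
    proof (rule tensor_sum_cong)
      fix a1 a2 assume "(a1, a2) \<in> set (sweedler k A a)"
      then have a12: "a1 \<in> carrier A" "a2 \<in> carrier A" using X by auto
      have "?E (?in a1 a2)
        = tensor_sum k (\<lambda>b1 b2. ?E (pure_tensor k K K (c a1 b1) (c a2 b2))) (sweedler k B b)"
        by (rule S.lift_sum[OF st]) (use Y cc a12 in auto)
      also have "\<dots> = tensor_sum k (\<lambda>b1 b2. \<omega> (c a1 b1) s \<otimes>\<^bsub>k\<^esub> \<omega> (c a2 b2) t) (sweedler k B b)"
        by (rule tensor_sum_cong) (use Y cc a12 st in \<open>simp add: S.lift_pure\<close>)
      finally show "?E (?in a1 a2) = \<dots>" .
    qed
    also have "\<dots> = \<omega> (c a b) (s \<otimes>\<^bsub>T\<^esub> t)" using t(4)[OF ab st] by simp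
    finally show "?E (?out)
      = \<omega> (c a b) (s \<otimes>\<^bsub>T\<^esub> t)" .
  qed
  have 2: "counit K (c a b) = counit A a \<otimes>\<^bsub>k\<^esub> counit B b" if "a \<in> carrier A" "b \<in> carrier B" for a b
    using t(7)[OF that] S.pairing_simps(4)[OF cc[OF that]] by simp
  have eval: "\<omega> (tensor_sum K F xs) t = tensor_sum k (\<lambda>a b. \<omega> (F a b) t) xs"
    if "t \<in> carrier T" "\<And>a b. (a, b) \<in> set xs \<Longrightarrow> F a b \<in> carrier K" for t F and xs :: "('p \<times> 'q) list"
    using module_hom_tensor_sum[OF S.linear_left[OF that(1)] S.K.H_module S.K.k1, of xs F] that(2) by simp
  have 3: "c (x \<otimes>\<^bsub>A\<^esub> y) z = tensor_sum K (\<lambda>z1 z2. c x z1 \<otimes>\<^bsub>K\<^esub> c y z2) (sweedler k B z)"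
    if xyz: "x \<in> carrier A" "y \<in> carrier A" "z \<in> carrier B" for x y z
  proof (rule S.eqI)
    note Z = B.sweedlerD[OF xyz(3)]
    show "tensor_sum K (\<lambda>z1 z2. c x z1 \<otimes>\<^bsub>K\<^esub> c y z2) (sweedler k B z) \<in> carrier K"
      by (rule module_tensor_sum_closed[OF S.K.H_module]) (use Z cc xyz in auto)
    fix s assume s: "s \<in> carrier T"
    have "\<omega> (tensor_sum K (\<lambda>z1 z2. c x z1 \<otimes>\<^bsub>K\<^esub> c y z2) (sweedler k B z)) s
      = tensor_sum k (\<lambda>z1 z2. \<omega> (c x z1 \<otimes>\<^bsub>K\<^esub> c y z2) s) (sweedler k B z)"
      by (rule eval[OF s]) (use Z cc xyz in auto)
    also have "\<dots> = \<omega> (c (x \<otimes>\<^bsub>A\<^esub> y) z) s"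
      unfolding t(2)[OF xyz s] by (rule tensor_sum_cong) (use Z cc xyz s in \<open>simp add: S.pairing_simps\<close>)
    finally show "\<omega> (c (x \<otimes>\<^bsub>A\<^esub> y) z) s = \<omega> (tensor_sum K (\<lambda>z1 z2. c x z1 \<otimes>\<^bsub>K\<^esub> c y z2) (sweedler k B z)) s" by simp
  qed (use cc xyz in auto)
  have 4: "c x (w \<otimes>\<^bsub>B\<^esub> z) = tensor_sum K (\<lambda>x1 x2. c x1 w \<otimes>\<^bsub>K\<^esub> c x2 z) (sweedler k A x)"
    if xyz: "x \<in> carrier A" "w \<in> carrier B" "z \<in> carrier B" for x w z
  proof (rule S.eqI)
    note Z = A.sweedlerD[OF xyz(1)]
    show "tensor_sum K (\<lambda>x1 x2. c x1 w \<otimes>\<^bsub>K\<^esub> c x2 z) (sweedler k A x) \<in> carrier K"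
      by (rule module_tensor_sum_closed[OF S.K.H_module]) (use Z cc xyz in auto)
    fix s assume s: "s \<in> carrier T"
    have "\<omega> (tensor_sum K (\<lambda>x1 x2. c x1 w \<otimes>\<^bsub>K\<^esub> c x2 z) (sweedler k A x)) s
      = tensor_sum k (\<lambda>x1 x2. \<omega> (c x1 w \<otimes>\<^bsub>K\<^esub> c x2 z) s) (sweedler k A x)"
      by (rule eval[OF s]) (use Z cc xyz in auto)
    also have "\<dots> = \<omega> (c x (w \<otimes>\<^bsub>B\<^esub> z)) s"
      unfolding t(3)[OF xyz s] by (rule tensor_sum_cong) (use Z cc xyz s in \<open>simp add: S.pairing_simps\<close>)
    finally show "\<omega> (c x (w \<otimes>\<^bsub>B\<^esub> z)) s = \<omega> (tensor_sum K (\<lambda>x1 x2. c x1 w \<otimes>\<^bsub>K\<^esub> c x2 z) (sweedler k A x)) s" by simp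
  qed (use cc xyz in auto)
  have 5: "c x \<one>\<^bsub>B\<^esub> = counit A x \<odot>\<^bsub>K\<^esub> \<one>\<^bsub>K\<^esub>" if "x \<in> carrier A" for x
    by (rule S.eqI) (use that cc t(6) module_homD(3)[OF S.linear_left] in \<open>auto simp: S.pairing_simps\<close>)
  have 6: "c \<one>\<^bsub>A\<^esub> z = counit B z \<odot>\<^bsub>K\<^esub> \<one>\<^bsub>K\<^esub>" if "z \<in> carrier B" for z
    by (rule S.eqI) (use that cc t(5) module_homD(3)[OF S.linear_left] in \<open>auto simp: S.pairing_simps\<close>)
  show ?thesis
    unfolding bilinear_map_iff[OF S.K.hopf_algebra_axioms] c_eq using f 1 2 3 4 5 6 by simp
qed

text \<open>If each functional \<open>\<tau> a b\<close> comes from an element of \<open>K\<close>,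
  separation makes this element unique and therefore bilinear in \<open>a\<close> and
  \<open>b\<close>. This is the way back from forms to maps, and the assumption \<open>ex\<close> is
  where the choice of a sufficiently large \<open>K\<close> enters.\<close>

lemma ex_bilinear_map:
  assumes S: "separating_pairing k K T \<omega>" and \<tau>: "trilinear_pairing k A B T \<tau>"
    and ex: "\<And>a b. a \<in> carrier A \<Longrightarrow> b \<in> carrier B \<Longrightarrow> \<exists>x\<in>carrier K. \<forall>t\<in>carrier T. \<omega> x t = \<tau> a b t"
  obtains f where "f \<in> bilinear_map k A B K"
    "\<And>a b t. a \<in> carrier A \<Longrightarrow> b \<in> carrier B \<Longrightarrow> t \<in> carrier T \<Longrightarrow> \<omega> (f (pure_tensor k A B a b)) t = \<tau> a b t"
proof -
  interpret S: separating_pairing k K T \<omega> by fact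
  define \<delta> where "\<delta> a b = (SOME x. x \<in> carrier K \<and> (\<forall>t\<in>carrier T. \<omega> x t = \<tau> a b t))" for a b
  have \<delta>: "\<delta> a b \<in> carrier K \<and> (\<forall>t\<in>carrier T. \<omega> (\<delta> a b) t = \<tau> a b t)" if "a \<in> carrier A" "b \<in> carrier B" for a b
    unfolding \<delta>_def by (rule someI_ex) (use ex[OF that] in blast)
  note tri = trilinearD[OF trilinear_pairingD(1)[OF \<tau>]]
  have bil: "bilinear k A B K \<delta>"
  proof (rule bilinearI)
    fix b assume b: "b \<in> carrier B"
    show "(\<lambda>a. \<delta> a b) \<in> module_hom k A K"
    proof (rule S.linearI[OF _ _ A.H_module])
      show "(\<lambda>a. \<omega> (\<delta> a b) t) \<in> module_hom k A (base_algebra k)" if "t \<in> carrier T" for t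
        by (rule module_hom_congI[OF tri(1)[OF b that] A.H_module]) (use \<delta> b that in simp)
    qed (use \<delta> b in auto)
  next
    fix a assume a: "a \<in> carrier A"
    show "\<delta> a \<in> module_hom k B K"
    proof (rule S.linearI[OF _ _ B.H_module])
      show "(\<lambda>b. \<omega> (\<delta> a b) t) \<in> module_hom k B (base_algebra k)" if "t \<in> carrier T" for t
        by (rule module_hom_congI[OF tri(2)[OF a that] B.H_module]) (use \<delta> a that in simp)
    qed (use \<delta> a in auto)
  qed
  let ?f = "tensor_lift K \<delta>"
  have f: "\<omega> (?f (pure_tensor k A B a b)) t = \<tau> a b t" if "a \<in> carrier A" "b \<in> carrier B" "t \<in> carrier T" for a b t
    using \<delta> that AB.tensor_lift_pure[OF bil S.K.H_module] by simp
  have "trilinear_pairing k A B T (\<lambda>a b t. \<omega> (?f (pure_tensor k A B a b)) t)"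
    by (rule trilinear_pairing_cong[OF A.hopf_algebra_axioms B.hopf_algebra_axioms S.T.hopf_algebra_axioms _ \<tau>])
      (simp add: f)
  then show ?thesis
    by (intro that[OF bilinear_mapI_pairing[OF S AB.tensor_lift_linear[OF bil S.K.H_module]] f])
qed

end

text \<open>For the functoriality of the box: \<open>box_map\<close> is the homomorphism induced by
  such a composite, so it must be bilinear for the description in \<open>box_map\<close> to be
  proper.\<close>

lemma bilinear_map_tensor_map:
  assumes A: "hopf_algebra k A" and A': "hopf_algebra k A'" and B: "hopf_algebra k B" and K: "hopf_algebra k K"
    and f: "f \<in> hopf_hom k A' A" and \<gamma>: "\<gamma> \<in> bilinear_map k A B K"
  shows "(\<lambda>t. \<gamma> (tensor_map k A B f id t)) \<in> bilinear_map k A' B K"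
    and "a \<in> carrier A' \<Longrightarrow> b \<in> carrier B \<Longrightarrow> tensor_map k A B f id (pure_tensor k A' B a b) = pure_tensor k A B (f a) b"
    and "t \<in> carrier (tensor k A' B) \<Longrightarrow> tensor_map k A B f id t \<in> carrier (tensor k A B)"
proof -
  interpret A: hopf_algebra k A by fact
  interpret A': hopf_algebra k A' by fact
  interpret B: hopf_algebra k B by fact
  interpret K: hopf_algebra k K by fact
  interpret AB: two_hopf_algebras k A B ..
  interpret AB': two_hopf_algebras k A' B ..
  note f' = hopf_homD[OF f]
  have bil: "bilinear k A' B (tensor k A B) (\<lambda>a b. pure_tensor k A B (f a) (id b))"
    unfolding id_apply by (rule bilinear_comp2[OF AB.AB.pure_bilinear f'(1) module_hom_id])
  have lin: "tensor_map k A B f id \<in> module_hom k (tensor k A' B) (tensor k A B)"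
    unfolding tensor_map_def by (rule AB'.AB.tensor_lift_linear[OF bil AB.AB.tensor_module])
  show pure: "tensor_map k A B f id (pure_tensor k A' B a b) = pure_tensor k A B (f a) b"
    if "a \<in> carrier A'" "b \<in> carrier B" for a b
    using AB'.AB.tensor_lift_pure[OF bil AB.AB.tensor_module that] by (simp add: tensor_map_def)
  show "t \<in> carrier (tensor k A' B) \<Longrightarrow> tensor_map k A B f id t \<in> carrier (tensor k A B)"
    by (rule module_homD(1)[OF lin])
  define c where "c = (\<lambda>a b. \<gamma> (pure_tensor k A B a b))"
  have c_eq: "\<gamma> (pure_tensor k A B a b) = c a b" for a b by (simp add: c_def)
  note G = \<gamma>[unfolded AB.bilinear_map_iff[OF K] c_eq]
  have gl: "\<gamma> \<in> module_hom k (tensor k A B) K" using G by blast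
  have cl: "bilinear k A B K c"
    unfolding c_def by (rule bilinear_comp[OF AB.AB.pure_bilinear gl])
  note fc = f'(4) and cc = bilinearD(3)[OF cl]
  have 1: "comult K (c (f a) b) = tensor_sum (tensor k K K) (\<lambda>a1 a2.
      tensor_sum (tensor k K K) (\<lambda>b1 b2. pure_tensor k K K (c (f a1) b1) (c (f a2) b2)) (sweedler k B b)) (sweedler k A' a)"
    if ab: "a \<in> carrier A'" "b \<in> carrier B" for a b
  proof -
    \<comment> \<open>The inner sum is bilinear in the two components of its first argument, so the
      components of \<open>f a\<close> may be replaced by the images of those of
      \<open>a\<close>.\<close>
    have "bilinear k A A (tensor k K K) (\<lambda>a1 a2.
      tensor_sum (tensor k K K) (\<lambda>b1 b2. pure_tensor k K K (c a1 b1) (c a2 b2)) (sweedler k B b))"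
      by (intro bilinearI module_hom_sum A.H_module K.HH.tensor_module
          module_hom_comp[OF bilinearD(1)[OF cl] bilinearD(1)[OF K.HH.pure_bilinear]]
          module_hom_comp[OF bilinearD(1)[OF cl] bilinearD(2)[OF K.HH.pure_bilinear]])
        (use B.sweedlerD[OF ab(2)] cc in auto)
    from coalg_hom_sweedler[OF A' A f'(2) this K.HH.tensor_module ab(1)]
    show ?thesis using G fc[OF ab(1)] ab(2) by simp
  qed
  have 2: "c (f x) (w \<otimes>\<^bsub>B\<^esub> z) = tensor_sum K (\<lambda>x1 x2. c (f x1) w \<otimes>\<^bsub>K\<^esub> c (f x2) z) (sweedler k A' x)"
    if "x \<in> carrier A'" "w \<in> carrier B" "z \<in> carrier B" for x w z
  proof -
    have "bilinear k A A K (\<lambda>x1 x2. c x1 w \<otimes>\<^bsub>K\<^esub> c x2 z)"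
      by (intro bilinearI module_hom_mult_left module_hom_mult_right K.H_algebra bilinearD[OF cl] that)
    from coalg_hom_sweedler[OF A' A f'(2) this K.H_module that(1)]
    show ?thesis using G fc[OF that(1)] that by simp
  qed
  have sA: "tensor_sum M (\<lambda>a1 a2. F (\<gamma> (tensor_map k A B f id (pure_tensor k A' B a1 b))) (\<gamma> (tensor_map k A B f id (pure_tensor k A' B a2 b')))) (sweedler k A' a)
      = tensor_sum M (\<lambda>a1 a2. F (c (f a1) b) (c (f a2) b')) (sweedler k A' a)"
    if "a \<in> carrier A'" "b \<in> carrier B" "b' \<in> carrier B" for M :: "('p, 'q) ring_scheme" and F a b b'
    by (rule tensor_sum_cong) (use that A'.sweedlerD[OF that(1)] pure c_eq in simp)
  have sB: "tensor_sum M (\<lambda>b1 b2. F (\<gamma> (tensor_map k A B f id (pure_tensor k A' B a b1))) (\<gamma> (tensor_map k A B f id (pure_tensor k A' B a' b2)))) (sweedler k B b)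
      = tensor_sum M (\<lambda>b1 b2. F (c (f a) b1) (c (f a') b2)) (sweedler k B b)"
    if "a \<in> carrier A'" "a' \<in> carrier A'" "b \<in> carrier B" for M :: "('p, 'q) ring_scheme" and F a a' b
    by (rule tensor_sum_cong) (use that B.sweedlerD[OF that(3)] pure c_eq in simp)
  have sAB: "tensor_sum (tensor k K K) (\<lambda>a1 a2. tensor_sum (tensor k K K) (\<lambda>b1 b2.
      pure_tensor k K K (\<gamma> (tensor_map k A B f id (pure_tensor k A' B a1 b1))) (\<gamma> (tensor_map k A B f id (pure_tensor k A' B a2 b2)))) (sweedler k B b)) (sweedler k A' a)
    = tensor_sum (tensor k K K) (\<lambda>a1 a2.
      tensor_sum (tensor k K K) (\<lambda>b1 b2. pure_tensor k K K (c (f a1) b1) (c (f a2) b2)) (sweedler k B b)) (sweedler k A' a)"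
    if "a \<in> carrier A'" "b \<in> carrier B" for a b
    by (intro tensor_sum_cong sB) (use that A'.sweedlerD[OF that(1)] in auto)
  show "(\<lambda>t. \<gamma> (tensor_map k A B f id t)) \<in> bilinear_map k A' B K"
    unfolding AB'.bilinear_map_iff[OF K]
  proof (intro conjI module_hom_comp[OF lin gl])
  qed (use 1 2 G fc f'(5-7) in \<open>simp_all add: sA sB sAB pure c_eq\<close>)
qed

text \<open>\<open>tensor_lift\<close> looks at all representatives of the class, and each of them
  has its entries in the carriers.\<close>

lemma tensor_lift_cong:
  assumes "two_modules k A B" "t \<in> carrier (tensor k A B)"
    and "\<And>a b. a \<in> carrier A \<Longrightarrow> b \<in> carrier B \<Longrightarrow> F a b = G a b"
  shows "tensor_lift M F t = tensor_lift M G t"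
proof -
  interpret two_modules k A B by fact
  obtain xs where xs: "xs \<in> L" "t = cls xs" using assms(2) by (rule tensor_cases)
  have "tensor_sum M F ys = tensor_sum M G ys" if "ys \<in> cls xs" for ys
  proof (rule tensor_sum_cong)
    have "ys \<in> L" using that rel_lists by (auto simp: tensor_class_def)
    then show "F a b = G a b" if "(a, b) \<in> set ys" for a b
      using listsD[OF _ that] assms(3) by auto
  qed
  then show ?thesis unfolding tensor_lift_def xs(2) by (metis (no_types, lifting) image_cong)
qed

lemma tensor_rel_transfer:
  assumes "carrier A = carrier A'" "add A = add A'" "zero A = zero A'" "smult A = smult A'"
    "carrier B = carrier B'" "add B = add B'" "smult B = smult B'"
    and "tensor_rel k A B xs ys"
  shows "tensor_rel k A' B' xs ys"
  using assms(8) by (induction rule: tensor_rel.induct) (use assms(1-7) in \<open>auto intro: tensor_rel.intros\<close>)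

text \<open>For records of different types with the same underlying algebra: a Hopf algebra of
  functionals versus the dual with restricted carrier, or a transported Hopf algebra versus its
  underlying module. Their tensor squares are literally equal.\<close>

lemma tensor_cong:
  assumes "carrier A = carrier A'" "add A = add A'" "zero A = zero A'" "smult A = smult A'"
    "mult A = mult A'" "one A = one A'"
    "carrier B = carrier B'" "add B = add B'" "smult B = smult B'" "mult B = mult B'" "one B = one B'"
  shows "tensor k A B = tensor k A' B'" "tensor_class k A B = tensor_class k A' B'"
proof -
  have "tensor_rel k A B = tensor_rel k A' B'"
    by (intro ext iffI; rule tensor_rel_transfer, assumption?) (simp_all add: assms)
  then show c: "tensor_class k A B = tensor_class k A' B'" by (simp add: tensor_class_def fun_eq_iff)
  show "tensor k A B = tensor k A' B'"
    using assms by (simp add: tensor_def c pure_tensor_def)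
qed

context hopf_algebra
begin

lemma hsum_mult_left:
  assumes "c \<in> carrier H" "\<And>a b. (a, b) \<in> set xs \<Longrightarrow> F a b \<in> carrier H"
  shows "c \<otimes>\<^bsub>H\<^esub> tensor_sum H F xs = tensor_sum H (\<lambda>a b. c \<otimes>\<^bsub>H\<^esub> F a b) xs"
  using module_hom_tensor_sum[OF module_hom_mult_right[OF H_algebra module_hom_id assms(1)] H_module H_module assms(2)] .

lemmas hsum_closed = module_tensor_sum_closed[OF H_module]
lemmas hsum_swap = module_tensor_sum_swap[OF H_module]

text \<open>Expand \<open>\<Sum> S(x\<^sub>1 y\<^sub>1) x\<^sub>2 y\<^sub>2 S(x\<^sub>3) S(y\<^sub>3)\<close> in two ways.\<close>

lemma antipode_mult:
  assumes x: "x \<in> carrier H" and y: "y \<in> carrier H"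
  shows "antipode H (x \<otimes>\<^bsub>H\<^esub> y) = antipode H x \<otimes>\<^bsub>H\<^esub> antipode H y"
proof -
  define S where "S = antipode H"
  have S [simp]: "S a \<in> carrier H" if "a \<in> carrier H" for a using that by (simp add: S_def)
  have Sl: "S \<in> module_hom k H H" unfolding S_def by (rule antipode_linear)
  \<comment> \<open>\<open>a\<close>, \<open>b\<close>, \<open>c\<close> are the three legs of
    \<open>x\<close>, and \<open>d\<close>, \<open>e\<close>, \<open>f\<close> those of
    \<open>y\<close>.\<close>
  define Q where "Q a b c d e f = S (a \<otimes>\<^bsub>H\<^esub> d) \<otimes>\<^bsub>H\<^esub> ((b \<otimes>\<^bsub>H\<^esub> e) \<otimes>\<^bsub>H\<^esub> (S c \<otimes>\<^bsub>H\<^esub> S f))" for a b c d e f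
  have Q [simp]: "Q a b c d e f \<in> carrier H"
    if "a \<in> carrier H" "b \<in> carrier H" "c \<in> carrier H" "d \<in> carrier H" "e \<in> carrier H" "f \<in> carrier H" for a b c d e f
    using that by (simp add: Q_def)
  note lins = module_hom_mult_left[OF H_algebra] module_hom_mult_right[OF H_algebra] module_hom_comp[OF _ Sl] module_hom_id
  have Q1: "trilinear k H H H H (\<lambda>d e f. Q a b c d e f)" if "a \<in> carrier H" "b \<in> carrier H" "c \<in> carrier H" for a b c
    unfolding Q_def by (intro trilinearI lins) (use that in auto)
  have Q2: "trilinear k H H H H (\<lambda>a b c. Q a b c d e f)" if "d \<in> carrier H" "e \<in> carrier H" "f \<in> carrier H" for d e f
    unfolding Q_def by (intro trilinearI lins) (use that in auto)
  \<comment> \<open>The legs of \<open>y\<close> are summed out first, so that coassociativity for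
    \<open>x\<close> can be applied to a function of three variables. \<open>G'\<close> is the same
    sum with the other bracketing of \<open>y\<close>.\<close>
  define G where "G a b c = tensor_sum H (\<lambda>d v. tensor_sum H (\<lambda>e f. Q a b c d e f) (\<Delta> v)) (\<Delta> y)" for a b c
  note Y = sweedlerD[OF y] and X = sweedlerD[OF x]
  have G: "trilinear k H H H H G"
  proof -
    have "(\<lambda>z. tensor_sum H (\<lambda>d v. tensor_sum H (\<lambda>e f. R z d e f) (\<Delta> v)) (\<Delta> y)) \<in> module_hom k H H"
      if R: "\<And>d e f. d \<in> carrier H \<Longrightarrow> e \<in> carrier H \<Longrightarrow> f \<in> carrier H \<Longrightarrow> (\<lambda>z. R z d e f) \<in> module_hom k H H" for R
    proof (intro module_hom_sum H_module R)
      fix d v e f assume "(d, v) \<in> set (\<Delta> y)" "(e, f) \<in> set (\<Delta> v)"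
      then show "d \<in> carrier H" "e \<in> carrier H" "f \<in> carrier H" using Y sweedlerD[of v e f] by auto
    qed
    then show ?thesis unfolding G_def by (intro trilinearI) (use trilinearD(1-3)[OF Q2] in auto)
  qed
  have G': "G a b c = tensor_sum H (\<lambda>v f. tensor_sum H (\<lambda>d e. Q a b c d e f) (\<Delta> v)) (\<Delta> y)"
    if "a \<in> carrier H" "b \<in> carrier H" "c \<in> carrier H" for a b c
    unfolding G_def by (rule sweedler_coassoc[OF Q1[OF that] H_module y, symmetric])
  \<comment> \<open>Second and third legs cancel: \<open>b S(c)\<close> and \<open>e S(f)\<close>
    each contract to a counit.\<close>
  have in1: "tensor_sum H (\<lambda>b c. tensor_sum H (\<lambda>e f. Q a b c d e f) (\<Delta> v)) (\<Delta> u) = counit H u \<odot>\<^bsub>H\<^esub> (counit H v \<odot>\<^bsub>H\<^esub> S (a \<otimes>\<^bsub>H\<^esub> d))"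
    if "a \<in> carrier H" "d \<in> carrier H" "u \<in> carrier H" "v \<in> carrier H" for a d u v
  proof -
    note U = sweedlerD[OF that(3)] and V = sweedlerD[OF that(4)]
    have "tensor_sum H (\<lambda>b c. tensor_sum H (\<lambda>e f. Q a b c d e f) (\<Delta> v)) (\<Delta> u)
      = tensor_sum H (\<lambda>b c. (S (a \<otimes>\<^bsub>H\<^esub> d) \<otimes>\<^bsub>H\<^esub> (b \<otimes>\<^bsub>H\<^esub> S c)) \<otimes>\<^bsub>H\<^esub> tensor_sum H (\<lambda>e f. e \<otimes>\<^bsub>H\<^esub> S f) (\<Delta> v)) (\<Delta> u)"
    proof (rule tensor_sum_cong)
      fix b c assume "(b, c) \<in> set (\<Delta> u)"
      then have bc: "b \<in> carrier H" "c \<in> carrier H" using U by auto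
      have "tensor_sum H (\<lambda>e f. Q a b c d e f) (\<Delta> v) = tensor_sum H (\<lambda>e f. (S (a \<otimes>\<^bsub>H\<^esub> d) \<otimes>\<^bsub>H\<^esub> (b \<otimes>\<^bsub>H\<^esub> S c)) \<otimes>\<^bsub>H\<^esub> (e \<otimes>\<^bsub>H\<^esub> S f)) (\<Delta> v)"
        by (rule tensor_sum_cong) (use V bc that in \<open>simp add: Q_def m_ac\<close>)
      also have "\<dots> = (S (a \<otimes>\<^bsub>H\<^esub> d) \<otimes>\<^bsub>H\<^esub> (b \<otimes>\<^bsub>H\<^esub> S c)) \<otimes>\<^bsub>H\<^esub> tensor_sum H (\<lambda>e f. e \<otimes>\<^bsub>H\<^esub> S f) (\<Delta> v)"
        by (rule hsum_mult_left[symmetric]) (use V bc that in auto)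
      finally show "tensor_sum H (\<lambda>e f. Q a b c d e f) (\<Delta> v) = \<dots>" .
    qed
    also have "tensor_sum H (\<lambda>e f. e \<otimes>\<^bsub>H\<^esub> S f) (\<Delta> v) = counit H v \<odot>\<^bsub>H\<^esub> \<one>\<^bsub>H\<^esub>"
      unfolding S_def by (rule sweedler_antipode_right[OF module_hom_id H_module that(4)])
    also have "tensor_sum H (\<lambda>b c. (S (a \<otimes>\<^bsub>H\<^esub> d) \<otimes>\<^bsub>H\<^esub> (b \<otimes>\<^bsub>H\<^esub> S c)) \<otimes>\<^bsub>H\<^esub> (counit H v \<odot>\<^bsub>H\<^esub> \<one>\<^bsub>H\<^esub>)) (\<Delta> u)
      = counit H u \<odot>\<^bsub>H\<^esub> (S (a \<otimes>\<^bsub>H\<^esub> d) \<otimes>\<^bsub>H\<^esub> \<one>\<^bsub>H\<^esub> \<otimes>\<^bsub>H\<^esub> (counit H v \<odot>\<^bsub>H\<^esub> \<one>\<^bsub>H\<^esub>))"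
      unfolding S_def
      by (rule sweedler_antipode_right[OF _ H_module that(3), where g = "\<lambda>w. antipode H (a \<otimes>\<^bsub>H\<^esub> d) \<otimes>\<^bsub>H\<^esub> w \<otimes>\<^bsub>H\<^esub> (counit H v \<odot>\<^bsub>H\<^esub> \<one>\<^bsub>H\<^esub>)"])
        (intro lins, use that in auto)
    also have "S (a \<otimes>\<^bsub>H\<^esub> d) \<otimes>\<^bsub>H\<^esub> \<one>\<^bsub>H\<^esub> \<otimes>\<^bsub>H\<^esub> (counit H v \<odot>\<^bsub>H\<^esub> \<one>\<^bsub>H\<^esub>) = counit H v \<odot>\<^bsub>H\<^esub> S (a \<otimes>\<^bsub>H\<^esub> d)"
      using that smult_assoc2[of "counit H v" "\<one>\<^bsub>H\<^esub>" "S (a \<otimes>\<^bsub>H\<^esub> d)"] by (simp add: m_comm)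
    finally show ?thesis .
  qed
  \<comment> \<open>First and second legs cancel: multiplicativity of the coproduct recognises
    \<open>S(ad) be\<close> as the antipode law for the product \<open>uv\<close>.\<close>
  have in2: "tensor_sum H (\<lambda>a b. tensor_sum H (\<lambda>d e. Q a b c d e f) (\<Delta> v)) (\<Delta> u) = counit H u \<odot>\<^bsub>H\<^esub> (counit H v \<odot>\<^bsub>H\<^esub> (S c \<otimes>\<^bsub>H\<^esub> S f))"
    if "c \<in> carrier H" "f \<in> carrier H" "u \<in> carrier H" "v \<in> carrier H" for c f u v
  proof -
    note U = sweedlerD[OF that(3)] and V = sweedlerD[OF that(4)]
    have bil: "bilinear k H H H (\<lambda>p q. S p \<otimes>\<^bsub>H\<^esub> q \<otimes>\<^bsub>H\<^esub> (S c \<otimes>\<^bsub>H\<^esub> S f))"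
      by (intro bilinearI lins Sl) (use that in auto)
    have "tensor_sum H (\<lambda>a b. tensor_sum H (\<lambda>d e. Q a b c d e f) (\<Delta> v)) (\<Delta> u)
      = tensor_sum H (\<lambda>a b. tensor_sum H (\<lambda>d e. S (a \<otimes>\<^bsub>H\<^esub> d) \<otimes>\<^bsub>H\<^esub> (b \<otimes>\<^bsub>H\<^esub> e) \<otimes>\<^bsub>H\<^esub> (S c \<otimes>\<^bsub>H\<^esub> S f)) (\<Delta> v)) (\<Delta> u)"
      by (intro tensor_sum_cong) (use U V that in \<open>simp add: Q_def m_assoc\<close>)
    also have "\<dots> = tensor_sum H (\<lambda>p q. S p \<otimes>\<^bsub>H\<^esub> q \<otimes>\<^bsub>H\<^esub> (S c \<otimes>\<^bsub>H\<^esub> S f)) (\<Delta> (u \<otimes>\<^bsub>H\<^esub> v))"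
      by (rule sweedler_mult[OF bil H_module that(3,4), symmetric])
    also have "\<dots> = counit H (u \<otimes>\<^bsub>H\<^esub> v) \<odot>\<^bsub>H\<^esub> (\<one>\<^bsub>H\<^esub> \<otimes>\<^bsub>H\<^esub> (S c \<otimes>\<^bsub>H\<^esub> S f))"
      unfolding S_def
      by (rule sweedler_antipode_left[OF _ H_module, where g = "\<lambda>w. w \<otimes>\<^bsub>H\<^esub> (antipode H c \<otimes>\<^bsub>H\<^esub> antipode H f)"])
        (intro lins, use that in auto)
    finally show ?thesis using that by (simp add: counit_mult smult_assoc1)
  qed
  \<comment> \<open>Counits are inserted in one bracketing, where \<open>in1\<close> yields the
    antipode of the product, and removed in the other, where \<open>in2\<close> yields the product
    of the antipodes.\<close>
  have "S (x \<otimes>\<^bsub>H\<^esub> y) = tensor_sum H (\<lambda>a u. counit H u \<odot>\<^bsub>H\<^esub> S (a \<otimes>\<^bsub>H\<^esub> y)) (\<Delta> x)"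
    by (rule sweedler_counit_right[OF _ H_module x, where g = "\<lambda>a. S (a \<otimes>\<^bsub>H\<^esub> y)", symmetric]) (intro lins y)
  also have "\<dots> = tensor_sum H (\<lambda>a u. tensor_sum H (\<lambda>b c. G a b c) (\<Delta> u)) (\<Delta> x)"
  proof (rule tensor_sum_cong)
    fix a u assume "(a, u) \<in> set (\<Delta> x)"
    then have au: "a \<in> carrier H" "u \<in> carrier H" using X by auto
    note U = sweedlerD[OF au(2)]
    have "tensor_sum H (\<lambda>b c. G a b c) (\<Delta> u)
      = tensor_sum H (\<lambda>d v. tensor_sum H (\<lambda>b c. tensor_sum H (\<lambda>e f. Q a b c d e f) (\<Delta> v)) (\<Delta> u)) (\<Delta> y)"
      unfolding G_def
    proof (intro hsum_swap hsum_closed Q au)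
      fix b c d v e f assume "(b, c) \<in> set (\<Delta> u)" "(d, v) \<in> set (\<Delta> y)" "(e, f) \<in> set (\<Delta> v)"
      then show "b \<in> carrier H" "c \<in> carrier H" "d \<in> carrier H" "e \<in> carrier H" "f \<in> carrier H"
        using U Y sweedlerD[of v e f] by auto
    qed
    also have "\<dots> = tensor_sum H (\<lambda>d v. counit H v \<odot>\<^bsub>H\<^esub> (counit H u \<odot>\<^bsub>H\<^esub> S (a \<otimes>\<^bsub>H\<^esub> d))) (\<Delta> y)"
      by (rule tensor_sum_cong) (use au Y in \<open>simp add: in1 smult_assoc1[symmetric] R.m_comm\<close>)
    also have "\<dots> = counit H u \<odot>\<^bsub>H\<^esub> S (a \<otimes>\<^bsub>H\<^esub> y)"
      by (rule sweedler_counit_right[OF _ H_module y, where g = "\<lambda>d. counit H u \<odot>\<^bsub>H\<^esub> S (a \<otimes>\<^bsub>H\<^esub> d)"])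
        (intro lins module_hom_smult H_module, use au in auto)
    finally show "counit H u \<odot>\<^bsub>H\<^esub> S (a \<otimes>\<^bsub>H\<^esub> y) = tensor_sum H (\<lambda>b c. G a b c) (\<Delta> u)" by simp
  qed
  also have "\<dots> = tensor_sum H (\<lambda>w c. tensor_sum H (\<lambda>a b. G a b c) (\<Delta> w)) (\<Delta> x)"
    by (rule sweedler_coassoc[OF G H_module x, symmetric])
  also have "\<dots> = tensor_sum H (\<lambda>w c. counit H w \<odot>\<^bsub>H\<^esub> (S c \<otimes>\<^bsub>H\<^esub> S y)) (\<Delta> x)"
  proof (rule tensor_sum_cong)
    fix w c assume "(w, c) \<in> set (\<Delta> x)"
    then have wc: "w \<in> carrier H" "c \<in> carrier H" using X by auto
    note W = sweedlerD[OF wc(1)]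
    have "tensor_sum H (\<lambda>a b. G a b c) (\<Delta> w)
      = tensor_sum H (\<lambda>a b. tensor_sum H (\<lambda>v f. tensor_sum H (\<lambda>d e. Q a b c d e f) (\<Delta> v)) (\<Delta> y)) (\<Delta> w)"
      by (rule tensor_sum_cong) (use W wc in \<open>simp add: G'\<close>)
    also have "\<dots> = tensor_sum H (\<lambda>v f. tensor_sum H (\<lambda>a b. tensor_sum H (\<lambda>d e. Q a b c d e f) (\<Delta> v)) (\<Delta> w)) (\<Delta> y)"
    proof (intro hsum_swap hsum_closed Q wc)
      fix a b v f d e assume "(a, b) \<in> set (\<Delta> w)" "(v, f) \<in> set (\<Delta> y)" "(d, e) \<in> set (\<Delta> v)"
      then show "a \<in> carrier H" "b \<in> carrier H" "d \<in> carrier H" "e \<in> carrier H" "f \<in> carrier H"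
        using W Y sweedlerD[of v d e] by auto
    qed
    also have "\<dots> = tensor_sum H (\<lambda>v f. counit H v \<odot>\<^bsub>H\<^esub> (counit H w \<odot>\<^bsub>H\<^esub> (S c \<otimes>\<^bsub>H\<^esub> S f))) (\<Delta> y)"
      by (rule tensor_sum_cong) (use wc Y in \<open>simp add: in2 smult_assoc1[symmetric] R.m_comm\<close>)
    also have "\<dots> = counit H w \<odot>\<^bsub>H\<^esub> (S c \<otimes>\<^bsub>H\<^esub> S y)"
      by (rule sweedler_counit_left[OF _ H_module y, where g = "\<lambda>f. counit H w \<odot>\<^bsub>H\<^esub> (S c \<otimes>\<^bsub>H\<^esub> S f)"])
        (intro lins Sl module_hom_smult H_module, use wc in auto)
    finally show "tensor_sum H (\<lambda>a b. G a b c) (\<Delta> w) = counit H w \<odot>\<^bsub>H\<^esub> (S c \<otimes>\<^bsub>H\<^esub> S y)" .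
  qed
  also have "\<dots> = S x \<otimes>\<^bsub>H\<^esub> S y"
    by (rule sweedler_counit_left[OF _ H_module x, where g = "\<lambda>c. S c \<otimes>\<^bsub>H\<^esub> S y"]) (intro lins Sl, use y in auto)
  finally show ?thesis by (simp add: S_def)
qed

section \<open>The dual algebra and its Hopf subalgebras\<close>

lemma dual_algebra_simps:
  "carrier (dual_algebra k H) = module_hom k H (base_algebra k) \<inter> extensional (carrier H)"
  "mult (dual_algebra k H) = (\<lambda>f g. \<lambda>x\<in>carrier H. tensor_lift k (\<lambda>a b. f a \<otimes>\<^bsub>k\<^esub> g b) (comult H x))"
  "one (dual_algebra k H) = restrict (counit H) (carrier H)"
  "zero (dual_algebra k H) = (\<lambda>x\<in>carrier H. \<zero>\<^bsub>k\<^esub>)"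
  "add (dual_algebra k H) = (\<lambda>f g. \<lambda>x\<in>carrier H. f x \<oplus>\<^bsub>k\<^esub> g x)"
  "smult (dual_algebra k H) = (\<lambda>c f. \<lambda>x\<in>carrier H. c \<otimes>\<^bsub>k\<^esub> f x)"
  by (simp_all add: dual_algebra_def)

abbreviation Dual where "Dual \<equiv> dual_algebra k H"

lemma dual_linear: "f \<in> carrier Dual \<Longrightarrow> f \<in> module_hom k H (base_algebra k)"
  by (simp add: dual_algebra_simps)

lemma dual_apply_closed [simp]: "f \<in> carrier Dual \<Longrightarrow> x \<in> carrier H \<Longrightarrow> f x \<in> carrier k"
  using module_homD(1)[OF dual_linear] by simp

lemma dual_bilinear: "f \<in> carrier Dual \<Longrightarrow> g \<in> carrier Dual \<Longrightarrow> bilinear k H H (base_algebra k) (\<lambda>a b. f a \<otimes>\<^bsub>k\<^esub> g b)"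
  by (intro bilinearI module_hom_scalar_left module_hom_scalar_right k_cring dual_linear) auto

lemma dual_eqI:
  "f \<in> carrier Dual \<Longrightarrow> g \<in> carrier Dual \<Longrightarrow> (\<And>x. x \<in> carrier H \<Longrightarrow> f x = g x) \<Longrightarrow> f = g"
  by (rule extensionalityI[of _ "carrier H"]) (auto simp: dual_algebra_simps)

lemma dualI: "f \<in> module_hom k H (base_algebra k) \<Longrightarrow> restrict f (carrier H) \<in> carrier Dual"
  using module_hom_congI[OF _ H_module, of f "base_algebra k" "restrict f (carrier H)"]
  by (simp add: dual_algebra_simps)

lemma dual_mult_apply:
  "f \<in> carrier Dual \<Longrightarrow> g \<in> carrier Dual \<Longrightarrow> x \<in> carrier H \<Longrightarrow>
    (f \<otimes>\<^bsub>Dual\<^esub> g) x = tensor_sum k (\<lambda>a b. f a \<otimes>\<^bsub>k\<^esub> g b) (\<Delta> x)"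
  using lift_comult[OF dual_bilinear k1] by (simp add: dual_algebra_simps)

lemma dual_mult_closed:
  assumes fg: "f \<in> carrier Dual" "g \<in> carrier Dual"
  shows "f \<otimes>\<^bsub>Dual\<^esub> g \<in> carrier Dual"
proof -
  have "(\<lambda>x. tensor_lift (base_algebra k) (\<lambda>a b. f a \<otimes>\<^bsub>k\<^esub> g b) (comult H x)) \<in> module_hom k H (base_algebra k)"
    by (rule module_hom_comp[OF comult_linear HH.tensor_lift_linear[OF dual_bilinear[OF fg] k1]])
  from dualI[OF this] show ?thesis by (simp add: dual_algebra_def)
qed

lemma dual_one_closed: "\<one>\<^bsub>Dual\<^esub> \<in> carrier Dual"
  unfolding dual_algebra_simps(3) by (rule dualI[OF counit_linear])

lemma dual_zero_closed: "\<zero>\<^bsub>Dual\<^esub> \<in> carrier Dual"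
  unfolding dual_algebra_simps(4) by (rule dualI) (simp add: module_hom_iff)

lemma dual_add_closed: "f \<in> carrier Dual \<Longrightarrow> g \<in> carrier Dual \<Longrightarrow> f \<oplus>\<^bsub>Dual\<^esub> g \<in> carrier Dual"
  unfolding dual_algebra_simps(5)
  by (rule dualI) (auto intro!: module_homI simp: module_homD(2,3)[OF dual_linear] R.r_distr R.a_ac)

lemma dual_smult_closed: "c \<in> carrier k \<Longrightarrow> f \<in> carrier Dual \<Longrightarrow> c \<odot>\<^bsub>Dual\<^esub> f \<in> carrier Dual"
  unfolding dual_algebra_simps(6) by (rule dualI) (intro module_hom_scalar_right k_cring dual_linear)

lemma dual_antipode_closed: "f \<in> carrier Dual \<Longrightarrow> dual_antipode H f \<in> carrier Dual"
  unfolding dual_antipode_def by (rule dualI) (intro module_hom_comp[OF antipode_linear] dual_linear)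

lemma dual_apply:
  "x \<in> carrier H \<Longrightarrow> (f \<oplus>\<^bsub>Dual\<^esub> g) x = f x \<oplus>\<^bsub>k\<^esub> g x"
  "x \<in> carrier H \<Longrightarrow> (c \<odot>\<^bsub>Dual\<^esub> f) x = c \<otimes>\<^bsub>k\<^esub> f x"
  "x \<in> carrier H \<Longrightarrow> \<one>\<^bsub>Dual\<^esub> x = counit H x"
  "x \<in> carrier H \<Longrightarrow> \<zero>\<^bsub>Dual\<^esub> x = \<zero>\<^bsub>k\<^esub>"
  "x \<in> carrier H \<Longrightarrow> dual_antipode H f x = f (antipode H x)"
  by (simp_all add: dual_algebra_simps dual_antipode_def)

text \<open>A unital subalgebra of the dual in elementary terms; negatives come from the scalar
  \<open>-1\<close>. Antipode and coproduct are treated separately, since the algebra laws are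
  available before them.\<close>

definition dual_subspace where
  "dual_subspace S \<longleftrightarrow> S \<subseteq> carrier Dual \<and> \<one>\<^bsub>Dual\<^esub> \<in> S \<and> \<zero>\<^bsub>Dual\<^esub> \<in> S \<and>
    (\<forall>f\<in>S. \<forall>g\<in>S. f \<oplus>\<^bsub>Dual\<^esub> g \<in> S \<and> f \<otimes>\<^bsub>Dual\<^esub> g \<in> S) \<and> (\<forall>c\<in>carrier k. \<forall>f\<in>S. c \<odot>\<^bsub>Dual\<^esub> f \<in> S)"

text \<open>Stated for any record with these operations, because it is applied to the full dual, to
  the dual with restricted carrier and to \<open>dual_hopf\<close>.\<close>

lemma dual_subspace_separated:
  fixes M :: "('k, 'a \<Rightarrow> 'k, 'z) module_scheme"
  assumes S: "dual_subspace S" and M: "carrier M = S" "add M = add Dual" "mult M = mult Dual"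
    "one M = one Dual" "zero M = zero Dual" "smult M = smult Dual"
  shows "separated_algebra k H M (\<lambda>f. f)"
proof -
  have sub: "S \<subseteq> carrier Dual" using S by (simp add: dual_subspace_def)
  show ?thesis
  proof (unfold_locales, unfold M)
    show "f = g" if "f \<in> S" "g \<in> S" "\<And>x. x \<in> carrier H \<Longrightarrow> f x = g x" for f g
      using dual_eqI that sub by blast
  qed (use S sub in \<open>auto simp: dual_subspace_def dual_apply dual_mult_apply subset_iff dual_linear\<close>)
qed

lemma Dual_algebra: "algebra k Dual"
proof -
  have "dual_subspace (carrier Dual)"
    by (simp add: dual_subspace_def dual_one_closed dual_zero_closed dual_add_closed dual_mult_closed dual_smult_closed)
  then show ?thesis
    using separated_algebra.is_algebra[OF dual_subspace_separated] by blast
qed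

text \<open>Both functionals are linear on the tensor square of \<open>H\<close>, so they agree as
  soon as they agree on pure tensors. The work lies in showing that the embedded \<open>t\<close> is
  linear in its argument.\<close>

lemma dual_comult_eq_embed_iff:
  assumes S: "dual_subspace S" and f: "f \<in> carrier Dual" and t: "t \<in> carrier (dual_tensor_square k H S)"
  shows "dual_comult k H f = dual_tensor_embed k H t \<longleftrightarrow>
    (\<forall>x\<in>carrier H. \<forall>y\<in>carrier H. f (x \<otimes>\<^bsub>H\<^esub> y) = tensor_lift k (\<lambda>g h. g x \<otimes>\<^bsub>k\<^esub> h y) t)"
proof -
  let ?D = "Dual\<lparr>carrier := S\<rparr>"
  interpret D: separated_algebra k H ?D "\<lambda>f. f" by (rule dual_subspace_separated[OF S]) simp_all
  interpret DD: two_vector_spaces k ?D ?D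
    by (intro two_vector_spaces.intro two_modules.intro D.K_module) unfold_locales
  have sub: "g \<in> S \<Longrightarrow> g \<in> carrier Dual" for g using S by (auto simp: dual_subspace_def)
  have mb: "bilinear k H H H (mult H)"
    by (intro bilinearI module_hom_mult_left module_hom_mult_right H_algebra module_hom_id)
  have lin1: "(\<lambda>u. f (tensor_lift H (mult H) u)) \<in> module_hom k (tensor k H H) (base_algebra k)"
    by (rule module_hom_comp[OF HH.tensor_lift_linear[OF mb H_module] dual_linear[OF f]])
  \<comment> \<open>The value of \<open>g \<otimes> h\<close> at \<open>u\<close>. It has to be
    bilinear in \<open>g\<close> and \<open>h\<close> for the lift over \<open>t\<close>, and linear
    in \<open>u\<close> for the comparison on pure tensors.\<close>
  define G where "G u g h = tensor_lift k (\<lambda>x y. g x \<otimes>\<^bsub>k\<^esub> h y) u"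
    for u :: "('a \<times> 'a) list set" and g h
  have lk: "g \<in> S \<Longrightarrow> g \<in> module_hom k H (base_algebra k)" for g by (intro dual_linear sub)
  have Gu: "bilinear k ?D ?D (base_algebra k) (G u)" if u: "u \<in> carrier (tensor k H H)" for u
  proof (rule bilinearI)
    fix h assume h: "h \<in> carrier ?D"
    show "(\<lambda>g. G u g h) \<in> module_hom k ?D (base_algebra k)"
      unfolding G_def
      using HH.tensor_lift_linear_param[OF k1 D.K_module u, of "\<lambda>g x y. g x \<otimes>\<^bsub>k\<^esub> h y"] h sub
        module_hom_scalar_left[OF k_cring separatingD(1)[OF D.separating]] dual_bilinear by simp
  next
    fix g assume g: "g \<in> carrier ?D"
    show "G u g \<in> module_hom k ?D (base_algebra k)"
      unfolding G_def
      using HH.tensor_lift_linear_param[OF k1 D.K_module u, of "\<lambda>h x y. g x \<otimes>\<^bsub>k\<^esub> h y"] g sub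
        module_hom_scalar_right[OF k_cring separatingD(1)[OF D.separating]] dual_bilinear by simp
  qed
  have lin2: "(\<lambda>u. tensor_lift k (G u) t) \<in> module_hom k (tensor k H H) (base_algebra k)"
    using DD.tensor_lift_linear_param[OF k1 HH.tensor_module t, of G] Gu
      HH.tensor_lift_linear[OF dual_bilinear k1] sub by (simp add: G_def)
  have pure: "f (tensor_lift H (mult H) (pure_tensor k H H x y)) = f (x \<otimes>\<^bsub>H\<^esub> y)"
    "tensor_lift k (G (pure_tensor k H H x y)) t = tensor_lift k (\<lambda>g h. g x \<otimes>\<^bsub>k\<^esub> h y) t"
    if xy: "x \<in> carrier H" "y \<in> carrier H" for x y
  proof -
    show "f (tensor_lift H (mult H) (pure_tensor k H H x y)) = f (x \<otimes>\<^bsub>H\<^esub> y)"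
      using HH.tensor_lift_pure[OF mb H_module xy] by simp
    show "tensor_lift k (G (pure_tensor k H H x y)) t = tensor_lift k (\<lambda>g h. g x \<otimes>\<^bsub>k\<^esub> h y) t"
      by (rule tensor_lift_cong[OF DD.two_modules_axioms t])
        (use HH.tensor_lift_pure[OF dual_bilinear k1 xy] sub in \<open>simp add: G_def\<close>)
  qed
  have "dual_comult k H f = dual_tensor_embed k H t \<longleftrightarrow>
    (\<forall>u\<in>carrier (tensor k H H). f (tensor_lift H (mult H) u) = tensor_lift k (G u) t)"
    unfolding dual_comult_def dual_tensor_embed_def G_def by (auto simp: fun_eq_iff restrict_def)
  also have "\<dots> \<longleftrightarrow> (\<forall>x\<in>carrier H. \<forall>y\<in>carrier H. f (x \<otimes>\<^bsub>H\<^esub> y) = tensor_lift k (\<lambda>g h. g x \<otimes>\<^bsub>k\<^esub> h y) t)"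
  proof (intro iffI ballI)
    fix x y assume "\<forall>u\<in>carrier (tensor k H H). f (tensor_lift H (mult H) u) = tensor_lift k (G u) t"
      and "x \<in> carrier H" "y \<in> carrier H"
    then show "f (x \<otimes>\<^bsub>H\<^esub> y) = tensor_lift k (\<lambda>g h. g x \<otimes>\<^bsub>k\<^esub> h y) t"
      using pure by (metis HH.pure_closed)
  next
    fix u assume "\<forall>x\<in>carrier H. \<forall>y\<in>carrier H. f (x \<otimes>\<^bsub>H\<^esub> y) = tensor_lift k (\<lambda>g h. g x \<otimes>\<^bsub>k\<^esub> h y) t"
      and u: "u \<in> carrier (tensor k H H)"
    then show "f (tensor_lift H (mult H) u) = tensor_lift k (G u) t"
      by (intro HH.module_hom_eqI[OF lin1 lin2 k1 u]) (simp add: pure)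
  qed
  finally show ?thesis .
qed

text \<open>\<open>ts\<close> lists the components of the coproduct of \<open>f\<close>. Unlike the
  tensor square of \<open>S\<close>, whose relations depend on \<open>S\<close>, this condition does
  not mention the ambient set of functionals.\<close>

definition represents where
  "represents ts f \<longleftrightarrow> (\<forall>x\<in>carrier H. \<forall>y\<in>carrier H.
     f (x \<otimes>\<^bsub>H\<^esub> y) = tensor_sum k (\<lambda>g h. g x \<otimes>\<^bsub>k\<^esub> h y) ts)"

lemma lift_dual_class:
  assumes S: "dual_subspace S" and ts: "ts \<in> lists (S \<times> S)" and xy: "x \<in> carrier H" "y \<in> carrier H"
  shows "tensor_lift k (\<lambda>g h. g x \<otimes>\<^bsub>k\<^esub> h y) (tensor_class k (Dual\<lparr>carrier := S\<rparr>) (Dual\<lparr>carrier := S\<rparr>) ts)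
    = tensor_sum k (\<lambda>g h. g x \<otimes>\<^bsub>k\<^esub> h y) ts"
proof -
  let ?D = "Dual\<lparr>carrier := S\<rparr>"
  interpret D: separated_algebra k H ?D "\<lambda>f. f" by (rule dual_subspace_separated[OF S]) simp_all
  interpret DD: two_vector_spaces k ?D ?D
    by (intro two_vector_spaces.intro two_modules.intro D.K_module) unfold_locales
  show ?thesis
    using DD.tensor_lift_cls[OF DD.bilinear_pairing[where \<omega> = "\<lambda>f. f" and \<omega>' = "\<lambda>f. f", OF separatingD(1)[OF D.separating xy(1)] separatingD(1)[OF D.separating xy(2)]] k1]
      ts by simp
qed

text \<open>With lists instead of tensor classes, the coproduct condition passes from one set of
  functionals to a larger one merely by monotonicity of \<open>lists\<close>. All constructions of
  Hopf subalgebras below use this form.\<close>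

lemma hopf_subalgebra_of_dual_iff:
  "hopf_subalgebra_of_dual k H S \<longleftrightarrow> dual_subspace S \<and> (\<forall>f\<in>S. dual_antipode H f \<in> S) \<and>
     (\<forall>f\<in>S. \<exists>ts\<in>lists (S \<times> S). represents ts f)"
proof -
  interpret Dual: algebra k Dual by (rule Dual_algebra)
  have sub: "subring S Dual \<and> (\<forall>c\<in>carrier k. \<forall>f\<in>S. c \<odot>\<^bsub>Dual\<^esub> f \<in> S) \<longleftrightarrow> dual_subspace S"
  proof
    assume "subring S Dual \<and> (\<forall>c\<in>carrier k. \<forall>f\<in>S. c \<odot>\<^bsub>Dual\<^esub> f \<in> S)"
    then show "dual_subspace S" using subringE[of S Dual] by (simp add: dual_subspace_def)
  next
    assume S: "dual_subspace S"
    have m: "\<ominus>\<^bsub>Dual\<^esub> h = (\<ominus>\<^bsub>k\<^esub> \<one>\<^bsub>k\<^esub>) \<odot>\<^bsub>Dual\<^esub> h" if "h \<in> carrier Dual" for h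
      using that by (simp add: Dual.smult_l_minus)
    have "subring S Dual"
      by (rule ring.subringI[OF Dual.ring_axioms]) (use S m in \<open>auto simp: dual_subspace_def subset_iff\<close>)
    then show "subring S Dual \<and> (\<forall>c\<in>carrier k. \<forall>f\<in>S. c \<odot>\<^bsub>Dual\<^esub> f \<in> S)"
      using S by (simp add: dual_subspace_def)
  qed
  have "(\<exists>t\<in>carrier (dual_tensor_square k H S). dual_comult k H f = dual_tensor_embed k H t)
    \<longleftrightarrow> (\<exists>ts\<in>lists (S \<times> S). represents ts f)" if S: "dual_subspace S" and f: "f \<in> S" for f
  proof -
    have c: "carrier (dual_tensor_square k H S) = tensor_class k (Dual\<lparr>carrier := S\<rparr>) (Dual\<lparr>carrier := S\<rparr>) ` lists (S \<times> S)"
      by (simp add: tensor_def)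
    have "f \<in> carrier Dual" using S f by (auto simp: dual_subspace_def)
    then have "dual_comult k H f = dual_tensor_embed k H (tensor_class k (Dual\<lparr>carrier := S\<rparr>) (Dual\<lparr>carrier := S\<rparr>) ts)
      \<longleftrightarrow> represents ts f" if "ts \<in> lists (S \<times> S)" for ts
      using dual_comult_eq_embed_iff[OF S, of f] lift_dual_class[OF S that] that c by (simp add: represents_def)
    then show ?thesis unfolding c by (simp only: bex_simps image_iff) blast
  qed
  then show ?thesis unfolding hopf_subalgebra_of_dual_def using sub by blast
qed

lemma dual_hopf_simps:
  "carrier (dual_hopf k H S) = S" "add (dual_hopf k H S) = add Dual" "mult (dual_hopf k H S) = mult Dual"
  "one (dual_hopf k H S) = one Dual" "zero (dual_hopf k H S) = zero Dual" "smult (dual_hopf k H S) = smult Dual"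
  "counit (dual_hopf k H S) = (\<lambda>f. f \<one>\<^bsub>H\<^esub>)" "antipode (dual_hopf k H S) = dual_antipode H"
  "comult (dual_hopf k H S) f = (THE t. t \<in> carrier (dual_tensor_square k H S) \<and>
     dual_comult k H f = dual_tensor_embed k H t)"
  by (simp_all add: dual_hopf_def module.extend_def hopf.fields_def)

text \<open>The functionals on \<open>H\<close> separate themselves by evaluation, so the only point
  is that the definite description of the coproduct is proper.\<close>

lemma dual_hopf_separated:
  assumes "hopf_subalgebra_of_dual k H S"
  shows "separated_hopf k H (dual_hopf k H S) (\<lambda>f. f)"
proof -
  let ?W = "dual_hopf k H S" and ?D = "Dual\<lparr>carrier := S\<rparr>"
  have S: "dual_subspace S" and anti: "f \<in> S \<Longrightarrow> dual_antipode H f \<in> S"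
    and rep: "f \<in> S \<Longrightarrow> \<exists>ts\<in>lists (S \<times> S). represents ts f" for f
    using assms by (auto simp: hopf_subalgebra_of_dual_iff)
  have sub: "g \<in> S \<Longrightarrow> g \<in> carrier Dual" for g using S by (auto simp: dual_subspace_def)
  interpret D: separated_algebra k H ?D "\<lambda>f. f" by (rule dual_subspace_separated[OF S]) simp_all
  interpret DD: two_vector_spaces k ?D ?D
    by (intro two_vector_spaces.intro two_modules.intro D.K_module) unfold_locales
  interpret W: separated_algebra k H ?W "\<lambda>f. f" by (rule dual_subspace_separated[OF S]) (simp_all add: dual_hopf_simps)
  have WD: "tensor k ?W ?W = tensor k ?D ?D" by (rule tensor_cong) (simp_all add: dual_hopf_simps)
  have comult: "comult ?W f \<in> carrier (tensor k ?D ?D) \<and>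
      (\<forall>x\<in>carrier H. \<forall>y\<in>carrier H. f (x \<otimes>\<^bsub>H\<^esub> y) = tensor_lift k (\<lambda>g h. g x \<otimes>\<^bsub>k\<^esub> h y) (comult ?W f))"
    if f: "f \<in> S" for f
  proof -
    let ?P = "\<lambda>t. t \<in> carrier (tensor k ?D ?D) \<and> dual_comult k H f = dual_tensor_embed k H t"
    have "\<exists>t. ?P t"
      using assms f by (auto simp: hopf_subalgebra_of_dual_def)
    \<comment> \<open>Two candidates have the same values on all pairs from \<open>H\<close>, and
      evaluation at pairs separates the tensor square of \<open>S\<close>.\<close>
    moreover have "t = t'" if "?P t" "?P t'" for t t'
    proof (rule separating_eqI[OF DD.tensor_separating[OF D.separating D.separating] DD.tensor_module])
      fix z assume "z \<in> carrier H \<times> carrier H"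
      then obtain x y where z: "z = (x, y)" and xy: "x \<in> carrier H" "y \<in> carrier H" by auto
      show "(case z of (x, y) \<Rightarrow> tensor_lift k (\<lambda>a b. a x \<otimes>\<^bsub>k\<^esub> b y) t) = (case z of (x, y) \<Rightarrow> tensor_lift k (\<lambda>a b. a x \<otimes>\<^bsub>k\<^esub> b y) t')"
        using that dual_comult_eq_embed_iff[OF S sub[OF f], of t] dual_comult_eq_embed_iff[OF S sub[OF f], of t'] xy
        by (simp add: z)
    qed (use that in auto)
    ultimately have "\<exists>!t. ?P t" by blast
    then have "?P (THE t. ?P t)" by (rule theI')
    then have "?P (comult ?W f)" unfolding dual_hopf_simps .
    then show ?thesis using dual_comult_eq_embed_iff[OF S sub[OF f], of "comult ?W f"] by blast
  qed
  show ?thesis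
    by unfold_locales (use comult anti in \<open>auto simp: dual_hopf_simps(1,7,8) WD dual_apply\<close>)
qed

text \<open>The antipode of \<open>H\<close> is an algebra endomorphism, so \<open>\<Delta>(f) \<in> X \<otimes> X\<close> passes from
  the generators of \<open>X\<close> to all of \<open>X\<close>.\<close>

inductive_set dual_closure for Y where
  base: "f \<in> Y \<Longrightarrow> f \<in> dual_closure Y"
| one: "\<one>\<^bsub>Dual\<^esub> \<in> dual_closure Y"
| add: "f \<in> dual_closure Y \<Longrightarrow> g \<in> dual_closure Y \<Longrightarrow> f \<oplus>\<^bsub>Dual\<^esub> g \<in> dual_closure Y"
| mult: "f \<in> dual_closure Y \<Longrightarrow> g \<in> dual_closure Y \<Longrightarrow> f \<otimes>\<^bsub>Dual\<^esub> g \<in> dual_closure Y"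
| smult: "c \<in> carrier k \<Longrightarrow> f \<in> dual_closure Y \<Longrightarrow> c \<odot>\<^bsub>Dual\<^esub> f \<in> dual_closure Y"
| antipode: "f \<in> dual_closure Y \<Longrightarrow> dual_antipode H f \<in> dual_closure Y"

text \<open>The coproduct of the dual is multiplicative because that of \<open>H\<close> is, so
  components multiply termwise; the computation is again \<open>sum_interchange\<close>.\<close>

lemma represents_mult:
  assumes S: "S \<subseteq> carrier Dual" and fg: "f \<in> carrier Dual" "g \<in> carrier Dual"
    and ts: "ts \<in> lists (S \<times> S)" "represents ts f" and us: "us \<in> lists (S \<times> S)" "represents us g"
  shows "represents [(a \<otimes>\<^bsub>Dual\<^esub> c, b \<otimes>\<^bsub>Dual\<^esub> d). (a, b) \<leftarrow> ts, (c, d) \<leftarrow> us] (f \<otimes>\<^bsub>Dual\<^esub> g)"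
  unfolding represents_def
proof (intro ballI)
  fix x y assume xy: "x \<in> carrier H" "y \<in> carrier H"
  note X = sweedlerD[OF xy(1)] and Y = sweedlerD[OF xy(2)]
  have T: "a \<in> carrier Dual" "b \<in> carrier Dual" if "(a, b) \<in> set ts" for a b
    using that ts(1) S by (auto simp: lists_eq_set)
  have U: "a \<in> carrier Dual" "b \<in> carrier Dual" if "(a, b) \<in> set us" for a b
    using that us(1) S by (auto simp: lists_eq_set)
  have "(f \<otimes>\<^bsub>Dual\<^esub> g) (x \<otimes>\<^bsub>H\<^esub> y)
    = tensor_sum k (\<lambda>x1 x2. tensor_sum k (\<lambda>y1 y2. f (x1 \<otimes>\<^bsub>H\<^esub> y1) \<otimes>\<^bsub>k\<^esub> g (x2 \<otimes>\<^bsub>H\<^esub> y2)) (\<Delta> y)) (\<Delta> x)"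
    using sweedler_mult[OF dual_bilinear[OF fg] k1 xy] fg xy by (simp add: dual_mult_apply)
  also have "\<dots> = tensor_sum k (\<lambda>x1 x2. tensor_sum k (\<lambda>y1 y2.
      tensor_sum k (\<lambda>a b. a x1 \<otimes>\<^bsub>k\<^esub> b y1) ts \<otimes>\<^bsub>k\<^esub> tensor_sum k (\<lambda>c d. c x2 \<otimes>\<^bsub>k\<^esub> d y2) us) (\<Delta> y)) (\<Delta> x)"
    by (intro tensor_sum_cong) (use ts(2) us(2) X Y in \<open>simp add: represents_def\<close>)
  also have "\<dots> = tensor_sum k (\<lambda>a b. tensor_sum k (\<lambda>c d.
      tensor_sum k (\<lambda>x1 x2. a x1 \<otimes>\<^bsub>k\<^esub> c x2) (\<Delta> x) \<otimes>\<^bsub>k\<^esub> tensor_sum k (\<lambda>y1 y2. b y1 \<otimes>\<^bsub>k\<^esub> d y2) (\<Delta> y)) us) ts"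
    by (rule sum_interchange) (use T U X Y in auto)
  also have "\<dots> = tensor_sum k (\<lambda>a b. tensor_sum k (\<lambda>c d.
      (a \<otimes>\<^bsub>Dual\<^esub> c) x \<otimes>\<^bsub>k\<^esub> (b \<otimes>\<^bsub>Dual\<^esub> d) y) us) ts"
    by (intro tensor_sum_cong) (use T U xy in \<open>simp add: dual_mult_apply\<close>)
  also have "\<dots> = tensor_sum k (\<lambda>g h. g x \<otimes>\<^bsub>k\<^esub> h y) [(a \<otimes>\<^bsub>Dual\<^esub> c, b \<otimes>\<^bsub>Dual\<^esub> d). (a, b) \<leftarrow> ts, (c, d) \<leftarrow> us]"
    by (rule R.tensor_sum_prod[symmetric]) (use T U xy in \<open>simp add: dual_mult_closed\<close>)
  finally show "(f \<otimes>\<^bsub>Dual\<^esub> g) (x \<otimes>\<^bsub>H\<^esub> y)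
    = tensor_sum k (\<lambda>g h. g x \<otimes>\<^bsub>k\<^esub> h y) [(a \<otimes>\<^bsub>Dual\<^esub> c, b \<otimes>\<^bsub>Dual\<^esub> d). (a, b) \<leftarrow> ts, (c, d) \<leftarrow> us]" .
qed

lemma hopf_subalgebra_dual_closure:
  assumes Y: "Y \<subseteq> carrier Dual" and rep: "\<And>f. f \<in> Y \<Longrightarrow> \<exists>ts\<in>lists (Y \<times> Y). represents ts f"
  shows "hopf_subalgebra_of_dual k H (dual_closure Y)"
proof -
  let ?C = "dual_closure Y"
  have sub: "f \<in> carrier Dual" if "f \<in> ?C" for f
    using that by (induction) (use Y in \<open>auto intro: dual_one_closed dual_add_closed dual_mult_closed
      dual_smult_closed dual_antipode_closed\<close>)
  have zero: "\<zero>\<^bsub>Dual\<^esub> \<in> ?C"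
  proof -
    have "\<zero>\<^bsub>k\<^esub> \<odot>\<^bsub>Dual\<^esub> \<one>\<^bsub>Dual\<^esub> = \<zero>\<^bsub>Dual\<^esub>"
      by (rule dual_eqI) (auto intro: dual_smult_closed dual_one_closed dual_zero_closed simp: dual_apply)
    then show ?thesis using dual_closure.smult[OF R.zero_closed dual_closure.one] by metis
  qed
  have "\<exists>ts\<in>lists (?C \<times> ?C). represents ts f" if "f \<in> ?C" for f
    using that
  proof induction
    case (base f)
    then show ?case using rep[OF base] dual_closure.base by (auto simp: lists_eq_set) blast
  next
    case one
    have "represents [(\<one>\<^bsub>Dual\<^esub>, \<one>\<^bsub>Dual\<^esub>)] \<one>\<^bsub>Dual\<^esub>"
      by (simp add: represents_def dual_apply counit_mult)
    then show ?case using dual_closure.one by (intro bexI) auto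
  next
    case (add f g)
    then obtain ts us where ts: "ts \<in> lists (?C \<times> ?C)" "represents ts f" and us: "us \<in> lists (?C \<times> ?C)" "represents us g"
      by blast
    have "represents (ts @ us) (f \<oplus>\<^bsub>Dual\<^esub> g)"
      unfolding represents_def
    proof (intro ballI)
      fix x y assume xy: "x \<in> carrier H" "y \<in> carrier H"
      have "tensor_sum k (\<lambda>g h. g x \<otimes>\<^bsub>k\<^esub> h y) (ts @ us)
        = tensor_sum k (\<lambda>g h. g x \<otimes>\<^bsub>k\<^esub> h y) ts \<oplus>\<^bsub>k\<^esub> tensor_sum k (\<lambda>g h. g x \<otimes>\<^bsub>k\<^esub> h y) us"
        by (rule R.tensor_sum_append) (use ts(1) us(1) sub xy in \<open>auto simp: lists_eq_set\<close>)
      then show "(f \<oplus>\<^bsub>Dual\<^esub> g) (x \<otimes>\<^bsub>H\<^esub> y) = tensor_sum k (\<lambda>g h. g x \<otimes>\<^bsub>k\<^esub> h y) (ts @ us)"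
        using ts(2) us(2) xy by (simp add: represents_def dual_apply)
    qed
    then show ?case using ts us by (intro bexI[of _ "ts @ us"]) auto
  next
    case (mult f g)
    then obtain ts us where ts: "ts \<in> lists (?C \<times> ?C)" "represents ts f" and us: "us \<in> lists (?C \<times> ?C)" "represents us g"
      by blast
    let ?p = "[(a \<otimes>\<^bsub>Dual\<^esub> c, b \<otimes>\<^bsub>Dual\<^esub> d). (a, b) \<leftarrow> ts, (c, d) \<leftarrow> us]"
    have "u \<in> ?C \<times> ?C" if u: "u \<in> set ?p" for u
    proof -
      obtain a b c d where "(a, b) \<in> set ts" "(c, d) \<in> set us" "u = (a \<otimes>\<^bsub>Dual\<^esub> c, b \<otimes>\<^bsub>Dual\<^esub> d)"
        using u by auto
      moreover from this have "a \<in> ?C" "b \<in> ?C" "c \<in> ?C" "d \<in> ?C"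
        using ts(1) us(1) by (auto simp: lists_eq_set)
      ultimately show ?thesis by (simp add: dual_closure.mult)
    qed
    then have "?p \<in> lists (?C \<times> ?C)" unfolding lists_eq_set by blast
    then show ?case
      using represents_mult[OF _ sub[OF mult.hyps(1)] sub[OF mult.hyps(2)] ts us] sub by blast
  next
    case (smult c f)
    then obtain ts where ts: "ts \<in> lists (?C \<times> ?C)" "represents ts f" by blast
    let ?t = "map (\<lambda>(a, b). (c \<odot>\<^bsub>Dual\<^esub> a, b)) ts"
    have T: "a \<in> carrier Dual" "b \<in> carrier Dual" if "(a, b) \<in> set ts" for a b
      using that ts(1) sub by (auto simp: lists_eq_set)
    have "represents ?t (c \<odot>\<^bsub>Dual\<^esub> f)"
      unfolding represents_def
    proof (intro ballI)
      fix x y assume xy: "x \<in> carrier H" "y \<in> carrier H"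
      have "(c \<odot>\<^bsub>Dual\<^esub> f) (x \<otimes>\<^bsub>H\<^esub> y) = c \<otimes>\<^bsub>k\<^esub> tensor_sum k (\<lambda>a b. a x \<otimes>\<^bsub>k\<^esub> b y) ts"
        using ts(2) xy by (simp add: represents_def dual_apply)
      also have "\<dots> = tensor_sum k (\<lambda>a b. c \<otimes>\<^bsub>k\<^esub> (a x \<otimes>\<^bsub>k\<^esub> b y)) ts"
        by (rule sum_mult_left) (use T xy smult.hyps in auto)
      also have "\<dots> = tensor_sum k (\<lambda>a b. (c \<odot>\<^bsub>Dual\<^esub> a) x \<otimes>\<^bsub>k\<^esub> b y) ts"
        by (rule tensor_sum_cong) (use T xy smult.hyps in \<open>simp add: dual_apply R.m_assoc\<close>)
      also have "\<dots> = tensor_sum k (\<lambda>a b. a x \<otimes>\<^bsub>k\<^esub> b y) ?t"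
        by (rule tensor_sum_map[symmetric])
      finally show "(c \<odot>\<^bsub>Dual\<^esub> f) (x \<otimes>\<^bsub>H\<^esub> y) = tensor_sum k (\<lambda>a b. a x \<otimes>\<^bsub>k\<^esub> b y) ?t" .
    qed
    moreover have "?t \<in> lists (?C \<times> ?C)"
      using ts(1) smult.hyps by (induction ts) (auto intro: dual_closure.smult)
    ultimately show ?case by blast
  next
    case (antipode f)
    then obtain ts where ts: "ts \<in> lists (?C \<times> ?C)" "represents ts f" by blast
    let ?t = "map (\<lambda>(a, b). (dual_antipode H a, dual_antipode H b)) ts"
    have "represents ?t (dual_antipode H f)"
      unfolding represents_def
    proof (intro ballI)
      fix x y assume xy: "x \<in> carrier H" "y \<in> carrier H"
      have "dual_antipode H f (x \<otimes>\<^bsub>H\<^esub> y) = tensor_sum k (\<lambda>a b. a (antipode H x) \<otimes>\<^bsub>k\<^esub> b (antipode H y)) ts"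
        using ts(2) xy by (simp add: represents_def dual_apply antipode_mult)
      also have "\<dots> = tensor_sum k (\<lambda>a b. dual_antipode H a x \<otimes>\<^bsub>k\<^esub> dual_antipode H b y) ts"
        using xy by (simp add: dual_apply)
      also have "\<dots> = tensor_sum k (\<lambda>a b. a x \<otimes>\<^bsub>k\<^esub> b y) ?t"
        by (rule tensor_sum_map[symmetric])
      finally show "dual_antipode H f (x \<otimes>\<^bsub>H\<^esub> y) = tensor_sum k (\<lambda>a b. a x \<otimes>\<^bsub>k\<^esub> b y) ?t" .
    qed
    moreover have "?t \<in> lists (?C \<times> ?C)"
      using ts(1) by (induction ts) (auto intro: dual_closure.antipode)
    ultimately show ?case by blast
  qed
  then show ?thesis
    unfolding hopf_subalgebra_of_dual_iff dual_subspace_def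
    using sub zero by (auto intro: dual_closure.intros)
qed

section \<open>The finite dual as the largest Hopf subalgebra\<close>

abbreviation Finite_Dual where "Finite_Dual \<equiv> \<Union>{S. hopf_subalgebra_of_dual k H S}"

text \<open>Stability of \<open>Y\<close> under the coproduct is enough, because the closure of
  \<open>Y\<close> under the remaining operations is a Hopf subalgebra. Sets of functionals that
  arise from pairings satisfy this condition without being subalgebras.\<close>

lemma finite_dualI:
  assumes "Y \<subseteq> carrier Dual" "\<And>f. f \<in> Y \<Longrightarrow> \<exists>ts\<in>lists (Y \<times> Y). represents ts f"
  shows "Y \<subseteq> Finite_Dual"
  using hopf_subalgebra_dual_closure[OF assms] dual_closure.base[of _ Y] by blast

text \<open>The sum of elements of two different Hopf subalgebras need not lie in either of them.
  But the closure of the union is a Hopf subalgebra, hence one of the sets in the union, so the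
  union is closed.\<close>

lemma hopf_subalgebra_finite_dual: "hopf_subalgebra_of_dual k H Finite_Dual"
proof -
  have "hopf_subalgebra_of_dual k H (dual_closure Finite_Dual)"
  proof (rule hopf_subalgebra_dual_closure)
    show "Finite_Dual \<subseteq> carrier Dual" by (auto simp: hopf_subalgebra_of_dual_iff dual_subspace_def)
    fix f assume "f \<in> Finite_Dual"
    then obtain S where S: "hopf_subalgebra_of_dual k H S" "f \<in> S" by auto
    then obtain ts where "ts \<in> lists (S \<times> S)" "represents ts f" unfolding hopf_subalgebra_of_dual_iff by blast
    moreover have "lists (S \<times> S) \<subseteq> lists (Finite_Dual \<times> Finite_Dual)" using S(1) by (intro lists_mono) auto
    ultimately show "\<exists>ts\<in>lists (Finite_Dual \<times> Finite_Dual). represents ts f" by blast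
  qed
  moreover from this have "dual_closure Finite_Dual = Finite_Dual"
    using dual_closure.base[of _ Finite_Dual] by auto
  ultimately show ?thesis by simp
qed

end

section \<open>Smallness\<close>

text \<open>Phrased by an injection because that is what transport of structure needs;
  \<open>small_iff\<close> passes to cardinals for the closure properties. The first argument only
  carries the type \<open>'u\<close>.\<close>

definition small :: "'u itself \<Rightarrow> 'a set \<Rightarrow> bool" where
  "small U X \<longleftrightarrow> (\<exists>i :: 'a \<Rightarrow> 'u. inj_on i X)"

lemma small_iff: "small TYPE('u) X \<longleftrightarrow> (card_of X, card_of (UNIV :: 'u set)) \<in> ordLeq"
  unfolding small_def card_of_ordLeq[symmetric] by simp

lemma small_subset: "small U X \<Longrightarrow> Y \<subseteq> X \<Longrightarrow> small U Y"
  unfolding small_def using inj_on_subset by blast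

lemma small_image: "small TYPE('u) X \<Longrightarrow> small TYPE('u) (f ` X)"
  unfolding small_iff by (rule ordLeq_transitive[OF card_of_image])

context
  assumes inf: "infinite (UNIV :: 'u set)"
begin

lemma small_UN:
  "small TYPE('u) I \<Longrightarrow> (\<And>i. i \<in> I \<Longrightarrow> small TYPE('u) (A i)) \<Longrightarrow> small TYPE('u) (\<Union>i\<in>I. A i)"
  unfolding small_iff using card_of_UNION_ordLeq_infinite[OF inf] by blast

lemma small_nat: "small TYPE('u) (X :: nat set)"
proof -
  obtain f :: "nat \<Rightarrow> 'u" where "inj f" using infinite_countable_subset[OF inf] by blast
  then show ?thesis unfolding small_def using inj_on_subset by blast
qed

lemma small_finite:
  assumes "finite X" shows "small TYPE('u) X"
proof -
  obtain f :: "_ \<Rightarrow> nat" where f: "inj_on f X" using finite_imp_inj_to_nat_seg[OF assms] by blast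
  obtain g :: "nat \<Rightarrow> 'u" where "inj g" using infinite_countable_subset[OF inf] by blast
  then have "inj_on (g \<circ> f) X" using f by (auto intro!: comp_inj_on inj_on_subset[of g UNIV])
  then show ?thesis unfolding small_def by blast
qed

lemma small_Un:
  assumes "small TYPE('u) X" "small TYPE('u) Y" shows "small TYPE('u) (X \<union> Y)"
proof -
  have "small TYPE('u) (\<Union>b\<in>{True, False}. if b then X else Y)"
    by (rule small_UN) (auto intro: small_finite simp: assms)
  then show ?thesis by (simp add: Un_commute)
qed

lemma small_Times:
  assumes "small TYPE('u) X" "small TYPE('u) Y" shows "small TYPE('u) (X \<times> Y)"
proof -
  have "X \<times> Y = (\<Union>x\<in>X. Pair x ` Y)" by auto
  then show ?thesis using small_UN[OF assms(1), of "\<lambda>x. Pair x ` Y"] small_image[OF assms(2)] by metis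
qed

lemma small_lists:
  assumes "small TYPE('u) X" shows "small TYPE('u) (lists X)"
proof -
  define L where "L n = {xs \<in> lists X. length xs = n}" for n
  have "small TYPE('u) (L n)" for n
  proof (induction n)
    case 0
    have "L 0 = {[]}" by (auto simp: L_def)
    then show ?case by (simp add: small_finite)
  next
    case (Suc n)
    have "L (Suc n) = (\<lambda>(x, xs). x # xs) ` (X \<times> L n)"
      by (auto simp: L_def length_Suc_conv image_iff)
    then show ?case using small_image[OF small_Times[OF assms Suc]] by simp
  qed
  moreover have "lists X = (\<Union>n. L n)" by (auto simp: L_def)
  ultimately show ?thesis using small_UN[OF small_nat[of UNIV], of L] by simp
qed

text \<open>\<open>G\<close> assigns to a finite list a small set of values, so one function covers
  constants, operations of all arities and families of operations. The closure takes countably many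
  stages, and a finite list already lies in one of them.\<close>

lemma small_closure:
  assumes Y: "small TYPE('u) Y" "Y \<subseteq> Z"
    and G: "\<And>xs. xs \<in> lists Z \<Longrightarrow> small TYPE('u) (G xs) \<and> G xs \<subseteq> Z"
  obtains X where "Y \<subseteq> X" "X \<subseteq> Z" "small TYPE('u) X" "\<And>xs. xs \<in> lists X \<Longrightarrow> G xs \<subseteq> X"
proof -
  define X where "X n = ((\<lambda>X. X \<union> (\<Union>xs\<in>lists X. G xs)) ^^ n) Y" for n
  have X0: "X 0 = Y" and XS: "X (Suc n) = X n \<union> (\<Union>xs\<in>lists (X n). G xs)" for n by (simp_all add: X_def)
  have *: "small TYPE('u) (X n) \<and> X n \<subseteq> Z" for n
  proof (induction n)
    case (Suc n)
    then have l: "xs \<in> lists Z" if "xs \<in> lists (X n)" for xs using that lists_mono[of "X n" Z] by blast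
    have "small TYPE('u) (\<Union>xs\<in>lists (X n). G xs)"
      by (rule small_UN[OF small_lists]) (use Suc G l in blast)+
    then show ?case using Suc G l unfolding XS by (blast intro: small_Un)
  qed (use Y X0 in simp)
  have mono: "X m \<subseteq> X n" if "m \<le> n" for m n
    by (rule lift_Suc_mono_le[OF _ that]) (simp add: XS)
  show thesis
  proof
    show "Y \<subseteq> (\<Union>n. X n)" using X0 by blast
    show "(\<Union>n. X n) \<subseteq> Z" using * by blast
    show "small TYPE('u) (\<Union>n. X n)" using small_UN[OF small_nat[of UNIV]] * by blast
    fix xs assume "xs \<in> lists (\<Union>n. X n)"
    then have "\<exists>n. xs \<in> lists (X n)"
    proof (induction xs rule: list.induct)
      case (Cons x xs)
      then obtain m n where "x \<in> X m" "xs \<in> lists (X n)" by auto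
      then have "x # xs \<in> lists (X (max m n))"
        using mono[of m "max m n"] lists_mono[OF mono[of n "max m n"]] by auto
      then show ?case by blast
    qed auto
    then show "G xs \<subseteq> (\<Union>n. X n)" using XS by blast
  qed
qed

end

section \<open>Transport of a Hopf algebra along an injection\<close>

definition transport_module :: "('b \<Rightarrow> 'u) \<Rightarrow> ('k, 'b, 'z) module_scheme \<Rightarrow> ('k, 'u) module" where
  "transport_module i K = (let j = the_inv_into (carrier K) i in
    \<lparr> carrier = i ` carrier K, mult = (\<lambda>x y. i (j x \<otimes>\<^bsub>K\<^esub> j y)), one = i \<one>\<^bsub>K\<^esub>, zero = i \<zero>\<^bsub>K\<^esub>,
      add = (\<lambda>x y. i (j x \<oplus>\<^bsub>K\<^esub> j y)), smult = (\<lambda>c x. i (c \<odot>\<^bsub>K\<^esub> j x)) \<rparr>)"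

text \<open>The coproduct takes values in the tensor square over the new carrier, so the module
  structure must be there first; hence the split into two definitions.\<close>

definition transport_hopf ::
  "('k, 'm) ring_scheme \<Rightarrow> ('b \<Rightarrow> 'u) \<Rightarrow> ('k, 'b, 'z) hopf_scheme \<Rightarrow> ('k, 'u) hopf" where
  "transport_hopf k i K = (let j = the_inv_into (carrier K) i; M = transport_module i K in
    module.extend M (hopf.fields
      (\<lambda>x. tensor_class k M M (map (\<lambda>(a, b). (i a, i b)) (sweedler k K (j x))))
      (\<lambda>x. counit K (j x))
      (\<lambda>x. i (antipode K (j x)))))"

text \<open>The transported elements act by the same functionals on \<open>T\<close>, which still
  separate them. Hence no Hopf law has to be carried through the injection:
  \<open>is_hopf_algebra\<close> supplies them for the copy.\<close>

lemma (in separated_hopf) transport: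
  assumes i: "inj_on i (carrier K)"
  shows "separated_hopf k T (transport_hopf k i K) (\<lambda>x. \<omega> (the_inv_into (carrier K) i x))"
    and "carrier (transport_hopf k i K) = i ` carrier K"
proof -
  let ?j = "the_inv_into (carrier K) i" and ?M = "transport_module i K" and ?W = "transport_hopf k i K"
  have M: "carrier ?M = i ` carrier K" "mult ?M = (\<lambda>x y. i (?j x \<otimes>\<^bsub>K\<^esub> ?j y))" "one ?M = i \<one>\<^bsub>K\<^esub>" "zero ?M = i \<zero>\<^bsub>K\<^esub>"
    "add ?M = (\<lambda>x y. i (?j x \<oplus>\<^bsub>K\<^esub> ?j y))" "smult ?M = (\<lambda>c x. i (c \<odot>\<^bsub>K\<^esub> ?j x))"
    by (simp_all add: transport_module_def Let_def)
  have WM: "carrier ?W = carrier ?M" "mult ?W = mult ?M" "one ?W = one ?M" "zero ?W = zero ?M"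
    "add ?W = add ?M" "smult ?W = smult ?M"
    and W: "comult ?W = (\<lambda>x. tensor_class k ?M ?M (map (\<lambda>(a, b). (i a, i b)) (sweedler k K (?j x))))"
    "counit ?W = (\<lambda>x. counit K (?j x))" "antipode ?W = (\<lambda>x. i (antipode K (?j x)))"
    by (simp_all add: transport_hopf_def Let_def module.extend_def hopf.fields_def)
  show "carrier ?W = i ` carrier K" by (simp add: WM M)
  have j [simp]: "?j (i x) = x" if "x \<in> carrier K" for x using the_inv_into_f_f[OF i that] .
  interpret W: separated_algebra k T ?W "\<lambda>x. \<omega> (?j x)"
  proof unfold_locales
    fix x y assume xy: "x \<in> carrier ?W" "y \<in> carrier ?W" and eq: "\<And>t. t \<in> carrier T \<Longrightarrow> \<omega> (?j x) t = \<omega> (?j y) t"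
    obtain a b where ab: "a \<in> carrier K" "x = i a" "b \<in> carrier K" "y = i b" using xy by (auto simp: WM M)
    have "a = b" by (rule eqI) (use ab eq in auto)
    then show "x = y" using ab by simp
  qed (auto simp: WM M linear add zero mult one smult)
  interpret WW: two_vector_spaces k ?W ?W
    by (intro two_vector_spaces.intro two_modules.intro W.K_module) unfold_locales
  have c: "tensor_class k ?W ?W = tensor_class k ?M ?M"
    by (rule tensor_cong) (simp_all add: WM)
  have l: "map (\<lambda>(a, b). (i a, i b)) (sweedler k K x) \<in> lists (carrier ?W \<times> carrier ?W)" if "x \<in> carrier K" for x
    using sweedlerD[OF that] by (auto simp: lists_eq_set WM M)
  show "separated_hopf k T ?W (\<lambda>x. \<omega> (?j x))"
  proof (unfold_locales, goal_cases)
    case (1 x)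
    then show ?case using WW.cls_closed[OF l] by (auto simp: W WM M c)
  next
    case (5 x s t)
    then obtain y where y: "y \<in> carrier K" "x = i y" by (auto simp: WM M)
    have "tensor_lift (base_algebra k) (\<lambda>a b. \<omega> (?j a) s \<otimes>\<^bsub>k\<^esub> \<omega> (?j b) t) (comult ?W x)
      = tensor_sum k (\<lambda>a b. \<omega> (?j a) s \<otimes>\<^bsub>k\<^esub> \<omega> (?j b) t) (map (\<lambda>(a, b). (i a, i b)) (sweedler k K y))"
      using WW.tensor_lift_cls[OF WW.bilinear_pairing[where \<omega> = "\<lambda>x. \<omega> (?j x)" and \<omega>' = "\<lambda>x. \<omega> (?j x)",
          OF separatingD(1)[OF W.separating 5(2)] separatingD(1)[OF W.separating 5(3)]] T.k1 l[OF y(1)]]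
      y by (simp add: W c)
    also have "\<dots> = tensor_sum k (\<lambda>a b. \<omega> (?j (i a)) s \<otimes>\<^bsub>k\<^esub> \<omega> (?j (i b)) t) (sweedler k K y)"
      by (rule tensor_sum_map)
    also have "\<dots> = tensor_sum k (\<lambda>a b. \<omega> a s \<otimes>\<^bsub>k\<^esub> \<omega> b t) (sweedler k K y)"
      by (rule tensor_sum_cong) (use sweedlerD[OF y(1)] in simp)
    finally show ?case using ev_sweedler[OF y(1) 5(2,3)] y by simp
  qed (auto simp: W WM M counit antipode)
qed

lemma (in separated_hopf) separating_pairing: "separating_pairing k K T \<omega>"
  by (intro separating_pairing.intro separating_pairing_axioms.intro is_hopf_algebra hopf_pairing eqI T.hopf_algebra_axioms)

section \<open>Small Hopf subalgebras of the finite dual\<close>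

context hopf_algebra
begin

lemma counit_scalar: "c \<in> carrier k \<Longrightarrow> counit H (c \<odot>\<^bsub>H\<^esub> \<one>\<^bsub>H\<^esub>) = c"
  using module_homD(3)[OF counit_linear, of c "\<one>\<^bsub>H\<^esub>"] by (simp add: counit_one)

text \<open>The counit maps a Hopf algebra onto its base field.\<close>

lemma small_scalars:
  assumes "small TYPE('u) (carrier H)" shows "small TYPE('u) (carrier k)"
proof -
  have "carrier k \<subseteq> counit H ` carrier H"
  proof
    fix c assume "c \<in> carrier k"
    then show "c \<in> counit H ` carrier H" by (intro image_eqI[of _ _ "c \<odot>\<^bsub>H\<^esub> \<one>\<^bsub>H\<^esub>"]) (simp_all add: counit_scalar)
  qed
  then show ?thesis using small_subset[OF small_image[OF assms]] by blast
qed

text \<open>A downward Loewenheim-Skolem argument: close \<open>Y\<close> under the algebra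
  operations, the antipode, the scalars and the components of one chosen coproduct for each
  functional.\<close>

lemma small_hopf_subalgebra:
  assumes inf: "infinite (UNIV :: 'u set)" and k: "small TYPE('u) (carrier k)"
    and Y: "small TYPE('u) Y" "Y \<subseteq> Finite_Dual"
  obtains X where "hopf_subalgebra_of_dual k H X" "Y \<subseteq> X" "small TYPE('u) X"
proof -
  define Z where "Z = Finite_Dual"
  have YZ: "Y \<subseteq> Z" unfolding Z_def by (rule Y(2))
  have sZ: "dual_subspace Z" and anti: "f \<in> Z \<Longrightarrow> dual_antipode H f \<in> Z"
    and rep: "f \<in> Z \<Longrightarrow> \<exists>ts\<in>lists (Z \<times> Z). represents ts f" for f
    using hopf_subalgebra_of_dual_iff[of Z] hopf_subalgebra_finite_dual[folded Z_def] by blast+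
  \<comment> \<open>Fixing one list per functional adds only finitely many components, whereas all
    possible lists together could be too many.\<close>
  define R where "R f = (SOME ts. ts \<in> lists (Z \<times> Z) \<and> represents ts f)" for f
  have R: "R f \<in> lists (Z \<times> Z) \<and> represents (R f) f" if "f \<in> Z" for f
    unfolding R_def by (rule someI_ex) (use rep[OF that] in blast)
  \<comment> \<open>The scalar multiples of one functional form an image of the field, and this is
    where smallness of \<open>carrier k\<close> enters.\<close>
  define G where "G fs = {\<one>\<^bsub>Dual\<^esub>, \<zero>\<^bsub>Dual\<^esub>} \<union>
    (\<Union>f\<in>set fs. {dual_antipode H f} \<union> (\<lambda>c. c \<odot>\<^bsub>Dual\<^esub> f) ` carrier k \<union> fst ` set (R f) \<union> snd ` set (R f)) \<union>
    (\<Union>f\<in>set fs. \<Union>g\<in>set fs. {f \<oplus>\<^bsub>Dual\<^esub> g, f \<otimes>\<^bsub>Dual\<^esub> g})" for fs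
  have "small TYPE('u) (G fs)" for fs
    unfolding G_def by (intro small_Un[OF inf] small_UN[OF inf] small_finite[OF inf] small_image k) auto
  moreover have "G fs \<subseteq> Z" if "fs \<in> lists Z" for fs
  proof -
    have fs: "f \<in> Z" if "f \<in> set fs" for f using that \<open>fs \<in> _\<close> by (auto simp: lists_eq_set)
    have "fst z \<in> Z \<and> snd z \<in> Z" if "f \<in> set fs" "z \<in> set (R f)" for f z
    proof -
      have "set (R f) \<subseteq> Z \<times> Z" using R[OF fs[OF that(1)]] by (simp add: lists_eq_set)
      then have "z \<in> Z \<times> Z" using that(2) by blast
      then show ?thesis by (simp add: mem_Times_iff)
    qed
    then show ?thesis
      using fs anti[OF fs] sZ unfolding G_def dual_subspace_def by (intro Un_least UN_least) auto
  qed
  ultimately have GZ: "small TYPE('u) (G fs) \<and> G fs \<subseteq> Z" if "fs \<in> lists Z" for fs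
    using that by simp
  obtain X where X: "Y \<subseteq> X" "X \<subseteq> Z" "small TYPE('u) X" "\<And>fs. fs \<in> lists X \<Longrightarrow> G fs \<subseteq> X"
    by (rule small_closure[OF inf Y(1) YZ, of G]) (erule GZ, rule that)
  \<comment> \<open>The empty list yields the constants; lists of length one and two yield the unary
    and the binary operations.\<close>
  have Gn: "G [] \<subseteq> X" by (rule X(4)) simp
  have G1: "G [f] \<subseteq> X" if "f \<in> X" for f by (rule X(4)) (use that in simp)
  have G2: "G [f, g] \<subseteq> X" if "f \<in> X" "g \<in> X" for f g by (rule X(4)) (use that in simp)
  have "dual_subspace X"
    unfolding dual_subspace_def
  proof (intro conjI ballI)
    show "X \<subseteq> carrier Dual" using X(2) sZ unfolding dual_subspace_def by blast
    show "c \<odot>\<^bsub>Dual\<^esub> f \<in> X" if "c \<in> carrier k" "f \<in> X" for c f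
      using G1[OF that(2)] that(1) by (auto simp: G_def)
  qed (use Gn G1 G2 in \<open>auto simp: G_def\<close>)
  moreover have "\<exists>ts\<in>lists (X \<times> X). represents ts f" if f: "f \<in> X" for f
  proof
    have "fst ` set (R f) \<subseteq> X" "snd ` set (R f) \<subseteq> X" using G1[OF f] by (auto simp: G_def)
    then show "R f \<in> lists (X \<times> X)" by (auto simp: lists_eq_set)
    show "represents (R f) f" using R f X(2) by blast
  qed
  moreover have "dual_antipode H f \<in> X" if "f \<in> X" for f using G1[OF that] by (auto simp: G_def)
  ultimately have "hopf_subalgebra_of_dual k H X" unfolding hopf_subalgebra_of_dual_iff by blast
  then show thesis using that X by blast
qed

lemma small_separated_hopf:
  assumes inf: "infinite (UNIV :: 'u set)" and k: "small TYPE('u) (carrier k)"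
    and Y: "small TYPE('u) Y" "Y \<subseteq> Finite_Dual"
  obtains K :: "('k, 'u) hopf" and \<omega> where "separated_hopf k H K \<omega>"
    "\<And>f. f \<in> Y \<Longrightarrow> \<exists>x\<in>carrier K. \<forall>t\<in>carrier H. \<omega> x t = f t"
    "\<And>x. x \<in> carrier K \<Longrightarrow> restrict (\<omega> x) (carrier H) \<in> Finite_Dual"
proof -
  obtain X where X: "hopf_subalgebra_of_dual k H X" "Y \<subseteq> X" "small TYPE('u) X"
    using small_hopf_subalgebra[OF assms] by blast
  obtain i :: "_ \<Rightarrow> 'u" where i: "inj_on i X" using X(3) by (auto simp: small_def)
  interpret X: separated_hopf k H "dual_hopf k H X" "\<lambda>f. f" by (rule dual_hopf_separated[OF X(1)])
  have inj: "inj_on i (carrier (dual_hopf k H X))" using i by (simp add: dual_hopf_simps)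
  show thesis
  proof (rule that[OF X.transport(1)[OF inj]])
    fix f assume f: "f \<in> Y"
    then have "f \<in> X" using X(2) by blast
    then show "\<exists>x\<in>carrier (transport_hopf k i (dual_hopf k H X)).
        \<forall>t\<in>carrier H. the_inv_into (carrier (dual_hopf k H X)) i x t = f t"
      by (intro bexI[of _ "i f"]) (auto simp: X.transport(2)[OF inj] dual_hopf_simps the_inv_into_f_f[OF i])
  next
    fix x assume "x \<in> carrier (transport_hopf k i (dual_hopf k H X))"
    then obtain f where f: "f \<in> X" "x = i f" by (auto simp: X.transport(2)[OF inj] dual_hopf_simps)
    have "f \<in> carrier Dual" using f(1) X(1) by (auto simp: hopf_subalgebra_of_dual_iff dual_subspace_def)
    then have "restrict f (carrier H) = f" by (auto simp: dual_algebra_simps extensional_restrict)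
    then show "restrict (the_inv_into (carrier (dual_hopf k H X)) i x) (carrier H) \<in> Finite_Dual"
      using f X(1) by (auto simp: dual_hopf_simps the_inv_into_f_f[OF i])
  qed
qed

end

section \<open>Duals of finite dimensional Hopf algebras\<close>

text \<open>Coordinates with respect to a finite basis are unique, so those of a sum or a multiple
  are recognised by the vector that they produce; this gives their linearity.\<close>

lemma (in vectorspace) ex_dual_basis:
  assumes "fin_dim"
  obtains es \<phi> where "distinct es" "set es \<subseteq> carrier V"
    "\<And>e. e \<in> set es \<Longrightarrow> \<phi> e \<in> module_hom K V (base_algebra K)"
    "\<And>x. x \<in> carrier V \<Longrightarrow> x = (\<Oplus>\<^bsub>V\<^esub>e\<in>set es. \<phi> e x \<odot>\<^bsub>V\<^esub> e)"
proof -
  obtain A where A: "finite A" "basis A" using finite_basis_exists[OF assms] by blast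
  then have AC: "A \<subseteq> carrier V" by (simp add: basis_def)
  have ex1: "\<exists>!a. a \<in> A \<rightarrow>\<^sub>E carrier K \<and> lincomb a A = v" if "v \<in> carrier V" for v
    using basis_criterion[OF A(1) AC] A(2) that by blast
  define c where "c v = (THE a. a \<in> A \<rightarrow>\<^sub>E carrier K \<and> lincomb a A = v)" for v
  have c: "c v \<in> A \<rightarrow>\<^sub>E carrier K \<and> lincomb (c v) A = v" if "v \<in> carrier V" for v
    unfolding c_def by (rule theI'[OF ex1[OF that]])
  have cu: "c v = a" if "v \<in> carrier V" "a \<in> A \<rightarrow>\<^sub>E carrier K" "lincomb a A = v" for v a
    using ex1[OF that(1)] c[OF that(1)] that(2,3) by blast
  have cc: "c v e \<in> carrier K" if "v \<in> carrier V" "e \<in> A" for v e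
    using c[OF that(1)] that(2) by auto
  obtain es where es: "set es = A" "distinct es" using finite_distinct_list[OF A(1)] by blast
  show thesis
  proof (rule that[OF es(2)])
    show "set es \<subseteq> carrier V" using es AC by simp
    show "x = (\<Oplus>\<^bsub>V\<^esub>e\<in>set es. c x e \<odot>\<^bsub>V\<^esub> e)" if "x \<in> carrier V" for x
      using c[OF that] by (simp add: es lincomb_def)
    fix e assume e: "e \<in> set es"
    show "(\<lambda>x. c x e) \<in> module_hom K V (base_algebra K)"
    proof (rule module_homI)
      fix x y assume xy: "x \<in> carrier V" "y \<in> carrier V"
      have "lincomb (restrict (\<lambda>e. c x e \<oplus>\<^bsub>K\<^esub> c y e) A) A = (\<Oplus>\<^bsub>V\<^esub>e\<in>A. c x e \<odot>\<^bsub>V\<^esub> e \<oplus>\<^bsub>V\<^esub> c y e \<odot>\<^bsub>V\<^esub> e)"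
        unfolding lincomb_def
        by (rule M.finsum_cong') (use cc xy AC in \<open>auto simp: smult_l_distr subset_iff\<close>)
      also have "\<dots> = lincomb (c x) A \<oplus>\<^bsub>V\<^esub> lincomb (c y) A"
        unfolding lincomb_def by (rule M.finsum_addf) (use cc xy AC in auto)
      finally have "c (x \<oplus>\<^bsub>V\<^esub> y) = restrict (\<lambda>e. c x e \<oplus>\<^bsub>K\<^esub> c y e) A"
        using c xy cc by (intro cu) auto
      then show "c (x \<oplus>\<^bsub>V\<^esub> y) e = c x e \<oplus>\<^bsub>base_algebra K\<^esub> c y e" using e es by simp
    next
      fix r x assume rx: "r \<in> carrier K" "x \<in> carrier V"
      have "lincomb (restrict (\<lambda>e. r \<otimes>\<^bsub>K\<^esub> c x e) A) A = (\<Oplus>\<^bsub>V\<^esub>e\<in>A. r \<odot>\<^bsub>V\<^esub> (c x e \<odot>\<^bsub>V\<^esub> e))"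
        unfolding lincomb_def
        by (rule M.finsum_cong') (use cc rx AC in \<open>auto simp: smult_assoc1 subset_iff\<close>)
      also have "\<dots> = r \<odot>\<^bsub>V\<^esub> lincomb (c x) A"
        unfolding lincomb_def by (rule finsum_smult[symmetric]) (use cc rx AC in auto)
      finally have "c (r \<odot>\<^bsub>V\<^esub> x) = restrict (\<lambda>e. r \<otimes>\<^bsub>K\<^esub> c x e) A"
        using c rx cc by (intro cu) auto
      then show "c (r \<odot>\<^bsub>V\<^esub> x) e = r \<odot>\<^bsub>base_algebra K\<^esub> c x e" using e es by simp
    qed (use cc e es in auto)
  qed
qed

lemma (in abelian_monoid) tensor_sum_eq_finsum:
  assumes "distinct es" "\<And>e. e \<in> set es \<Longrightarrow> F e (\<phi> e) \<in> carrier G"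
  shows "tensor_sum G F (map (\<lambda>e. (e, \<phi> e)) es) = (\<Oplus>e\<in>set es. F e (\<phi> e))"
  using assms by (induction es) auto

context hopf_algebra
begin

text \<open>Basis vectors paired with their coordinate functionals, in the form of a list so that
  expansions become instances of \<open>tensor_sum\<close>.\<close>

lemma ex_dual_basis_list:
  assumes "vectorspace.fin_dim k H"
  obtains zs where "zs \<in> lists (carrier H \<times> carrier Dual)"
    "\<And>x. x \<in> carrier H \<Longrightarrow> x = tensor_sum H (\<lambda>e \<phi>. \<phi> x \<odot>\<^bsub>H\<^esub> e) zs"
proof -
  interpret V: vectorspace k H by unfold_locales
  obtain es \<phi> where es: "distinct es" "set es \<subseteq> carrier H"
    and \<phi>: "\<And>e. e \<in> set es \<Longrightarrow> \<phi> e \<in> module_hom k H (base_algebra k)"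
    and x: "\<And>x. x \<in> carrier H \<Longrightarrow> x = (\<Oplus>\<^bsub>H\<^esub>e\<in>set es. \<phi> e x \<odot>\<^bsub>H\<^esub> e)"
    using V.ex_dual_basis[OF assms] by blast
  let ?zs = "map (\<lambda>e. (e, restrict (\<phi> e) (carrier H))) es"
  show thesis
  proof (rule that[of ?zs])
    show "?zs \<in> lists (carrier H \<times> carrier Dual)"
      using es(2) dualI[OF \<phi>] by (auto simp: lists_eq_set)
    fix y assume y: "y \<in> carrier H"
    have "tensor_sum H (\<lambda>e \<phi>. \<phi> y \<odot>\<^bsub>H\<^esub> e) ?zs = (\<Oplus>\<^bsub>H\<^esub>e\<in>set es. restrict (\<phi> e) (carrier H) y \<odot>\<^bsub>H\<^esub> e)"
      by (rule M.tensor_sum_eq_finsum[OF es(1)]) (use module_homD(1)[OF \<phi>] y es(2) in auto)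
    also have "\<dots> = (\<Oplus>\<^bsub>H\<^esub>e\<in>set es. \<phi> e y \<odot>\<^bsub>H\<^esub> e)"
      by (rule M.finsum_cong') (use module_homD(1)[OF \<phi>] y es(2) in auto)
    finally show "y = tensor_sum H (\<lambda>e \<phi>. \<phi> y \<odot>\<^bsub>H\<^esub> e) ?zs" using x[OF y] by simp
  qed
qed

text \<open>Everything comes from expanding \<open>x\<close> as the sum of the
  \<open>\<phi>(x) e\<close> over the list \<open>zs\<close>: the coproduct of a functional,
  separation of points, biduality, and the size of the dual.\<close>

lemma finite_dim_dual:
  assumes fd: "vectorspace.fin_dim k H"
  shows "hopf_subalgebra_of_dual k H (carrier Dual)"
    and "hopf_algebra k (linear_dual k H)"
    and "separating_pairing k H (linear_dual k H) (\<lambda>x f. f x)"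
    and "\<And>L. L \<in> module_hom k (linear_dual k H) (base_algebra k) \<Longrightarrow>
      \<exists>x\<in>carrier H. \<forall>f\<in>carrier (linear_dual k H). f x = L f"
    and "infinite (UNIV :: 'u set) \<Longrightarrow> small TYPE('u) (carrier k) \<Longrightarrow> small TYPE('u) (carrier (linear_dual k H))"
proof -
  obtain zs where zs: "zs \<in> lists (carrier H \<times> carrier Dual)"
    and x: "\<And>x. x \<in> carrier H \<Longrightarrow> x = tensor_sum H (\<lambda>e \<phi>. \<phi> x \<odot>\<^bsub>H\<^esub> e) zs"
    using ex_dual_basis_list[OF fd] by blast
  have Z: "e \<in> carrier H" "\<phi> \<in> carrier Dual" if "(e, \<phi>) \<in> set zs" for e \<phi>
    using that zs by (auto simp: lists_eq_set)
  have expand: "g x = tensor_sum M (\<lambda>e \<phi>. \<phi> x \<odot>\<^bsub>M\<^esub> g e) zs"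
    if x': "x \<in> carrier H" and g: "g \<in> module_hom k H M" and M: "module k M"
    for x g and M :: "('k, 'c, 'd) module_scheme"
  proof -
    have "g x = g (tensor_sum H (\<lambda>e \<phi>. \<phi> x \<odot>\<^bsub>H\<^esub> e) zs)" using x[OF x'] by simp
    also have "\<dots> = tensor_sum M (\<lambda>e \<phi>. g (\<phi> x \<odot>\<^bsub>H\<^esub> e)) zs"
      by (rule module_hom_tensor_sum[OF g H_module M]) (use Z x' in auto)
    also have "\<dots> = tensor_sum M (\<lambda>e \<phi>. \<phi> x \<odot>\<^bsub>M\<^esub> g e) zs"
      by (rule tensor_sum_cong) (use Z x' module_homD(3)[OF g] in auto)
    finally show ?thesis .
  qed
  have expand_k: "f x = tensor_sum k (\<lambda>e \<phi>. \<phi> x \<otimes>\<^bsub>k\<^esub> f e) zs" if "x \<in> carrier H" "f \<in> module_hom k H (base_algebra k)" for x f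
    using expand[OF that k1] by simp
  show sub: "hopf_subalgebra_of_dual k H (carrier Dual)"
    unfolding hopf_subalgebra_of_dual_iff
  proof (intro conjI ballI)
    show "dual_subspace (carrier Dual)"
      by (simp add: dual_subspace_def dual_one_closed dual_zero_closed dual_add_closed dual_mult_closed dual_smult_closed)
    fix f assume f: "f \<in> carrier Dual"
    show "dual_antipode H f \<in> carrier Dual" by (rule dual_antipode_closed[OF f])
    \<comment> \<open>Expanding \<open>x\<close> gives \<open>f(xy)\<close> as the sum of the
      products \<open>\<phi>(x) f(ey)\<close>, so the left components are the coordinates and the
      right ones are \<open>y \<mapsto> f(ey)\<close>.\<close>
    let ?t = "map (\<lambda>(e, \<phi>). (\<phi>, restrict (\<lambda>y. f (e \<otimes>\<^bsub>H\<^esub> y)) (carrier H))) zs"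
    have left: "(\<lambda>y. f (e \<otimes>\<^bsub>H\<^esub> y)) \<in> module_hom k H (base_algebra k)" if "e \<in> carrier H" for e
      by (rule module_hom_comp[OF module_hom_mult_right[OF H_algebra module_hom_id that] dual_linear[OF f]])
    show "\<exists>ts\<in>lists (carrier Dual \<times> carrier Dual). represents ts f"
    proof (rule bexI[of _ ?t])
      show "?t \<in> lists (carrier Dual \<times> carrier Dual)"
        unfolding lists_eq_set using Z dualI[OF left] by auto
      show "represents ?t f"
        unfolding represents_def
      proof (intro ballI)
        fix x y assume xy: "x \<in> carrier H" "y \<in> carrier H"
        have "f (x \<otimes>\<^bsub>H\<^esub> y) = tensor_sum k (\<lambda>e \<phi>. \<phi> x \<otimes>\<^bsub>k\<^esub> f (e \<otimes>\<^bsub>H\<^esub> y)) zs"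
          by (rule expand_k[OF xy(1) module_hom_comp[OF module_hom_mult_left[OF H_algebra module_hom_id xy(2)] dual_linear[OF f]]])
        also have "\<dots> = tensor_sum k (\<lambda>e \<phi>. \<phi> x \<otimes>\<^bsub>k\<^esub> restrict (\<lambda>y. f (e \<otimes>\<^bsub>H\<^esub> y)) (carrier H) y) zs"
          using xy by simp
        also have "\<dots> = tensor_sum k (\<lambda>g h. g x \<otimes>\<^bsub>k\<^esub> h y) ?t"
          by (rule tensor_sum_map[symmetric])
        finally show "f (x \<otimes>\<^bsub>H\<^esub> y) = tensor_sum k (\<lambda>g h. g x \<otimes>\<^bsub>k\<^esub> h y) ?t" .
      qed
    qed
  qed
  interpret D: separated_hopf k H "linear_dual k H" "\<lambda>f. f"
    unfolding linear_dual_def by (rule dual_hopf_separated[OF sub])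
  have cD: "carrier (linear_dual k H) = carrier Dual" by (simp add: linear_dual_def dual_hopf_simps)
  show hD: "hopf_algebra k (linear_dual k H)" by (rule D.is_hopf_algebra)
  show "separating_pairing k H (linear_dual k H) (\<lambda>x f. f x)"
  proof (intro separating_pairing.intro separating_pairing_axioms.intro hD hopf_algebra_axioms)
    show "hopf_pairing k H (linear_dual k H) (\<lambda>x f. f x)"
      using hopf_pairing_swap[OF D.hopf_pairing] .
    fix a b assume ab: "a \<in> carrier H" "b \<in> carrier H" and eq: "\<And>f. f \<in> carrier (linear_dual k H) \<Longrightarrow> f a = f b"
    have "tensor_sum H (\<lambda>e \<phi>. \<phi> a \<odot>\<^bsub>H\<^esub> e) zs = tensor_sum H (\<lambda>e \<phi>. \<phi> b \<odot>\<^bsub>H\<^esub> e) zs"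
    proof (rule tensor_sum_cong)
      fix e \<phi> assume "(e, \<phi>) \<in> set zs"
      then have "\<phi> a = \<phi> b" by (intro eq) (simp add: cD Z(2))
      then show "\<phi> a \<odot>\<^bsub>H\<^esub> e = \<phi> b \<odot>\<^bsub>H\<^esub> e" by simp
    qed
    then show "a = b" using x[OF ab(1)] x[OF ab(2)] by simp
  qed
  show "\<exists>x\<in>carrier H. \<forall>f\<in>carrier (linear_dual k H). f x = L f"
    if L: "L \<in> module_hom k (linear_dual k H) (base_algebra k)" for L
  proof (intro bexI ballI)
    \<comment> \<open>Every \<open>f\<close> is the sum of the \<open>f(e) \<phi>\<close>, so
      \<open>L\<close> is determined by the scalars \<open>L(\<phi>)\<close>. Used as coefficients
      of the \<open>e\<close>, they give the point at which \<open>L\<close> evaluates.\<close>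
    let ?x = "tensor_sum H (\<lambda>e \<phi>. L \<phi> \<odot>\<^bsub>H\<^esub> e) zs"
    have Lc: "L \<phi> \<in> carrier k" if "\<phi> \<in> carrier Dual" for \<phi> using module_homD(1)[OF L] that cD by simp
    show "?x \<in> carrier H" by (rule module_tensor_sum_closed[OF H_module]) (use Z Lc in auto)
    fix f assume "f \<in> carrier (linear_dual k H)"
    then have f: "f \<in> carrier Dual" by (simp add: cD)
    let ?f = "tensor_sum (linear_dual k H) (\<lambda>e \<phi>. f e \<odot>\<^bsub>linear_dual k H\<^esub> \<phi>) zs"
    have sm: "f e \<odot>\<^bsub>linear_dual k H\<^esub> \<phi> \<in> carrier (linear_dual k H)" if "(e, \<phi>) \<in> set zs" for e \<phi>
      by (rule D.smult_closed) (use Z[OF that] f cD in auto)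
    have "f = ?f"
    proof (rule D.eqI)
      show "f \<in> carrier (linear_dual k H)" using f cD by simp
      show "?f \<in> carrier (linear_dual k H)"
        by (rule module_tensor_sum_closed[OF D.K_module sm])
      fix y assume y: "y \<in> carrier H"
      have "?f y = tensor_sum k (\<lambda>e \<phi>. (f e \<odot>\<^bsub>linear_dual k H\<^esub> \<phi>) y) zs"
        using module_hom_tensor_sum[OF separatingD(1)[OF D.separating y] D.K_module k1 sm] by simp
      also have "\<dots> = tensor_sum k (\<lambda>e \<phi>. \<phi> y \<otimes>\<^bsub>k\<^esub> f e) zs"
        by (rule tensor_sum_cong) (use Z f cD y in \<open>simp add: D.smult R.m_comm\<close>)
      finally show "f y = ?f y" using expand_k[OF y dual_linear[OF f]] by simp
    qed
    then have "L f = L ?f" by simp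
    also have "\<dots> = tensor_sum k (\<lambda>e \<phi>. L (f e \<odot>\<^bsub>linear_dual k H\<^esub> \<phi>)) zs"
      using module_hom_tensor_sum[OF L D.K_module k1 sm] by simp
    also have "\<dots> = tensor_sum k (\<lambda>e \<phi>. f (L \<phi> \<odot>\<^bsub>H\<^esub> e)) zs"
      by (rule tensor_sum_cong) (use Z f cD Lc module_homD(3)[OF L] module_homD(3)[OF dual_linear[OF f]] in \<open>simp add: R.m_comm\<close>)
    also have "\<dots> = f ?x"
      using module_hom_tensor_sum[OF dual_linear[OF f] H_module k1, of zs "\<lambda>e \<phi>. L \<phi> \<odot>\<^bsub>H\<^esub> e"] Z Lc by simp
    finally show "f ?x = L f" by simp
  qed
  show "small TYPE('u) (carrier (linear_dual k H))" if inf: "infinite (UNIV :: 'u set)" and k: "small TYPE('u) (carrier k)"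
  proof -
    \<comment> \<open>A functional is determined by its values at the finitely many basis vectors,
      so the dual embeds into lists of scalars.\<close>
    let ?v = "\<lambda>f. map (\<lambda>(e, \<phi>). f e) zs"
    have inj: "inj_on ?v (carrier Dual)"
    proof (rule inj_onI)
      fix f g assume fg: "f \<in> carrier Dual" "g \<in> carrier Dual" and eq: "?v f = ?v g"
      have e: "f e = g e" if "(e, \<phi>) \<in> set zs" for e \<phi>
        using eq that by auto
      show "f = g"
      proof (rule dual_eqI[OF fg])
        fix y assume y: "y \<in> carrier H"
        have "tensor_sum k (\<lambda>e \<phi>. \<phi> y \<otimes>\<^bsub>k\<^esub> f e) zs = tensor_sum k (\<lambda>e \<phi>. \<phi> y \<otimes>\<^bsub>k\<^esub> g e) zs"
          by (rule tensor_sum_cong) (use e in simp)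
        then show "f y = g y" using expand_k[OF y dual_linear[OF fg(1)]] expand_k[OF y dual_linear[OF fg(2)]] by simp
      qed
    qed
    have "?v ` carrier Dual \<subseteq> lists (carrier k)"
      using Z(1) by (auto simp: lists_eq_set)
    then have "small TYPE('u) (?v ` carrier Dual)" by (rule small_subset[OF small_lists[OF inf k]])
    then have "small TYPE('u) (inv_into (carrier Dual) ?v ` (?v ` carrier Dual))" by (rule small_image)
    moreover have "inv_into (carrier Dual) ?v ` (?v ` carrier Dual) = carrier Dual"
      by (rule inv_into_image_cancel[OF inj HOL.refl[THEN equalityD1]])
    ultimately show ?thesis by (simp add: cD)
  qed
qed

end

section \<open>Cartier duality\<close>

lemma is_boxD:
  fixes T K :: "('k, 'u) hopf"
  assumes "is_box k A B T \<beta>"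
  shows "hopf_algebra k T" "\<beta> \<in> bilinear_map k A B T"
    "hopf_algebra k K \<Longrightarrow> \<gamma> \<in> bilinear_map k A B K \<Longrightarrow>
      \<exists>!f. f \<in> hopf_hom k T K \<and> (\<forall>t\<in>carrier (tensor k A B). f (\<beta> t) = \<gamma> t)"
proof -
  note b = assms[unfolded is_box_def]
  show "hopf_algebra k T" by (rule b[THEN conjunct1])
  show "\<beta> \<in> bilinear_map k A B T" by (rule b[THEN conjunct2, THEN conjunct1])
  show "hopf_algebra k K \<Longrightarrow> \<gamma> \<in> bilinear_map k A B K \<Longrightarrow>
      \<exists>!f. f \<in> hopf_hom k T K \<and> (\<forall>t\<in>carrier (tensor k A B). f (\<beta> t) = \<gamma> t)"
    by (rule b[THEN conjunct2, THEN conjunct2, THEN spec, THEN spec, THEN mp, THEN mp])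
qed

section \<open>Homomorphisms into the Cartier dual as pairings\<close>

context hopf_algebra
begin

abbreviation Cartier where "Cartier \<equiv> cartier_dual k H"

lemma cartier_separated: "separated_hopf k H Cartier (\<lambda>f. f)"
  unfolding cartier_dual_def by (rule dual_hopf_separated[OF hopf_subalgebra_finite_dual])

lemma carrier_cartier: "carrier Cartier = Finite_Dual"
  by (simp add: cartier_dual_def dual_hopf_simps)

text \<open>The components of \<open>a\<close> provide the components of the functional
  \<open>\<pi> a\<close>, so the image of \<open>A\<close> is stable under the coproduct and
  \<open>finite_dualI\<close> applies.\<close>

lemma pairing_finite_dual:
  assumes A: "hopf_algebra k A" and \<pi>: "hopf_pairing k A H \<pi>"
  shows "(\<lambda>a. restrict (\<pi> a) (carrier H)) ` carrier A \<subseteq> Finite_Dual"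
proof (rule finite_dualI)
  interpret A: hopf_algebra k A by fact
  note p = hopf_pairingD[OF \<pi>]
  let ?r = "\<lambda>a. restrict (\<pi> a) (carrier H)"
  show "?r ` carrier A \<subseteq> carrier Dual"
    using dualI[OF bilinearD(2)[OF p(1)]] by blast
  fix f assume "f \<in> ?r ` carrier A"
  then obtain a where a: "a \<in> carrier A" "f = ?r a" by blast
  let ?t = "map (\<lambda>(a1, a2). (?r a1, ?r a2)) (sweedler k A a)"
  show "\<exists>ts\<in>lists (?r ` carrier A \<times> ?r ` carrier A). represents ts f"
  proof (rule bexI[of _ ?t])
    show "?t \<in> lists (?r ` carrier A \<times> ?r ` carrier A)"
      using A.sweedlerD[OF a(1)] by (auto simp: lists_eq_set)
    show "represents ?t f"
      unfolding represents_def
    proof (intro ballI)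
      fix x y assume xy: "x \<in> carrier H" "y \<in> carrier H"
      have "f (x \<otimes>\<^bsub>H\<^esub> y) = tensor_sum k (\<lambda>a1 a2. ?r a1 x \<otimes>\<^bsub>k\<^esub> ?r a2 y) (sweedler k A a)"
        using p(3)[OF a(1) xy] xy a by simp
      also have "\<dots> = tensor_sum k (\<lambda>g h. g x \<otimes>\<^bsub>k\<^esub> h y) ?t"
        by (rule tensor_sum_map[symmetric])
      finally show "f (x \<otimes>\<^bsub>H\<^esub> y) = tensor_sum k (\<lambda>g h. g x \<otimes>\<^bsub>k\<^esub> h y) ?t" .
    qed
  qed
qed

text \<open>The passage from pairings to homomorphisms. Restriction to the carrier is needed because
  elements of the dual are extensional while \<open>\<pi> a\<close> is arbitrary outside.\<close>

lemma hopf_hom_cartier: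
  assumes A: "hopf_algebra k A" and \<pi>: "hopf_pairing k A H \<pi>"
  shows "(\<lambda>a\<in>carrier A. restrict (\<pi> a) (carrier H)) \<in> hopf_hom k A Cartier"
proof -
  interpret S: separated_hopf k H Cartier "\<lambda>f. f" by (rule cartier_separated)
  show ?thesis
  proof (rule separating_pairing.hopf_homI_pairing[OF S.separating_pairing A])
    show "(\<lambda>a\<in>carrier A. restrict (\<pi> a) (carrier H)) \<in> carrier A \<rightarrow> carrier Cartier"
      using pairing_finite_dual[OF A \<pi>] by (auto simp: carrier_cartier)
    show "hopf_pairing k A H (\<lambda>a t. (\<lambda>a\<in>carrier A. restrict (\<pi> a) (carrier H)) a t)"
      by (rule hopf_pairing_cong[OF A hopf_algebra_axioms _ \<pi>]) simp
  qed simp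
qed

text \<open>The inverse passage: evaluation pairs the Cartier dual with \<open>H\<close>, and
  pairings pull back along homomorphisms.\<close>

lemma pairing_of_hopf_hom_cartier:
  "hopf_algebra k A \<Longrightarrow> h \<in> hopf_hom k A Cartier \<Longrightarrow> hopf_pairing k A H h"
  using hopf_pairing_comp[of k A Cartier h H "\<lambda>f. f"] separated_hopf.is_hopf_algebra[OF cartier_separated]
    separated_hopf.hopf_pairing[OF cartier_separated] hopf_algebra_axioms by simp

end

text \<open>By multiplicativity in the last variable, the components of \<open>b\<close> and of
  \<open>d\<close> together provide those of the functional \<open>\<tau> b d\<close>. So the map of
  pairs \<open>b\<close>, \<open>d\<close> that the form defines takes its values in the finite dual
  of \<open>A\<close>.\<close>

lemma trilinear_finite_dual:
  assumes A: "hopf_algebra k A" and B: "hopf_algebra k B" and D: "hopf_algebra k D"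
    and \<tau>: "trilinear_pairing k B D A \<tau>"
  shows "(\<lambda>(b, d). restrict (\<tau> b d) (carrier A)) ` (carrier B \<times> carrier D) \<subseteq> \<Union>{S. hopf_subalgebra_of_dual k A S}"
proof -
  interpret A: hopf_algebra k A by fact
  interpret B: hopf_algebra k B by fact
  interpret D: hopf_algebra k D by fact
  note t = trilinear_pairingD[OF \<tau>]
  define r where "r b d = restrict (\<tau> b d) (carrier A)" for b d
  define Y where "Y = (\<lambda>(b, d). r b d) ` (carrier B \<times> carrier D)"
  have YI: "r b d \<in> Y" if "b \<in> carrier B" "d \<in> carrier D" for b d
    unfolding Y_def by (rule image_eqI[of _ _ "(b, d)"]) (use that in auto)
  have "Y \<subseteq> \<Union>{S. hopf_subalgebra_of_dual k A S}"
  proof (rule A.finite_dualI)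
    show "Y \<subseteq> carrier A.Dual"
      unfolding Y_def r_def using A.dualI[OF trilinearD(3)[OF t(1)]] by auto
    fix f assume "f \<in> Y"
    then obtain b d where bd: "b \<in> carrier B" "d \<in> carrier D" "f = r b d" by (auto simp: Y_def)
    note X = B.sweedlerD[OF bd(1)] and Z = D.sweedlerD[OF bd(2)]
    let ?t = "[(r b1 d1, r b2 d2). (b1, b2) \<leftarrow> sweedler k B b, (d1, d2) \<leftarrow> sweedler k D d]"
    show "\<exists>ts\<in>lists (Y \<times> Y). A.represents ts f"
    proof (rule bexI[of _ ?t])
      have "u \<in> Y \<times> Y" if u: "u \<in> set ?t" for u
      proof -
        obtain b1 b2 d1 d2 where "(b1, b2) \<in> set (sweedler k B b)" "(d1, d2) \<in> set (sweedler k D d)"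
          "u = (r b1 d1, r b2 d2)" using u by auto
        then show ?thesis using X Z by (simp add: YI)
      qed
      then show "?t \<in> lists (Y \<times> Y)" unfolding lists_eq_set by blast
      show "A.represents ?t f"
        unfolding A.represents_def
      proof (intro ballI)
        fix x y assume xy: "x \<in> carrier A" "y \<in> carrier A"
        have "f (x \<otimes>\<^bsub>A\<^esub> y) = tensor_sum k (\<lambda>b1 b2. tensor_sum k (\<lambda>d1 d2. r b1 d1 x \<otimes>\<^bsub>k\<^esub> r b2 d2 y) (sweedler k D d)) (sweedler k B b)"
          using t(4)[OF bd(1,2) xy] xy bd by (simp add: r_def)
        also have "\<dots> = tensor_sum k (\<lambda>g h. g x \<otimes>\<^bsub>k\<^esub> h y) ?t"
          by (rule A.R.tensor_sum_prod[symmetric]) (use X Z xy t(8) in \<open>simp add: r_def\<close>)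
        finally show "f (x \<otimes>\<^bsub>A\<^esub> y) = tensor_sum k (\<lambda>g h. g x \<otimes>\<^bsub>k\<^esub> h y) ?t" .
      qed
    qed
  qed
  then show ?thesis unfolding Y_def r_def .
qed

text \<open>The universal property of \<open>T = B \<boxtimes> C\<^sup>*\<close> is only available for targets living on
  \<open>'u\<close>, so as the target of maps from \<open>T\<close> a small Hopf subalgebra replaces \<open>A\<^sup>0\<close>.\<close>

locale box_with_dual = B: hopf_algebra k B + C: hopf_algebra k C
  for k :: "('k, 'm) ring_scheme" and B C :: "('k, 'u) hopf" +
  fixes T :: "('k, 'u) hopf" and \<beta> :: "('u \<times> ('u \<Rightarrow> 'k)) list set \<Rightarrow> 'u"
  assumes infinite_u: "infinite (UNIV :: 'u set)"
    and fin_dim: "vectorspace.fin_dim k C"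
    and box: "is_box k B (linear_dual k C) T \<beta>"
begin

abbreviation D where "D \<equiv> linear_dual k C"

sublocale D: hopf_algebra k D
  by (rule C.finite_dim_dual(2)[OF fin_dim])

sublocale T: hopf_algebra k T
  by (rule is_boxD(1)[OF box])

sublocale BD: two_hopf_algebras k B D ..

sublocale CD: separating_pairing k C D "\<lambda>x f. f x"
  by (rule C.finite_dim_dual(3)[OF fin_dim])

sublocale T0: separated_hopf k T "cartier_dual k T" "\<lambda>f. f"
  by (rule T.cartier_separated)

abbreviation T0 where "T0 \<equiv> cartier_dual k T"

lemma T0_hopf: "hopf_algebra k T0"
  by (rule T0.is_hopf_algebra)

lemma small_carrier: "small TYPE('u) (carrier (A :: ('k, 'u) hopf))"
  unfolding small_def by (rule exI[of _ id]) simp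

lemma small_k: "small TYPE('u) (carrier k)"
  by (rule B.small_scalars[OF small_carrier])

lemma small_D: "small TYPE('u) (carrier D)"
  by (rule C.finite_dim_dual(5)[OF fin_dim infinite_u small_k])

lemma \<beta>_linear: "\<beta> \<in> module_hom k (tensor k B D) T"
  using is_boxD(2)[OF box] BD.bilinear_map_iff[OF T.hopf_algebra_axioms] by blast

text \<open>Both sides are the same form in \<open>a\<close>, \<open>b\<close> and \<open>d\<close>,
  once as the value of \<open>h a\<close> at \<open>b \<circ> d\<close> and once as the value of
  \<open>d\<close> at \<open>a \<circ> b\<close>. A relation is enough here: existence in both
  directions and uniqueness are proved separately.\<close>

definition corresponds where
  "corresponds A \<gamma> h \<longleftrightarrow> (\<forall>a\<in>carrier A. \<forall>b\<in>carrier B. \<forall>d\<in>carrier D.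
     h a (\<beta> (pure_tensor k B D b d)) = d (\<gamma> (pure_tensor k A B a b)))"

lemma correspondsD:
  "corresponds A \<gamma> h \<Longrightarrow> a \<in> carrier A \<Longrightarrow> b \<in> carrier B \<Longrightarrow> d \<in> carrier D \<Longrightarrow>
    h a (\<beta> (pure_tensor k B D b d)) = d (\<gamma> (pure_tensor k A B a b))"
  by (simp add: corresponds_def)

text \<open>The form belonging to \<open>\<gamma>\<close> is rotated so that \<open>A\<close> comes
  last, which gives a bilinear map from \<open>B\<close> and \<open>D\<close> to functionals on
  \<open>A\<close>. The universal property of \<open>T\<close> factors it through \<open>T\<close>,
  and the resulting pairing of \<open>T\<close> and \<open>A\<close> is read as a map from
  \<open>A\<close>.\<close>

lemma ex_hom_of_bilinear:
  fixes A :: "('k, 'u) hopf"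
  assumes A: "hopf_algebra k A" and \<gamma>: "\<gamma> \<in> bilinear_map k A B C"
  obtains h where "h \<in> hopf_hom k A T0" "corresponds A \<gamma> h"
proof -
  interpret A: hopf_algebra k A by fact
  interpret AB: two_hopf_algebras k A B ..
  define \<tau> where "\<tau> = (\<lambda>a b (d :: 'u \<Rightarrow> 'k). d (\<gamma> (pure_tensor k A B a b)))"
  have "trilinear_pairing k A B D \<tau>"
    unfolding \<tau>_def by (rule AB.bilinear_map_trilinear_pairing[OF C.hopf_algebra_axioms D.hopf_algebra_axioms CD.pairing \<gamma>])
  from trilinear_pairing_rotate[OF A B.hopf_algebra_axioms D.hopf_algebra_axioms this]
  have tri: "trilinear_pairing k B D A (\<lambda>b d a. \<tau> a b d)" .
  \<comment> \<open>Only these values of the bilinear map matter, so a small \<open>K\<close>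
    containing them replaces the finite dual of \<open>A\<close> as its target.\<close>
  let ?Y = "(\<lambda>(b, d). restrict (\<lambda>a. \<tau> a b d) (carrier A)) ` (carrier B \<times> carrier D)"
  obtain K :: "('k, 'u) hopf" and \<omega> where K: "separated_hopf k A K \<omega>"
    and KY: "\<And>f. f \<in> ?Y \<Longrightarrow> \<exists>x\<in>carrier K. \<forall>t\<in>carrier A. \<omega> x t = f t"
    using A.small_separated_hopf[OF infinite_u small_k small_image[OF small_Times[OF infinite_u small_carrier small_D]]
        trilinear_finite_dual[OF A B.hopf_algebra_axioms D.hopf_algebra_axioms tri]] by metis
  interpret K: separated_hopf k A K \<omega> by (rule K)
  have KH: "hopf_algebra k K" by (rule K.is_hopf_algebra)
  obtain \<delta> where \<delta>: "\<delta> \<in> bilinear_map k B D K"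
    "\<And>b d a. b \<in> carrier B \<Longrightarrow> d \<in> carrier D \<Longrightarrow> a \<in> carrier A \<Longrightarrow> \<omega> (\<delta> (pure_tensor k B D b d)) a = \<tau> a b d"
  proof (rule BD.ex_bilinear_map[OF K.separating_pairing tri])
    fix b d assume bd: "b \<in> carrier B" "d \<in> carrier D"
    then have "restrict (\<lambda>a. \<tau> a b d) (carrier A) \<in> ?Y"
      by (intro image_eqI[of _ _ "(b, d)"]) auto
    from KY[OF this] show "\<exists>x\<in>carrier K. \<forall>a\<in>carrier A. \<omega> x a = \<tau> a b d" by auto
  qed (rule that)
  obtain g where g: "g \<in> hopf_hom k T K" "\<And>t. t \<in> carrier (tensor k B D) \<Longrightarrow> g (\<beta> t) = \<delta> t"
    using is_boxD(3)[OF box KH \<delta>(1)] by blast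
  \<comment> \<open>\<open>g\<close> pulls the evaluation of \<open>K\<close> at points of
    \<open>A\<close> back to a pairing of \<open>T\<close> with \<open>A\<close>.\<close>
  have \<pi>: "hopf_pairing k A T (\<lambda>a t. \<omega> (g t) a)"
    by (rule hopf_pairing_swap[OF hopf_pairing_comp[OF T.hopf_algebra_axioms KH g(1) A K.hopf_pairing]])
  let ?h = "\<lambda>a\<in>carrier A. restrict (\<lambda>t. \<omega> (g t) a) (carrier T)"
  have "corresponds A \<gamma> ?h"
    unfolding corresponds_def using g(2) \<delta>(2) module_homD(1)[OF \<beta>_linear] by (simp add: \<tau>_def)
  then show thesis using that T.hopf_hom_cartier[OF A \<pi>] by blast
qed

text \<open>Agreement on the elements \<open>b \<circ> d\<close> has to determine \<open>h\<close>.
  The uniqueness clause of the box gives this once \<open>h\<close> and \<open>h'\<close> have been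
  turned into homomorphisms from \<open>T\<close> to a Hopf algebra on \<open>'u\<close> whose
  elements act as functionals on \<open>A\<close>.\<close>

lemma hom_unique:
  fixes A :: "('k, 'u) hopf"
  assumes A: "hopf_algebra k A" and h: "h \<in> hopf_hom k A T0" "h' \<in> hopf_hom k A T0"
    and eq: "\<And>a b d. a \<in> carrier A \<Longrightarrow> b \<in> carrier B \<Longrightarrow> d \<in> carrier D \<Longrightarrow>
      h a (\<beta> (pure_tensor k B D b d)) = h' a (\<beta> (pure_tensor k B D b d))"
  shows "h = h'"
proof -
  interpret A: hopf_algebra k A by fact
  have p: "hopf_pairing k T A (\<lambda>t a. g a t)" if "g \<in> hopf_hom k A T0" for g
    by (rule hopf_pairing_swap[OF T.pairing_of_hopf_hom_cartier[OF A that]])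
  let ?y = "\<lambda>g t. restrict (\<lambda>a. g a t) (carrier A)"
  \<comment> \<open>The functionals of \<open>h\<close> and of \<open>h'\<close> are put into a
    single \<open>K\<close>, so that the two homomorphisms from \<open>T\<close> have the same
    target.\<close>
  let ?Y = "?y h ` carrier T \<union> ?y h' ` carrier T"
  have Yd: "?Y \<subseteq> \<Union>{S. hopf_subalgebra_of_dual k A S}"
    using A.pairing_finite_dual[OF T.hopf_algebra_axioms p[OF h(1)]] A.pairing_finite_dual[OF T.hopf_algebra_axioms p[OF h(2)]]
    by (rule Un_least)
  have Ys: "small TYPE('u) ?Y" by (intro small_Un[OF infinite_u] small_image small_carrier)
  obtain K :: "('k, 'u) hopf" and \<omega> where K: "separated_hopf k A K \<omega>"
    and KY: "\<And>f. f \<in> ?Y \<Longrightarrow> \<exists>x\<in>carrier K. \<forall>t\<in>carrier A. \<omega> x t = f t"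
    using A.small_separated_hopf[OF infinite_u small_k Ys Yd] by metis
  interpret K: separated_hopf k A K \<omega> by (rule K)
  interpret KS: separating_pairing k K A \<omega> by (rule K.separating_pairing)
  have KH: "hopf_algebra k K" by (rule K.is_hopf_algebra)
  have ex: "\<exists>f. f \<in> hopf_hom k T K \<and> (\<forall>t\<in>carrier T. \<forall>a\<in>carrier A. \<omega> (f t) a = g a t)"
    if g: "g \<in> hopf_hom k A T0" and gY: "?y g ` carrier T \<subseteq> ?Y" for g
  proof -
    have "\<exists>x\<in>carrier K. \<forall>a\<in>carrier A. \<omega> x a = g a t" if t: "t \<in> carrier T" for t
      using KY[of "?y g t"] gY t by auto
    then obtain f where f: "f t \<in> carrier K \<and> (\<forall>a\<in>carrier A. \<omega> (f t) a = g a t)" if "t \<in> carrier T" for t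
      by metis
    have "restrict f (carrier T) \<in> hopf_hom k T K"
    proof (rule KS.hopf_homI_pairing[OF T.hopf_algebra_axioms])
      show "hopf_pairing k T A (\<lambda>t a. \<omega> (restrict f (carrier T) t) a)"
        by (rule hopf_pairing_cong[OF T.hopf_algebra_axioms A _ p[OF g]]) (use f in simp)
    qed (use f in auto)
    then show ?thesis using f by (intro exI[of _ "restrict f (carrier T)"]) simp
  qed
  obtain f where f: "f \<in> hopf_hom k T K" "\<And>t a. t \<in> carrier T \<Longrightarrow> a \<in> carrier A \<Longrightarrow> \<omega> (f t) a = h a t"
    using ex[OF h(1)] by blast
  obtain f' where f': "f' \<in> hopf_hom k T K" "\<And>t a. t \<in> carrier T \<Longrightarrow> a \<in> carrier A \<Longrightarrow> \<omega> (f' t) a = h' a t"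
    using ex[OF h(2)] by blast
  note \<beta>c = module_homD(1)[OF \<beta>_linear]
  let ?\<delta> = "\<lambda>t. f (\<beta> t)"
  have lin: "?\<delta> \<in> module_hom k (tensor k B D) K"
    by (rule module_hom_comp[OF \<beta>_linear hopf_homD(1)[OF f(1)]])
  have lin': "(\<lambda>t. f' (\<beta> t)) \<in> module_hom k (tensor k B D) K"
    by (rule module_hom_comp[OF \<beta>_linear hopf_homD(1)[OF f'(1)]])
  have \<delta>: "?\<delta> \<in> bilinear_map k B D K"
  proof (rule BD.bilinear_mapI_pairing[OF K.separating_pairing lin])
    show "trilinear_pairing k B D A (\<lambda>b d a. \<omega> (f (\<beta> (pure_tensor k B D b d))) a)"
      by (rule trilinear_pairing_cong[OF B.hopf_algebra_axioms D.hopf_algebra_axioms A _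
          BD.bilinear_map_trilinear_pairing[OF T.hopf_algebra_axioms A p[OF h(1)] is_boxD(2)[OF box]]])
        (simp add: f(2) \<beta>c)
  qed
  have "f' (\<beta> t) = f (\<beta> t)" if t: "t \<in> carrier (tensor k B D)" for t
  proof (rule BD.AB.module_hom_eqI[OF lin' lin K.K_module t])
    fix b d assume bd: "b \<in> carrier B" "d \<in> carrier D"
    show "f' (\<beta> (pure_tensor k B D b d)) = f (\<beta> (pure_tensor k B D b d))"
      by (rule KS.eqI) (use bd \<beta>c hopf_homD(4)[OF f(1)] hopf_homD(4)[OF f'(1)] in \<open>auto simp: f(2) f'(2) eq\<close>)
  qed
  \<comment> \<open>Both factor the bilinear map \<open>?\<delta>\<close>.\<close>
  then have "f = f'" using is_boxD(3)[OF box KH \<delta>] f(1) f'(1) by blast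
  then have ht: "h a t = h' a t" if "a \<in> carrier A" "t \<in> carrier T" for a t
    using f(2) f'(2) that by metis
  show "h = h'"
  proof (rule extensionalityI[OF hopf_homD(3)[OF h(1)] hopf_homD(3)[OF h(2)]])
    fix a assume a: "a \<in> carrier A"
    show "h a = h' a"
      by (rule T0.eqI) (use a ht hopf_homD(4)[OF h(1)] hopf_homD(4)[OF h(2)] in auto)
  qed
qed

text \<open>For fixed \<open>a\<close> and \<open>b\<close> the form is a functional on the dual of
  \<open>C\<close>. Biduality for the finite dimensional \<open>C\<close> turns it into an element
  of \<open>C\<close>, the value of \<open>\<gamma>\<close>.\<close>

lemma ex_bilinear_of_hom:
  fixes A :: "('k, 'u) hopf"
  assumes A: "hopf_algebra k A" and h: "h \<in> hopf_hom k A T0"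
  obtains \<gamma> where "\<gamma> \<in> bilinear_map k A B C" "corresponds A \<gamma> h"
proof -
  interpret A: hopf_algebra k A by fact
  interpret AB: two_hopf_algebras k A B ..
  define \<tau> where "\<tau> = (\<lambda>a b d. h a (\<beta> (pure_tensor k B D b d)))"
  have "trilinear_pairing k B D A (\<lambda>b d a. \<tau> a b d)"
    unfolding \<tau>_def
    by (rule BD.bilinear_map_trilinear_pairing[OF T.hopf_algebra_axioms A
          hopf_pairing_swap[OF T.pairing_of_hopf_hom_cartier[OF A h]] is_boxD(2)[OF box]])
  \<comment> \<open>Two rotations take the order \<open>b\<close>, \<open>d\<close>,
    \<open>a\<close> to \<open>a\<close>, \<open>b\<close>, \<open>d\<close>.\<close>
  from trilinear_pairing_rotate[OF D.hopf_algebra_axioms A B.hopf_algebra_axioms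
      trilinear_pairing_rotate[OF B.hopf_algebra_axioms D.hopf_algebra_axioms A this]]
  have tri: "trilinear_pairing k A B D \<tau>" .
  obtain \<gamma> where \<gamma>: "\<gamma> \<in> bilinear_map k A B C"
    "\<And>a b d. a \<in> carrier A \<Longrightarrow> b \<in> carrier B \<Longrightarrow> d \<in> carrier D \<Longrightarrow> d (\<gamma> (pure_tensor k A B a b)) = \<tau> a b d"
  proof (rule AB.ex_bilinear_map[OF CD.separating_pairing_axioms tri])
    fix a b assume "a \<in> carrier A" "b \<in> carrier B"
    then show "\<exists>x\<in>carrier C. \<forall>d\<in>carrier D. d x = \<tau> a b d"
      by (intro C.finite_dim_dual(4)[OF fin_dim] trilinearD(3)[OF trilinear_pairingD(1)[OF tri]])
  qed (rule that)
  then show thesis using that by (simp add: corresponds_def \<tau>_def)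
qed

text \<open>The relation \<open>corresponds\<close> fixes all values
  \<open>d (\<gamma> (a \<otimes> b))\<close>, and the functionals \<open>d\<close> separate the
  points of \<open>C\<close>.\<close>

lemma bilinear_eqI:
  fixes A :: "('k, 'u) hopf"
  assumes A: "hopf_algebra k A" and \<gamma>: "\<gamma> \<in> bilinear_map k A B C" "\<gamma>' \<in> bilinear_map k A B C"
    and h: "corresponds A \<gamma> h" "corresponds A \<gamma>' h" and t: "t \<in> carrier (tensor k A B)"
  shows "\<gamma> t = \<gamma>' t"
proof -
  interpret A: hopf_algebra k A by fact
  interpret AB: two_hopf_algebras k A B ..
  have l: "\<gamma> \<in> module_hom k (tensor k A B) C" "\<gamma>' \<in> module_hom k (tensor k A B) C"
    using \<gamma> AB.bilinear_map_iff[OF C.hopf_algebra_axioms] by blast+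
  show ?thesis
  proof (rule AB.AB.module_hom_eqI[OF l C.H_module t])
    fix a b assume ab: "a \<in> carrier A" "b \<in> carrier B"
    show "\<gamma> (pure_tensor k A B a b) = \<gamma>' (pure_tensor k A B a b)"
    proof (rule CD.eqI)
      show "\<gamma> (pure_tensor k A B a b) \<in> carrier C" "\<gamma>' (pure_tensor k A B a b) \<in> carrier C"
        using ab module_homD(1)[OF l(1)] module_homD(1)[OF l(2)] by simp_all
      show "d (\<gamma> (pure_tensor k A B a b)) = d (\<gamma>' (pure_tensor k A B a b))" if "d \<in> carrier D" for d
        using correspondsD[OF h(1) ab that] correspondsD[OF h(2) ab that] by simp
    qed
  qed
qed

text \<open>Composition with \<open>u\<close> compares maps into \<open>E\<close> with maps into
  \<open>T0\<close>, for sources on \<open>'u\<close>. The facts \<open>lift\<close> and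
  \<open>unique\<close> express its surjectivity, and its injectivity at \<open>E\<close>. They
  produce an inverse of \<open>u\<close> only after \<open>T0\<close> has been given a copy on
  \<open>'u\<close>.\<close>

theorem internal_hom_isomorphic:
  assumes E: "is_internal_hom k B C E"
  shows "hopf_isomorphic k E T0"
proof -
  have EH: "hopf_algebra k E" using E by (simp add: is_internal_hom_def)
  interpret E: hopf_algebra k E by (rule EH)
  note BH = B.hopf_algebra_axioms and CH = C.hopf_algebra_axioms
  obtain box :: "('k, 'u) hopf \<Rightarrow> ('k, 'u) hopf" and b \<phi> where
    bx: "\<And>A. hopf_algebra k A \<Longrightarrow> is_box k A B (box A) (b A)"
    and \<phi>: "\<And>A. hopf_algebra k A \<Longrightarrow> bij_betw (\<phi> A) (hopf_hom k (box A) C) (hopf_hom k A E)"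
    and nat: "\<And>A A' f g. hopf_algebra k A \<Longrightarrow> hopf_algebra k A' \<Longrightarrow> f \<in> hopf_hom k A' A \<Longrightarrow>
      g \<in> hopf_hom k (box A) C \<Longrightarrow>
      \<phi> A' (compose (carrier (box A')) g (box_map k A' A B (box A') (b A') (box A) (b A) f))
        = compose (carrier A') (\<phi> A g) f"
    using E unfolding is_internal_hom_def by blast
  note boxH = is_boxD(1)[OF bx]
  have idE: "(\<lambda>x\<in>carrier E. x) \<in> hopf_hom k E E" by (rule hopf_hom_id[OF EH])
  \<comment> \<open>The universal element, which represents the identity of \<open>E\<close>. The
    map \<open>\<gamma>E\<close> defined from it plays the role of evaluation from \<open>E\<close>
    and \<open>B\<close> to \<open>C\<close>.\<close>
  obtain gE where gE: "gE \<in> hopf_hom k (box E) C" "\<phi> E gE = (\<lambda>x\<in>carrier E. x)"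
    using bij_betw_imp_surj_on[OF \<phi>[OF EH]] idE by (metis image_iff)
  define m where "m A f = box_map k A E B (box A) (b A) (box E) (b E) f" for A f
  have m: "m A f \<in> hopf_hom k (box A) (box E)"
    "\<And>t. t \<in> carrier (tensor k A B) \<Longrightarrow> m A f (b A t) = b E (tensor_map k E B f id t)"
    if A: "hopf_algebra k A" and f: "f \<in> hopf_hom k A E" for A f
  proof -
    have "(\<lambda>t. b E (tensor_map k E B f id t)) \<in> bilinear_map k A B (box E)"
      by (rule bilinear_map_tensor_map(1)[OF EH A BH boxH[OF EH] f is_boxD(2)[OF bx[OF EH]]])
    from theI'[OF is_boxD(3)[OF bx[OF A] boxH[OF EH] this]]
    show "m A f \<in> hopf_hom k (box A) (box E)"
      "\<And>t. t \<in> carrier (tensor k A B) \<Longrightarrow> m A f (b A t) = b E (tensor_map k E B f id t)"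
      unfolding m_def box_map_def by blast+
  qed
  define \<gamma>E where "\<gamma>E t = gE (b E t)" for t
  have pullback_mem: "compose (carrier (box A)) gE (m A f) \<in> hopf_hom k (box A) C"
    if A: "hopf_algebra k A" and f: "f \<in> hopf_hom k A E" for A f
    by (rule hopf_hom_compose[OF boxH[OF A] boxH[OF EH] CH m(1)[OF A f] gE(1)])
  \<comment> \<open>Naturality along \<open>f\<close>, applied to the universal element: pulling
    \<open>gE\<close> back inverts \<open>\<phi> A\<close>.\<close>
  have \<phi>_pullback: "\<phi> A (compose (carrier (box A)) gE (m A f)) = f"
    if A: "hopf_algebra k A" and f: "f \<in> hopf_hom k A E" for A f
  proof -
    have "\<phi> A (compose (carrier (box A)) gE (m A f)) = compose (carrier A) (\<lambda>x\<in>carrier E. x) f"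
      using nat[OF EH A f gE(1)] gE(2) by (simp add: m_def)
    also have "\<dots> = f"
      using hopf_homD(3,4)[OF f] by (intro extensionalityI[of _ "carrier A"]) (auto simp: compose_def)
    finally show ?thesis .
  qed
  have pullback_apply: "compose (carrier (box A)) gE (m A f) (b A t) = \<gamma>E (tensor_map k E B f id t)"
    if A: "hopf_algebra k A" and f: "f \<in> hopf_hom k A E" and t: "t \<in> carrier (tensor k A B)" for A f t
  proof -
    interpret A: hopf_algebra k A by fact
    interpret AB: two_hopf_algebras k A B ..
    have "b A \<in> module_hom k (tensor k A B) (box A)"
      using is_boxD(2)[OF bx[OF A]] AB.bilinear_map_iff[OF boxH[OF A]] by blast
    then have "b A t \<in> carrier (box A)" using t by (rule module_homD(1))
    then show ?thesis using m(2)[OF A f t] by (simp add: compose_def \<gamma>E_def)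
  qed
  \<comment> \<open>Instead of pushing every clause of bilinearity through \<open>g\<close>, the
    composite is tested against the functionals on \<open>C\<close>.\<close>
  have bil_comp: "(\<lambda>t. g (b A t)) \<in> bilinear_map k A B C" if A: "hopf_algebra k A" and g: "g \<in> hopf_hom k (box A) C" for A g
  proof -
    interpret A: hopf_algebra k A by fact
    interpret AB: two_hopf_algebras k A B ..
    have bl: "b A \<in> module_hom k (tensor k A B) (box A)"
      using is_boxD(2)[OF bx[OF A]] AB.bilinear_map_iff[OF boxH[OF A]] by blast
    have p: "hopf_pairing k (box A) D (\<lambda>x d. d (g x))"
      by (rule hopf_pairing_comp[OF boxH[OF A] CH g D.hopf_algebra_axioms CD.pairing])
    show ?thesis
      by (rule AB.bilinear_mapI_pairing[OF CD.separating_pairing_axioms module_hom_comp[OF bl hopf_homD(1)[OF g]]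
            AB.bilinear_map_trilinear_pairing[OF boxH[OF A] D.hopf_algebra_axioms p is_boxD(2)[OF bx[OF A]]]])
  qed
  have \<gamma>E: "\<gamma>E \<in> bilinear_map k E B C"
    unfolding \<gamma>E_def by (rule bil_comp[OF EH gE(1)])
  obtain u where u: "u \<in> hopf_hom k E T0" "corresponds E \<gamma>E u"
    by (rule ex_hom_of_bilinear[OF EH \<gamma>E])
  note tm = bilinear_map_tensor_map[OF EH _ BH CH _ \<gamma>E]
  have corr: "corresponds A (\<lambda>t. \<gamma>E (tensor_map k E B f id t)) (compose (carrier A) u f)"
    if A: "hopf_algebra k A" and f: "f \<in> hopf_hom k A E" for A f
    unfolding corresponds_def using correspondsD[OF u(2) hopf_homD(4)[OF f]] tm(2)[OF A f] by (simp add: compose_def)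
  \<comment> \<open>The bilinear map belonging to \<open>h\<close> is a homomorphism from
    \<open>box A\<close> to \<open>C\<close>, hence of the form obtained by pulling
    \<open>gE\<close> back along some \<open>f\<close>. Then \<open>h\<close> and the composite of
    \<open>u\<close> with \<open>f\<close> agree on all \<open>b \<circ> d\<close>, and
    \<open>hom_unique\<close> identifies them.\<close>
  have lift: "\<exists>f\<in>hopf_hom k A E. h = compose (carrier A) u f"
    if A: "hopf_algebra k A" and h: "h \<in> hopf_hom k A T0" for A :: "('k, 'u) hopf" and h
  proof -
    obtain \<gamma> where \<gamma>: "\<gamma> \<in> bilinear_map k A B C" "corresponds A \<gamma> h" by (rule ex_bilinear_of_hom[OF A h])
    obtain g where g: "g \<in> hopf_hom k (box A) C" "\<And>t. t \<in> carrier (tensor k A B) \<Longrightarrow> g (b A t) = \<gamma> t"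
      using is_boxD(3)[OF bx[OF A] CH \<gamma>(1)] by blast
    define f where "f = \<phi> A g"
    have f: "f \<in> hopf_hom k A E" unfolding f_def using bij_betwE[OF \<phi>[OF A]] g(1) by blast
    have "compose (carrier (box A)) gE (m A f) = g"
      by (rule inj_onD[OF bij_betw_imp_inj_on[OF \<phi>[OF A]] _ pullback_mem[OF A f] g(1)])
        (simp only: \<phi>_pullback[OF A f], simp only: f_def)
    then have \<gamma>f: "\<gamma> t = \<gamma>E (tensor_map k E B f id t)" if "t \<in> carrier (tensor k A B)" for t
      using pullback_apply[OF A f that] g(2)[OF that] by simp
    interpret A: hopf_algebra k A by fact
    interpret AB: two_hopf_algebras k A B ..
    have "h = compose (carrier A) u f"
    proof (rule hom_unique[OF A h hopf_hom_compose[OF A EH T0_hopf f u(1)]])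
      fix a x d assume axd: "a \<in> carrier A" "x \<in> carrier B" "d \<in> carrier D"
      then show "h a (\<beta> (pure_tensor k B D x d)) = compose (carrier A) u f a (\<beta> (pure_tensor k B D x d))"
        using correspondsD[OF \<gamma>(2) axd] correspondsD[OF corr[OF A f] axd] \<gamma>f by simp
    qed
    then show ?thesis using f by blast
  qed
  \<comment> \<open>A homomorphism into \<open>T0\<close> determines its bilinear map, which
    determines a homomorphism from \<open>box E\<close> to \<open>C\<close>, whose image under
    \<open>\<phi> E\<close> is the original endomorphism.\<close>
  have unique: "f = f'"
    if f: "f \<in> hopf_hom k E E" and f': "f' \<in> hopf_hom k E E" and eq: "compose (carrier E) u f = compose (carrier E) u f'" for f f'
  proof -
    have "\<gamma>E (tensor_map k E B f id t) = \<gamma>E (tensor_map k E B f' id t)" if "t \<in> carrier (tensor k E B)" for t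
      using corr[OF EH f] corr[OF EH f'] eq
      by (intro bilinear_eqI[OF EH tm(1)[OF EH f] tm(1)[OF EH f'] _ _ that]) auto
    then have "compose (carrier (box E)) gE (m E f) (b E t) = compose (carrier (box E)) gE (m E f') (b E t)"
      if "t \<in> carrier (tensor k E B)" for t
      using pullback_apply[OF EH f that] pullback_apply[OF EH f' that] that by simp
    then have "compose (carrier (box E)) gE (m E f) = compose (carrier (box E)) gE (m E f')"
      using is_boxD(3)[OF bx[OF EH] CH bil_comp[OF EH pullback_mem[OF EH f']]] pullback_mem[OF EH f] pullback_mem[OF EH f'] by blast
    then show ?thesis using \<phi>_pullback[OF EH f] \<phi>_pullback[OF EH f'] by metis
  qed
  \<comment> \<open>Each \<open>x\<close> lies in a Hopf subalgebra with a copy \<open>K\<close> on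
    \<open>'u\<close>. The inclusion of \<open>K\<close> into \<open>T0\<close> factors through
    \<open>u\<close> by \<open>lift\<close>, so \<open>x\<close> is in the image of
    \<open>u\<close>.\<close>
  have surj: "u ` carrier E = carrier T0"
  proof (intro equalityI subsetI)
    fix x assume "x \<in> u ` carrier E"
    then show "x \<in> carrier T0" using hopf_homD(4)[OF u(1)] by blast
  next
    fix x assume x: "x \<in> carrier T0"
    have fin: "small TYPE('u) {x}" by (rule small_finite[OF infinite_u]) simp
    have sub: "{x} \<subseteq> \<Union>{S. hopf_subalgebra_of_dual k T S}" using x by (simp add: T.carrier_cartier)
    obtain K :: "('k, 'u) hopf" and \<omega> where K: "separated_hopf k T K \<omega>"
      and Kx: "\<And>f. f \<in> {x} \<Longrightarrow> \<exists>y\<in>carrier K. \<forall>t\<in>carrier T. \<omega> y t = f t"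
      using T.small_separated_hopf[OF infinite_u small_k fin sub] by metis
    interpret K: separated_hopf k T K \<omega> by (rule K)
    note KH = K.is_hopf_algebra
    obtain y where y: "y \<in> carrier K" "\<And>t. t \<in> carrier T \<Longrightarrow> \<omega> y t = x t" using Kx[of x] by auto
    let ?h = "\<lambda>z\<in>carrier K. restrict (\<omega> z) (carrier T)"
    have h: "?h \<in> hopf_hom k K T0" by (rule T.hopf_hom_cartier[OF KH K.hopf_pairing])
    obtain f where f: "f \<in> hopf_hom k K E" "?h = compose (carrier K) u f" using lift[OF KH h] by blast
    have "x = ?h y"
      by (rule T0.eqI[OF x hopf_homD(4)[OF h y(1)]]) (use y in simp)
    also have "\<dots> = u (f y)" using f(2) y(1) by (simp add: compose_def)
    finally show "x \<in> u ` carrier E" using hopf_homD(4)[OF f(1) y(1)] by blast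
  qed
  \<comment> \<open>As an image of \<open>carrier E\<close>, the Cartier dual is no larger than
    \<open>'u\<close>. From here on it can itself, through a copy, be a source for
    \<open>lift\<close>.\<close>
  have "small TYPE('u) (carrier T0)" unfolding surj[symmetric] by (intro small_image small_carrier)
  then obtain i :: "_ \<Rightarrow> 'u" where i: "inj_on i (carrier T0)" by (auto simp: small_def)
  define K where "K = transport_hopf k i T0"
  define \<omega> where "\<omega> x = the_inv_into (carrier T0) i x" for x
  have K: "separated_hopf k T K \<omega>" "carrier K = i ` carrier T0"
    using T0.transport[OF i] by (simp_all add: K_def \<omega>_def[abs_def])
  interpret K: separated_hopf k T K \<omega> by (rule K(1))
  note KH = K.is_hopf_algebra
  have \<omega>i [simp]: "\<omega> (i x) = x" if "x \<in> carrier T0" for x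
    using the_inv_into_f_f[OF i that] by (simp add: \<omega>_def)
  have \<omega>_mem: "\<omega> y \<in> carrier T0" if "y \<in> carrier K" for y using that K(2) by auto
  \<comment> \<open>Elements of the Cartier dual are already extensional. That the restriction
    belongs to it again is read off from its own evaluation pairing with \<open>T\<close>.\<close>
  have res: "restrict x (carrier T) = x" if "x \<in> carrier T0" for x
    by (rule T0.eqI) (use that T.hopf_hom_cartier[OF T0_hopf T0.hopf_pairing, THEN hopf_homD(4), OF that] in auto)
  let ?w = "restrict \<omega> (carrier K)"
  have "(\<lambda>z\<in>carrier K. restrict (\<omega> z) (carrier T)) = ?w"
    by (rule restrict_ext) (simp add: res \<omega>_mem)
  then have w: "?w \<in> hopf_hom k K T0" using T.hopf_hom_cartier[OF KH K.hopf_pairing] by simp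
  obtain f where f: "f \<in> hopf_hom k K E" "?w = compose (carrier K) u f" using lift[OF KH w] by blast
  let ?v = "\<lambda>x\<in>carrier E. i (u x)"
  note uc = hopf_homD(4)[OF u(1)]
  have v: "?v \<in> hopf_hom k E K"
  proof (rule separating_pairing.hopf_homI_pairing[OF K.separating_pairing EH])
    show "hopf_pairing k E T (\<lambda>a t. \<omega> (?v a) t)"
      by (rule hopf_pairing_cong[OF EH T.hopf_algebra_axioms _ T.pairing_of_hopf_hom_cartier[OF EH u(1)]])
        (simp add: uc)
  qed (use uc K(2) in auto)
  have fi: "u (f (i x)) = x" if "x \<in> carrier T0" for x
    using fun_cong[OF f(2), of "i x"] that K(2) by (simp add: compose_def)
  \<comment> \<open>\<open>u\<close> after \<open>f\<close> is the identification of the copy with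
    \<open>T0\<close>, and \<open>?v\<close> is \<open>u\<close> followed by the inverse
    identification, so both sides agree after \<open>u\<close>. The resulting left inverse shows
    that \<open>u\<close> is injective.\<close>
  have fv: "compose (carrier E) f ?v = (\<lambda>x\<in>carrier E. x)"
  proof (rule unique[OF hopf_hom_compose[OF EH KH EH v f(1)] idE])
    show "compose (carrier E) u (compose (carrier E) f ?v) = compose (carrier E) u (\<lambda>x\<in>carrier E. x)"
      by (rule ext) (simp add: compose_def fi uc)
  qed
  have "f (i (u x)) = x" if "x \<in> carrier E" for x
    using fun_cong[OF fv, of x] by (simp add: compose_eq that)
  then have "inj_on u (carrier E)" by (intro inj_on_inverseI[of _ "\<lambda>y. f (i y)"])
  then show ?thesis
    unfolding hopf_isomorphic_def using EH T0_hopf u(1) surj by (auto simp: bij_betw_def)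
qed

end

theorem corollary4p11:
  fixes k :: "'k ring" and p \<nu> :: nat
    and H1 H2 E T :: "('k, 'u) hopf"
    and \<beta> :: "('u \<times> ('u \<Rightarrow> 'k)) list set \<Rightarrow> 'u"
  assumes "infinite (UNIV :: 'u set)"
    and "field k" and "characteristic k = p" and "p > 0"
    and "hopf_algebra_killed_by k (p ^ \<nu>) H1"
    and "hopf_algebra_killed_by k (p ^ \<nu>) H2"
    and "vectorspace.fin_dim k H2"
    and "is_internal_hom k H1 H2 E"
    and "is_box k H1 (linear_dual k H2) T \<beta>"
  shows "hopf_isomorphic k E (cartier_dual k T)"
proof -
  have "hopf_algebra k H1" "hopf_algebra k H2"
    using assms(5,6) by (simp_all add: hopf_algebra_killed_by_def)
  then interpret box_with_dual k H1 H2 T \<beta>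
    by (intro box_with_dual.intro box_with_dual_axioms.intro assms)
  show ?thesis by (rule internal_hom_isomorphic[OF assms(8)])
qed

end
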